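(* Let $q\in\{0,\dots,d\}$, $r>0$, and let $\mathcal A=\{A_1,\ldots,A_m\}$ be a degree-$q$, radius-$r$ homological certificate for $M$. Then, for every starting point $z\in M$ and every $T\ge s_0$, $$\mathbb P_z\big(R_q(T,r)\big)\ge 1-a_{hk}\,\Phi_{\mathcal A}(T-s_0).$$ In particular, $\mathbb P_z\big(H_q(\Gamma_T^r)\cong H_q(M)\big)\ge1-\delta$ whenever $a_{hk}\,\Phi_{\mathcal A}(T-s_0)\le\delta$. If $\mathcal A$ is a full homological certificate at radius $r$, the same bound holds for the simultaneous event $R(T,r)$.
   Context: Setting. $d\ge2$; homology has coefficients in a fixed field. $M\subset\mathbb R^d$ is the closure of a bounded connected open set. $d_M(x,y)$ is the infimum of the lengths of rectifiable curves in $M$ joining $x$ to $y$; $B_M(x,\varepsilon)=\{y\in M:d_M(x,y)<\varepsilon\}$; $\mu(A)=|A|/|M|$ is normalized Lebesgue measure on $M$. $M$ satisfies the following assumptions. (1) Positive reach: $\operatorname{reach}(M)>0$, i.e. every $z$ with $0<\operatorname{dist}(z,M)<\operatorname{reach}(M)$ has a unique nearest point in $M$. (2) There are $c_{ie}\ge1$, $\rho_{ie}>0$ with $d_M(x,y)\le c_{ie}|x-y|$ whenever $x,y\in M$, $|x-y|<\rho_{ie}$. (3) There are $c_{vol},C_{vol},\rho_{vol}>0$ with $c_{vol}\varepsilon^d\le\mu(B_M(x,\varepsilon))\le C_{vol}\varepsilon^d$ for all $x\in M$, $0<\varepsilon<\rho_{vol}$. (4) $M$ is an admissible reflecting domain: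 its boundary is regular enough that reflected Brownian motion in $M$ exists and is unique in law, has a symmetric Neumann heat kernel, the Neumann semigroup on $L^2(M,\mu)$ is compact, the Neumann spectrum is discrete with positive spectral gap, and there are uniform bi-Lipschitz charts at a fixed scale (onto Euclidean balls in the interior, onto half-balls with $\partial M$ carried into the flat face near $\partial M$). (A compact connected Lipschitz domain with uniform chart constants suffices for (4).) (5) Heat-kernel domination: there are $s_0>0$, $a_{hk}\ge1$ such that the transition density $p_t(x,y)$ of the process below with respect to $\mu$ satisfies $p_t(x,y)\le a_{hk}$ for all $t\ge s_0$, $x,y\in M$. Process. $X=(X_t)_{t\ge0}$ is reflected Brownian motion in $M$: the conservative $\mu$-symmetric Hunt process with continuous paths associated with the Dirichlet form $\mathcal E(f,g)=\frac12\int_M\nabla f\cdot\nabla g\,d\mu$, $f,g\in H^1(M)$. $\mathbb P_z$ is its law started at $z$. Notation. $\Gamma_T=\{X_t:0\le t\le T\}$; for compact $S\subset\mathbb R^d$, $S^r=\{x\in\mathbb R^d:\operatorname{dist}(x,S)\le r\}$. $R_q(T,r)=\{H_q(\Gamma_T^r)\cong H_q(M)\}$ and $R(T,r)=\bigcap_{q=0}^dR_q(T,r)$. Certificates. For a continuous path $\gamma:[0,T]\to M$ put $\operatorname{Tr}(\gamma)=\gamma([0,T])$; $\gamma$ hits all targets of a finite family $\mathcal A=\{A_1,\dots,A_m\}$ of measurable subsets of $M$ if $\operatorname{Tr}(\gamma)\cap A_i\ne\varnothing$ for all $i$. $\mathcal A$ is a degree-$q$, radius-$r$ homological certificate for $M$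 if every continuous path $\gamma:[0,T]\to M$ (any $T$) hitting all targets of $\mathcal A$ satisfies $H_q(\operatorname{Tr}(\gamma)^r)\cong H_q(M)$; it is a full homological certificate at radius $r$ if this holds simultaneously for every $q=0,\dots,d$. Spectral profile. For $A\subset M$ of positive capacity, $\lambda_A=\inf\{\mathcal E(f,f)/\|f\|_{L^2(\mu)}^2: f\in H^1(M),\ f=0\text{ quasi-everywhere on }A,\ f\ne0\}$ is its principal killed eigenvalue. The targets in $\mathcal A$ are measurable sets of positive capacity, and $\Phi_{\mathcal A}(u)=\sum_{A\in\mathcal A}e^{-\lambda_Au}$ for $u\ge0$. *)

theory Defs
  imports "HOL-Probability.Probability" "HOL-Homology.Simplices"
begin

section \<open>Singular homology with coefficients in a field\<close>

text \<open>
  The library's singular chains have integer coefficients.  Here the coefficients lie in an arbitrary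
  field, given as a type \<open>'k\<close> of class \<^class>\<open>field\<close>; the singular simplices and their faces are the
  library's.  The argument of type \<open>'k itself\<close> selects the field.
\<close>

type_synonym ('a, 'k) fchain = "((nat \<Rightarrow> real) \<Rightarrow> 'a) \<Rightarrow>\<^sub>0 'k"

definition fchains :: "nat \<Rightarrow> 'a topology \<Rightarrow> ('a, 'k::field) fchain set" where
  "fchains q X = {c. Poly_Mapping.keys c \<subseteq> singular_simplex_set q X}"

definition fboundary :: "nat \<Rightarrow> ('a, 'k::field) fchain \<Rightarrow> ('a, 'k) fchain" where
  "fboundary q c = (if q = 0 then 0 else
     (\<Sum>\<sigma>\<in>Poly_Mapping.keys c. \<Sum>i\<le>q.
        Poly_Mapping.single (singular_face q i \<sigma>) ((-1) ^ i * Poly_Mapping.lookup c \<sigma>)))"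

definition fcycles :: "nat \<Rightarrow> 'a topology \<Rightarrow> ('a, 'k::field) fchain set" where
  "fcycles q X = {c \<in> fchains q X. fboundary q c = 0}"

definition fboundaries :: "nat \<Rightarrow> 'a topology \<Rightarrow> ('a, 'k::field) fchain set" where
  "fboundaries q X = fboundary (Suc q) ` fchains (Suc q) X"

text \<open>The quotient space of cycles by boundaries, its elements being cosets.\<close>

definition fhomology :: "nat \<Rightarrow> 'a topology \<Rightarrow> ('a, 'k::field) fchain set set" where
  "fhomology q X = (\<lambda>c. {c + b |b. b \<in> fboundaries q X}) ` fcycles q X"

definition fhom_add ::
  "('a, 'k::field) fchain set \<Rightarrow> ('a, 'k) fchain set \<Rightarrow> ('a, 'k) fchain set" where
  "fhom_add S S' = {c + c' |c c'. c \<in> S \<and> c' \<in> S'}"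

text \<open>Adding the boundaries keeps the result a full coset also for the scalar \<open>0\<close>.\<close>

definition fhom_scale ::
  "nat \<Rightarrow> 'a topology \<Rightarrow> 'k \<Rightarrow> ('a, 'k::field) fchain set \<Rightarrow> ('a, 'k) fchain set" where
  "fhom_scale q X a S =
     {Poly_Mapping.map ((*) a) c + b |c b. c \<in> S \<and> b \<in> fboundaries q X}"

definition fhom_iso :: "'k::field itself \<Rightarrow> nat \<Rightarrow> 'a topology \<Rightarrow> 'b topology \<Rightarrow> bool" where
  "fhom_iso _ q X Y \<longleftrightarrow>
     (\<exists>\<phi> :: ('a, 'k) fchain set \<Rightarrow> ('b, 'k) fchain set.
        bij_betw \<phi> (fhomology q X) (fhomology q Y) \<and>
        (\<forall>S\<in>fhomology q X. \<forall>S'\<in>fhomology q X. \<phi> (fhom_add S S') = fhom_add (\<phi> S) (\<phi> S')) \<and>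
        (\<forall>a. \<forall>S\<in>fhomology q X. \<phi> (fhom_scale q X a S) = fhom_scale q Y a (\<phi> S)))"


section \<open>Geometry of the domain\<close>

definition nbhd :: "'a::metric_space set \<Rightarrow> real \<Rightarrow> 'a set" where
  "nbhd S r = {x. infdist x S \<le> r}"

definition reach :: "'a::metric_space set \<Rightarrow> ereal" where
  "reach M = (SUP r \<in> {r. 0 \<le> r \<and>
      (\<forall>z. 0 < infdist z M \<and> infdist z M < r \<longrightarrow> (\<exists>!p. p \<in> M \<and> dist z p = infdist z M))}. ereal r)"

definition curve_length :: "(real \<Rightarrow> 'a::metric_space) \<Rightarrow> ennreal" where
  "curve_length g = (SUP ts \<in> {ts. sorted ts \<and> set ts \<subseteq> {0..1}}.
      ennreal (\<Sum>i<length ts - 1. dist (g (ts ! i)) (g (ts ! Suc i))))"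

text \<open>Curves of infinite length do not affect the infimum, which is \<open>\<infinity>\<close> if no rectifiable
  curve joins the two points.\<close>

definition intrinsic_dist :: "'a::real_normed_vector set \<Rightarrow> 'a \<Rightarrow> 'a \<Rightarrow> ennreal" where
  "intrinsic_dist M x y = (INF g \<in> {g. path g \<and> path_image g \<subseteq> M \<and> pathstart g = x \<and> pathfinish g = y}.
      curve_length g)"

definition intrinsic_ball :: "'a::real_normed_vector set \<Rightarrow> 'a \<Rightarrow> real \<Rightarrow> 'a set" where
  "intrinsic_ball M x \<epsilon> = {y \<in> M. intrinsic_dist M x y < ennreal \<epsilon>}"

text \<open>Normalized Lebesgue measure, as a measure whose space is \<open>M\<close> itself (Borel subsets of \<open>M\<close>).\<close>

definition nleb :: "'a::euclidean_space set \<Rightarrow> 'a measure" where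
  "nleb M = uniform_measure (restrict_space lborel M) M"

definition intrinsic_euclidean_comparison :: "'a::euclidean_space set \<Rightarrow> bool" where
  "intrinsic_euclidean_comparison M \<longleftrightarrow> (\<exists>c \<rho>. 1 \<le> c \<and> 0 < \<rho> \<and>
     (\<forall>x\<in>M. \<forall>y\<in>M. dist x y < \<rho> \<longrightarrow> intrinsic_dist M x y \<le> ennreal (c * dist x y)))"

definition volume_regular :: "'a::euclidean_space set \<Rightarrow> bool" where
  "volume_regular M \<longleftrightarrow> (\<exists>c C \<rho>. 0 < c \<and> 0 < C \<and> 0 < \<rho> \<and>
     (\<forall>x\<in>M. \<forall>\<epsilon>. 0 < \<epsilon> \<and> \<epsilon> < \<rho> \<longrightarrow>
        c * \<epsilon> ^ DIM('a) \<le> measure (nleb M) (intrinsic_ball M x \<epsilon>) \<and>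
        measure (nleb M) (intrinsic_ball M x \<epsilon>) \<le> C * \<epsilon> ^ DIM('a)))"

definition bilipschitz_chart ::
  "real \<Rightarrow> ('a::metric_space \<Rightarrow> 'b::metric_space) \<Rightarrow> 'a set \<Rightarrow> 'b set \<Rightarrow> bool" where
  "bilipschitz_chart L \<phi> V W \<longleftrightarrow> bij_betw \<phi> V W \<and>
     (\<forall>x\<in>V. \<forall>y\<in>V. dist x y / L \<le> dist (\<phi> x) (\<phi> y) \<and> dist (\<phi> x) (\<phi> y) \<le> L * dist x y)"

text \<open>One bi-Lipschitz constant \<open>L\<close>, one model radius \<open>R\<close> and one chart size \<open>\<rho>\<close> serve all points.
  The model of a boundary chart is the half-ball above the hyperplane orthogonal to \<open>e\<close>.\<close>

definition uniform_bilipschitz_charts :: "'a::euclidean_space set \<Rightarrow> bool" where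
  "uniform_bilipschitz_charts M \<longleftrightarrow> (\<exists>L R \<rho>. 1 \<le> L \<and> 0 < R \<and> 0 < \<rho> \<and>
     (\<forall>x\<in>M. \<exists>V \<phi>. openin (top_of_set M) V \<and> M \<inter> ball x \<rho> \<subseteq> V \<and>
        ((V \<inter> frontier M = {} \<and> bilipschitz_chart L \<phi> V (ball (0::'a) R)) \<or>
         (\<exists>e\<in>Basis. bilipschitz_chart L \<phi> V {y \<in> ball (0::'a) R. 0 \<le> y \<bullet> e} \<and>
            \<phi> ` (V \<inter> frontier M) \<subseteq> {y. y \<bullet> e = 0}))))"


section \<open>The Dirichlet form on \<open>H\<^sup>1\<close> and its capacity\<close>

primrec Ck :: "nat \<Rightarrow> ('a::euclidean_space \<Rightarrow> real) \<Rightarrow> bool" where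
  "Ck 0 f \<longleftrightarrow> continuous_on UNIV f"
| "Ck (Suc k) f \<longleftrightarrow> (\<forall>x. f differentiable (at x)) \<and>
     (\<forall>b\<in>Basis. Ck k (\<lambda>x. frechet_derivative f (at x) b))"

definition test_function :: "'a::euclidean_space set \<Rightarrow> ('a \<Rightarrow> real) \<Rightarrow> bool" where
  "test_function U \<phi> \<longleftrightarrow> (\<forall>k. Ck k \<phi>) \<and>
     compact (closure {x. \<phi> x \<noteq> 0}) \<and> closure {x. \<phi> x \<noteq> 0} \<subseteq> U"

definition L2 :: "'a::euclidean_space set \<Rightarrow> ('a \<Rightarrow> real) set" where
  "L2 M = {f \<in> borel_measurable (nleb M). integrable (nleb M) (\<lambda>x. (f x)\<^sup>2)}"

definition l2_inner :: "'a::euclidean_space set \<Rightarrow> ('a \<Rightarrow> real) \<Rightarrow> ('a \<Rightarrow> real) \<Rightarrow> real" where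
  "l2_inner M f g = (\<integral>x. f x * g x \<partial>nleb M)"

definition weak_gradient :: "'a::euclidean_space set \<Rightarrow> ('a \<Rightarrow> real) \<Rightarrow> ('a \<Rightarrow> 'a) \<Rightarrow> bool" where
  "weak_gradient M f g \<longleftrightarrow>
     g \<in> borel_measurable (nleb M) \<and> integrable (nleb M) (\<lambda>x. (norm (g x))\<^sup>2) \<and>
     (\<forall>\<phi> b. test_function (interior M) \<phi> \<and> b \<in> Basis \<longrightarrow>
        (\<integral>x. f x * frechet_derivative \<phi> (at x) b \<partial>nleb M) = - (\<integral>x. (g x \<bullet> b) * \<phi> x \<partial>nleb M))"

definition H1 :: "'a::euclidean_space set \<Rightarrow> ('a \<Rightarrow> real) set" where
  "H1 M = {f \<in> L2 M. \<exists>g. weak_gradient M f g}"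

text \<open>The weak gradient is determined almost everywhere on the interior, hence on \<open>M\<close>: the
  boundary is a null set, because the charts above carry it into a hyperplane.\<close>

definition grad :: "'a::euclidean_space set \<Rightarrow> ('a \<Rightarrow> real) \<Rightarrow> 'a \<Rightarrow> 'a" where
  "grad M f = (SOME g. weak_gradient M f g)"

definition energy :: "'a::euclidean_space set \<Rightarrow> ('a \<Rightarrow> real) \<Rightarrow> ('a \<Rightarrow> real) \<Rightarrow> real" where
  "energy M f g = 1 / 2 * (\<integral>x. grad M f x \<bullet> grad M g x \<partial>nleb M)"

text \<open>The 1-capacity of the form, first on relatively open sets, then as an outer capacity.\<close>

definition cap_open :: "'a::euclidean_space set \<Rightarrow> 'a set \<Rightarrow> ennreal" where
  "cap_open M G = (INF f \<in> {f \<in> H1 M. AE x in nleb M. x \<in> G \<longrightarrow> 1 \<le> f x}.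
      ennreal (energy M f f + l2_inner M f f))"

definition capacity :: "'a::euclidean_space set \<Rightarrow> 'a set \<Rightarrow> ennreal" where
  "capacity M A = (INF G \<in> {G. openin (top_of_set M) G \<and> A \<subseteq> G}. cap_open M G)"

definition quasi_continuous :: "'a::euclidean_space set \<Rightarrow> ('a \<Rightarrow> real) \<Rightarrow> bool" where
  "quasi_continuous M f \<longleftrightarrow>
     (\<forall>\<epsilon>>0. \<exists>G. openin (top_of_set M) G \<and> capacity M G < ennreal \<epsilon> \<and> continuous_on (M - G) f)"

text \<open>A class in \<open>H\<^sup>1\<close> vanishes quasi-everywhere on \<open>A\<close> if a quasi-continuous version of it is
  zero on \<open>A\<close> outside a set of capacity zero.\<close>

definition vanishes_qe :: "'a::euclidean_space set \<Rightarrow> ('a \<Rightarrow> real) \<Rightarrow> 'a set \<Rightarrow> bool" where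
  "vanishes_qe M f A \<longleftrightarrow>
     (\<exists>g. quasi_continuous M g \<and> (AE x in nleb M. g x = f x) \<and>
        (\<exists>N. N \<subseteq> M \<and> capacity M N = 0 \<and> (\<forall>x\<in>A - N. g x = 0)))"

text \<open>The value is \<open>\<infinity>\<close> if no nonzero function is admissible (for instance if \<open>A = M\<close>).\<close>

definition killed_eigenvalue :: "'a::euclidean_space set \<Rightarrow> 'a set \<Rightarrow> ereal" where
  "killed_eigenvalue M A = (INF f \<in> {f \<in> H1 M. vanishes_qe M f A \<and> l2_inner M f f \<noteq> 0}.
      ereal (energy M f f / l2_inner M f f))"

text \<open>\<open>e\<close> to the power \<open>- l * u\<close> for \<open>u \<ge> 0\<close> and \<open>l \<in> [0, \<infinity>]\<close>, with \<open>\<infinity> * 0 = 0\<close>.\<close>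

definition exp_decay :: "ereal \<Rightarrow> real \<Rightarrow> real" where
  "exp_decay l u = (if l = \<infinity> then (if u = 0 then 1 else 0) else exp (- real_of_ereal l * u))"

definition spectral_profile :: "'a::euclidean_space set \<Rightarrow> 'a set set \<Rightarrow> real \<Rightarrow> real" where
  "spectral_profile M \<A> u = (\<Sum>A\<in>\<A>. exp_decay (killed_eigenvalue M A) u)"


section \<open>Reflected Brownian motion\<close>

text \<open>
  The process is the coordinate process on the space of continuous paths from \<open>[0, \<infinity>)\<close> to \<open>M\<close>
  (functions that are \<^const>\<open>undefined\<close> at negative times) with the sigma-algebra generated by the
  coordinates.  It is thus represented by the family of its laws \<open>P z\<close>, \<open>z \<in> M\<close>.
\<close>

definition path_space :: "'a::euclidean_space set \<Rightarrow> (real \<Rightarrow> 'a) measure" where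
  "path_space M = restrict_space (PiM {0..} (\<lambda>_. restrict_space borel M)) {\<omega>. continuous_on {0..} \<omega>}"

definition past :: "'a::euclidean_space set \<Rightarrow> real \<Rightarrow> (real \<Rightarrow> 'a) set set" where
  "past M t = sigma_sets (space (path_space M))
     {{\<omega> \<in> space (path_space M). \<omega> s \<in> B} |s B. 0 \<le> s \<and> s \<le> t \<and> B \<in> sets borel}"

definition path_shift :: "real \<Rightarrow> (real \<Rightarrow> 'a) \<Rightarrow> real \<Rightarrow> 'a" where
  "path_shift s \<omega> = restrict (\<lambda>t. \<omega> (s + t)) {0..}"

text \<open>Stopping times of the right-continuous filtration \<open>\<F>\<close> with \<open>\<F> t = (\<Inter>u>t. past M u)\<close>
  and the events prior to them.\<close>

definition optional_time :: "'a::euclidean_space set \<Rightarrow> ((real \<Rightarrow> 'a) \<Rightarrow> ennreal) \<Rightarrow> bool" where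
  "optional_time M \<tau> \<longleftrightarrow> (\<forall>t\<ge>0. {\<omega> \<in> space (path_space M). \<tau> \<omega> < ennreal t} \<in> past M t)"

definition prior_events ::
  "'a::euclidean_space set \<Rightarrow> ((real \<Rightarrow> 'a) \<Rightarrow> ennreal) \<Rightarrow> (real \<Rightarrow> 'a) set set" where
  "prior_events M \<tau> = {\<Lambda> \<in> sets (path_space M). \<forall>t\<ge>0. {\<omega> \<in> \<Lambda>. \<tau> \<omega> < ennreal t} \<in> past M t}"

text \<open>
  A conservative Hunt process with continuous paths: it has infinite lifetime because the \<open>P z\<close>
  are probability measures on paths in \<open>M\<close>, and quasi-left-continuity is implied by path
  continuity, so that measurability, normality and the strong Markov property remain.
\<close>

definition continuous_hunt_process ::
  "'a::euclidean_space set \<Rightarrow> ('a \<Rightarrow> (real \<Rightarrow> 'a) measure) \<Rightarrow> bool" where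
  "continuous_hunt_process M P \<longleftrightarrow>
     P \<in> restrict_space borel M \<rightarrow>\<^sub>M prob_algebra (path_space M) \<and>
     (\<forall>z\<in>M. AE \<omega> in P z. \<omega> 0 = z) \<and>
     (\<forall>\<tau>. optional_time M \<tau> \<longrightarrow>
        (\<forall>\<Lambda>\<in>prior_events M \<tau>. \<forall>E\<in>sets (path_space M). \<forall>z\<in>M.
           emeasure (P z) {\<omega> \<in> \<Lambda>. \<tau> \<omega> < \<infinity> \<and> path_shift (enn2real (\<tau> \<omega>)) \<omega> \<in> E} =
           (\<integral>\<^sup>+\<omega>. emeasure (P (\<omega> (enn2real (\<tau> \<omega>)))) E * indicator {\<omega> \<in> \<Lambda>. \<tau> \<omega> < \<infinity>} \<omega> \<partial>P z)))"

definition symmetric_process ::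
  "'a::euclidean_space set \<Rightarrow> ('a \<Rightarrow> (real \<Rightarrow> 'a) measure) \<Rightarrow> bool" where
  "symmetric_process M P \<longleftrightarrow>
     (\<forall>t\<ge>0. \<forall>f\<in>borel_measurable (nleb M). \<forall>g\<in>borel_measurable (nleb M).
        (\<integral>\<^sup>+x. f x * (\<integral>\<^sup>+\<omega>. g (\<omega> t) \<partial>P x) \<partial>nleb M) =
        (\<integral>\<^sup>+x. (\<integral>\<^sup>+\<omega>. f (\<omega> t) \<partial>P x) * g x \<partial>nleb M))"

definition semigroup :: "('a \<Rightarrow> (real \<Rightarrow> 'a) measure) \<Rightarrow> real \<Rightarrow> ('a \<Rightarrow> real) \<Rightarrow> 'a \<Rightarrow> real" where
  "semigroup P t f x = (\<integral>\<omega>. f (\<omega> t) \<partial>P x)"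

text \<open>The Dirichlet form of a symmetric process is the limit of \<open>(f - P\<^sub>t f, g) / t\<close> as \<open>t\<close> decreases to
  \<open>0\<close>; its domain consists of the \<open>f\<close> for which the limit with \<open>g = f\<close> is finite.\<close>

definition associated_with_energy ::
  "'a::euclidean_space set \<Rightarrow> ('a \<Rightarrow> (real \<Rightarrow> 'a) measure) \<Rightarrow> bool" where
  "associated_with_energy M P \<longleftrightarrow>
     (\<forall>f\<in>L2 M. f \<in> H1 M \<longleftrightarrow>
        (\<exists>l. ((\<lambda>t. l2_inner M (\<lambda>x. f x - semigroup P t f x) f / t) \<longlongrightarrow> l) (at_right 0))) \<and>
     (\<forall>f\<in>H1 M. \<forall>g\<in>H1 M.
        ((\<lambda>t. l2_inner M (\<lambda>x. f x - semigroup P t f x) g / t) \<longlongrightarrow> energy M f g) (at_right 0))"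

definition reflected_BM ::
  "'a::euclidean_space set \<Rightarrow> ('a \<Rightarrow> (real \<Rightarrow> 'a) measure) \<Rightarrow> bool" where
  "reflected_BM M P \<longleftrightarrow>
     continuous_hunt_process M P \<and> symmetric_process M P \<and> associated_with_energy M P"

text \<open>Symmetric transition densities with respect to normalized Lebesgue measure, for every starting
  point.\<close>

definition neumann_heat_kernel ::
  "'a::euclidean_space set \<Rightarrow> ('a \<Rightarrow> (real \<Rightarrow> 'a) measure) \<Rightarrow> (real \<Rightarrow> 'a \<Rightarrow> 'a \<Rightarrow> real) \<Rightarrow> bool" where
  "neumann_heat_kernel M P p \<longleftrightarrow>
     (\<forall>t>0. (\<lambda>(x, y). p t x y) \<in> borel_measurable (nleb M \<Otimes>\<^sub>M nleb M) \<and>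
        (\<forall>x\<in>M. \<forall>y\<in>M. 0 \<le> p t x y \<and> p t x y = p t y x) \<and>
        (\<forall>x\<in>M. distr (P x) (nleb M) (\<lambda>\<omega>. \<omega> t) = density (nleb M) (\<lambda>y. ennreal (p t x y))))"

definition compact_semigroup ::
  "'a::euclidean_space set \<Rightarrow> ('a \<Rightarrow> (real \<Rightarrow> 'a) measure) \<Rightarrow> bool" where
  "compact_semigroup M P \<longleftrightarrow>
     (\<forall>t>0. \<forall>f::nat \<Rightarrow> 'a \<Rightarrow> real. (\<forall>n. f n \<in> L2 M) \<and> (\<exists>C. \<forall>n. l2_inner M (f n) (f n) \<le> C) \<longrightarrow>
        (\<exists>r g. strict_mono r \<and> g \<in> L2 M \<and>
           (\<lambda>n. \<integral>x. (semigroup P t (f (r n)) x - g x)\<^sup>2 \<partial>nleb M) \<longlonglongrightarrow> 0))"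

text \<open>The spectrum consists of eigenvalues \<open>0 = \<lambda>\<^sub>0 < \<lambda>\<^sub>1 \<le> \<lambda>\<^sub>2 \<le> \<dots>\<close> of finite multiplicity tending to
  infinity, with a complete orthonormal system of eigenfunctions.\<close>

definition discrete_spectrum_with_gap :: "'a::euclidean_space set \<Rightarrow> bool" where
  "discrete_spectrum_with_gap M \<longleftrightarrow>
     (\<exists>(\<Lambda>::nat \<Rightarrow> real) (e::nat \<Rightarrow> 'a \<Rightarrow> real).
        (\<forall>n. e n \<in> H1 M \<and> (\<forall>g\<in>H1 M. energy M (e n) g = \<Lambda> n * l2_inner M (e n) g)) \<and>
        (\<forall>m n. l2_inner M (e m) (e n) = (if m = n then 1 else 0)) \<and>
        (\<forall>f\<in>L2 M. (\<forall>n. l2_inner M f (e n) = 0) \<longrightarrow> (AE x in nleb M. f x = 0)) \<and>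
        mono \<Lambda> \<and> filterlim \<Lambda> at_top sequentially \<and> \<Lambda> 0 = 0 \<and> 0 < \<Lambda> 1)"

text \<open>
  Uniqueness in law is required among the processes that possess a heat kernel.  Without transition
  densities for every starting point the Dirichlet form determines \<open>P z\<close> only for quasi-every \<open>z\<close>:
  for instance, a polar point may be turned into a trap.
\<close>

definition admissible_reflecting_domain :: "'a::euclidean_space set \<Rightarrow> bool" where
  "admissible_reflecting_domain M \<longleftrightarrow>
     (\<exists>P p. reflected_BM M P \<and> neumann_heat_kernel M P p \<and> compact_semigroup M P) \<and>
     (\<forall>P p P' p'. reflected_BM M P \<and> neumann_heat_kernel M P p \<and>
        reflected_BM M P' \<and> neumann_heat_kernel M P' p' \<longrightarrow> (\<forall>z\<in>M. P z = P' z)) \<and>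
     discrete_spectrum_with_gap M \<and>
     uniform_bilipschitz_charts M"


section \<open>Recovery events and certificates\<close>

definition hits_all :: "(real \<Rightarrow> 'a) \<Rightarrow> real \<Rightarrow> 'a set set \<Rightarrow> bool" where
  "hits_all \<gamma> T \<A> \<longleftrightarrow> (\<forall>A\<in>\<A>. \<gamma> ` {0..T} \<inter> A \<noteq> {})"

definition homology_recovered ::
  "'k::field itself \<Rightarrow> 'a::euclidean_space set \<Rightarrow> nat \<Rightarrow> real \<Rightarrow> 'a set \<Rightarrow> bool" where
  "homology_recovered k M q r S \<longleftrightarrow> fhom_iso k q (top_of_set (nbhd S r)) (top_of_set M)"

definition homological_certificate ::
  "'k::field itself \<Rightarrow> 'a::euclidean_space set \<Rightarrow> nat \<Rightarrow> real \<Rightarrow> 'a set set \<Rightarrow> bool" where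
  "homological_certificate k M q r \<A> \<longleftrightarrow>
     (\<forall>T \<gamma>. 0 \<le> T \<and> continuous_on {0..T} \<gamma> \<and> \<gamma> ` {0..T} \<subseteq> M \<and> hits_all \<gamma> T \<A> \<longrightarrow>
        homology_recovered k M q r (\<gamma> ` {0..T}))"

definition full_homological_certificate ::
  "'k::field itself \<Rightarrow> 'a::euclidean_space set \<Rightarrow> real \<Rightarrow> 'a set set \<Rightarrow> bool" where
  "full_homological_certificate k M r \<A> \<longleftrightarrow> (\<forall>q\<le>DIM('a). homological_certificate k M q r \<A>)"

definition recovery_event ::
  "'k::field itself \<Rightarrow> 'a::euclidean_space set \<Rightarrow> nat \<Rightarrow> real \<Rightarrow> real \<Rightarrow> (real \<Rightarrow> 'a) set" where
  "recovery_event k M q T r =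
     {\<omega> \<in> space (path_space M). homology_recovered k M q r (\<omega> ` {0..T})}"

definition full_recovery_event ::
  "'k::field itself \<Rightarrow> 'a::euclidean_space set \<Rightarrow> real \<Rightarrow> real \<Rightarrow> (real \<Rightarrow> 'a) set" where
  "full_recovery_event k M T r = (\<Inter>q\<in>{..DIM('a)}. recovery_event k M q T r)"

text \<open>
  The recovery events need not belong to the sigma-algebra generated by the coordinates.  Their
  probability is read as inner probability, which agrees with the probability on every event of the
  completed sigma-algebra; lower bounds for it are the strongest possible reading.
\<close>

definition inner_prob :: "'b measure \<Rightarrow> 'b set \<Rightarrow> real" where
  "inner_prob N S = (SUP E \<in> {E \<in> sets N. E \<subseteq> S}. measure N E)"

lemma inner_prob_completion:
  assumes "prob_space N" and S: "S \<in> sets (completion N)"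
  shows "inner_prob N S = measure (completion N) S"
proof -
  interpret prob_space N by fact
  have sub: "main_part N S \<subseteq> S"
    using main_part_null_part_Un[OF S] by blast
  have "measure N (main_part N S) = measure (completion N) S"
    using emeasure_completion[OF S] by (simp add: measure_def)
  moreover have "measure N E \<le> measure (completion N) S" if "E \<in> sets N" "E \<subseteq> S" for E
  proof -
    interpret C: prob_space "completion N"
      by (rule prob_spaceI) (simp add: emeasure_space_1)
    show ?thesis
      using C.finite_measure_mono[OF that(2) S] that(1) by (simp add: measure_completion)
  qed
  ultimately show ?thesis
    unfolding inner_prob_def using sub S
    by (intro cSup_eq_maximum) (auto intro!: image_eqI[where x = "main_part N S"])
qed

lemma inner_prob_eq:
  assumes "prob_space N" and "S \<in> sets N"
  shows "inner_prob N S = measure N S"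
  using inner_prob_completion[OF assms(1), of S] assms(2) by (simp add: measure_completion)

end

theory Submission
 imports Defs
begin

text \<open>
A path that hits every target of a certificate recovers the homology, so failure means that some target A is
avoided up to time T, in particular during [s0, T]. By the Markov property at time s0, where the density of
the process is at most a_hk, that has probability at most a_hk times the probability that the stationary
process avoids A for the time u = T - s0. By a union bound it suffices to show mass A u <= exp (- l * u),
where mass A u is that stationary probability and l the killed eigenvalue of A (decay, hitting_bound).

Let f be the survival probability surv A (u/2) as a function of the starting point. Time reversal gives (surv
A s, surv A t) = mass A (s + t). Hence f has squared norm mass A u, and by the Cauchy-Schwarz inequality mass
A is log-convex in time. As mass A 0 <= 1, log-convexity forces the logarithmic derivative of mass A at u
to be at least ln (mass A u) / u, which says that f has energy at most - ln (mass A u) / u * mass A u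
(surv_energy). Since f vanishes quasi-everywhere on A, it is admissible in the variational definition of l, so
l <= - ln (mass A u) / u.

Two things need work. First, for a Borel set A neither the measurability of the avoidance event nor the
vanishing of f on A is immediate. For compact A both follow by approximation with open neighbourhoods. In
general A is replaced by an increasing union S \<subseteq> A of compact sets with the least possible mass S
(u/2) (avoiding_set). If surv S (u/2) did not vanish quasi-everywhere on A, Choquet's theorem would give a
compact subset of A of positive capacity on which it is bounded below, and adding that set to S would make the
mass smaller. Choquet's theorem needs the capacity to be continuous along increasing sequences. That rests on
quasi-continuous versions and on convex combinations that turn bounded sequences into strongly convergent ones
(hull_cauchy).

Second, quasi-continuous versions exist only if continuous functions are plentiful in H1 M. This comes from
the charts and the volume bound. A function f with gradient g has the property that the integral of (f x - f
y)^2 over the pairs with |x - y| < r is at most K * r^(d + 2) times the integral of |g|^2 (oscillation_bound),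
so its smooth local averages at scale r have bounded energy and converge to f in L2 M (average_estimates).
With the convex combinations above this weak form of density is enough.

Throughout, the energy is handled through the forms Et t f, integrals of (f x - f y)^2 against the law of the
stationary process at the times 0 and t. They turn contraction properties, lower semicontinuity and the
parallelogram law into pointwise statements.
\<close>

section \<open>Suslin sets and capacities\<close>

text \<open>Suslin schemes with closed sets, indexed by infinite sequences with the requirement that level n depends only
on the first n entries. Recoding the index sequences is then mere substitution.\<close>

definition suslin :: "'a::topological_space set => bool" where
 "suslin A \<longleftrightarrow> (\<exists>F :: nat => (nat => nat) => 'a set.
  (\<forall>n sigma. closed (F n sigma)) & (\<forall>n sigma tau. (\<forall>i<n. sigma i = tau i) --> F n sigma = F n tau) &
  A = (\<Union>sigma. \<Inter>n. F n sigma))"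

lemma suslin_closed: "closed A ==> suslin A"
 unfolding suslin_def by (rule exI[of _ "%n sigma. A"]) auto

text \<open>The first entry of an index sequence selects the set; the remaining entries run through its scheme.\<close>

lemma suslin_UN:
 fixes A :: "nat => 'a::topological_space set"
 assumes "!!i. suslin (A i)"
 shows "suslin (\<Union>i. A i)"
proof -
 from assms have "\<forall>i. \<exists>F :: nat => (nat => nat) => 'a set.
  (\<forall>n sigma. closed (F n sigma)) & (\<forall>n sigma tau. (\<forall>i<n. sigma i = tau i) --> F n sigma = F n tau) &
  A i = (\<Union>sigma. \<Inter>n. F n sigma)"
  unfolding suslin_def by blast
 then obtain F :: "nat => nat => (nat => nat) => 'a set" where
  F: "!!i n sigma. closed (F i n sigma)" "!!i n sigma tau. (\<forall>k<n. sigma k = tau k) ==> F i n sigma = F i n tau"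
   "!!i. A i = (\<Union>sigma. \<Inter>n. F i n sigma)"
  by metis
 define G where "G = (%n (sigma::nat => nat). case n of 0 => UNIV | Suc m => F (sigma 0) m (%k. sigma (Suc k)))"
 have "closed (G n sigma)" for n sigma using F(1) by (cases n) (auto simp: G_def)
 moreover have "G n sigma = G n tau" if "\<forall>i<n. sigma i = tau i" for n sigma tau
 proof (cases n)
  case (Suc m)
  hence "F (sigma 0) m (%k. sigma (Suc k)) = F (sigma 0) m (%k. tau (Suc k))"
   by (intro F(2)) (use that in auto)
  thus ?thesis using that Suc by (auto simp: G_def)
 qed (auto simp: G_def)
 moreover have "(\<Union>i. A i) = (\<Union>sigma. \<Inter>n. G n sigma)"
 proof (intro equalityI subsetI)
  fix x assume "x \<in> (\<Union>i. A i)"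
  then obtain i sigma where "!!n. x \<in> F i n sigma" unfolding F(3) by auto
  hence "x \<in> G n (case_nat i sigma)" for n by (cases n) (auto simp: G_def)
  thus "x \<in> (\<Union>sigma. \<Inter>n. G n sigma)" by auto
 next
  fix x assume "x \<in> (\<Union>sigma. \<Inter>n. G n sigma)"
  then obtain sigma where sigma: "!!n. x \<in> G n sigma" by blast
  have "x \<in> F (sigma 0) n (%k. sigma (Suc k))" for n using sigma[of "Suc n"] by (simp add: G_def)
  thus "x \<in> (\<Union>i. A i)" unfolding F(3) by auto
 qed
 ultimately show ?thesis unfolding suslin_def by (intro exI[of _ G]) simp
qed

text \<open>One sequence codes infinitely many: its entry at prod_encode (i, k) is the k-th index for the i-th set. Level
prod_encode (i, k) sees the first k of these because prod_encode (i, _) is increasing.\<close>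

lemma suslin_INT:
 fixes A :: "nat => 'a::topological_space set"
 assumes "!!i. suslin (A i)"
 shows "suslin (\<Inter>i. A i)"
proof -
 from assms have "\<forall>i. \<exists>F :: nat => (nat => nat) => 'a set.
  (\<forall>n sigma. closed (F n sigma)) & (\<forall>n sigma tau. (\<forall>i<n. sigma i = tau i) --> F n sigma = F n tau) &
  A i = (\<Union>sigma. \<Inter>n. F n sigma)"
  unfolding suslin_def by blast
 then obtain F :: "nat => nat => (nat => nat) => 'a set" where
  F: "!!i n sigma. closed (F i n sigma)" "!!i n sigma tau. (\<forall>k<n. sigma k = tau k) ==> F i n sigma = F i n tau"
   "!!i. A i = (\<Union>sigma. \<Inter>n. F i n sigma)"
  by metis
 define G where "G = (%n (sigma::nat => nat).
  F (fst (prod_decode n)) (snd (prod_decode n)) (%k. sigma (prod_encode (fst (prod_decode n), k))))"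
 have G_enc: "G (prod_encode (i, k)) sigma = F i k (%j. sigma (prod_encode (i, j)))" for i k sigma
  by (simp add: G_def)
 have mono: "prod_encode (i, j) < prod_encode (i, k)" if "j < k" for i j k
 proof -
  have "triangle (i + j) < triangle (i + k)" using that
  proof (induction k)
   case (Suc k)
   thus ?case by (cases "j = k") (auto simp: less_Suc_eq)
  qed auto
  thus ?thesis by (simp add: prod_encode_def)
 qed
 have "closed (G n sigma)" for n sigma using F(1) by (auto simp: G_def)
 moreover have "G n sigma = G n tau" if *: "\<forall>i<n. sigma i = tau i" for n sigma tau
 proof -
  obtain i k where n: "n = prod_encode (i, k)" by (metis prod_decode_inverse surj_pair)
  show ?thesis unfolding n G_enc by (rule F(2)) (use * mono n in auto)
 qed
 moreover have "(\<Inter>i. A i) = (\<Union>sigma. \<Inter>n. G n sigma)"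
 proof (intro equalityI subsetI)
  fix x assume "x \<in> (\<Inter>i. A i)"
  hence "\<forall>i. \<exists>sigma. \<forall>n. x \<in> F i n sigma" unfolding F(3) by auto
  then obtain s where s: "!!i n. x \<in> F i n (s i)" by metis
  define sigma where "sigma n = s (fst (prod_decode n)) (snd (prod_decode n))" for n
  have "x \<in> G n sigma" for n
  proof -
   obtain i k where n: "n = prod_encode (i, k)" by (metis prod_decode_inverse surj_pair)
   show ?thesis using s[of i k] unfolding n G_enc by (simp add: sigma_def)
  qed
  thus "x \<in> (\<Union>sigma. \<Inter>n. G n sigma)" by auto
 next
  fix x assume "x \<in> (\<Union>sigma. \<Inter>n. G n sigma)"
  then obtain sigma where sigma: "!!n. x \<in> G n sigma" by blast
  have "x \<in> F i k (%j. sigma (prod_encode (i, j)))" for i k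
   using sigma[of "prod_encode (i, k)"] by (simp add: G_enc)
  thus "x \<in> (\<Inter>i. A i)" unfolding F(3) by auto
 qed
 ultimately show ?thesis unfolding suslin_def by (intro exI[of _ G]) simp
qed

lemma suslin_open:
 fixes A :: "'a::metric_space set"
 assumes "open A" shows "suslin A"
proof (cases "A = UNIV")
 case False
 hence ne: "- A ~= {}" by auto
 have "A = (\<Union>n. {x. 1 / real (Suc n) <= infdist x (- A)})"
 proof (intro equalityI subsetI)
  fix x assume "x \<in> A"
  hence "x \<notin> - A" by auto
  moreover have "closed (- A)" using assms by auto
  ultimately have "infdist x (- A) > 0"
   using ne in_closed_iff_infdist_zero[of "- A" x] infdist_nonneg[of x "- A"] by force
  thus "x \<in> (\<Union>n. {x. 1 / real (Suc n) <= infdist x (- A)})"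
   using nat_approx_posE[of "infdist x (- A)"] less_imp_le by (metis (mono_tags, lifting) UN_I UNIV_I mem_Collect_eq)
 next
  fix x assume "x \<in> (\<Union>n. {x. 1 / real (Suc n) <= infdist x (- A)})"
  then obtain n where "1 / real (Suc n) <= infdist x (- A)" by auto
  hence "infdist x (- A) > 0" by (smt (verit) divide_pos_pos of_nat_0_less_iff zero_less_Suc)
  thus "x \<in> A" by (metis ComplI infdist_zero less_irrefl)
 qed
 moreover have "suslin {x. 1 / real (Suc n) <= infdist x (- A)}" for n
  by (intro suslin_closed closed_Collect_le continuous_intros)
 ultimately show ?thesis using suslin_UN by metis
qed (auto intro: suslin_closed)

text \<open>Suslin sets are not closed under complements, so the induction carries A and its complement together.\<close>

lemma suslin_borel:
 fixes A :: "'a::metric_space set"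
 assumes "A \<in> sets borel" shows "suslin A"
proof -
 have "suslin A & suslin (- A)"
 proof -
  have "A \<in> sigma_sets UNIV {S. open S}"
   using assms unfolding borel_def by simp
  thus ?thesis
 proof (induction rule: sigma_sets.induct)
  case (Basic a)
  thus ?case by (auto intro: suslin_open suslin_closed)
 next
  case Empty
  thus ?case by (auto intro: suslin_closed)
 next
  case (Compl a)
  thus ?case by (simp add: Compl_eq_Diff_UNIV[symmetric])
 next
  case (Union a)
  thus ?case by (auto intro: suslin_UN suslin_INT)
 qed
 qed
 thus ?thesis by simp
qed

text \<open>Bounding the indices one after the other, continuity along increasing sequences keeps the capacity above
\<open>a\<close>. The sets that remain have compact supersets K n, given by finitely many index prefixes, and
continuity along decreasing compact sets passes to their intersection. That intersection lies in A by Koenig's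
lemma, since only finitely many indices are left at each place.\<close>

theorem choquet_capacitability:
 fixes A M :: "'a::metric_space set" and c :: "'a set => ennreal"
 assumes mono: "!!S T. S \<subseteq> T ==> T \<subseteq> M ==> c S <= c T"
  and up: "!!S a. incseq S ==> (!!n::nat. S n \<subseteq> M & c (S n) <= a) ==> c (\<Union>n. S n) <= a"
  and down: "!!K a. decseq K ==> (!!n::nat. compact (K n) & K n \<subseteq> M & a <= c (K n)) ==> a <= c (\<Inter>n. K n)"
  and "compact M" "A \<subseteq> M" "suslin A" "a < c A"
 obtains K where "compact K" "K \<subseteq> A" "a <= c K"
proof -
 obtain F :: "nat => (nat => nat) => 'a set" where
  F: "!!n sigma. closed (F n sigma)" "!!n sigma tau. (!!i. i < n ==> sigma i = tau i) ==> F n sigma = F n tau"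
  and A: "A = (\<Union>sigma. \<Inter>n. F n sigma)"
  using \<open>suslin A\<close> unfolding suslin_def by metis
 \<comment> \<open>Index sequences bounded by tau in the first n places.\<close>
 define B where "B tau n = {sigma. \<forall>i<n. sigma i <= tau i}" for tau :: "nat => nat" and n :: nat
 define D where "D tau n = (\<Union>sigma\<in>B tau n. \<Inter>k. F k sigma)" for tau n
 have DM: "D tau n \<subseteq> M" for tau n using \<open>A \<subseteq> M\<close> unfolding D_def A by auto
 have "\<exists>t. \<forall>n. a < c (D (t n) n) & (\<forall>i<n. t (Suc n) i = t n i)"
 proof (rule dependent_nat_choice)
  have "D undefined 0 = A" by (auto simp: D_def B_def A)
  thus "\<exists>tau. a < c (D tau 0)" using \<open>a < c A\<close> by metis
 next
  fix tau n assume *: "a < c (D tau n)"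
  have inc: "incseq (%j. D (tau(n := j)) (Suc n))"
  proof (intro incseq_SucI)
   fix j
   have "B (tau(n := j)) (Suc n) \<subseteq> B (tau(n := Suc j)) (Suc n)" by (auto simp: B_def less_Suc_eq)
   thus "D (tau(n := j)) (Suc n) \<subseteq> D (tau(n := Suc j)) (Suc n)" unfolding D_def by (rule UN_mono) simp
  qed
  have "sigma \<in> B (tau(n := sigma n)) (Suc n)" if "sigma \<in> B tau n" for sigma
   using that by (auto simp: B_def less_Suc_eq)
  moreover have "B (tau(n := j)) (Suc n) \<subseteq> B tau n" for j
  proof
   fix sigma assume "sigma \<in> B (tau(n := j)) (Suc n)"
   hence "sigma i <= (tau(n := j)) i" if "i < Suc n" for i using that by (simp add: B_def)
   from this[OF less_SucI] show "sigma \<in> B tau n" by (simp add: B_def split: if_splits)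
  qed
  ultimately have "B tau n = (\<Union>j. B (tau(n := j)) (Suc n))" by blast
  hence eq: "D tau n = (\<Union>j. D (tau(n := j)) (Suc n))"
   unfolding D_def by (simp only: UN_UN_flatten)
  have "\<exists>j. a < c (D (tau(n := j)) (Suc n))"
  proof (rule ccontr)
   assume "\<not> ?thesis"
   hence "c (\<Union>j. D (tau(n := j)) (Suc n)) <= a"
    by (intro up inc) (auto simp: not_less DM)
   with * eq show False by (simp add: not_less[symmetric])
  qed
  then obtain j where "a < c (D (tau(n := j)) (Suc n))" ..
  thus "\<exists>tau'. a < c (D tau' (Suc n)) & (\<forall>i<n. tau' i = tau i)"
   by (intro exI[of _ "tau(n := j)"]) auto
 qed
 then obtain t where t: "!!n. a < c (D (t n) n)" "!!n i. i < n ==> t (Suc n) i = t n i" by auto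
 define tau where "tau i = t (Suc i) i" for i
 have ttau: "t n i = tau i" if "i < n" for n i
  using that
 proof (induction n)
  case (Suc n)
  thus ?case using t(2) by (cases "i = n") (auto simp: tau_def less_Suc_eq)
 qed auto
 have aD: "a < c (D tau n)" for n
 proof -
  have "B (t n) n = B tau n" using ttau by (auto simp: B_def)
  thus ?thesis using t(1)[of n] by (simp add: D_def)
 qed
 define K where "K n = M \<inter> (\<Union>sigma\<in>B tau n. \<Inter>k\<in>{..n}. F k sigma)" for n
 have K_fin: "K n = M \<inter> (\<Union>sigma\<in>PiE {..<n} (%i. {..tau i}). \<Inter>k\<in>{..n}. F k sigma)" for n
 proof -
  have 1: "\<exists>sigma'\<in>PiE {..<n} (%i. {..tau i}). (\<Inter>k\<in>{..n}. F k sigma) = (\<Inter>k\<in>{..n}. F k sigma')" if "sigma \<in> B tau n" for sigma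
  proof (rule bexI[of _ "restrict sigma {..<n}"])
   have "F k sigma = F k (restrict sigma {..<n})" if "k <= n" for k
    using that by (intro F(2)) auto
   thus "(\<Inter>k\<in>{..n}. F k sigma) = (\<Inter>k\<in>{..n}. F k (restrict sigma {..<n}))" by auto
  qed (use that in "auto simp: B_def")
  have 2: "PiE {..<n} (%i. {..tau i}) \<subseteq> B tau n" by (auto simp: B_def PiE_def Pi_def)
  have "(\<Union>sigma\<in>B tau n. \<Inter>k\<in>{..n}. F k sigma) = (\<Union>sigma\<in>PiE {..<n} (%i. {..tau i}). \<Inter>k\<in>{..n}. F k sigma)"
  proof (intro equalityI UN_least)
   fix sigma assume "sigma \<in> B tau n"
   then obtain sigma' where "sigma' \<in> PiE {..<n} (%i. {..tau i})" "(\<Inter>k\<in>{..n}. F k sigma) = (\<Inter>k\<in>{..n}. F k sigma')"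
    using 1[of sigma] by metis
   thus "(\<Inter>k\<in>{..n}. F k sigma) \<subseteq> (\<Union>sigma\<in>PiE {..<n} (%i. {..tau i}). \<Inter>k\<in>{..n}. F k sigma)" by auto
  next
   fix sigma assume "sigma \<in> PiE {..<n} (%i. {..tau i})"
   with 2 show "(\<Inter>k\<in>{..n}. F k sigma) \<subseteq> (\<Union>sigma\<in>B tau n. \<Inter>k\<in>{..n}. F k sigma)" by (intro UN_upper) auto
  qed
  thus ?thesis unfolding K_def by simp
 qed
 have cK: "compact (K n)" for n
  unfolding K_fin by (intro compact_Int_closed \<open>compact M\<close> closed_UN closed_INT ballI F finite_PiE) auto
 note cK
 moreover have "decseq K"
 proof (intro decseq_SucI)
  fix n
  have "B tau (Suc n) \<subseteq> B tau n" by (auto simp: B_def)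
  hence "(\<Union>sigma\<in>B tau (Suc n). \<Inter>k\<in>{..Suc n}. F k sigma) \<subseteq> (\<Union>sigma\<in>B tau n. \<Inter>k\<in>{..n}. F k sigma)"
   by (rule UN_mono) auto
  thus "K (Suc n) \<subseteq> K n" unfolding K_def by blast
 qed
 moreover have "a <= c (K n)" for n
 proof -
  have "D tau n \<subseteq> K n" using DM[of tau n] unfolding D_def K_def by auto
  hence "c (D tau n) <= c (K n)" by (rule mono) (auto simp: K_def)
  thus ?thesis using aD[of n] by simp
 qed
 moreover have "K n \<subseteq> M" for n by (simp add: K_def)
 ultimately have "a <= c (\<Inter>n. K n)" by (intro down) simp_all
 moreover have "compact (\<Inter>n. K n)"
 proof -
  have "compact (K 0 \<inter> (\<Inter>n. K n))"
   using cK by (intro compact_Int_closed closed_INT ballI compact_imp_closed)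
  thus ?thesis by (simp add: Int_absorb1 INF_lower)
 qed
 moreover have "(\<Inter>n. K n) \<subseteq> A"
 proof
  fix x assume x: "x \<in> (\<Inter>n. K n)"
  \<comment> \<open>The prefix s of length n extends to arbitrarily long bounded sequences through x.\<close>
  define good where "good n s \<longleftrightarrow> (\<forall>m\<ge>n. \<exists>sigma\<in>B tau m. (\<forall>i<n. sigma i = s i) & (\<forall>k\<le>m. x \<in> F k sigma))" for n and s :: "nat => nat"
  have "\<exists>s. \<forall>n. good n (s n) & (\<forall>i<n. s (Suc n) i = s n i)"
  proof (rule dependent_nat_choice)
   show "\<exists>s. good 0 s" using x unfolding good_def K_def by (intro exI[of _ undefined]) blast
  next
   fix s n assume g: "good n s"
   have "\<exists>j. good (Suc n) (s(n := j))"
   proof (rule ccontr)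
    assume "\<not> ?thesis"
    hence "\<forall>j. \<exists>m\<ge>Suc n. \<not> (\<exists>sigma\<in>B tau m. (\<forall>i<Suc n. sigma i = (s(n := j)) i) & (\<forall>k\<le>m. x \<in> F k sigma))"
     unfolding good_def by blast
    then obtain m where m: "!!j. m j \<ge> Suc n"
     "!!j. \<not> (\<exists>sigma\<in>B tau (m j). (\<forall>i<Suc n. sigma i = (s(n := j)) i) & (\<forall>k\<le>m j. x \<in> F k sigma))" by metis
    define L where "L = Max (m ` {..tau n})"
    have L: "m j <= L" if "j <= tau n" for j using that unfolding L_def by (intro Max_ge) auto
    have "n < L" using L[of 0] m(1)[of 0] by simp
    then obtain sigma where sigma: "sigma \<in> B tau L" "\<forall>i<n. sigma i = s i" "\<forall>k\<le>L. x \<in> F k sigma"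
     using g unfolding good_def by (metis less_imp_le)
    have "sigma n <= tau n" using sigma(1) \<open>n < L\<close> by (auto simp: B_def)
    hence "m (sigma n) <= L" by (rule L)
    hence "sigma \<in> B tau (m (sigma n))" "\<forall>k\<le>m (sigma n). x \<in> F k sigma" using sigma by (auto simp: B_def)
    moreover have "\<forall>i<Suc n. sigma i = (s(n := sigma n)) i" using sigma(2) by auto
    ultimately show False using m(2)[of "sigma n"] by blast
   qed
   thus "\<exists>s'. good (Suc n) s' & (\<forall>i<n. s' i = s i)" by (metis fun_upd_other less_irrefl)
  qed
  then obtain s where s: "!!n. good n (s n)" "!!n i. i < n ==> s (Suc n) i = s n i" by auto
  define sigma where "sigma i = s (Suc i) i" for i
  have ssigma: "s n i = sigma i" if "i < n" for n i
   using that
  proof (induction n)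
   case (Suc n)
   thus ?case using s(2) by (cases "i = n") (auto simp: sigma_def less_Suc_eq)
  qed auto
  have "x \<in> F n sigma" for n
  proof -
   obtain rho where rho: "\<forall>i<n. rho i = s n i" "x \<in> F n rho" using s(1)[of n] unfolding good_def by blast
   have "F n rho = F n sigma" by (rule F(2)) (use rho ssigma in auto)
   thus ?thesis using rho by simp
  qed
  thus "x \<in> A" unfolding A by auto
 qed
 ultimately show ?thesis using that by blast
qed

section \<open>The reflected process and its approximating Dirichlet forms\<close>

locale reflected_process =
 fixes M :: "'a::euclidean_space set"
  and P :: "'a => (real => 'a) measure"
  and p :: "real => 'a => 'a => real"
 assumes compact_M: "compact M" and interior_M: "interior M ~= {}"
  and rbm: "reflected_BM M P" and hk: "neumann_heat_kernel M P p"
begin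

abbreviation "\<mu> \<equiv> nleb M"

text \<open>Integrals without an explicit measure are taken against \<mu>.\<close>

abbreviation mu_integral :: "('a => real) => real" (binder "\<integral>" 10) where
 "mu_integral f \<equiv> integral\<^sup>L \<mu> f"

abbreviation mu_nn_integral :: "('a => ennreal) => ennreal" (binder "\<integral>\<^sup>+" 10) where
 "mu_nn_integral f \<equiv> integral\<^sup>N \<mu> f"

abbreviation "grad_sq (g :: 'a => 'a) \<equiv> (\<integral>x. (norm (g x))^2)"

abbreviation "unit_val (f :: 'a => real) \<equiv> \<forall>x\<in>M. 0 <= f x & f x <= 1"

abbreviation "relopen \<equiv> openin (top_of_set M)"

lemma M_borel [measurable]: "M \<in> sets borel"
 using compact_M by (intro borel_closed compact_imp_closed)

lemma space_mu [simp]: "space \<mu> = M"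
 by (simp add: nleb_def space_restrict_space)

lemma sets_mu: "sets \<mu> = sets (restrict_space borel M)"
 by (simp add: nleb_def sets_restrict_space)

lemma emeasure_M: "emeasure lborel M ~= 0" "emeasure lborel M ~= \<infinity>"
proof -
 obtain x e where xe: "e > 0" "ball x e \<subseteq> M" using interior_M mem_interior by blast
 have "emeasure lborel (ball x e) ~= 0"
  using xe open_not_negligible[of "ball x e"] by (auto simp: negligible_iff_emeasure0)
 hence "0 < emeasure lborel (ball x e)" by (simp add: zero_less_iff_neq_zero)
 also have "... <= emeasure lborel M" by (rule emeasure_mono) (use xe in auto)
 finally show "emeasure lborel M ~= 0" by simp
 show "emeasure lborel M ~= \<infinity>"
  using emeasure_compact_finite[OF compact_M] by auto
qed

sublocale mu: prob_space \<mu>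
 unfolding nleb_def by (rule prob_space_uniform_measure) (use emeasure_M in "auto simp: emeasure_restrict_space")

lemma P_kernel [measurable]: "P \<in> \<mu> \<rightarrow>\<^sub>M prob_algebra (path_space M)"
 using rbm unfolding reflected_BM_def continuous_hunt_process_def
 by (simp cong: measurable_cong_sets add: sets_mu)

lemma prob_space_P: "x \<in> M ==> prob_space (P x)"
 using measurable_space[OF P_kernel, of x] by (auto simp: space_prob_algebra)

lemma sets_P: "x \<in> M ==> sets (P x) = sets (path_space M)"
 using measurable_space[OF P_kernel, of x] by (auto simp: space_prob_algebra)

lemma space_P: "x \<in> M ==> space (P x) = space (path_space M)"
 using sets_eq_imp_space_eq[OF sets_P] .

lemma space_path: "space (path_space M) = {omega \<in> extensional {0..}. (\<forall>t\<ge>0. omega t \<in> M) & continuous_on {0..} omega}"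
 by (auto simp: path_space_def space_restrict_space space_PiM PiE_def)

lemma path_measurable: "0 <= t ==> (%omega. omega t) \<in> path_space M \<rightarrow>\<^sub>M \<mu>"
 unfolding path_space_def
 by (rule measurable_restrict_space1) (simp add: measurable_component_singleton sets_mu cong: measurable_cong_sets)

lemma path_measurable_P: "0 <= t ==> x \<in> M ==> (%omega. omega t) \<in> P x \<rightarrow>\<^sub>M \<mu>"
 using path_measurable[of t] by (simp add: sets_P cong: measurable_cong_sets)

lemma p_measurable [measurable]: "0 < t ==> (%(x, y). p t x y) \<in> borel_measurable (\<mu> \<Otimes>\<^sub>M \<mu>)"
 using hk unfolding neumann_heat_kernel_def by blast

lemma p_nonneg: "0 < t ==> x \<in> M ==> y \<in> M ==> 0 <= p t x y"
 and p_sym: "0 < t ==> x \<in> M ==> y \<in> M ==> p t x y = p t y x"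
 and p_distr: "0 < t ==> x \<in> M ==> distr (P x) \<mu> (%omega. omega t) = density \<mu> (%y. ennreal (p t x y))"
 using hk unfolding neumann_heat_kernel_def by blast+

lemma p_measurable_y [measurable]: "0 < t ==> x \<in> M ==> (%y. p t x y) \<in> borel_measurable \<mu>"
 using measurable_Pair2[OF p_measurable, of t x] by simp

lemma nn_integral_P:
 assumes "0 < t" "x \<in> M" and [measurable]: "f \<in> borel_measurable \<mu>"
 shows "(\<integral>\<^sup>+omega. f (omega t) \<partial>P x) = (\<integral>\<^sup>+y. ennreal (p t x y) * f y)"
proof -
 have "(\<integral>\<^sup>+omega. f (omega t) \<partial>P x) = (\<integral>\<^sup>+y. f y \<partial>distr (P x) \<mu> (%omega. omega t))"
  using assms by (subst nn_integral_distr) (auto intro: path_measurable_P)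
 also have "... = (\<integral>\<^sup>+y. ennreal (p t x y) * f y)"
  unfolding p_distr[OF assms(1,2)] by (rule nn_integral_density) (use assms in auto)
 finally show ?thesis .
qed

lemma p_integral: "0 < t ==> x \<in> M ==> (\<integral>\<^sup>+y. ennreal (p t x y)) = 1"
 using nn_integral_P[of t x "%_. 1"] prob_space.emeasure_space_1[OF prob_space_P, of x] by simp

lemma integral_P:
 assumes "0 < t" "x \<in> M" and [measurable]: "f \<in> borel_measurable \<mu>"
 shows "semigroup P t f x = (\<integral>y. p t x y * f y)"
proof -
 have "semigroup P t f x = (\<integral>y. f y \<partial>distr (P x) \<mu> (%omega. omega t))"
  unfolding semigroup_def using assms by (subst integral_distr) (auto intro: path_measurable_P)
 also have "... = (\<integral>y. p t x y * f y)"
  unfolding p_distr[OF assms(1,2)]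
 proof (rule integral_real_density)
  show "AE y in \<mu>. 0 <= p t x y" by (rule AE_I2) (simp add: p_nonneg assms)
 qed (use assms in simp_all)
 finally show ?thesis .
qed

text \<open>For t > 0 this is the law of the process at the times 0 and t when it starts from \<mu>; both marginals are
\<mu>, and the symmetry of the density makes it invariant under exchange of the coordinates.\<close>

definition joint_law :: "real => ('a \<times> 'a) measure" where
 "joint_law t = density (\<mu> \<Otimes>\<^sub>M \<mu>) (%(x, y). ennreal (p t x y))"

lemma sets_joint [simp, measurable_cong]: "sets (joint_law t) = sets (\<mu> \<Otimes>\<^sub>M \<mu>)"
 by (simp add: joint_law_def)

lemma space_joint [simp]: "space (joint_law t) = M \<times> M"
 by (simp add: joint_law_def space_pair_measure)

lemma nn_integral_joint:
 assumes "0 < t" and [measurable]: "f \<in> borel_measurable (\<mu> \<Otimes>\<^sub>M \<mu>)"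
 shows "(\<integral>\<^sup>+z. f z \<partial>joint_law t) = (\<integral>\<^sup>+x. \<integral>\<^sup>+y. ennreal (p t x y) * f (x, y) \<partial>\<mu>)"
 unfolding joint_law_def using assms p_measurable[OF assms(1)]
 by (subst nn_integral_density) (auto simp: mu.nn_integral_fst[symmetric] split_beta)

lemma nn_integral_joint_swap:
 assumes "0 < t" and [measurable]: "f \<in> borel_measurable (\<mu> \<Otimes>\<^sub>M \<mu>)"
 shows "(\<integral>\<^sup>+z. f (snd z, fst z) \<partial>joint_law t) = (\<integral>\<^sup>+z. f z \<partial>joint_law t)"
proof -
 interpret PP: pair_sigma_finite \<mu> \<mu> ..
 have m: "(%z. ennreal (p t (fst z) (snd z)) * f z) \<in> borel_measurable (\<mu> \<Otimes>\<^sub>M \<mu>)"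
  using p_measurable[OF assms(1)] by (simp add: split_beta)
 have "(\<integral>\<^sup>+z. f (snd z, fst z) \<partial>joint_law t) = (\<integral>\<^sup>+x. \<integral>\<^sup>+y. ennreal (p t x y) * f (y, x) \<partial>\<mu>)"
  using assms by (subst nn_integral_joint) auto
 also have "... = (\<integral>\<^sup>+x. \<integral>\<^sup>+y. ennreal (p t y x) * f (y, x) \<partial>\<mu>)"
  by (intro nn_integral_cong) (use p_sym[OF assms(1)] in simp)
 also have "... = (\<integral>\<^sup>+y. \<integral>\<^sup>+x. ennreal (p t y x) * f (y, x) \<partial>\<mu>)"
  using PP.Fubini'[of "%y x. ennreal (p t y x) * f (y, x)"] m unfolding split_beta by simp
 also have "... = (\<integral>\<^sup>+z. f z \<partial>joint_law t)"
  using assms by (subst nn_integral_joint) auto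
 finally show ?thesis .
qed

lemma joint_fst:
 assumes "0 < t" and [measurable]: "f \<in> borel_measurable \<mu>"
 shows "(\<integral>\<^sup>+z. f (fst z) \<partial>joint_law t) = (\<integral>\<^sup>+x. f x)"
proof -
 have "(\<integral>\<^sup>+z. f (fst z) \<partial>joint_law t) = (\<integral>\<^sup>+x. \<integral>\<^sup>+y. ennreal (p t x y) * f x \<partial>\<mu>)"
  using assms by (subst nn_integral_joint) auto
 also have "... = (\<integral>\<^sup>+x. f x)"
  by (intro nn_integral_cong) (use assms p_integral in "simp add: nn_integral_multc")
 finally show ?thesis .
qed

lemma joint_snd:
 assumes "0 < t" and [measurable]: "f \<in> borel_measurable \<mu>"
 shows "(\<integral>\<^sup>+z. f (snd z) \<partial>joint_law t) = (\<integral>\<^sup>+x. f x)"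
 using nn_integral_joint_swap[of t "%z. f (fst z)"] joint_fst[of t f] assms by simp

lemma prob_space_joint: "0 < t ==> prob_space (joint_law t)"
 using joint_fst[of t "%_. 1"] mu.emeasure_space_1 by (intro prob_spaceI) simp

lemma distr_joint_fst: "0 < t ==> distr (joint_law t) \<mu> fst = \<mu>"
proof (rule measure_eqI)
 fix A assume t: "0 < t" and A: "A \<in> sets (distr (joint_law t) \<mu> fst)"
 hence [measurable]: "A \<in> sets \<mu>" by simp
 show "emeasure (distr (joint_law t) \<mu> fst) A = emeasure \<mu> A"
  using joint_fst[OF t, of "indicator A"] A
  by (subst nn_integral_indicator[symmetric], simp, subst nn_integral_distr) auto
qed simp

lemma distr_joint_snd: "0 < t ==> distr (joint_law t) \<mu> snd = \<mu>"
proof (rule measure_eqI)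
 fix A assume t: "0 < t" and A: "A \<in> sets (distr (joint_law t) \<mu> snd)"
 hence [measurable]: "A \<in> sets \<mu>" by simp
 show "emeasure (distr (joint_law t) \<mu> snd) A = emeasure \<mu> A"
  using joint_snd[OF t, of "indicator A"] A
  by (subst nn_integral_indicator[symmetric], simp, subst nn_integral_distr) auto
qed simp

lemma integrable_joint:
 fixes f :: "'a => real"
 assumes t: "0 < t" and f: "integrable \<mu> f"
 shows "integrable (joint_law t) (%z. f (fst z))" "integrable (joint_law t) (%z. f (snd z))"
  "(\<integral>z. f (fst z) \<partial>joint_law t) = (\<integral>x. f x)" "(\<integral>z. f (snd z) \<partial>joint_law t) = (\<integral>x. f x)"
proof -
 have [measurable]: "f \<in> borel_measurable \<mu>" using f by auto
 show "integrable (joint_law t) (%z. f (fst z))" 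
  using integrable_distr_eq[of fst "joint_law t" \<mu> f] f distr_joint_fst[OF t] by simp
 show "integrable (joint_law t) (%z. f (snd z))" 
  using integrable_distr_eq[of snd "joint_law t" \<mu> f] f distr_joint_snd[OF t] by simp
 show "(\<integral>z. f (fst z) \<partial>joint_law t) = (\<integral>x. f x)"
  using integral_distr[of fst "joint_law t" \<mu> f] distr_joint_fst[OF t] by simp
 show "(\<integral>z. f (snd z) \<partial>joint_law t) = (\<integral>x. f x)"
  using integral_distr[of snd "joint_law t" \<mu> f] distr_joint_snd[OF t] by simp
qed

lemma integral_joint_swap:
 fixes f :: "'a \<times> 'a => real"
 assumes t: "0 < t" and [measurable]: "f \<in> borel_measurable (\<mu> \<Otimes>\<^sub>M \<mu>)"
 shows "(\<integral>z. f (snd z, fst z) \<partial>joint_law t) = (\<integral>z. f z \<partial>joint_law t)"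
proof -
 have "distr (joint_law t) (\<mu> \<Otimes>\<^sub>M \<mu>) (%z. (snd z, fst z)) = joint_law t"
 proof (rule measure_eqI)
  fix A assume "A \<in> sets (distr (joint_law t) (\<mu> \<Otimes>\<^sub>M \<mu>) (%z. (snd z, fst z)))"
  hence A[measurable]: "A \<in> sets (\<mu> \<Otimes>\<^sub>M \<mu>)" by simp
  show "emeasure (distr (joint_law t) (\<mu> \<Otimes>\<^sub>M \<mu>) (%z. (snd z, fst z))) A = emeasure (joint_law t) A"
   using nn_integral_joint_swap[OF t, of "indicator A"] A
   by (subst nn_integral_indicator[symmetric], simp, subst nn_integral_distr) auto
 qed simp
 thus ?thesis
  using integral_distr[of "%z. (snd z, fst z)" "joint_law t" "\<mu> \<Otimes>\<^sub>M \<mu>" f] by simp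
qed

text \<open>For f in L2 M this equals (f - P_t f, f) / t, hence tends to the energy. As an integral of squared differences
it shows contraction properties at once.\<close>

definition Et :: "real => ('a => real) => real" where
 "Et t f = 1 / (2 * t) * (\<integral>z. (f (fst z) - f (snd z))^2 \<partial>joint_law t)"

lemma L2D: assumes "f \<in> L2 M" shows "f \<in> borel_measurable \<mu>" "integrable \<mu> (%x. (f x)^2)"
 using assms by (auto simp: L2_def)

lemma L2_joint:
 assumes t: "0 < t" and f: "f \<in> L2 M" and g: "g \<in> L2 M"
 shows "integrable (joint_law t) (%z. f (fst z) * g (snd z))"
  and "integrable (joint_law t) (%z. (f (fst z) - g (snd z))^2)"
proof -
 note [measurable] = L2D(1)[OF f] L2D(1)[OF g]
 have I: "integrable (joint_law t) (%z. (f (fst z))^2 + (g (snd z))^2)"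
  using integrable_joint(1)[OF t L2D(2)[OF f]] integrable_joint(2)[OF t L2D(2)[OF g]] by simp
 have "\<bar>a * b\<bar> <= a^2 + b^2" for a b :: real
  using sum_squares_ge_zero[of "\<bar>a\<bar> - \<bar>b\<bar>" 0] abs_mult[of a b] zero_le_power2[of a] zero_le_power2[of b] mult_nonneg_nonneg[of "\<bar>a\<bar>" "\<bar>b\<bar>"]
  by (simp add: power2_eq_square algebra_simps)
 thus "integrable (joint_law t) (%z. f (fst z) * g (snd z))"
  by (intro Bochner_Integration.integrable_bound[OF I]) auto
 have "(a - b)^2 <= 2 * (a^2 + b^2)" for a b :: real
  using zero_le_power2[of "a + b"] by (simp add: power2_eq_square algebra_simps)
 thus "integrable (joint_law t) (%z. (f (fst z) - g (snd z))^2)"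
  using I by (intro Bochner_Integration.integrable_bound[OF integrable_mult_right[OF I, of 2]]) auto
qed

lemma l2_semigroup:
 assumes t: "0 < t" and f: "f \<in> L2 M" and g: "g \<in> L2 M"
 shows "integrable \<mu> (%x. f x * semigroup P t g x)"
  and "(\<integral>x. f x * semigroup P t g x) = (\<integral>z. f (fst z) * g (snd z) \<partial>joint_law t)"
proof -
 interpret PP: pair_sigma_finite \<mu> \<mu> ..
 note [measurable] = L2D(1)[OF f] L2D(1)[OF g] p_measurable[OF t]
 let ?h = "%z. p t (fst z) (snd z) * (f (fst z) * g (snd z))"
 have pm: "(%z. p t (fst z) (snd z)) \<in> borel_measurable (\<mu> \<Otimes>\<^sub>M \<mu>)"
  using p_measurable[OF t] by (simp add: split_beta)
 have nn: "AE z in \<mu> \<Otimes>\<^sub>M \<mu>. 0 <= p t (fst z) (snd z)"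
  by (rule AE_I2) (auto simp: space_pair_measure p_nonneg t)
 have I: "integrable (\<mu> \<Otimes>\<^sub>M \<mu>) ?h"
  using L2_joint(1)[OF t f g] pm nn unfolding joint_law_def split_beta
  by (subst (asm) integrable_density) auto
 have eq: "(\<integral>y. ?h (x, y)) = f x * semigroup P t g x" if "x \<in> M" for x
  using integral_P[OF t that, of g] by (simp add: mult.left_commute)
 have "integrable \<mu> (%x. \<integral>y. ?h (x, y) \<partial>\<mu>)" by (rule PP.integrable_fst'[OF I])
 thus "integrable \<mu> (%x. f x * semigroup P t g x)"
  by (subst (asm) Bochner_Integration.integrable_cong[OF refl eq]) auto
 have "(\<integral>z. f (fst z) * g (snd z) \<partial>joint_law t) = (\<integral>z. ?h z \<partial>(\<mu> \<Otimes>\<^sub>M \<mu>))"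
  unfolding joint_law_def split_beta using pm nn by (subst integral_density) auto
 also have "... = (\<integral>x. \<integral>y. ?h (x, y) \<partial>\<mu>)" by (rule PP.integral_fst'[OF I, symmetric])
 also have "... = (\<integral>x. f x * semigroup P t g x)"
  by (rule Bochner_Integration.integral_cong) (use eq in auto)
 finally show "(\<integral>x. f x * semigroup P t g x) = (\<integral>z. f (fst z) * g (snd z) \<partial>joint_law t)" ..
qed

text \<open>Expand the square; both marginals of joint_law t are \<mu>.\<close>

lemma Et_eq:
 assumes t: "0 < t" and f: "f \<in> L2 M"
 shows "Et t f = ((\<integral>x. (f x)^2) - (\<integral>x. f x * semigroup P t f x)) / t"
proof -
 have "(\<integral>z. (f (fst z) - f (snd z))^2 \<partial>joint_law t) =
  (\<integral>z. (f (fst z))^2 + (f (snd z))^2 - 2 * (f (fst z) * f (snd z)) \<partial>joint_law t)"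
  by (simp add: power2_diff algebra_simps)
 also have "... = 2 * (\<integral>x. (f x)^2) - 2 * (\<integral>x. f x * semigroup P t f x)"
  using integrable_joint[OF t L2D(2)[OF f]] L2_joint[OF t f f] l2_semigroup[OF t f f]
  by (subst Bochner_Integration.integral_diff) auto
 finally have *: "(\<integral>z. (f (fst z) - f (snd z))^2 \<partial>joint_law t) = 2 * ((\<integral>x. (f x)^2) - (\<integral>x. f x * semigroup P t f x))" by simp
 show ?thesis unfolding Et_def * using t by (simp add: divide_simps)
qed

lemma Et_l2_inner:
 assumes t: "0 < t" and f: "f \<in> L2 M"
 shows "l2_inner M (%x. f x - semigroup P t f x) f / t = Et t f"
 unfolding Et_eq[OF assms] l2_inner_def left_diff_distrib
 using L2D(2)[OF f] l2_semigroup(1)[OF t f f]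
 by (subst Bochner_Integration.integral_diff) (auto simp: power2_eq_square mult.commute)

lemma Et_nonneg: "0 < t ==> 0 <= Et t f" unfolding Et_def by simp

lemma assoc: "associated_with_energy M P" using rbm by (simp add: reflected_BM_def)

lemma Et_lim:
 assumes f: "f \<in> L2 M"
 shows "f \<in> H1 M \<longleftrightarrow> (\<exists>l. ((%t. Et t f) \<longlongrightarrow> l) (at_right 0))"
  and "f \<in> H1 M ==> ((%t. Et t f) \<longlongrightarrow> energy M f f) (at_right 0)"
proof -
 have ev: "eventually (%t. l2_inner M (%x. f x - semigroup P t f x) f / t = Et t f) (at_right 0)"
  using Et_l2_inner[OF _ f] eventually_at_right_less[of "0::real"] by (auto elim: eventually_mono)
 have 1: "f \<in> H1 M \<longleftrightarrow>
    (\<exists>l. ((%t. l2_inner M (%x. f x - semigroup P t f x) f / t) \<longlongrightarrow> l) (at_right 0))"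
  using assoc f unfolding associated_with_energy_def by (elim conjE) (drule bspec)
 show "f \<in> H1 M \<longleftrightarrow> (\<exists>l. ((%t. Et t f) \<longlongrightarrow> l) (at_right 0))"
  unfolding 1 tendsto_cong[OF ev] ..
 assume "f \<in> H1 M"
 hence "((%t. l2_inner M (%x. f x - semigroup P t f x) f / t) \<longlongrightarrow> energy M f f) (at_right 0)"
  using assoc unfolding associated_with_energy_def by (elim conjE) (drule(1) bspec, drule(1) bspec)
 thus "((%t. Et t f) \<longlongrightarrow> energy M f f) (at_right 0)"
  unfolding tendsto_cong[OF ev] .
qed

definition bdd :: "('a => real) => bool" where
 "bdd f \<longleftrightarrow> f \<in> borel_measurable \<mu> & (\<exists>C. \<forall>x\<in>M. \<bar>f x\<bar> <= C)"

lemma bddI: "f \<in> borel_measurable \<mu> ==> (!!x. x \<in> M ==> \<bar>f x\<bar> <= C) ==> bdd f"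
 unfolding bdd_def by blast

lemma bdd_meas: "bdd f ==> f \<in> borel_measurable \<mu>" unfolding bdd_def by blast

lemma bdd_integrable: "bdd f ==> integrable \<mu> f"
 unfolding bdd_def by (auto intro!: mu.integrable_const_bound AE_I2)

lemma bdd_comp:
 assumes "bdd f" "bdd g" "continuous_on UNIV (%z::real\<times>real. h (fst z) (snd z) :: real)"
 shows "bdd (%x. h (f x) (g x))"
proof -
 obtain C D where C: "!!x. x \<in> M ==> \<bar>f x\<bar> <= C" "!!x. x \<in> M ==> \<bar>g x\<bar> <= D" using assms unfolding bdd_def by blast
 have "compact ((%z. h (fst z) (snd z)) ` ({-C..C} \<times> {-D..D}))"
  by (intro compact_continuous_image compact_Times) (auto intro: continuous_on_subset[OF assms(3)])
 then obtain B where B: "!!y. y \<in> (%z. h (fst z) (snd z)) ` ({-C..C} \<times> {-D..D}) ==> \<bar>y\<bar> <= B"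
  by (metis bounded_real compact_imp_bounded)
 have [measurable]: "(%z. h (fst z) (snd z)) \<in> borel_measurable borel" by (rule borel_measurable_continuous_onI[OF assms(3)])
 have m: "(%x. (f x, g x)) \<in> \<mu> \<rightarrow>\<^sub>M (borel :: (real\<times>real) measure)"
  using assms bdd_meas by (simp add: borel_prod[symmetric])
 have "(%x. h (f x) (g x)) \<in> borel_measurable \<mu>"
  using measurable_compose[OF m, of "%z. h (fst z) (snd z)"] by simp
 thus ?thesis
 proof (rule bddI[where C = B])
  fix x assume "x \<in> M"
  hence "(f x, g x) \<in> {-C..C} \<times> {-D..D}" using C[of x] by (auto simp: abs_le_iff)
  thus "\<bar>h (f x) (g x)\<bar> <= B" by (intro B image_eqI[of _ _ "(f x, g x)"]) auto
 qed
qed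

lemma bdd_const [simp]: "bdd (%_. c)" by (rule bddI[of _ "\<bar>c\<bar>"]) auto
lemma bdd_add: "bdd f ==> bdd g ==> bdd (%x. f x + g x)"
 by (rule bdd_comp) (auto intro!: continuous_intros)
lemma bdd_diff: "bdd f ==> bdd g ==> bdd (%x. f x - g x)"
 by (rule bdd_comp) (auto intro!: continuous_intros)
lemma bdd_mult: "bdd f ==> bdd g ==> bdd (%x. f x * g x)"
 by (rule bdd_comp) (auto intro!: continuous_intros)
lemma bdd_power2: "bdd f ==> bdd (%x. (f x)^2)"
 using bdd_mult[of f f] by (simp add: power2_eq_square)

lemma bdd_L2: "bdd f ==> f \<in> L2 M"
 unfolding L2_def using bdd_integrable[OF bdd_power2] bdd_meas by simp

lemma bdd_semigroup:
 assumes t: "0 < t" and f: "bdd f" shows "bdd (semigroup P t f)"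
proof -
 obtain C where C: "!!x. x \<in> M ==> \<bar>f x\<bar> <= C" using f unfolding bdd_def by blast
 note [measurable] = bdd_meas[OF f] p_measurable[OF t]
 have pm: "(%z. p t (fst z) (snd z)) \<in> borel_measurable (\<mu> \<Otimes>\<^sub>M \<mu>)"
  using p_measurable[OF t] by (simp add: split_beta)
 have "(%x. \<integral>y. p t x y * f y \<partial>\<mu>) \<in> borel_measurable \<mu>"
  by (rule mu.borel_measurable_lebesgue_integral) (simp add: split_beta)
 hence "semigroup P t f \<in> borel_measurable \<mu>"
  by (subst measurable_cong[of \<mu> "semigroup P t f" "%x. \<integral>y. p t x y * f y \<partial>\<mu>"]) (auto simp: integral_P t)
 moreover have "\<bar>semigroup P t f x\<bar> <= C" if x: "x \<in> M" for x
 proof -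
  interpret Px: prob_space "P x" by (rule prob_space_P[OF x])
  have fm: "(%omega. f (omega t)) \<in> borel_measurable (P x)"
   using measurable_compose[OF path_measurable_P[of t x] bdd_meas[OF f]] t x by simp
  have *: "AE omega in P x. \<bar>f (omega t)\<bar> <= C"
   by (rule AE_I2) (use C t x in "auto simp: space_P space_path")
  have i: "integrable (P x) (%omega. f (omega t))" by (rule Px.integrable_const_bound[OF _ fm]) (use * in auto)
  have "\<bar>\<integral>omega. f (omega t) \<partial>P x\<bar> <= (\<integral>omega. \<bar>f (omega t)\<bar> \<partial>P x)" by (rule integral_abs_bound)
  also have "... <= C" by (rule Px.integral_le_const) (use i * in auto)
  finally show ?thesis by (simp add: semigroup_def)
 qed
 ultimately show ?thesis by (rule bddI)
qed
end

section \<open>The Markov property and the approximating forms in time\<close>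

context reflected_process begin

lemma path_shift_measurable:
 assumes s: "0 <= s" shows "path_shift s \<in> path_space M \<rightarrow>\<^sub>M path_space M"
proof -
 have 1: "path_shift s \<in> path_space M \<rightarrow>\<^sub>M PiM {0..} (%_. restrict_space borel M)"
  unfolding path_shift_def
 proof (rule measurable_restrict)
  fix t :: real assume "t \<in> {0..}"
  hence "(%omega. omega (s + t)) \<in> path_space M \<rightarrow>\<^sub>M \<mu>" using path_measurable[of "s + t"] s by simp
  thus "(%omega. omega (s + t)) \<in> path_space M \<rightarrow>\<^sub>M restrict_space borel M"
   unfolding measurable_cong_sets[OF refl sets_mu] .
 qed
 have "continuous_on {0..} (path_shift s omega)" if "omega \<in> space (path_space M)" for omega
 proof -
  have "continuous_on {0..} (%t. omega (s + t))"
  proof (rule continuous_on_compose2[of "{0..}" omega _ "%t. s + t"])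
   show "continuous_on {0..} omega" using that by (simp add: space_path)
   show "continuous_on {0..} (%t. s + t)" by (intro continuous_intros)
  qed (use s in auto)
  thus ?thesis unfolding path_shift_def by (rule continuous_on_eq) simp
 qed
 with 1 show ?thesis
  by (subst (2) path_space_def) (rule measurable_restrict_space2; auto)
qed

lemma hunt: "continuous_hunt_process M P" using rbm by (simp add: reflected_BM_def)

lemma AE_start: "x \<in> M ==> AE omega in P x. omega 0 = x"
 using hunt unfolding continuous_hunt_process_def by blast

text \<open>Deterministic times are optional times.\<close>

lemma simple_markov:
 assumes s: "0 <= s" and x: "x \<in> M" and E: "E \<in> sets (path_space M)"
 shows "emeasure (P x) {omega \<in> space (path_space M). path_shift s omega \<in> E} = (\<integral>\<^sup>+omega. emeasure (P (omega s)) E \<partial>P x)"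
proof -
 let ?tau = "%omega::real => 'a. ennreal s"
 have pa: "{omega \<in> space (path_space M). ?tau omega < ennreal t} \<in> past M t" for t
  unfolding past_def by (cases "ennreal s < ennreal t") (auto intro: sigma_sets_top sigma_sets.Empty)
 have "optional_time M ?tau" unfolding optional_time_def using pa by simp
 moreover have "space (path_space M) \<in> prior_events M ?tau" unfolding prior_events_def using pa by simp
 ultimately have "emeasure (P x) {omega \<in> space (path_space M). ?tau omega < \<infinity> & path_shift (enn2real (?tau omega)) omega \<in> E} =
     (\<integral>\<^sup>+omega. emeasure (P (omega (enn2real (?tau omega)))) E * indicator {omega \<in> space (path_space M). ?tau omega < \<infinity>} omega \<partial>P x)"
  using hunt x E unfolding continuous_hunt_process_def by fast
 also have "... = (\<integral>\<^sup>+omega. emeasure (P (omega s)) E \<partial>P x)"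
  by (rule nn_integral_cong) (use s x in "simp add: space_P less_top")
 finally show ?thesis using s by (simp add: less_top)
qed

lemma P_subprob: "(%omega. P (omega s)) \<in> P x \<rightarrow>\<^sub>M subprob_algebra (path_space M)" if "0 <= s" "x \<in> M"
 using measurable_compose[OF path_measurable_P[OF that] measurable_prob_algebraD[OF P_kernel]] .

lemma distr_shift:
 assumes s: "0 <= s" and x: "x \<in> M"
 shows "distr (P x) (path_space M) (path_shift s) = P x \<bind> (%omega. P (omega s))"
proof (rule measure_eqI)
 interpret prob_space "P x" by (rule prob_space_P[OF x])
 have sb: "sets (P x \<bind> (%omega. P (omega s))) = sets (path_space M)"
  by (rule sets_bind[OF _ not_empty]) (use s x in "auto intro!: sets_P simp: space_P space_path")
 show "sets (distr (P x) (path_space M) (path_shift s)) = sets (P x \<bind> (%omega. P (omega s)))"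
  using sb by simp
 fix E assume "E \<in> sets (distr (P x) (path_space M) (path_shift s))"
 hence E: "E \<in> sets (path_space M)" by simp
 have m: "path_shift s \<in> P x \<rightarrow>\<^sub>M path_space M"
  using path_shift_measurable[OF s] sets_P[OF x] by (simp cong: measurable_cong_sets)
 have "emeasure (distr (P x) (path_space M) (path_shift s)) E = (\<integral>\<^sup>+omega. emeasure (P (omega s)) E \<partial>P x)"
  using simple_markov[OF s x E] by (subst emeasure_distr[OF m E]) (simp add: vimage_def Int_def space_P[OF x] conj_commute)
 also have "... = emeasure (P x \<bind> (%omega. P (omega s))) E"
  by (rule emeasure_bind[symmetric, OF not_empty P_subprob[OF s x] E])
 finally show "emeasure (distr (P x) (path_space M) (path_shift s)) E = emeasure (P x \<bind> (%omega. P (omega s))) E" .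
qed

lemma markov_nn:
 assumes s: "0 <= s" and x: "x \<in> M" and F: "F \<in> borel_measurable (path_space M)"
 shows "(\<integral>\<^sup>+omega. F (path_shift s omega) \<partial>P x) = (\<integral>\<^sup>+omega. \<integral>\<^sup>+omega'. F omega' \<partial>P (omega s) \<partial>P x)"
proof -
 have m: "path_shift s \<in> P x \<rightarrow>\<^sub>M path_space M"
  using path_shift_measurable[OF s] sets_P[OF x] by (simp cong: measurable_cong_sets)
 have "(\<integral>\<^sup>+omega. F (path_shift s omega) \<partial>P x) = (\<integral>\<^sup>+omega. F omega \<partial>distr (P x) (path_space M) (path_shift s))"
  by (subst nn_integral_distr[OF m]) (use F in simp_all)
 also have "... = (\<integral>\<^sup>+omega. \<integral>\<^sup>+omega'. F omega' \<partial>P (omega s) \<partial>P x)"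
  unfolding distr_shift[OF s x] by (rule nn_integral_bind[OF F P_subprob[OF s x]])
 finally show ?thesis .
qed

lemma bdd_path_integrable:
 assumes "0 <= t" "x \<in> M" "bdd f" shows "integrable (P x) (%omega. f (omega t))"
proof -
 interpret Px: prob_space "P x" by (rule prob_space_P[OF assms(2)])
 obtain C where C: "!!x. x \<in> M ==> \<bar>f x\<bar> <= C" using assms(3) unfolding bdd_def by blast
 show ?thesis
  by (rule Px.integrable_const_bound[of _ C])
   (use C assms measurable_compose[OF path_measurable_P[OF assms(1,2)] bdd_meas[OF assms(3)]]
   in "auto intro!: AE_I2 simp: space_P space_path")
qed

lemma semigroup_0: "x \<in> M ==> bdd f ==> semigroup P 0 f x = f x"
proof -
 assume x: "x \<in> M" and f: "bdd f"
 interpret Px: prob_space "P x" by (rule prob_space_P[OF x])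
 have "semigroup P 0 f x = (\<integral>omega. f x \<partial>P x)" unfolding semigroup_def
  by (rule integral_cong_AE) (use AE_start[OF x] bdd_path_integrable[OF _ x f, of 0] in auto)
 thus ?thesis by (simp add: Px.prob_space)
qed

lemma bdd_semigroup0: "0 <= t ==> bdd f ==> bdd (semigroup P t f)"
proof (cases "t = 0")
 case True
 assume "bdd f"
 thus ?thesis using True semigroup_0 measurable_cong[of \<mu> "semigroup P 0 f" f] unfolding bdd_def by auto
qed (auto intro: bdd_semigroup)

lemma semigroup_nonneg: "0 <= t ==> x \<in> M ==> (!!y. y \<in> M ==> 0 <= f y) ==> 0 <= semigroup P t f x"
 unfolding semigroup_def by (rule integral_nonneg_AE, rule AE_I2) (auto simp: space_P space_path)

text \<open>The Markov property concerns nonnegative functions; a bounded function is made nonnegative by adding a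
constant.\<close>

lemma semigroup_add:
 assumes s: "0 <= s" and t: "0 <= t" and x: "x \<in> M" and f: "bdd f"
 shows "semigroup P (s + t) f x = semigroup P s (semigroup P t f) x"
proof -
 have pos: "semigroup P (s + t) g x = semigroup P s (semigroup P t g) x"
  if g: "bdd g" and g0: "!!y. y \<in> M ==> 0 <= g y" for g
 proof -
  have nn: "(\<integral>\<^sup>+omega. ennreal (h (omega u)) \<partial>P y) = ennreal (semigroup P u h y)"
   if "0 <= u" "y \<in> M" "bdd h" "!!y. y \<in> M ==> 0 <= h y" for h u y
   unfolding semigroup_def
   by (rule nn_integral_eq_integral[OF bdd_path_integrable]) (use that in "auto intro!: AE_I2 simp: space_P space_path")
  have pos: "0 <= semigroup P t g y" if "y \<in> M" for y
   by (rule semigroup_nonneg[OF t that g0])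
  have "ennreal (semigroup P (s + t) g x) = (\<integral>\<^sup>+omega. ennreal (g (path_shift s omega t)) \<partial>P x)"
   using nn[of "s + t" x g] s t x g g0 by (simp add: path_shift_def)
  also have "... = (\<integral>\<^sup>+omega. \<integral>\<^sup>+omega'. ennreal (g (omega' t)) \<partial>P (omega s) \<partial>P x)"
   by (rule markov_nn[OF s x]) (use measurable_compose[OF path_measurable[OF t] bdd_meas[OF g]] in simp)
  also have "... = (\<integral>\<^sup>+omega. ennreal (semigroup P t g (omega s)) \<partial>P x)"
   by (rule nn_integral_cong) (use nn[OF t _ g g0] s x in "auto simp: space_P space_path")
  also have "... = ennreal (semigroup P s (semigroup P t g) x)"
   by (rule nn[OF s x bdd_semigroup0[OF t g] pos])
  finally show ?thesis
   using semigroup_nonneg[of "s + t" x g] semigroup_nonneg[of s x "semigroup P t g"] pos g0 s t x by simp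
 qed
 obtain C where C: "!!x. x \<in> M ==> \<bar>f x\<bar> <= C" using f unfolding bdd_def by blast
 have lin: "semigroup P u (%y. h y + C) y = semigroup P u h y + C" if "0 <= u" "y \<in> M" "bdd h" for u h y
 proof -
  interpret Px: prob_space "P y" by (rule prob_space_P[OF that(2)])
  show ?thesis using bdd_path_integrable[OF that] unfolding semigroup_def by (simp add: Px.prob_space)
 qed
 have g: "bdd (%y. f y + C)" by (intro bdd_add f bdd_const)
 have "semigroup P (s + t) f x + C = semigroup P s (semigroup P t (%y. f y + C)) x"
 proof -
  have "0 <= f y + C" if "y \<in> M" for y using C[OF that] by simp
  thus ?thesis using pos[OF g] lin[of "s + t" x f] s t x f by simp
 qed
 also have "... = semigroup P s (%y. semigroup P t f y + C) x"
  unfolding semigroup_def[of P s]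
  by (rule Bochner_Integration.integral_cong) (use lin[OF t _ f] s x in "auto simp: space_P space_path")
 also have "... = semigroup P s (semigroup P t f) x + C"
  by (rule lin[OF s x bdd_semigroup0[OF t f]])
 finally show ?thesis by simp
qed

text \<open>The autocorrelation (f, P_t f) of the stationary process. By symmetry it equals the squared norm of P_s f with
s = t/2; hence it is convex and decreasing in t.\<close>

definition corr :: "('a => real) => real => real" where
 "corr f t = (\<integral>x. f x * semigroup P t f x)"

lemma semigroup_sym:
 assumes t: "0 <= t" and f: "bdd f" and g: "bdd g"
 shows "(\<integral>x. f x * semigroup P t g x) = (\<integral>x. g x * semigroup P t f x)"
proof (cases "t = 0")
 case True
 thus ?thesis
  by (intro Bochner_Integration.integral_cong) (auto simp: semigroup_0 f g)
next
 case False
 hence t: "0 < t" using t by simp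
 note [measurable] = bdd_meas[OF f] bdd_meas[OF g]
 show ?thesis
  using l2_semigroup(2)[OF t bdd_L2[OF f] bdd_L2[OF g]] l2_semigroup(2)[OF t bdd_L2[OF g] bdd_L2[OF f]]
   integral_joint_swap[OF t, of "%z. f (fst z) * g (snd z)"] by (simp add: mult.commute)
qed

lemma corr_add:
 assumes a: "0 <= a" and b: "0 <= b" and f: "bdd f"
 shows "(\<integral>x. semigroup P a f x * semigroup P b f x) = corr f (a + b)"
proof -
 have "(\<integral>x. semigroup P a f x * semigroup P b f x) = (\<integral>x. f x * semigroup P b (semigroup P a f) x)"
  using semigroup_sym[OF b bdd_semigroup0[OF a f] f] by simp
 also have "... = corr f (a + b)"
  unfolding corr_def
  by (intro Bochner_Integration.integral_cong) (auto simp: semigroup_add[OF b a _ f, symmetric] add.commute)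
 finally show ?thesis .
qed

lemma corr_0: "bdd f ==> corr f 0 = (\<integral>x. (f x)^2)"
 unfolding corr_def by (intro Bochner_Integration.integral_cong) (auto simp: semigroup_0 power2_eq_square)

text \<open>The squared norm of P_a f - P_b f is nonnegative.\<close>

lemma corr_convex:
 assumes a: "0 <= a" and b: "0 <= b" and f: "bdd f"
 shows "2 * corr f (a + b) <= corr f (2 * a) + corr f (2 * b)"
proof -
 note A = bdd_semigroup0[OF a f] and B = bdd_semigroup0[OF b f]
 have "(\<integral>x. (semigroup P a f x - semigroup P b f x)^2) = (\<integral>x. semigroup P a f x * semigroup P a f x + semigroup P b f x * semigroup P b f x
   - 2 * (semigroup P a f x * semigroup P b f x))"
  by (intro Bochner_Integration.integral_cong) (auto simp: power2_eq_square algebra_simps)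
 also have "... = corr f (a + a) + corr f (b + b) - 2 * corr f (a + b)"
  by (simp only: Bochner_Integration.integral_diff[OF
     Bochner_Integration.integrable_add[OF bdd_integrable[OF bdd_mult[OF A A]] bdd_integrable[OF bdd_mult[OF B B]]]
     integrable_mult_right[OF bdd_integrable[OF bdd_mult[OF A B]]]]
    Bochner_Integration.integral_add[OF bdd_integrable[OF bdd_mult[OF A A]] bdd_integrable[OF bdd_mult[OF B B]]]
    integral_mult_right_zero corr_add[OF a a f] corr_add[OF b b f] corr_add[OF a b f])
 finally have eq: "(\<integral>x. (semigroup P a f x - semigroup P b f x)^2) = corr f (a + a) + corr f (b + b) - 2 * corr f (a + b)" .
 have "0 <= (\<integral>x. (semigroup P a f x - semigroup P b f x)^2)" by (rule Bochner_Integration.integral_nonneg) simp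
 hence "0 <= corr f (a + a) + corr f (b + b) - 2 * corr f (a + b)" unfolding eq .
 moreover have "a + a = 2 * a" "b + b = 2 * b" by simp_all
 ultimately show ?thesis by (simp only: diff_ge_0_iff_ge)
qed

lemma corr_le:
 assumes "0 <= a" "a <= b" and f: "bdd f" shows "corr f b <= corr f a"
proof (cases "a = b")
 case False
 define t where "t = b - a"
 have t: "0 < t" using False assms t_def by auto
 define h where "h = semigroup P (a / 2) f"
 have h: "bdd h" unfolding h_def using assms by (intro bdd_semigroup0) auto
 have "semigroup P t h x = semigroup P (t + a / 2) f x" if "x \<in> M" for x
  unfolding h_def using semigroup_add[of t "a / 2" x f] that assms t by auto
 hence "(\<integral>x. h x * semigroup P t h x) = (\<integral>x. semigroup P (a/2) f x * semigroup P (t + a / 2) f x)"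
  by (intro Bochner_Integration.integral_cong) (auto simp: h_def)
 also have "... = corr f b" using corr_add[of "a/2" "t + a/2" f] assms t by (simp add: t_def field_simps)
 finally have 1: "(\<integral>x. h x * semigroup P t h x) = corr f b" .
 have "(\<integral>x. (h x)^2) = corr f a"
  using corr_add[of "a/2" "a/2" f] assms by (simp add: h_def power2_eq_square)
 with 1 Et_eq[OF t bdd_L2[OF h]] Et_nonneg[OF t, of h] t show ?thesis
  by (simp add: zero_le_divide_iff)
qed simp

text \<open>By convexity corr f decreases over each step of length s at most as much as over the first one; t is covered
by at most t / s + 1 steps. The factor 1 + s / t accounts for the last, incomplete step. It tends to 1 as s
tends to 0, so that a bound on Et along some null sequence is a bound for all times.\<close>

lemma Et_almost_decreasing:
 assumes s: "0 < s" and st: "s <= t" and f: "bdd f"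
 shows "Et t f <= (1 + s / t) * Et s f"
proof -
 have E: "u * Et u f = corr f 0 - corr f u" if "0 < u" for u
  using Et_eq[OF that bdd_L2[OF f]] that by (simp add: corr_0[OF f] corr_def[of f u])
 define d where "d j = corr f (real j * s) - corr f (real (Suc j) * s)" for j
 have "d (Suc j) <= d j" for j
  using corr_convex[of "real j * s / 2" "real (j + 2) * s / 2" f] s f unfolding d_def by (simp add: algebra_simps add_divide_distrib)
 hence d: "d j <= d 0" for j using lift_Suc_antimono_le[of d 0 j] by simp
 have sum: "(\<Sum>j<n. d j) = corr f 0 - corr f (real n * s)" for n
  by (induction n) (auto simp: d_def)
 \<comment> \<open>The number of steps of length s that cover t.\<close>
 define n where "n = nat \<lceil>t / s\<rceil>"
 have n: "t / s <= real n" "real n <= t / s + 1" using s st unfolding n_def by (auto simp: of_nat_ceiling)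
 hence n': "t <= real n * s" "real n * s <= t + s" using s by (simp_all add: field_simps)
 have "t * Et t f = corr f 0 - corr f t" using E s st by simp
 also have "... <= corr f 0 - corr f (real n * s)" using corr_le[OF _ n'(1) f] s st by simp
 also have "... <= real n * d 0" using sum_bounded_above[of "{..<n}" d "d 0"] d sum[of n] by simp
 also have "d 0 = s * Et s f" using E[OF s] by (simp add: d_def)
 also have "real n * (s * Et s f) <= (t + s) * Et s f"
  using n'(2) Et_nonneg[OF s, of f] by (simp add: mult_right_mono mult.assoc[symmetric])
 finally show ?thesis using s st by (simp add: field_simps)
qed
end

section \<open>Bounded functions of finite energy\<close>

context reflected_process begin

definition HB :: "('a => real) => bool" where "HB f \<longleftrightarrow> bdd f & f \<in> H1 M"

text \<open>The square of the norm of the form plus the inner product, the quantity minimized in the definition of the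
capacity.\<close>

definition N1 :: "('a => real) => real" where "N1 f = energy M f f + (\<integral>x. (f x)^2)"

text \<open>The approximation of N1 by a single integral over pairs.\<close>

definition Qt :: "real => ('a => real) => real" where
 "Qt t f = (\<integral>z. (f (fst z) - f (snd z))^2 / (2 * t) + (f (fst z))^2 \<partial>joint_law t)"

lemma Qt_integrable:
 "0 < t ==> f \<in> L2 M ==> integrable (joint_law t) (%z. (f (fst z) - f (snd z))^2 / (2 * t) + (f (fst z))^2)"
 by (intro Bochner_Integration.integrable_add integrable_divide_zero L2_joint integrable_joint L2D) auto

lemma Qt_eq: "0 < t ==> f \<in> L2 M ==> Qt t f = Et t f + (\<integral>x. (f x)^2)"
 unfolding Qt_def Et_def
 by (subst Bochner_Integration.integral_add)
  (auto intro!: integrable_divide_zero L2_joint integrable_joint L2D simp: integrable_joint(3)[OF _ L2D(2)])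

lemma HB_bdd: "HB f ==> bdd f" and HB_H1: "HB f ==> f \<in> H1 M" by (auto simp: HB_def)

lemma HB_L2: "HB f ==> f \<in> L2 M" by (auto simp: HB_def bdd_L2)

lemma H1_L2: "f \<in> H1 M ==> f \<in> L2 M" by (simp add: H1_def)

lemma Qt_tendsto:
 assumes "f \<in> H1 M"
 shows "((%t. Qt t f) \<longlongrightarrow> energy M f f + (\<integral>x. (f x)^2)) (at_right 0)"
proof -
 have "((%t. Et t f + (\<integral>x. (f x)^2)) \<longlongrightarrow> energy M f f + (\<integral>x. (f x)^2)) (at_right 0)"
  by (intro tendsto_add Et_lim(2) H1_L2 assms tendsto_const)
 thus ?thesis
 proof (rule tendsto_cong[THEN iffD1, rotated])
  show "\<forall>\<^sub>F t in at_right 0. Et t f + (\<integral>x. (f x)^2) = Qt t f"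
   using eventually_at_right_less[of "0::real"] by eventually_elim (rule Qt_eq[OF _ H1_L2[OF assms], symmetric])
 qed
qed

lemma HB_limit: "HB f ==> ((%t. Qt t f) \<longlongrightarrow> N1 f) (at_right 0)"
 unfolding N1_def by (rule Qt_tendsto[OF HB_H1])

text \<open>Let s tend to 0 in Et_almost_decreasing.\<close>

lemma energy_ge: assumes f: "HB f" and t: "0 < t" shows "Et t f <= energy M f f"
proof -
 have "((%s. (1 + s / t) * Et s f) \<longlongrightarrow> (1 + 0 / t) * energy M f f) (at_right 0)"
  by (intro tendsto_intros Et_lim(2) HB_L2 HB_H1 f) (use t in auto)
 moreover have "\<forall>\<^sub>F s in at_right 0. Et t f <= (1 + s / t) * Et s f"
  unfolding eventually_at_right_field using Et_almost_decreasing[OF _ _ HB_bdd[OF f]] t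
  by (intro exI[of _ t]) simp
 ultimately have "Et t f <= (1 + 0 / t) * energy M f f"
  by (rule tendsto_lowerbound) simp
 thus ?thesis by simp
qed

lemma Qt_le: "HB f ==> 0 < t ==> Qt t f <= N1 f"
 using energy_ge[of f t] Qt_eq[of t f] HB_L2[of f] by (simp add: N1_def)

text \<open>Membership in H1 M asks for convergence of Et; almost monotone and bounded, it converges to its supremum.\<close>

lemma HBI_Et:
 assumes f: "bdd f" and C: "!!t. 0 < t ==> Et t f <= C"
 shows "HB f" "energy M f f <= C"
proof -
 define S where "S = (SUP t\<in>{0<..}. Et t f)"
 have bd: "bdd_above ((%t. Et t f) ` {0<..})" using C by (auto intro!: bdd_aboveI)
 have S: "Et t f <= S" if "0 < t" for t unfolding S_def by (rule cSUP_upper[OF _ bd]) (use that in auto)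
 have lim: "((%t. Et t f) \<longlongrightarrow> S) (at_right 0)"
 proof (rule order_tendstoI)
  fix a assume "a < S"
  then obtain t where t: "0 < t" "a < Et t f"
   unfolding S_def by (subst (asm) less_cSUP_iff[OF _ bd]) auto
  have "((%s. Et t f / (1 + s / t)) \<longlongrightarrow> Et t f / (1 + 0 / t)) (at_right 0)"
   by (intro tendsto_intros) (use t in auto)
  hence "\<forall>\<^sub>F s in at_right 0. a < Et t f / (1 + s / t)" using t by (auto dest: order_tendstoD(1))
  moreover have "\<forall>\<^sub>F s in at_right 0. Et t f / (1 + s / t) <= Et s f"
   unfolding eventually_at_right_field
  proof (intro exI[of _ t] conjI allI impI t)
   fix s assume s: "0 < s" "s < t"
   hence "0 < 1 + s / t" using t by (simp add: add_pos_pos)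
   thus "Et t f / (1 + s / t) <= Et s f"
    using Et_almost_decreasing[OF s(1) _ f, of t] s by (simp add: pos_divide_le_eq mult.commute)
  qed
  ultimately show "\<forall>\<^sub>F s in at_right 0. a < Et s f" by eventually_elim simp
 next
  fix a assume a: "S < a"
  show "\<forall>\<^sub>F s in at_right 0. Et s f < a"
   using eventually_at_right_less[of "0::real"] by eventually_elim (use S a in fastforce)
 qed
 hence H: "f \<in> H1 M" using Et_lim(1)[OF bdd_L2[OF f]] by blast
 thus "HB f" using f by (simp add: HB_def)
 have "energy M f f = S" by (rule tendsto_unique[OF _ Et_lim(2)[OF bdd_L2[OF f] H] lim]) simp
 also have "S <= C" unfolding S_def by (rule cSUP_least) (use C in auto)
 finally show "energy M f f <= C" .
qed

text \<open>The form in which H1 M is recognized for survival probabilities, where only discrete times are accessible.\<close>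

lemma HBI_Et_seq:
 assumes f: "bdd f" and s: "!!k::nat. 0 < s k" "s \<longlonglongrightarrow> 0" and c: "!!k. Et (s k) f <= c k" "c \<longlonglongrightarrow> C"
 shows "HB f" "energy M f f <= C"
proof -
 have "Et t f <= C" if t: "0 < t" for t
 proof (rule tendsto_lowerbound[OF _ _ sequentially_bot])
  show "(%k. (1 + s k / t) * c k) \<longlonglongrightarrow> C"
   using tendsto_mult[OF tendsto_add[OF tendsto_const[of 1] tendsto_divide[OF s(2) tendsto_const[of t]]] c(2)] t by simp
  have "\<forall>\<^sub>F k in sequentially. s k < t" using order_tendstoD(2)[OF s(2) t] .
  thus "\<forall>\<^sub>F k in sequentially. Et t f <= (1 + s k / t) * c k"
  proof eventually_elim
   fix k assume k: "s k < t"
   have "Et t f <= (1 + s k / t) * Et (s k) f" using Et_almost_decreasing[OF s(1) _ f] k by simp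
   also have "... <= (1 + s k / t) * c k" by (rule mult_left_mono[OF c(1)]) (use s(1)[of k] t in simp)
   finally show "Et t f <= (1 + s k / t) * c k" .
  qed
 qed
 from HBI_Et[OF f this] show "HB f" "energy M f f <= C" by auto
qed

lemma HBI:
 assumes f: "bdd f" and C: "!!t. 0 < t ==> Qt t f <= C"
 shows "HB f" "N1 f <= C"
proof -
 have "Et t f <= C - (\<integral>x. (f x)^2)" if "0 < t" for t
  using C[OF that] Qt_eq[OF that bdd_L2[OF f]] by simp
 from HBI_Et[OF f this] show "HB f" "N1 f <= C" by (auto simp: N1_def)
qed

lemma Qt_mono:
 assumes t: "0 < t" and fg: "f \<in> L2 M" "g \<in> L2 M"
  and le: "!!x y. x \<in> M ==> y \<in> M ==> \<bar>g x - g y\<bar> <= \<bar>f x - f y\<bar> & \<bar>g x\<bar> <= \<bar>f x\<bar>"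
 shows "Qt t g <= Qt t f"
 unfolding Qt_def
proof (rule integral_mono[OF Qt_integrable[OF t fg(2)] Qt_integrable[OF t fg(1)]])
 fix z assume "z \<in> space (joint_law t)"
 hence "fst z \<in> M" "snd z \<in> M" by auto
 from le[OF this] t show "(g (fst z) - g (snd z))^2 / (2 * t) + (g (fst z))^2 <= (f (fst z) - f (snd z))^2 / (2 * t) + (f (fst z))^2"
  by (intro add_mono divide_right_mono) (auto simp: abs_le_square_iff)
qed

text \<open>The Markov property of the form: a normal contraction decreases the integrand of Qt pointwise.\<close>

lemma HB_contraction:
 assumes f: "HB f" and g: "bdd g"
  and le: "!!x y. x \<in> M ==> y \<in> M ==> \<bar>g x - g y\<bar> <= \<bar>f x - f y\<bar> & \<bar>g x\<bar> <= \<bar>f x\<bar>"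
 shows "HB g" "N1 g <= N1 f"
proof -
 have "Qt t g <= N1 f" if t: "0 < t" for t
  using Qt_mono[OF t HB_L2[OF f] bdd_L2[OF g] le] Qt_le[OF f t] by linarith
 from HBI[OF g this] show "HB g" "N1 g <= N1 f" by auto
qed

text \<open>The lemma Et_almost_decreasing concerns bounded functions, so it is applied to the truncation, and the
unbounded f enters just through the limit of Qt t f.\<close>

lemma clamp_H1:
 assumes f: "f \<in> H1 M"
 shows "HB (%x. max 0 (min 1 (f x)))" "N1 (%x. max 0 (min 1 (f x))) <= energy M f f + (\<integral>x. (f x)^2)"
proof -
 define g where "g = (%x. max 0 (min 1 (f x)))"
 note [measurable] = L2D(1)[OF H1_L2[OF f]]
 have g: "bdd g" unfolding g_def by (rule bddI[of _ 1]) auto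
 have le: "Qt t g <= Qt t f" if "0 < t" for t
  by (rule Qt_mono[OF that H1_L2[OF f] bdd_L2[OF g]]) (auto simp: g_def)
 have bound: "Qt t g <= 2 * (\<bar>energy M f f + (\<integral>x. (f x)^2)\<bar> + 1)" if t: "0 < t" for t
 proof -
  let ?E = "energy M f f + (\<integral>x. (f x)^2)"
  have "\<forall>\<^sub>F s in at_right 0. Qt s f < ?E + 1"
   using order_tendstoD(2)[OF Qt_tendsto[OF f], of "?E + 1"] by simp
  then obtain b where b: "b > 0" "!!s. 0 < s ==> s < b ==> Qt s f < ?E + 1"
   unfolding eventually_at_right_field by blast
  define s where "s = min t (b / 2)"
  have s: "0 < s" "s <= t" "s < b" using t b by (auto simp: s_def)
  have i: "0 <= (\<integral>x. (g x)^2)" by simp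
  have st: "s / t <= 1" using s t by simp
  have "Et t g <= (1 + s / t) * Et s g" by (rule Et_almost_decreasing[OF s(1,2) g])
  also have "... <= 2 * Et s g" by (rule mult_right_mono[OF _ Et_nonneg[OF s(1)]]) (use st in simp)
  finally have 1: "Et t g <= 2 * Et s g" .
  have "Qt t g <= 2 * Qt s g"  using 1 i unfolding Qt_eq[OF t bdd_L2[OF g]] Qt_eq[OF s(1) bdd_L2[OF g]] distrib_left by linarith
  also have "... <= 2 * (?E + 1)" using le[OF s(1)] b(2)[OF s(1,3)] by (intro mult_left_mono) linarith+
  also have "... <= 2 * (\<bar>?E\<bar> + 1)" by (intro mult_left_mono) linarith+
  finally show ?thesis .
 qed
 have HB: "HB g" by (rule HBI[OF g bound])
 thus "HB (%x. max 0 (min 1 (f x)))" by (simp add: g_def)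
 have "N1 g <= energy M f f + (\<integral>x. (f x)^2)"
 proof (rule tendsto_le[OF _ Qt_tendsto[OF f] HB_limit[OF HB]])
  show "\<forall>\<^sub>F x in at_right 0. Qt x g <= Qt x f"
   using eventually_at_right_less[of "0::real"] by eventually_elim (rule le)
 qed simp
 thus "N1 (%x. max 0 (min 1 (f x))) <= energy M f f + (\<integral>x. (f x)^2)" by (simp add: g_def)
qed

lemma N1_nonneg: "HB f ==> 0 <= N1 f"
 using Qt_le[of f 1] by (rule order_trans[rotated]) (auto simp: Qt_def)

lemma integral_square_le_N1: "HB f ==> (\<integral>x. (f x)^2) <= N1 f"
 using energy_ge[of f 1] Et_nonneg[of 1 f] by (simp add: N1_def)

text \<open>The weight c is kept free because small_of_qc needs a sum whose first term costs hardly more than itself.\<close>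

lemma HB_add:
 assumes f: "HB f" and g: "HB g" and c: "0 < c"
 shows "HB (%x. f x + g x)" "N1 (%x. f x + g x) <= (1 + c) * N1 f + (1 + 1 / c) * N1 g"
proof -
 have fg: "bdd (%x. f x + g x)" by (intro bdd_add HB_bdd f g)
 have sq: "(a + b)^2 <= (1 + c) * a^2 + (1 + 1 / c) * b^2" for a b :: real
 proof -
  have "0 <= (c * a - b)^2 / c" using c by simp
  thus ?thesis using c by (simp add: power2_eq_square field_simps)
 qed
 have "Qt t (%x. f x + g x) <= (1 + c) * N1 f + (1 + 1 / c) * N1 g" if t: "0 < t" for t
 proof -
  let ?q = "%f z. (f (fst z) - f (snd z))^2 / (2 * t) + (f (fst z))^2"
  have "Qt t (%x. f x + g x) <= (\<integral>z. (1 + c) * ?q f z + (1 + 1 / c) * ?q g z \<partial>joint_law t)"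
   unfolding Qt_def
  proof (rule integral_mono[OF Qt_integrable[OF t bdd_L2[OF fg]]])
   show "integrable (joint_law t) (%z. (1 + c) * ?q f z + (1 + 1 / c) * ?q g z)"
    by (intro Bochner_Integration.integrable_add integrable_mult_right Qt_integrable[OF t] HB_L2 f g)
   fix z :: "'a \<times> 'a"
   have "(f (fst z) + g (fst z) - (f (snd z) + g (snd z)))^2 / (2 * t) <= ((1 + c) * (f (fst z) - f (snd z))^2 + (1 + 1 / c) * (g (fst z) - g (snd z))^2) / (2 * t)"
    using sq[of "f (fst z) - f (snd z)" "g (fst z) - g (snd z)"] t by (intro divide_right_mono) (auto simp: algebra_simps)
   thus "?q (%x. f x + g x) z <= (1 + c) * ?q f z + (1 + 1 / c) * ?q g z"
    using sq[of "f (fst z)" "g (fst z)"] by (simp add: algebra_simps add_divide_distrib)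
  qed
  also have "... = (1 + c) * Qt t f + (1 + 1 / c) * Qt t g"
   unfolding Qt_def using Qt_integrable[OF t HB_L2[OF f]] Qt_integrable[OF t HB_L2[OF g]]
   by (subst Bochner_Integration.integral_add) (auto simp del: distrib_left_numeral)
  also have "... <= (1 + c) * N1 f + (1 + 1 / c) * N1 g"
   using c by (intro add_mono mult_left_mono Qt_le f g t) auto
  finally show ?thesis .
 qed
 from HBI[OF fg this] show "HB (%x. f x + g x)" "N1 (%x. f x + g x) <= (1 + c) * N1 f + (1 + 1 / c) * N1 g" by auto
qed

lemma HB_add2:
 "HB f ==> HB g ==> HB (%x. f x + g x) & N1 (%x. f x + g x) <= 2 * N1 f + 2 * N1 g"
 using HB_add[of f g 1] by simp

lemma HB_cmult:
 assumes f: "HB f"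
 shows "HB (%x. c * f x)" "N1 (%x. c * f x) <= c^2 * N1 f"
proof -
 have b: "bdd (%x. c * f x)" by (intro bdd_mult HB_bdd f bdd_const)
 have "Qt t (%x. c * f x) <= c^2 * N1 f" if t: "0 < t" for t
 proof -
  have "Qt t (%x. c * f x) = c^2 * Qt t f"
  proof -
   have "(c * a - c * b)^2 / (2 * t) + (c * a)^2 = c^2 * ((a - b)^2 / (2 * t) + a^2)" for a b
    using t by (simp add: power2_eq_square field_simps)
   thus ?thesis unfolding Qt_def by simp
  qed
  thus ?thesis using Qt_le[OF f t] by (simp add: mult_left_mono)
 qed
 from HBI[OF b this] show "HB (%x. c * f x)" "N1 (%x. c * f x) <= c^2 * N1 f" by auto
qed

lemma HB_diff2:
 assumes "HB f" "HB g" shows "HB (%x. f x - g x)" "N1 (%x. f x - g x) <= 2 * N1 f + 2 * N1 g"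
 using HB_cmult[OF assms(2), of "-1"] HB_add2[OF assms(1), of "%x. - 1 * g x"] by auto

lemma HB_zero: "HB (%_. 0)" "N1 (%_. 0) = 0"
proof -
 have 1: "HB (%_. 0) & N1 (%_. 0) <= 0"
  using HBI[of "%_. 0" 0] by (auto simp: Qt_def)
 thus "HB (%_. 0)" "N1 (%_. 0) = 0" using N1_nonneg[of "%_. 0"] by auto
qed

text \<open>The Hilbert space structure, read off from Qt pointwise and passed to the limit.\<close>

lemma parallelogram:
 assumes f: "HB f" and g: "HB g"
 shows "N1 (%x. (f x - g x) / 2) + N1 (%x. (f x + g x) / 2) = (N1 f + N1 g) / 2"
proof -
 have H1: "HB (%x. (f x - g x) / 2)" using HB_cmult(1)[OF HB_diff2(1)[OF f g], of "1/2"] by simp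
 have H2: "HB (%x. (f x + g x) / 2)" using HB_cmult(1)[of "%x. f x + g x" "1/2"] HB_add2[OF f g] by simp
 have "Qt t (%x. (f x - g x) / 2) + Qt t (%x. (f x + g x) / 2) = (Qt t f + Qt t g) / 2" if t: "0 < t" for t
 proof -
  let ?q = "%f z. (f (fst z) - f (snd z))^2 / (2 * t) + (f (fst z))^2"
  have "Qt t (%x. (f x - g x) / 2) + Qt t (%x. (f x + g x) / 2) =
   (\<integral>z. ?q (%x. (f x - g x) / 2) z + ?q (%x. (f x + g x) / 2) z \<partial>joint_law t)"
   unfolding Qt_def by (rule Bochner_Integration.integral_add[symmetric]; rule Qt_integrable[OF t]; rule HB_L2; fact)
  also have "... = (\<integral>z. (?q f z + ?q g z) / 2 \<partial>joint_law t)"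
   by (intro Bochner_Integration.integral_cong refl) (use t in "simp add: power2_eq_square field_simps")
  also have "... = (Qt t f + Qt t g) / 2"
   unfolding Qt_def using Qt_integrable[OF t HB_L2[OF f]] Qt_integrable[OF t HB_L2[OF g]] by simp
  finally show ?thesis .
 qed
 hence ev: "\<forall>\<^sub>F t in at_right 0. Qt t (%x. (f x - g x) / 2) + Qt t (%x. (f x + g x) / 2) = (Qt t f + Qt t g) / 2"
  using eventually_at_right_less[of "0::real"] by (auto elim: eventually_mono)
 have "((%t. (Qt t f + Qt t g) / 2) \<longlongrightarrow> (N1 f + N1 g) / 2) (at_right 0)"
  by (intro tendsto_intros HB_limit f g) auto
 hence "((%t. Qt t (%x. (f x - g x) / 2) + Qt t (%x. (f x + g x) / 2)) \<longlongrightarrow> (N1 f + N1 g) / 2) (at_right 0)"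
  using tendsto_cong[OF ev] by simp
 moreover have "((%t. Qt t (%x. (f x - g x) / 2) + Qt t (%x. (f x + g x) / 2)) \<longlongrightarrow> N1 (%x. (f x - g x) / 2) + N1 (%x. (f x + g x) / 2)) (at_right 0)"
  by (intro tendsto_add HB_limit H1 H2)
 ultimately show ?thesis using tendsto_unique trivial_limit_at_right_real by blast
qed

lemma AE_joint:
 assumes t: "0 < t" and "AE x in \<mu>. Q x"
 shows "AE z in joint_law t. Q (fst z)" "AE z in joint_law t. Q (snd z)"
proof -
 have "AE x in distr (joint_law t) \<mu> fst. Q x" unfolding distr_joint_fst[OF t] by fact
 thus "AE z in joint_law t. Q (fst z)" by (rule AE_distrD[rotated]) simp
 have "AE x in distr (joint_law t) \<mu> snd. Q x" unfolding distr_joint_snd[OF t] by fact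
 thus "AE z in joint_law t. Q (snd z)" by (rule AE_distrD[rotated]) simp
qed

text \<open>For fixed t the form Qt t is continuous under dominated convergence and below N1, and N1 is its supremum.\<close>

lemma HB_lsc:
 assumes f: "!!n. HB (f n)" and b: "!!n x. x \<in> M ==> \<bar>f n x\<bar> <= B" and lim: "AE x in \<mu>. (%n. f n x) \<longlonglongrightarrow> g x"
  and g: "bdd g" and C: "!!n. N1 (f n) <= C"
 shows "HB g" "N1 g <= C"
proof -
 have "Qt t g <= C" if t: "0 < t" for t
 proof -
  interpret J: prob_space "joint_law t" by (rule prob_space_joint[OF t])
  let ?q = "%f z. (f (fst z) - f (snd z))^2 / (2 * t) + (f (fst z))^2"
  have "(%n. Qt t (f n)) \<longlonglongrightarrow> Qt t g"
   unfolding Qt_def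
  proof (rule integral_dominated_convergence[where w = "%_. (2 * B)^2 / (2 * t) + B^2"])
   show "?q g \<in> borel_measurable (joint_law t)" using Qt_integrable[OF t bdd_L2[OF g]] by auto
   show "?q (f n) \<in> borel_measurable (joint_law t)" for n using Qt_integrable[OF t HB_L2[OF f]] by auto
   show "AE z in joint_law t. (%n. ?q (f n) z) \<longlonglongrightarrow> ?q g z"
    using AE_joint[OF t lim] by eventually_elim (intro tendsto_intros, use t in auto)
   fix n
   show "AE z in joint_law t. norm (?q (f n) z) <= (2 * B)^2 / (2 * t) + B^2"
   proof (rule AE_I2)
    fix z assume "z \<in> space (joint_law t)"
    hence "\<bar>f n (fst z)\<bar> <= B" "\<bar>f n (snd z)\<bar> <= B" using b by auto
    hence "\<bar>f n (fst z) - f n (snd z)\<bar> <= \<bar>2 * B\<bar>" "\<bar>f n (fst z)\<bar> <= \<bar>B\<bar>" by linarith+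
    hence "(f n (fst z) - f n (snd z))^2 <= (2 * B)^2" "(f n (fst z))^2 <= B^2"
     by (simp_all only: abs_le_square_iff)
    thus "norm (?q (f n) z) <= (2 * B)^2 / (2 * t) + B^2"
    proof -
     assume *: "(f n (fst z) - f n (snd z))^2 <= (2 * B)^2" "(f n (fst z))^2 <= B^2"
     have "?q (f n) z <= (2 * B)^2 / (2 * t) + B^2" by (intro add_mono divide_right_mono *) (use t in simp)
     moreover have "0 <= ?q (f n) z" using t by (intro add_nonneg_nonneg divide_nonneg_nonneg) auto
     ultimately show ?thesis by (simp only: real_norm_def abs_of_nonneg)
    qed
   qed
  qed auto
  thus ?thesis
   by (rule LIMSEQ_le_const2) (use Qt_le[OF f t] C order_trans in blast)
 qed
 from HBI[OF g this] show "HB g" "N1 g <= C" by auto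
qed

lemma HB_AE:
 assumes f: "HB f" and g: "bdd g" and "AE x in \<mu>. f x = g x"
 shows "HB g" "N1 g <= N1 f"
proof -
 obtain B where B: "!!x. x \<in> M ==> \<bar>f x\<bar> <= B" using HB_bdd[OF f] unfolding bdd_def by blast
 have l: "AE x in \<mu>. (%n::nat. f x) \<longlonglongrightarrow> g x" using assms(3) by eventually_elim simp
 show "HB g" by (rule HB_lsc(1)[OF f B l g order_refl])
 show "N1 g <= N1 f" by (rule HB_lsc(2)[OF f B l g order_refl])
qed

end

section \<open>Convex combinations and sets of small capacity\<close>

text \<open>Closure under midpoints is all the convexity that the parallelogram law uses, and it gives simple inductions.\<close>

inductive_set midhull :: "('a => real) set => ('a => real) set" for U where
 midhull_base: "u \<in> U ==> u \<in> midhull U"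
| midhull_mid: "u \<in> midhull U ==> v \<in> midhull U ==> (%x. (u x + v x) / 2) \<in> midhull U"

lemma midhull_mono: "U \<subseteq> V ==> midhull U \<subseteq> midhull V"
proof
 fix u assume "U \<subseteq> V" "u \<in> midhull U"
 from this(2,1) show "u \<in> midhull V" by induction (auto intro: midhull.intros)
qed

lemma geometric_half_le: assumes "0 <= c" shows "(\<Sum>i<n. c * (1/2::real)^i) <= 2 * c"
proof -
 have "(\<Sum>i<n. (1/2::real)^i) <= 2" by (subst sum_gp_strict) (auto simp: field_simps)
 hence "c * (\<Sum>i<n. (1/2::real)^i) <= c * 2" by (rule mult_left_mono) (rule assms)
 thus ?thesis by (simp add: sum_distrib_left mult.commute)
qed

lemma two_power_quarter: "2 ^ i * (1/4::real) ^ i = (1/2) ^ i"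
 by (simp flip: power_mult_distrib)

context reflected_process begin

lemma HB_mid:
 assumes "HB f" "HB g" shows "HB (%x. (f x + g x) / 2)" "N1 (%x. (f x + g x) / 2) <= (N1 f + N1 g) / 2"
proof -
 have H1: "HB (%x. (f x - g x) / 2)" using HB_cmult(1)[OF HB_diff2(1)[OF assms], of "1/2"] by simp
 show "HB (%x. (f x + g x) / 2)" using HB_cmult(1)[of "%x. f x + g x" "1/2"] HB_add2[OF assms] by simp
 show "N1 (%x. (f x + g x) / 2) <= (N1 f + N1 g) / 2"
  using parallelogram[OF assms] N1_nonneg[OF H1] by linarith
qed

lemma midhull_HB:
 assumes "!!u. u \<in> U ==> HB u & N1 u <= C" "f \<in> midhull U"
 shows "HB f & N1 f <= C"
 using assms(2)
proof induction
 case (midhull_mid u v)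
 thus ?case using HB_mid[of u v] by auto
qed (use assms in auto)

text \<open>A substitute for weak compactness and the Banach-Saks theorem. The infima of N1 over the hulls of the tails
increase to a limit L. Two elements of a late hull with N1 close to L have their midpoint in the hull, so N1
of the midpoint is not much below L, and by the parallelogram law the two are close. The rate is chosen
geometric.\<close>

lemma hull_cauchy:
 assumes u: "!!n::nat. HB (u n)" "!!n. N1 (u n) <= C"
 obtains w where "!!n. w n \<in> midhull (u ` {n..})" "!!n. HB (w n)" "!!n. N1 (w n) <= C"
  "!!n. N1 (%x. w n x - w (Suc n) x) <= (1/64)^n"
proof -
 have hull: "HB f & N1 f <= C" if "f \<in> midhull (u ` {n..})" for f n
  by (rule midhull_HB[OF _ that]) (use u in auto)
 define a where "a n = (INF f\<in>midhull (u ` {n..}). N1 f)" for n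
 have ne: "u n \<in> midhull (u ` {n..})" for n by (rule midhull_base) auto
 have bd: "bdd_below (N1 ` midhull (u ` {n..}))" for n using hull N1_nonneg by (intro bdd_belowI[of _ 0]) blast
 have a_le: "a n <= N1 f" if "f \<in> midhull (u ` {n..})" for n f unfolding a_def by (rule cINF_lower[OF bd that])
 have "incseq a"
 proof (rule incseq_SucI)
  fix n
  have "midhull (u ` {Suc n..}) \<subseteq> midhull (u ` {n..})" by (rule midhull_mono) auto
  thus "a n <= a (Suc n)" unfolding a_def[of "Suc n"]
   by (intro cINF_greatest) (use ne a_le in blast)+
 qed
 moreover have aC: "a n <= C" for n using a_le[OF ne[of n]] u(2)[of n] by linarith
 ultimately obtain L where L: "a \<longlonglongrightarrow> L" "!!n. a n <= L" using incseq_convergent[of a C] by auto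
 define eta where "eta j = (1/64::real)^j / 8" for j
 have eta: "0 < eta j" "eta (Suc j) <= eta j" for j by (auto simp: eta_def)
 have "\<exists>n. \<forall>k\<ge>n. L - eta j <= a k" for j
 proof -
  have "\<forall>\<^sub>F k in sequentially. L - eta j < a k" by (rule order_tendstoD(1)[OF L(1)]) (use eta[of j] in simp)
  thus ?thesis unfolding eventually_sequentially by (meson less_imp_le)
 qed
 then obtain m where m: "!!j k. m j <= k ==> L - eta j <= a k" by metis
 \<comment> \<open>Late enough for accuracy eta j, and increasing so that consecutive elements lie in one hull.\<close>
 define n where "n j = j + (\<Sum>i\<le>j. m i)" for j
 have n: "j <= n j" "m j <= n j" "n j <= n (Suc j)" for j
  using member_le_sum[of j "{..j}" m] by (auto simp: n_def)
 have "\<exists>f. f \<in> midhull (u ` {n j..}) & N1 f < a (n j) + eta j" for j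
  using cINF_less_iff[OF _ bd, of "n j" "a (n j) + eta j"] ne eta[of j] unfolding a_def[symmetric] by auto
 then obtain w where w: "!!j. w j \<in> midhull (u ` {n j..})" "!!j. N1 (w j) < a (n j) + eta j" by metis
 have HBw: "HB (w j)" for j using hull[OF w(1)] by blast
 have "N1 (%x. w j x - w (Suc j) x) <= (1/64)^j" for j
 proof -
  have "midhull (u ` {n (Suc j)..}) \<subseteq> midhull (u ` {n j..})" by (rule midhull_mono) (use n(3)[of j] in auto)
  hence "(%x. (w j x + w (Suc j) x) / 2) \<in> midhull (u ` {n j..})" using w(1) by (intro midhull_mid) auto
  hence "L - eta j <= N1 (%x. (w j x + w (Suc j) x) / 2)" using a_le m[OF n(2)[of j]] by fastforce
  moreover have "N1 (w j) <= L + eta j" "N1 (w (Suc j)) <= L + eta j"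
   using w(2)[of j] w(2)[of "Suc j"] L(2)[of "n j"] L(2)[of "n (Suc j)"] eta(2)[of j] by linarith+
  ultimately have "N1 (%x. (w j x - w (Suc j) x) / 2) <= 2 * eta j"
   using parallelogram[OF HBw HBw, of j "Suc j"] unfolding add_divide_distrib by linarith
  moreover have "N1 (%x. w j x - w (Suc j) x) <= 2^2 * N1 (%x. (w j x - w (Suc j) x) / 2)"
  proof -
   define d where "d x = (w j x - w (Suc j) x) / 2" for x
   have "HB d" unfolding d_def using HB_cmult(1)[OF HB_diff2(1)[OF HBw HBw], of "1/2"] by simp
   from HB_cmult(2)[OF this, of 2] have "N1 (%x. 2 * d x) <= 2^2 * N1 d" .
   moreover have "(%x. 2 * d x) = (%x. w j x - w (Suc j) x)" by (rule ext) (simp add: d_def field_simps)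
   ultimately show ?thesis by (simp add: d_def[abs_def])
  qed
  moreover have "2^2 * (2 * eta j) = (1/64)^j" by (simp add: eta_def)
  ultimately show ?thesis by (simp only: power2_eq_square)
 qed
 moreover have "w j \<in> midhull (u ` {j..})" for j
 proof -
  have "u ` {n j..} \<subseteq> u ` {j..}" using n(1)[of j] by (intro image_mono) auto
  from midhull_mono[OF this] show ?thesis using w(1)[of j] by blast
 qed
 moreover have "N1 (w j) <= C" for j using hull[OF w(1)] by blast
 moreover note HBw
 ultimately show ?thesis by (intro that[of w])
qed

lemma openin_measurable: "relopen G ==> G \<in> sets \<mu>"
proof -
 assume "relopen G"
 then obtain W where "open W" "G = M \<inter> W" unfolding openin_open by blast
 moreover from this have "M \<inter> W \<in> sets borel" by (intro sets.Int M_borel borel_open)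
 ultimately show ?thesis unfolding sets_mu by (subst sets_restrict_space_iff) simp_all
qed

text \<open>Capacity below eps, as small_iff shows. Truncation to values in [0, 1] does not raise the energy and
yields the bounded functions to which Et_almost_decreasing applies.\<close>

definition small :: "real => 'a set => bool" where
 "small eps A \<longleftrightarrow> (\<exists>G h. relopen G & A \<subseteq> G & HB h & unit_val h &
  (AE x in \<mu>. x \<in> G --> 1 <= h x) & N1 h < eps)"

lemma l2_inner_square: "l2_inner M f f = (\<integral>x. (f x)^2)"
 by (simp add: l2_inner_def power2_eq_square)

lemma smallD_capacity:
 assumes "small eps A" shows "capacity M A < ennreal eps"
proof -
 obtain G h where G: "relopen G" "A \<subseteq> G" and h: "HB h" "AE x in \<mu>. x \<in> G --> 1 <= h x" "N1 h < eps"
  using assms unfolding small_def by blast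
 have "capacity M A <= cap_open M G" unfolding capacity_def by (rule INF_lower) (use G in auto)
 also have "... <= ennreal (energy M h h + l2_inner M h h)"
  unfolding cap_open_def by (rule INF_lower) (use h HB_H1 in auto)
 also have "... = ennreal (N1 h)" by (simp add: N1_def l2_inner_square)
 also have "... < ennreal eps" using h(3) N1_nonneg[OF h(1)] by (simp add: ennreal_less_iff)
 finally show ?thesis .
qed

lemma small_capacity:
 assumes "capacity M A < ennreal eps" shows "small eps A"
proof -
 obtain G where G: "relopen G" "A \<subseteq> G" and "cap_open M G < ennreal eps"
  using assms unfolding capacity_def INF_less_iff by blast
 then obtain f where f: "f \<in> H1 M" "AE x in \<mu>. x \<in> G --> 1 <= f x" "ennreal (energy M f f + l2_inner M f f) < ennreal eps"
  unfolding cap_open_def INF_less_iff by blast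
 let ?h = "%x. max 0 (min 1 (f x))"
 have e: "0 < eps" using assms by (metis ennreal_eq_0_iff not_less not_less_zero)
 have le: "N1 ?h <= energy M f f + l2_inner M f f" using clamp_H1(2)[OF f(1)] by (simp add: l2_inner_square)
 also have "... < eps"
  using f(3) order_trans[OF N1_nonneg[OF clamp_H1(1)[OF f(1)]] le] by (simp add: ennreal_less_iff)
 finally have "N1 ?h < eps" .
 moreover have "AE x in \<mu>. x \<in> G --> 1 <= ?h x" using f(2) by eventually_elim auto
 moreover have "\<forall>x\<in>M. 0 <= ?h x & ?h x <= 1" by auto
 ultimately show ?thesis unfolding small_def using G clamp_H1(1)[OF f(1)] by blast
qed

lemma small_iff: "small eps A \<longleftrightarrow> capacity M A < ennreal eps"
 using smallD_capacity small_capacity by blast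

lemma small_subset: "small eps A ==> B \<subseteq> A ==> eps <= delta ==> small delta B"
 unfolding small_def by (meson order_trans order_less_le_trans)

lemma HB_sum:
 fixes h :: "nat => 'a => real"
 assumes "!!i. HB (h i)"
 shows "HB (%x. \<Sum>i<n. h i x) & N1 (%x. \<Sum>i<n. h i x) <= (\<Sum>i<n. 2 ^ Suc i * N1 (h i))"
 using assms
proof (induction n arbitrary: h)
 case 0
 thus ?case using HB_zero by simp
next
 case (Suc n)
 have IH: "HB (%x. \<Sum>i<n. h (Suc i) x)" "N1 (%x. \<Sum>i<n. h (Suc i) x) <= (\<Sum>i<n. 2 ^ Suc i * N1 (h (Suc i)))"
  using Suc.IH[of "%i. h (Suc i)"] Suc.prems by auto
 have "N1 (%x. h 0 x + (\<Sum>i<n. h (Suc i) x)) <= 2 * N1 (h 0) + 2 * (\<Sum>i<n. 2 ^ Suc i * N1 (h (Suc i)))"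
  using HB_add2[OF Suc.prems IH(1), of 0] IH(2) by linarith
 moreover have "HB (%x. h 0 x + (\<Sum>i<n. h (Suc i) x))" using HB_add2[OF Suc.prems IH(1), of 0] by blast
 ultimately show ?case
  unfolding sum.lessThan_Suc_shift by (simp add: sum_distrib_left mult.assoc)
qed

lemma HB_clamp: assumes "HB f" shows "HB (%x. max 0 (min 1 (f x)))" "N1 (%x. max 0 (min 1 (f x))) <= N1 f"
 using clamp_H1[OF HB_H1[OF assms]] by (auto simp: N1_def)

lemma HB_abs: assumes "HB f" shows "HB (%x. \<bar>f x\<bar>)" "N1 (%x. \<bar>f x\<bar>) <= N1 f"
proof -
 have "bdd (%x. \<bar>f x\<bar>)" using HB_bdd[OF assms] unfolding bdd_def by auto
 from HB_contraction[OF assms this] show "HB (%x. \<bar>f x\<bar>)" "N1 (%x. \<bar>f x\<bar>) <= N1 f" by auto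
qed

text \<open>The truncated sum of the test functions works for the union, by lower semicontinuity. The factors 2 ^ Suc i
come from N1 (f + g) <= 2 * N1 f + 2 * N1 g, used repeatedly.\<close>

lemma small_UN:
 fixes A :: "nat => 'a set"
 assumes A: "!!i. small (eps i) (A i)" and S: "!!n. (\<Sum>i<n. 2 ^ Suc i * eps i) <= S" "S < delta"
 shows "small delta (\<Union>i. A i)"
proof -
 have "\<forall>i. \<exists>G h. relopen G & A i \<subseteq> G & HB h & unit_val h &
  (AE x in \<mu>. x \<in> G --> 1 <= h x) & N1 h < eps i"
  using A unfolding small_def by blast
 from choice[OF this] obtain G where "\<forall>i. \<exists>h. relopen (G i) & A i \<subseteq> G i & HB h & unit_val h &
  (AE x in \<mu>. x \<in> G i --> 1 <= h x) & N1 h < eps i" ..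
 from choice[OF this] obtain h where Gh: "\<forall>i. relopen (G i) & A i \<subseteq> G i & HB (h i) & unit_val (h i) &
  (AE x in \<mu>. x \<in> G i --> 1 <= h i x) & N1 (h i) < eps i" ..
 hence G: "!!i. relopen (G i)" "!!i. A i \<subseteq> G i" and
  h: "!!i. HB (h i)" "!!i x. x \<in> M ==> 0 <= h i x & h i x <= 1" "!!i. AE x in \<mu>. x \<in> G i --> 1 <= h i x" "!!i. N1 (h i) < eps i"
  by simp_all
 define s where "s n x = max 0 (min 1 (\<Sum>i<n. h i x))" for n x
 have s: "HB (s n)" "N1 (s n) <= S" for n
 proof -
  show "HB (s n)" unfolding s_def by (rule HB_clamp) (rule conjunct1[OF HB_sum[OF h(1)]])
  have "N1 (s n) <= N1 (%x. \<Sum>i<n. h i x)" unfolding s_def by (rule HB_clamp) (rule conjunct1[OF HB_sum[OF h(1)]])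
  also have "... <= (\<Sum>i<n. 2 ^ Suc i * N1 (h i))" by (rule conjunct2[OF HB_sum[OF h(1)]])
  also have "... <= (\<Sum>i<n. 2 ^ Suc i * eps i)" by (intro sum_mono mult_left_mono) (use h(4) less_imp_le in auto)
  also have "... <= S" by (rule S(1))
  finally show "N1 (s n) <= S" .
 qed
 have s01: "0 <= s n x" "s n x <= 1" for n x by (auto simp: s_def)
 have inc: "incseq (%n. s n x)" if "x \<in> M" for x
 proof (rule incseq_SucI)
  fix n
  have "(\<Sum>i<n. h i x) <= (\<Sum>i<Suc n. h i x)" using h(2)[OF that, of n] by simp
  thus "s n x <= s (Suc n) x" unfolding s_def by (intro max.mono min.mono order_refl)
 qed
 define g where "g x = (if x \<in> M then lim (%n. s n x) else 0)" for x
 have lim: "(%n. s n x) \<longlonglongrightarrow> g x" if x: "x \<in> M" for x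
 proof (rule incseq_convergent[OF inc[OF x], of 1])
  show "\<forall>i. s i x <= 1" using s01(2) by simp
  fix L assume "(%n. s n x) \<longlonglongrightarrow> L"
  thus ?thesis using x by (simp add: g_def limI)
 qed
 have g01: "0 <= g x & g x <= 1" if "x \<in> M" for x
  using LIMSEQ_le_const[OF lim[OF that], of 0] LIMSEQ_le_const2[OF lim[OF that], of 1] s01 by auto
 have gm: "g \<in> borel_measurable \<mu>"
  by (rule borel_measurable_LIMSEQ_real[of \<mu> s]) (use lim bdd_meas[OF HB_bdd[OF s(1)]] in auto)
 have gb: "bdd g" by (rule bddI[OF gm, of 1]) (use g01 in fastforce)
 have AEl: "AE x in \<mu>. (%n. s n x) \<longlonglongrightarrow> g x" by (rule AE_I2) (use lim in simp)
 have sB: "\<bar>s n x\<bar> <= 1" for n x using s01[of n x] by simp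
 have "HB g" "N1 g <= S" using HB_lsc[OF s(1) sB AEl gb s(2)] by auto
 moreover have "AE x in \<mu>. x \<in> (\<Union>i. G i) --> 1 <= g x"
 proof -
  have "AE x in \<mu>. \<forall>i. x \<in> G i --> 1 <= h i x" using h(3) by (simp add: AE_all_countable)
  moreover have "AE x in \<mu>. x \<in> M" by (rule AE_I2) simp
  ultimately show ?thesis
  proof eventually_elim
   fix x assume *: "\<forall>i. x \<in> G i --> 1 <= h i x" "x \<in> M"
   show "x \<in> (\<Union>i. G i) --> 1 <= g x"
   proof
    assume "x \<in> (\<Union>i. G i)"
    then obtain i where "x \<in> G i" by blast
    hence "1 <= h i x" using * by blast
    also have "h i x <= (\<Sum>i<Suc i. h i x)" using h(2)[OF \<open>x \<in> M\<close>] by (intro member_le_sum) auto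
    finally have "1 <= s (Suc i) x" by (auto simp: s_def)
    also have "s (Suc i) x <= g x" by (rule incseq_le[OF inc[OF \<open>x \<in> M\<close>] lim[OF \<open>x \<in> M\<close>]])
    finally show "1 <= g x" .
   qed
  qed
 qed
 moreover have "relopen (\<Union>i. G i)" using G(1) by blast
 moreover have "(\<Union>i. A i) \<subseteq> (\<Union>i. G i)" using G(2) by blast
 ultimately show ?thesis unfolding small_def using g01 S(2) by (meson order_le_less_trans)
qed

definition polar :: "'a set => bool" where "polar N \<longleftrightarrow> N \<subseteq> M & capacity M N = 0"

lemma small_0: "capacity M N = 0 \<longleftrightarrow> (\<forall>eps>0. small eps N)"
proof
 assume *: "\<forall>eps>0. small eps N"
 show "capacity M N = 0"
 proof (rule ccontr)
  assume "capacity M N ~= 0"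
  hence "0 < capacity M N" by (simp add: zero_less_iff_neq_zero)
  then obtain x where x: "0 < x" "x < capacity M N" using dense by blast
  then obtain r where r: "x = ennreal r" "0 <= r" by (metis ennreal_cases ennreal_less_top not_less_iff_gr_or_eq top.not_eq_extremum)
  hence "0 < r" using x(1) by simp
  hence "capacity M N < x" using * r by (simp add: small_iff)
  thus False using x(2) by simp
 qed
qed (auto simp: small_iff)

lemma small_empty: "0 < eps ==> small eps {}"
 unfolding small_def by (rule exI[of _ "{}"], rule exI[of _ "%_. 0"]) (use HB_zero in auto)

lemma small_Un:
 assumes "small eps A" "small eps' B" "2 * eps + 4 * eps' < delta" shows "small delta (A \<union> B)"
proof -
 have pos: "0 < eps" "0 < eps'" using assms by (auto simp: small_def dest: N1_nonneg)
 define kappa where "kappa = (delta - (2 * eps + 4 * eps')) / 2"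
 have kappa: "0 < kappa" using assms by (simp add: kappa_def)
 define E where "E i = (if i = 0 then eps else if i = 1 then eps' else kappa / 4 ^ i)" for i :: nat
 define D where "D i = (if i = 0 then A else if i = 1 then B else {})" for i :: nat
 have "small (E i) (D i)" for i using assms kappa small_empty by (auto simp: E_def D_def)
 moreover have "(\<Sum>i<n. 2 ^ Suc i * E i) <= 2 * eps + 4 * eps' + kappa" for n
 proof -
  have "(\<Sum>i<n. 2 ^ Suc i * E i) <= (\<Sum>i<n + 2. 2 ^ Suc i * E i)"
   using pos kappa by (intro sum_mono2) (auto simp: E_def)
  also have "... = 2 * eps + 4 * eps' + (\<Sum>i<n. 2 ^ Suc (Suc (Suc i)) * (kappa / 4 ^ (Suc (Suc i))))"
   unfolding add_2_eq_Suc' sum.lessThan_Suc_shift by (simp add: E_def)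
  also have "(\<Sum>i<n. 2 ^ Suc (Suc (Suc i)) * (kappa / 4 ^ (Suc (Suc i)))) = (\<Sum>i<n. kappa / 2 * (1/2)^i)"
   unfolding two_power_quarter[symmetric] by (simp add: power_one_over field_simps)
  also have "... <= kappa" using geometric_half_le[of "kappa / 2" n] kappa by simp
  finally show ?thesis by simp
 qed
 moreover have "2 * eps + 4 * eps' + kappa < delta" using assms by (simp add: kappa_def field_simps)
 ultimately have "small delta (\<Union>i. D i)" by (rule small_UN)
 moreover have "A \<union> B \<subseteq> (\<Union>i. D i)" by (auto simp: D_def intro: exI[of _ 0] exI[of _ 1])
 ultimately show ?thesis using small_subset by blast
qed

lemma geometric_small:
 assumes "!!i::nat. small (c * (1/4)^i) (A i)" "2 * 2 * c < delta"
 shows "small delta (\<Union>i. A i)"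
proof (rule small_UN[OF assms(1) _ assms(2)])
 fix n
 have c: "0 < c" using assms(1)[of 0] by (auto simp: small_def dest: N1_nonneg)
 have "(\<Sum>i<n. 2 ^ Suc i * (c * (1/4)^i)) = (\<Sum>i<n. 2 * c * (1/2)^i)"
  unfolding two_power_quarter[symmetric] by (simp add: mult_ac)
 also have "... <= 2 * 2 * c" using geometric_half_le[of "2 * c" n] c by simp
 finally show "(\<Sum>i<n. 2 ^ Suc i * (c * (1/4)^i)) <= 2 * 2 * c" .
qed

lemma polar_UN: "(!!i::nat. polar (A i)) ==> polar (\<Union>i. A i)"
 unfolding polar_def small_0
proof (intro conjI allI impI)
 fix eps :: real assume A: "!!i. A i \<subseteq> M & (\<forall>eps>0. small eps (A i))" and "0 < eps"
 show "small eps (\<Union>i. A i)" by (rule geometric_small[of "eps / 8"]) (use A \<open>0 < eps\<close> in auto)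
qed auto

lemma polar_Un: "polar A ==> polar B ==> polar (A \<union> B)"
proof -
 assume "polar A" "polar B"
 hence "polar (\<Union>i::nat. if i = 0 then A else B)" by (intro polar_UN) auto
 moreover have "(\<Union>i::nat. if i = 0 then A else B) = A \<union> B" by (auto split: if_splits)
 ultimately show ?thesis by simp
qed

lemma polar_subset: "polar A ==> B \<subseteq> A ==> polar B"
 unfolding polar_def small_0 using small_subset by blast

lemma small_measure:
 assumes "small eps A" obtains G where "G \<in> sets \<mu>" "A \<subseteq> G" "mu.prob G < eps"
proof -
 obtain G h where G: "relopen G" "A \<subseteq> G" and h: "HB h" "!!x. x \<in> M ==> 0 <= h x" "AE x in \<mu>. x \<in> G --> 1 <= h x" "N1 h < eps"
  using assms unfolding small_def by blast
 note [measurable] = openin_measurable[OF G(1)]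
 have "G \<inter> M = G" using openin_subset[OF G(1)] by auto
 hence "mu.prob G = (\<integral>x. indicator G x)" by simp
 also have "... <= (\<integral>x. (h x)^2)"
 proof (rule integral_mono_AE)
  show "integrable \<mu> (indicator G :: 'a => real)" by (simp add: less_top[symmetric])
  show "integrable \<mu> (%x. (h x)^2)" by (intro bdd_integrable bdd_power2 HB_bdd h)
  show "AE x in \<mu>. indicator G x <= (h x)^2"
   using h(3) by eventually_elim (auto simp: indicator_def intro: one_le_power)
 qed
 also have "... <= N1 h" by (rule integral_square_le_N1[OF h(1)])
 also note h(4)
 finally show ?thesis using that G openin_measurable by blast
qed

lemma polar_AE:
 assumes "polar N" shows "AE x in \<mu>. x \<notin> N"
proof -
 have "\<forall>n. \<exists>G. G \<in> sets \<mu> & N \<subseteq> G & mu.prob G < 1 / real (Suc n)"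
 proof
  fix n
  have "small (1 / real (Suc n)) N" using assms unfolding polar_def small_0 by simp
  thus "\<exists>G. G \<in> sets \<mu> & N \<subseteq> G & mu.prob G < 1 / real (Suc n)" by (rule small_measure) blast
 qed
 then obtain G where G: "!!n. G n \<in> sets \<mu>" "!!n. N \<subseteq> G n" "!!n. mu.prob (G n) < 1 / real (Suc n)" by metis
 have I: "(\<Inter>n. G n) \<in> sets \<mu>" using G by auto
 have "mu.prob (\<Inter>n. G n) <= 1 / real (Suc n)" for n
  using mu.finite_measure_mono[of "\<Inter>n. G n" "G n"] G by (smt (verit, ccfv_threshold) INF_lower UNIV_I)
 hence "mu.prob (\<Inter>n. G n) = 0"
  using LIMSEQ_le_const[OF LIMSEQ_inverse_real_of_nat, of "mu.prob (\<Inter>n. G n)"] by (simp add: inverse_eq_divide antisym)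
 hence "(\<Inter>n. G n) \<in> null_sets \<mu>" using I by (simp add: mu.emeasure_eq_measure null_sets_def)
 thus ?thesis by (rule AE_I') (use G in auto)
qed

end

section \<open>Quasi-continuous functions\<close>

context reflected_process begin

lemma smallI:
 assumes "relopen G" "A \<subseteq> G" and h: "HB h" "AE x in \<mu>. x \<in> G --> 1 <= h x" "N1 h < eps"
 shows "small eps A"
 unfolding small_def
proof (intro exI conjI)
 show "relopen G" "A \<subseteq> G" by fact+
 show "HB (%x. max 0 (min 1 (h x)))" by (rule HB_clamp(1)[OF h(1)])
 show "N1 (%x. max 0 (min 1 (h x))) < eps" using HB_clamp(2)[OF h(1)] h(3) by (rule order_le_less_trans)
 show "AE x in \<mu>. x \<in> G --> 1 <= max 0 (min 1 (h x))" using h(2) by eventually_elim auto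
qed auto

lemma smallE:
 assumes "small eps A"
 obtains G h where "relopen G" "A \<subseteq> G" "HB h" "!!x. x \<in> M ==> 0 <= h x"
  "AE x in \<mu>. x \<in> G --> 1 <= h x" "N1 h < eps"
 using assms unfolding small_def by (elim exE conjE) (rule that, auto)

lemma openin_Un_relative:
 assumes "relopen G" "openin (top_of_set (M - G)) W"
 shows "relopen (G \<union> W)"
proof -
 obtain V V' where V: "open V" "G = M \<inter> V" "open V'" "W = (M - G) \<inter> V'"
  using assms unfolding openin_open by blast
 have "x \<in> G \<union> W \<longleftrightarrow> x \<in> M \<inter> (V \<union> V')" for x
  using V(2,4) by (cases "x \<in> G"; cases "x \<in> M") simp_all
 hence "G \<union> W = M \<inter> (V \<union> V')" by blast
 thus ?thesis using openin_open_Int[OF open_Un[OF V(1,3)]] by simp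
qed

abbreviation qc :: "('a => real) => bool" where "qc \<equiv> quasi_continuous M"

lemma qcE:
 assumes "qc f" "0 < eps"
 obtains G where "relopen G" "small eps G" "continuous_on (M - G) f"
 using assms unfolding quasi_continuous_def small_iff by blast

lemma qcI:
 assumes "!!eps. 0 < eps ==> \<exists>G. relopen G & small eps G & continuous_on (M - G) f"
 shows "qc f"
 using assms unfolding quasi_continuous_def small_iff by blast

lemma qc_continuous: "continuous_on M f ==> qc f"
 by (rule qcI, rule exI[of _ "{}"]) (simp add: small_empty)

lemma qc_comp2:
 assumes f: "qc f" and g: "qc g" and h: "!!S. continuous_on S f ==> continuous_on S g ==> continuous_on S h"
 shows "qc h"
proof (rule qcI)
 fix eps :: real assume e: "0 < eps"
 obtain G where G: "relopen G" "small (eps / 8) G" "continuous_on (M - G) f"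
  by (rule qcE[OF f, of "eps / 8"]) (use e in auto)
 obtain G' where G': "relopen G'" "small (eps / 8) G'" "continuous_on (M - G') g"
  by (rule qcE[OF g, of "eps / 8"]) (use e in auto)
 have "small eps (G \<union> G')" by (rule small_Un[OF G(2) G'(2)]) (use e in simp)
 moreover have "relopen (G \<union> G')" by (rule openin_Un[OF G(1) G'(1)])
 moreover have "continuous_on (M - (G \<union> G')) h"
  by (rule h; rule continuous_on_subset, rule G(3) G'(3), blast)
 ultimately show "\<exists>G. relopen G & small eps G & continuous_on (M - G) h" by blast
qed

text \<open>Off a small open set D' the set where v < u is relatively open, and it is null within G. Hence a test function
for D' serves also for the open union of both.\<close>

lemma qc_le:
 assumes u: "qc u" and v: "qc v" and G: "relopen G" and le: "AE x in \<mu>. x \<in> G --> u x <= v x"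
 shows "polar {x \<in> G. v x < u x}"
 unfolding polar_def small_0
proof (intro conjI allI impI)
 show "{x \<in> G. v x < u x} \<subseteq> M" using openin_subset[OF G] by auto
 fix eps :: real assume e: "0 < eps"
 have "qc (%x. v x - u x)" by (rule qc_comp2[OF v u]) (rule continuous_on_diff)
 then obtain D where D: "relopen D" "small eps D" "continuous_on (M - D) (%x. v x - u x)"
  using qcE[OF _ e] by blast
 obtain D' h where D': "relopen D'" "D \<subseteq> D'" and h: "HB h" "!!x. x \<in> M ==> 0 <= h x" "AE x in \<mu>. x \<in> D' --> 1 <= h x" "N1 h < eps"
  using D(2) by (rule smallE) (rule that)
 have "continuous_on (M - D') (%x. v x - u x)" by (rule continuous_on_subset[OF D(3)]) (use D' in auto)
 hence "openin (top_of_set (M - D')) ((M - D') \<inter> (%x. v x - u x) -` {..<0})"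
  by (rule continuous_openin_preimage_gen) auto
 then obtain V where V: "open V" "(M - D') \<inter> (%x. v x - u x) -` {..<0} = (M - D') \<inter> V"
  unfolding openin_open by blast
 have Vx: "v x < u x \<longleftrightarrow> x \<in> V" if "x \<in> M" "x \<notin> D'" for x
  using V(2) that by auto
 have GM: "G \<subseteq> M" using openin_subset[OF G] by auto
 have o: "relopen (D' \<union> (G \<inter> (M \<inter> V)))"
  by (intro openin_Un openin_Int D' G openin_open_Int V)
 show "small eps {x \<in> G. v x < u x}"
 proof (rule smallI[OF o _ h(1) _ h(4)])
  show "{x \<in> G. v x < u x} \<subseteq> D' \<union> (G \<inter> (M \<inter> V))" using Vx GM by blast
  show "AE x in \<mu>. x \<in> D' \<union> (G \<inter> (M \<inter> V)) --> 1 <= h x"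
   using h(3) le
  proof eventually_elim
   fix x assume *: "x \<in> D' --> 1 <= h x" "x \<in> G --> u x <= v x"
   show "x \<in> D' \<union> (G \<inter> (M \<inter> V)) --> 1 <= h x"
    using * Vx[of x] by (cases "x \<in> D'") auto
  qed
 qed
qed

text \<open>The sets where consecutive terms differ by more than (1/2) ^ n have small capacity, because 2 ^ n times the
difference is a test function for them; their tails T k have small capacity by countable subadditivity.
Outside T k the convergence is uniform, so the limit is continuous there.\<close>

lemma qc_limit:
 assumes u: "!!n::nat. HB (u n)" "!!n. qc (u n)" and B: "!!n x. x \<in> M ==> \<bar>u n x\<bar> <= B"
  and cauchy: "!!n. N1 (%x. u n x - u (Suc n) x) <= (1/64)^n"
 obtains v N where "polar N" "!!x. x \<in> M - N ==> (%n. u n x) \<longlonglongrightarrow> v x" "!!x. x \<in> N ==> v x = 0" "HB v" "qc v"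
  "!!n. N1 (%x. u n x - v x) <= 4 * (1/64)^n"
proof -
 have "\<exists>S. relopen S & small ((1/16)^n / 8) S & continuous_on (M - S) (u n)" for n
  by (rule qcE[OF u(2)[of n], of "(1/16)^n / 8"]) (simp, blast)
 from choice[OF allI[OF this]] obtain S where S: "\<forall>n. relopen (S n) & small ((1/16)^n / 8) (S n) & continuous_on (M - S n) (u n)" ..
 let ?P = "%n R. relopen R & small (5 * (1/16)^n) R & continuous_on (M - R) (u n) &
   (\<forall>x\<in>M - R. \<bar>u n x - u (Suc n) x\<bar> <= (1/2)^n)"
 have ex: "\<exists>R. ?P n R" for n
 proof -
  have "small ((1/16)^Suc n / 8) (S (Suc n))" using S by blast
  hence "small ((1/16)^n / 8) (S (Suc n))" by (rule small_subset) simp_all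
  hence "small ((1/16)^n) (S n \<union> S (Suc n))" using S by (intro small_Un[of "(1/16)^n / 8"]) auto
  then obtain G h where G: "relopen G" "S n \<union> S (Suc n) \<subseteq> G" and h: "HB h" "!!x. x \<in> M ==> 0 <= h x"
   "AE x in \<mu>. x \<in> G --> 1 <= h x" "N1 h < (1/16)^n" by (rule smallE) (rule that)
  let ?d = "%x. \<bar>u n x - u (Suc n) x\<bar>"
  have c: "continuous_on (M - G) (u k)" if "S k \<subseteq> G" for k by (rule continuous_on_subset[of "M - S k"]) (use S that in auto)
  have cont: "continuous_on (M - G) (%x. u n x - u (Suc n) x)" "continuous_on (M - G) (u n)"
   using G(2) by (auto intro!: continuous_on_diff c)
  have "openin (top_of_set (M - G)) ((M - G) \<inter> ?d -` {(1/2)^n<..})"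
   by (rule continuous_openin_preimage_gen[OF continuous_on_rabs[OF cont(1)]]) auto
  hence o: "relopen (G \<union> ((M - G) \<inter> ?d -` {(1/2)^n<..}))"
   by (rule openin_Un_relative[OF G(1)])
  let ?R = "G \<union> ((M - G) \<inter> ?d -` {(1/2)^n<..})"
  have d: "HB ?d" "N1 ?d <= (1/64)^n"
   using HB_abs[OF HB_diff2(1)[OF u(1) u(1), of n "Suc n"]] cauchy[of n] by auto
  have d2: "HB (%x. 2 ^ n * ?d x)" "N1 (%x. 2 ^ n * ?d x) <= (2^n)^2 * N1 ?d" by (rule HB_cmult[OF d(1)])+
  have "(2^n)^2 * N1 ?d <= (2^n)^2 * (1/64)^n" by (rule mult_left_mono[OF d(2)]) simp
  also have "... = (2 * 2 * (1/64))^n" by (simp only: power2_eq_square power_mult_distrib)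
  finally have N: "N1 (%x. 2 ^ n * ?d x) <= (1/16)^n" using d2(2) by simp
  have "small (5 * (1/16)^n) ?R"
  proof (rule smallI[OF o order_refl])
   show "HB (%x. 2 ^ n * ?d x + h x)" using HB_add2[OF d2(1) h(1)] by (rule conjunct1)
   have "N1 (%x. 2 ^ n * ?d x + h x) <= 2 * N1 (%x. 2 ^ n * ?d x) + 2 * N1 h" using HB_add2[OF d2(1) h(1)] by (rule conjunct2)
   moreover have "0 < (1/16::real)^n" by simp
   ultimately show "N1 (%x. 2 ^ n * ?d x + h x) < 5 * (1/16)^n" using N h(4) by linarith
   show "AE x in \<mu>. x \<in> ?R --> 1 <= 2 ^ n * ?d x + h x"
    using h(3) AE_space
   proof eventually_elim
    fix x assume *: "x \<in> G --> 1 <= h x" "x \<in> space \<mu>"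
    hence h0: "0 <= h x" using h(2) by simp
    show "x \<in> ?R --> 1 <= 2 ^ n * ?d x + h x"
    proof
     assume "x \<in> ?R"
     then consider "x \<in> G" | "(1/2)^n < ?d x" by auto
     thus "1 <= 2 ^ n * ?d x + h x"
     proof cases
      case 1
      thus ?thesis using * by (simp add: add_increasing)
     next
      case 2
      hence "2 ^ n * (1/2)^n <= 2 ^ n * ?d x" by (intro mult_left_mono) auto
      moreover have "2 ^ n * (1/2)^n = (1::real)" by (simp flip: power_mult_distrib)
      ultimately show ?thesis using h0 by linarith
     qed
    qed
   qed
  qed
  moreover have "continuous_on (M - ?R) (u n)" by (rule continuous_on_subset[OF cont(2)]) blast
  moreover have "\<forall>x\<in>M - ?R. ?d x <= (1/2)^n" by auto
  ultimately show ?thesis using o by blast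
 qed
 from choice[OF allI[OF ex]] obtain R where R: "\<forall>n. ?P n (R n)" ..
 define T where "T k = (\<Union>i. R (k + i))" for k
 have To: "relopen (T k)" for k unfolding T_def by (rule openin_Union) (use R in auto)
 have Ts: "small (21 * (1/16)^k) (T k)" for k
  unfolding T_def
 proof (rule geometric_small[of "5 * (1/16)^k"])
  fix i
  have "(1/16::real)^i <= (1/4)^i" by (intro power_mono) auto
  hence "5 * (1/16::real)^(k+i) <= 5 * (1/16)^k * (1/4)^i" by (simp add: power_add)
  thus "small (5 * (1/16)^k * (1/4)^i) (R (k + i))" using R small_subset by blast
 qed simp
 define N where "N = (\<Inter>k. T k)"
 have N: "polar N"
  unfolding polar_def small_0
 proof (intro conjI allI impI)
  show "N \<subseteq> M" using openin_subset[OF To[of 0]] by (auto simp: N_def)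
  fix eps :: real assume "0 < eps"
  then obtain k where "(1/16)^k < eps / 21" using real_arch_pow_inv[of "eps / 21" "1/16"] by auto
  thus "small eps N" by (intro small_subset[OF Ts[of k]]) (auto simp: N_def)
 qed
 have Nm: "N \<in> sets \<mu>" unfolding N_def using openin_measurable[OF To] by auto
 define v where "v x = (if x \<in> M - N then lim (%n. u n x) else 0)" for x
 have unif: "uniform_limit (M - T k) (%n x. u (k + n) x) v sequentially" for k
 proof -
  let ?s = "%x. suminf (%i. u (k + Suc i) x - u (k + i) x)"
  have m: "uniform_limit (M - T k) (%n x. \<Sum>i<n. u (k + Suc i) x - u (k + i) x)
   ?s sequentially"
  proof (rule Weierstrass_m_test)
   fix n x assume x: "x \<in> M - T k"
   hence "x \<in> M - R (k + n)" by (auto simp: T_def)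
   hence "\<bar>u (k + n) x - u (Suc (k + n)) x\<bar> <= (1/2)^(k + n)" using R by blast
   also have "... <= (1/2)^n" by (rule power_decreasing) auto
   finally show "norm (u (k + Suc n) x - u (k + n) x) <= (1/2)^n" by (simp add: abs_minus_commute)
  qed (simp add: summable_geometric)
  have tel: "u k x + (\<Sum>i<n. u (k + Suc i) x - u (k + i) x) = u (k + n) x" for n x
   by (induction n) auto
  have "uniform_limit (M - T k) (%n x. u k x + (\<Sum>i<n. u (k + Suc i) x - u (k + i) x))
   (%x. u k x + ?s x) sequentially"
   by (intro uniform_limit_add uniform_limit_const m)
  hence U: "uniform_limit (M - T k) (%n x. u (k + n) x)
   (%x. u k x + ?s x) sequentially" by (simp only: tel)
  have "v x = u k x + ?s x" if x: "x \<in> M - T k" for x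
  proof -
   have "(%n. u (k + n) x) \<longlonglongrightarrow> u k x + ?s x"
    by (rule tendsto_uniform_limitI[OF U x])
   hence "(%n. u (n + k) x) \<longlonglongrightarrow> u k x + ?s x" by (simp only: add.commute)
   hence "(%n. u n x) \<longlonglongrightarrow> u k x + ?s x" by (rule LIMSEQ_offset)
   moreover have "x \<in> M - N" using x by (auto simp: N_def)
   ultimately show ?thesis by (simp add: v_def limI)
  qed
  thus ?thesis using U by (subst uniform_limit_cong'[OF refl]) auto
 qed
 have lim: "(%n. u n x) \<longlonglongrightarrow> v x" if x: "x \<in> M - N" for x
 proof -
  obtain k where "x \<in> M - T k" using x by (auto simp: N_def)
  hence "(%n. u (k + n) x) \<longlonglongrightarrow> v x" by (rule tendsto_uniform_limitI[OF unif])
  hence "(%n. u (n + k) x) \<longlonglongrightarrow> v x" by (simp only: add.commute)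
  thus ?thesis by (rule LIMSEQ_offset)
 qed
 have v0: "v x = 0" if "x \<in> N" for x using that by (simp add: v_def)
 have qcv: "qc v"
 proof (rule qcI)
  fix eps :: real assume "0 < eps"
  then obtain k where k: "(1/16)^k < eps / 21" using real_arch_pow_inv[of "eps / 21" "1/16"] by auto
  have "continuous_on (M - T k) v"
  proof (rule uniform_limit_theorem[OF _ unif sequentially_bot])
   have "continuous_on (M - T k) (u (k + n))" for n
    by (rule continuous_on_subset[of "M - R (k + n)"]) (use R in "auto simp: T_def")
   thus "\<forall>\<^sub>F n in sequentially. continuous_on (M - T k) (u (k + n))" by simp
  qed
  moreover have "small eps (T k)" by (rule small_subset[OF Ts order_refl]) (use k in simp)
  ultimately show "\<exists>G. relopen G & small eps G & continuous_on (M - G) v" using To by blast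
 qed
 have vm: "v \<in> borel_measurable \<mu>"
 proof (rule borel_measurable_LIMSEQ_real[of \<mu> "%n x. if x \<in> N then 0 else u n x"])
  fix x assume "x \<in> space \<mu>"
  thus "(%n. if x \<in> N then 0 else u n x) \<longlonglongrightarrow> v x" using lim[of x] v0[of x] by (cases "x \<in> N") simp_all
 next
  fix n
  have "u n \<in> borel_measurable \<mu>" by (rule bdd_meas[OF HB_bdd[OF u(1)]])
  thus "(%x. if x \<in> N then 0 else u n x) \<in> borel_measurable \<mu>"
  proof (rule measurable_If[OF borel_measurable_const])
   have "{x \<in> space \<mu>. x \<in> N} = N" using sets.sets_into_space[OF Nm] by blast
   thus "{x \<in> space \<mu>. x \<in> N} \<in> sets \<mu>" using Nm by simp
  qed
 qed
 have vB: "\<bar>v x\<bar> <= \<bar>B\<bar>" if x: "x \<in> M" for x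
 proof (cases "x \<in> N")
  case False
  have "(%n. \<bar>u n x\<bar>) \<longlonglongrightarrow> \<bar>v x\<bar>" by (intro tendsto_rabs lim) (use False x in simp)
  moreover have "\<bar>u n x\<bar> <= \<bar>B\<bar>" for n using B[OF x, of n] by linarith
  ultimately show ?thesis by (intro LIMSEQ_le_const2) auto
 qed (simp add: v0)
 have vb: "bdd v" by (rule bddI[OF vm vB])
 have AEl: "AE x in \<mu>. (%n. u n x) \<longlonglongrightarrow> v x"
  using polar_AE[OF N] AE_space by eventually_elim (rule lim, simp)
 have main: "HB (%x. u n x - v x) & N1 (%x. u n x - v x) <= 4 * (1/64)^n" for n
 proof -
  have tel: "(\<Sum>i<m. u (n + i) x - u (Suc (n + i)) x) = u n x - u (n + m) x" for m x by (induction m) auto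
  have H: "HB (%x. u n x - u (n + m) x)" for m by (rule HB_diff2(1)[OF u(1) u(1)])
  have le: "N1 (%x. u n x - u (n + m) x) <= 4 * (1/64)^n" for m
  proof -
   have "N1 (%x. u n x - u (n + m) x) <= (\<Sum>i<m. 2 ^ Suc i * N1 (%x. u (n + i) x - u (Suc (n + i)) x))"
    using conjunct2[OF HB_sum[of "%i x. u (n + i) x - u (Suc (n + i)) x" m]] HB_diff2(1)[OF u(1) u(1)] unfolding tel by blast
   also have "... <= (\<Sum>i<m. 2 * (1/64)^n * (1/2)^i)"
   proof (rule sum_mono)
    fix i
    have "2 ^ Suc i * N1 (%x. u (n + i) x - u (Suc (n + i)) x) <= 2 ^ Suc i * (1/64)^(n + i)"
     by (intro mult_left_mono cauchy) simp
    also have "... = 2 * (1/64)^n * (2 ^ i * (1/64)^i)" by (simp add: power_add)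
    also have "2 ^ i * (1/64)^i = (2 * (1/64::real))^i" by (simp only: power_mult_distrib)
    also have "... <= (1/2)^i" by (intro power_mono) auto
    finally show "2 ^ Suc i * N1 (%x. u (n + i) x - u (Suc (n + i)) x) <= 2 * (1/64)^n * (1/2)^i" by simp
   qed
   also have "... <= 2 * (2 * (1/64)^n)" by (rule geometric_half_le) simp
   finally show ?thesis by simp
  qed
  have b: "\<bar>u n x - u (n + m) x\<bar> <= 2 * B" if "x \<in> M" for m x
   using B[OF that, of n] B[OF that, of "n + m"] by linarith
  have l: "AE x in \<mu>. (%m. u n x - u (n + m) x) \<longlonglongrightarrow> u n x - v x"
   using AEl
  proof eventually_elim
   fix x assume "(%n. u n x) \<longlonglongrightarrow> v x"
   hence "(%m. u (m + n) x) \<longlonglongrightarrow> v x" by (rule LIMSEQ_ignore_initial_segment)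
   thus "(%m. u n x - u (n + m) x) \<longlonglongrightarrow> u n x - v x" by (intro tendsto_diff tendsto_const) (simp only: add.commute)
  qed
  show ?thesis using HB_lsc[OF H b l bdd_diff[OF HB_bdd[OF u(1)] vb] le] by blast
 qed
 have "HB (%x. u 0 x - (u 0 x - v x))" by (rule HB_diff2(1)[OF u(1) conjunct1[OF main]])
 hence "HB v" by simp
 thus ?thesis using that[OF N lim v0 _ qcv conjunct2[OF main]] by blast
qed

text \<open>The definition of capacity asks for a function that is at least 1 on an open set. Here h' is at least 1 on A
only. Multiplied by s > 1 it exceeds 1 on a set that is open up to sets of small capacity, and these are
covered by test functions g and k of their own.\<close>

lemma small_of_qc:
 assumes h: "HB h" "N1 h < eps" and h': "qc h'" "AE x in \<mu>. h' x = h x" and N: "polar N"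
  and A: "A \<subseteq> M" "!!x. x \<in> A - N ==> 1 <= h' x"
 shows "small eps A"
proof -
 have "((%s. s ^ 3 * N1 h) \<longlongrightarrow> 1 ^ 3 * N1 h) (at_right 1)" by (intro tendsto_intros)
 hence "\<forall>\<^sub>F s in at_right 1. s ^ 3 * N1 h < eps" using h(2) by (intro order_tendstoD(2)) auto
 then obtain b where b: "1 < b" "!!s. 1 < s ==> s < b ==> s ^ 3 * N1 h < eps" unfolding eventually_at_right_field by blast
 define s where "s = (1 + b) / 2"
 have s: "1 < s" "s ^ 3 * N1 h < eps" using b by (auto simp: s_def)
 \<comment> \<open>The factor 1 + 1 / (s - 1) is the price in HB_add with c = s - 1; what remains below eps is shared by g and k.\<close>
 define e where "e = (eps - s ^ 3 * N1 h) / (5 * (1 + 1 / (s - 1)))"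
 have e: "0 < e" using s by (simp add: e_def add_pos_pos)
 obtain G where G: "relopen G" "small e G" "continuous_on (M - G) h'" using qcE[OF h'(1) e] by blast
 obtain G1 g where G1: "relopen G1" "G \<subseteq> G1" and g: "HB g" "!!x. x \<in> M ==> 0 <= g x" "AE x in \<mu>. x \<in> G1 --> 1 <= g x" "N1 g < e"
  using G(2) by (rule smallE) (rule that)
 have "small e N" using N e unfolding polar_def small_0 by blast
 then obtain G2 k where G2: "relopen G2" "N \<subseteq> G2" and k: "HB k" "!!x. x \<in> M ==> 0 <= k x" "AE x in \<mu>. x \<in> G2 --> 1 <= k x" "N1 k < e"
  by (rule smallE) (rule that)
 have "continuous_on (M - G1) h'" by (rule continuous_on_subset[OF G(3)]) (use G1 in auto)
 hence "openin (top_of_set (M - G1)) ((M - G1) \<inter> h' -` {1 / s<..})" by (rule continuous_openin_preimage_gen) auto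
 hence o: "relopen (G1 \<union> ((M - G1) \<inter> h' -` {1 / s<..}))" by (rule openin_Un_relative[OF G1(1)])
 let ?O = "(G1 \<union> ((M - G1) \<inter> h' -` {1 / s<..})) \<union> G2"
 have o: "relopen ?O" by (rule openin_Un[OF o G2(1)])
 have s1: "1 / s < 1" using s by simp
 have sub: "A \<subseteq> ?O" using A G2 s1 by fastforce
 have habs: "HB (%x. \<bar>h x\<bar>)" "N1 (%x. \<bar>h x\<bar>) <= N1 h" by (rule HB_abs[OF h(1)])+
 have sh: "HB (%x. s * \<bar>h x\<bar>)" "N1 (%x. s * \<bar>h x\<bar>) <= s^2 * N1 h"
 proof -
  show "HB (%x. s * \<bar>h x\<bar>)" by (rule HB_cmult(1)[OF habs(1)])
  have "N1 (%x. s * \<bar>h x\<bar>) <= s^2 * N1 (%x. \<bar>h x\<bar>)" by (rule HB_cmult(2)[OF habs(1)])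
  also have "... <= s^2 * N1 h" by (rule mult_left_mono[OF habs(2)]) simp
  finally show "N1 (%x. s * \<bar>h x\<bar>) <= s^2 * N1 h" .
 qed
 have gk: "HB (%x. g x + k x)" "N1 (%x. g x + k x) < 4 * e" using HB_add2[OF g(1) k(1)] g(4) k(4) by linarith+
 show ?thesis
 proof (rule smallI[OF o sub])
  have s0: "0 < s - 1" using s by simp
  show "HB (%x. s * \<bar>h x\<bar> + (g x + k x))" by (rule HB_add(1)[OF sh(1) gk(1) s0])
  have "N1 (%x. s * \<bar>h x\<bar> + (g x + k x)) <= (1 + (s - 1)) * N1 (%x. s * \<bar>h x\<bar>) + (1 + 1 / (s - 1)) * N1 (%x. g x + k x)"
   by (rule HB_add(2)[OF sh(1) gk(1) s0])
  also have "... <= (1 + (s - 1)) * (s^2 * N1 h) + (1 + 1 / (s - 1)) * (4 * e)"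
   using s s0 sh(2) gk(2) by (intro add_mono mult_left_mono) auto
  also have "(1 + (s - 1)) * (s^2 * N1 h) = s ^ 3 * N1 h" by (simp add: power3_eq_cube power2_eq_square)
  also have "s ^ 3 * N1 h + (1 + 1 / (s - 1)) * (4 * e) < eps"
  proof -
   have p: "0 < 1 + 1 / (s - 1)" using s0 by (simp add: add_pos_pos)
   have "(1 + 1 / (s - 1)) * (5 * e) = eps - s ^ 3 * N1 h" 
   proof -
    have "K * (5 * (X / (5 * K))) = X" if "0 < K" for K X :: real using that by simp
    from this[OF p] show ?thesis unfolding e_def .
   qed
   moreover have "(1 + 1 / (s - 1)) * (4 * e) < (1 + 1 / (s - 1)) * (5 * e)" using p e by (intro mult_strict_left_mono) auto
   ultimately show ?thesis by linarith
  qed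
  finally show "N1 (%x. s * \<bar>h x\<bar> + (g x + k x)) < eps" .
  show "AE x in \<mu>. x \<in> ?O --> 1 <= s * \<bar>h x\<bar> + (g x + k x)"
   using g(3) k(3) h'(2) AE_space
  proof eventually_elim
   fix x assume *: "x \<in> G1 --> 1 <= g x" "x \<in> G2 --> 1 <= k x" "h' x = h x" "x \<in> space \<mu>"
   hence nn: "0 <= g x" "0 <= k x" using g k by auto
   have sn: "0 <= s * \<bar>h x\<bar>" using s by simp
   show "x \<in> ?O --> 1 <= s * \<bar>h x\<bar> + (g x + k x)"
   proof
    assume "x \<in> ?O"
    then consider "x \<in> G1" | "1 / s < h' x" | "x \<in> G2" by auto
    thus "1 <= s * \<bar>h x\<bar> + (g x + k x)"
    proof cases
     case 2
     hence "1 < s * h x" using s *(3) by (simp add: field_simps)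
     moreover have "s * h x <= s * \<bar>h x\<bar>" using s by simp
     ultimately show ?thesis using nn by linarith
    qed (use * nn sn in linarith)+
   qed
  qed
 qed
qed
end

section \<open>Borel sets are capacitable\<close>

text \<open>The density of continuous functions in the weak form that is proved for the domain: bounded N1 and convergence
in L2 M. Convex combinations upgrade it to strong convergence.\<close>

locale regular_process = reflected_process +
 assumes continuous_dense:
  "!!f. HB f ==> (!!x. x \<in> M ==> 0 <= f x & f x <= 1) ==>
   \<exists>(u :: nat => 'a => real) C. (\<forall>n. HB (u n) & continuous_on M (u n) & unit_val (u n) & N1 (u n) <= C) &
    (%n. \<integral>x. (u n x - f x)^2 \<partial>nleb M) \<longlonglongrightarrow> 0"

context reflected_process begin

lemma L2_mid:
 assumes "bdd u" "bdd v" "bdd f"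
 shows "(\<integral>x. ((u x + v x) / 2 - f x)^2) <= ((\<integral>x. (u x - f x)^2) + (\<integral>x. (v x - f x)^2)) / 2"
proof -
 have I: "integrable \<mu> (%x. (u x - f x)^2)" "integrable \<mu> (%x. (v x - f x)^2)"
  by (intro bdd_integrable bdd_power2 bdd_diff assms)+
 have "bdd (%x. (1/2) * (u x + v x) - f x)" by (intro bdd_diff bdd_mult bdd_add assms bdd_const)
 hence J: "integrable \<mu> (%x. ((u x + v x) / 2 - f x)^2)" using bdd_integrable[OF bdd_power2] by simp
 have pt: "((a + b) / 2 - c)^2 <= ((a - c)^2 + (b - c)^2) / 2" for a b c :: real
 proof -
  have "0 <= (a - b)^2" by simp
  thus ?thesis by (simp add: power2_eq_square field_simps)
 qed
 have "(\<integral>x. ((u x + v x) / 2 - f x)^2) <= (\<integral>x. ((u x - f x)^2 + (v x - f x)^2) / 2)"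
  by (rule integral_mono[OF J]) (use I pt in auto)
 also have "... = ((\<integral>x. (u x - f x)^2) + (\<integral>x. (v x - f x)^2)) / 2"
  using I by simp
 finally show ?thesis .
qed

lemma L2_zero_AE:
 assumes "bdd u" "bdd f" "!!e. 0 < e ==> (\<integral>x. (u x - f x)^2) <= e"
 shows "AE x in \<mu>. u x = f x"
proof -
 have i: "integrable \<mu> (%x. (u x - f x)^2)" by (intro bdd_integrable bdd_power2 bdd_diff assms)
 have "(\<integral>x. (u x - f x)^2) <= 0" by (rule field_le_epsilon) (use assms(3) in simp)
 hence "(\<integral>x. (u x - f x)^2) = 0" by (intro antisym) simp_all
 hence "AE x in \<mu>. (u x - f x)^2 = 0" using integral_nonneg_eq_0_iff_AE[OF i] by simp
 thus ?thesis by eventually_elim simp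
qed

lemma qc_mid: "qc u ==> qc v ==> qc (%x. (u x + v x) / 2)"
proof -
 assume u: "qc u" and v: "qc v"
 show ?thesis
 proof (rule qc_comp2[OF u v])
  fix S assume "continuous_on S u" "continuous_on S v"
  thus "continuous_on S (%x. (u x + v x) / 2)" by (intro continuous_on_divide continuous_on_add continuous_on_const) auto
 qed
qed

text \<open>Midpoints inherit quasi-continuity, the bounds and the vanishing on Z, and they stay close to f in L2 M. So
the strongly convergent combinations of hull_cauchy have a quasi-continuous limit with the same properties.\<close>

lemma qc_hull_limit:
 assumes u: "!!n::nat. HB (u n)" "!!n. qc (u n)" "!!n x. x \<in> M ==> 0 <= u n x & u n x <= 1" "!!n. N1 (u n) <= C"
  and f: "bdd f" and lim: "(%n. \<integral>x. (u n x - f x)^2 \<partial>\<mu>) \<longlonglongrightarrow> 0"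
  and Z: "!!n. \<exists>N. polar N & (\<forall>x\<in>Z - N. u n x = 0)"
 shows "\<exists>v N. qc v & HB v & (AE x in \<mu>. v x = f x) & unit_val v & polar N & (\<forall>x\<in>(Z \<inter> M) - N. v x = 0)"
proof -
 obtain w where w: "!!n. w n \<in> midhull (u ` {n..})" "!!n. HB (w n)" "!!n. N1 (w n) <= C" "!!n. N1 (%x. w n x - w (Suc n) x) <= (1/64)^n"
  by (rule hull_cauchy[OF u(1,4)]) (rule that)
 have wp: "qc (w n) & unit_val (w n) & (\<exists>N. polar N & (\<forall>x\<in>Z - N. w n x = 0))" for n
  using w(1)[of n]
 proof induction
  case (midhull_base g)
  thus ?case using u Z by auto
 next
  case (midhull_mid g h)
  then obtain N N' where "polar N" "polar N'" "\<forall>x\<in>Z - N. g x = 0" "\<forall>x\<in>Z - N'. h x = 0" by (elim conjE exE)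
  hence "polar (N \<union> N') & (\<forall>x\<in>Z - (N \<union> N'). (g x + h x) / 2 = 0)" using polar_Un by auto
  moreover have "qc (%x. (g x + h x) / 2)" by (rule qc_mid) (use midhull_mid.IH in simp_all)
  moreover have "0 <= (g x + h x) / 2 & (g x + h x) / 2 <= 1" if "x \<in> M" for x
  proof -
   have "0 <= g x" "g x <= 1" "0 <= h x" "h x <= 1" using midhull_mid.IH that by auto
   thus ?thesis by (simp add: field_simps)
  qed
  ultimately show ?case by (intro conjI ballI exI[of _ "N \<union> N'"]) simp_all
 qed
 have wb: "\<bar>w n x\<bar> <= 1" if "x \<in> M" for n x
 proof -
  have "0 <= w n x" "w n x <= 1" using wp that by blast+
  thus ?thesis by simp
 qed
 obtain v N where v: "polar N" "!!x. x \<in> M - N ==> (%n. w n x) \<longlonglongrightarrow> v x" "!!x. x \<in> N ==> v x = 0" "HB v" "qc v"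
  "!!n. N1 (%x. w n x - v x) <= 4 * (1/64)^n"
  by (rule qc_limit[OF w(2) conjunct1[OF wp] wb w(4)], assumption) (rule that)
 have w_f: "(\<integral>x. (w n x - f x)^2) <= e" if e: "!!k. n <= k ==> (\<integral>x. (u k x - f x)^2) <= e" for n e
 proof -
  have "bdd (w n) & (\<integral>x. (w n x - f x)^2) <= e"
   using w(1)[of n]
  proof induction
   case (midhull_base g)
   thus ?case using e HB_bdd[OF u(1)] by auto
  next
   case (midhull_mid g h)
   hence b: "bdd g" "bdd h" and le: "(\<integral>x. (g x - f x)^2) <= e" "(\<integral>x. (h x - f x)^2) <= e" by auto
   have "bdd (%x. (1/2) * (g x + h x))" by (intro bdd_mult bdd_add b bdd_const)
   moreover have "((\<integral>x. (g x - f x)^2) + (\<integral>x. (h x - f x)^2)) / 2 <= (e + e) / 2"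
    by (intro divide_right_mono add_mono le) simp
   ultimately show ?case using L2_mid[OF b f] by simp
  qed
  thus ?thesis ..
 qed
 have "AE x in \<mu>. v x = f x"
 proof (rule L2_zero_AE[OF HB_bdd[OF v(4)] f])
  fix e :: real assume e: "0 < e"
  have "\<forall>\<^sub>F n in sequentially. (\<integral>x. (u n x - f x)^2) < e / 4" by (rule order_tendstoD(2)[OF lim]) (use e in simp)
  then obtain n1 where n1: "!!n. n1 <= n ==> (\<integral>x. (u n x - f x)^2) < e / 4" unfolding eventually_sequentially by blast
  obtain n2 where "(1/64::real)^n2 < e / 16" using real_arch_pow_inv[of "e / 16" "1/64"] e by auto
  define n where "n = max n1 n2"
  have "(1/64::real)^n <= (1/64)^n2" by (rule power_decreasing) (auto simp: n_def)
  hence N1n: "N1 (%x. w n x - v x) <= e / 4" using v(6)[of n] \<open>(1/64::real)^n2 < e / 16\<close> by linarith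
  have "(\<integral>x. (w n x - v x)^2) <= N1 (%x. w n x - v x)" by (rule integral_square_le_N1[OF HB_diff2(1)[OF w(2) v(4)]])
  with N1n have 1: "(\<integral>x. (w n x - v x)^2) <= e / 4" by (rule order_trans[rotated])
  have 2: "(\<integral>x. (w n x - f x)^2) <= e / 4"
   by (rule w_f) (use n1 in "auto simp: n_def less_imp_le")
  have I: "integrable \<mu> (%x. (w n x - v x)^2)" "integrable \<mu> (%x. (w n x - f x)^2)" "integrable \<mu> (%x. (v x - f x)^2)"
   by (intro bdd_integrable bdd_power2 bdd_diff HB_bdd w v f)+
  have pt: "(b - c)^2 <= 2 * (a - b)^2 + 2 * (a - c)^2" for a b c :: real
  proof -
   have "0 <= (2 * a - b - c)^2" by simp
   thus ?thesis by (simp add: power2_eq_square algebra_simps)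
  qed
  have "(\<integral>x. (v x - f x)^2) <= (\<integral>x. 2 * (w n x - v x)^2 + 2 * (w n x - f x)^2)"
   by (rule integral_mono[OF I(3)]) (use I pt in auto)
  also have "... = 2 * (\<integral>x. (w n x - v x)^2) + 2 * (\<integral>x. (w n x - f x)^2)"
   using I by simp
  also have "... <= 2 * (e / 4) + 2 * (e / 4)" by (intro add_mono mult_left_mono 1 2) auto
  finally show "(\<integral>x. (v x - f x)^2) <= e" by simp
 qed
 moreover have "0 <= v x & v x <= 1" if x: "x \<in> M" for x
 proof (cases "x \<in> N")
  case False
  hence l: "(%n. w n x) \<longlonglongrightarrow> v x" using v(2) x by simp
  show ?thesis
   using LIMSEQ_le_const[OF l, of 0] LIMSEQ_le_const2[OF l, of 1] wp x by blast
 qed (simp add: v(3))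
 moreover obtain N' where "polar N' & (\<forall>x\<in>(Z \<inter> M) - N'. v x = 0)"
 proof -
  have "\<forall>n. \<exists>N. polar N & (\<forall>x\<in>Z - N. w n x = 0)" using wp by blast
  from choice[OF this] obtain R where R: "\<forall>n. polar (R n) & (\<forall>x\<in>Z - R n. w n x = 0)" ..
  have "polar (N \<union> (\<Union>n. R n))" by (intro polar_Un v(1) polar_UN) (use R in blast)
  moreover have "v x = 0" if x: "x \<in> Z \<inter> M" "x \<notin> N \<union> (\<Union>n. R n)" for x
  proof -
   have "(%n. w n x) \<longlonglongrightarrow> v x" using v(2)[of x] x by simp
   moreover have "w n x = 0" for n using R x by blast
   ultimately show ?thesis by (simp add: LIMSEQ_const_iff)
  qed
  ultimately have "polar (N \<union> (\<Union>n. R n)) & (\<forall>x\<in>(Z \<inter> M) - (N \<union> (\<Union>n. R n)). v x = 0)" by simp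
  thus thesis by (rule that)
 qed
 ultimately show ?thesis using v(4,5) by (intro exI[of _ v] exI[of _ N']) simp
qed

end

context regular_process begin

lemma qc_version:
 assumes f: "HB f" "!!x. x \<in> M ==> 0 <= f x & f x <= 1"
 shows "\<exists>v. qc v & HB v & (AE x in \<mu>. v x = f x) & unit_val v"
proof -
 from continuous_dense[OF f] obtain u C where u: "\<forall>n::nat. HB (u n) & continuous_on M (u n) & unit_val (u n) & N1 (u n) <= C"
  and lim: "(%n. \<integral>x. (u n x - f x)^2 \<partial>\<mu>) \<longlonglongrightarrow> 0" by blast
 have "polar {}" by (simp add: polar_def small_0 small_empty)
 hence Z: "\<exists>N. polar N & (\<forall>x\<in>{} - N. u n x = 0)" for n by blast
 have "\<exists>v N. qc v & HB v & (AE x in \<mu>. v x = f x) & unit_val v & polar N & (\<forall>x\<in>({} \<inter> M) - N. v x = 0)"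
  by (rule qc_hull_limit[where C = C, OF _ _ _ _ HB_bdd[OF f(1)] lim Z]) (use u qc_continuous in simp_all)
 thus ?thesis by (elim exE conjE) (rule exI, intro conjI)
qed

text \<open>A test function that is at least 1 almost everywhere on an open set has a quasi-continuous version that is at
least 1 there quasi-everywhere, by qc_le. This passes to limits, the almost everywhere statement on varying
open sets does not.\<close>

lemma qc_of_small:
 assumes "small eps A"
 shows "\<exists>h N. HB h & N1 h < eps & unit_val h & qc h & polar N & (\<forall>x\<in>A - N. 1 <= h x)"
proof -
 obtain G h where G: "relopen G" "A \<subseteq> G" and h: "HB h" "unit_val h" "AE x in \<mu>. x \<in> G --> 1 <= h x" "N1 h < eps"
  using assms unfolding small_def by blast
 obtain v where v: "qc v" "HB v" "AE x in \<mu>. v x = h x" "unit_val v"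
  using qc_version[OF h(1)] h(2) by blast
 have "AE x in \<mu>. h x = v x" using v(3) by eventually_elim simp
 from HB_AE(2)[OF h(1) HB_bdd[OF v(2)] this] have N: "N1 v < eps" using h(4) by simp
 have "AE x in \<mu>. x \<in> G --> 1 <= v x" using h(3) v(3) by eventually_elim simp
 from qc_le[OF qc_continuous[OF continuous_on_const] v(1) G(1) this]
 have "polar {x \<in> G. v x < 1}" .
 moreover have "\<forall>x\<in>A - {x \<in> G. v x < 1}. 1 <= v x" using G(2) by auto
 ultimately show ?thesis using v N by blast
qed

text \<open>Hulls of the tails of the test functions for S n still are at least 1 quasi-everywhere on S n, since S
increases. Their limit is at least 1 quasi-everywhere on the union and has N1 at most eps.\<close>

lemma small_up:
 assumes inc: "incseq S" and S: "!!n::nat. S n \<subseteq> M" "!!n. small eps (S n)" and "eps < delta"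
 shows "small delta (\<Union>n. S n)"
proof -
 have "\<forall>n. \<exists>h N. HB h & N1 h < eps & unit_val h & qc h & polar N & (\<forall>x\<in>S n - N. 1 <= h x)"
  by (intro allI qc_of_small[OF S(2)])
 from choice[OF this] obtain u where "\<forall>n. \<exists>N. HB (u n) & N1 (u n) < eps & unit_val (u n) & qc (u n) & polar N & (\<forall>x\<in>S n - N. 1 <= u n x)" ..
 hence u: "!!n. HB (u n)" "!!n. N1 (u n) <= eps" "!!n x. x \<in> M ==> 0 <= u n x & u n x <= 1" "!!n. qc (u n)"
  "!!n. \<exists>N. polar N & (\<forall>x\<in>S n - N. 1 <= u n x)" by (auto intro: less_imp_le)
 obtain w where w: "!!n. w n \<in> midhull (u ` {n..})" "!!n. HB (w n)" "!!n. N1 (w n) <= eps" "!!n. N1 (%x. w n x - w (Suc n) x) <= (1/64)^n"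
  by (rule hull_cauchy[OF u(1,2)]) (rule that)
 have wp: "qc (w n) & unit_val (w n) & (\<exists>N. polar N & (\<forall>x\<in>S n - N. 1 <= w n x))" for n
  using w(1)[of n]
 proof induction
  case (midhull_base g)
  then obtain k where k: "n <= k" "g = u k" by auto
  obtain N where "polar N" "\<forall>x\<in>S k - N. 1 <= u k x" using u(5) by blast
  moreover have "S n \<subseteq> S k" by (rule incseqD[OF inc k(1)])
  ultimately show ?case using u k by blast
 next
  case (midhull_mid g h)
  then obtain N N' where N: "polar N" "polar N'" "\<forall>x\<in>S n - N. 1 <= g x" "\<forall>x\<in>S n - N'. 1 <= h x" by (elim conjE exE)
  have "polar (N \<union> N')" by (rule polar_Un[OF N(1,2)])
  moreover have "1 <= (g x + h x) / 2" if "x \<in> S n - (N \<union> N')" for x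
  proof -
   have "1 <= g x" "1 <= h x" using N(3,4) that by auto
   thus ?thesis by (simp add: field_simps)
  qed
  moreover have "qc (%x. (g x + h x) / 2)" by (rule qc_mid) (use midhull_mid.IH in simp_all)
  moreover have "0 <= (g x + h x) / 2 & (g x + h x) / 2 <= 1" if "x \<in> M" for x
  proof -
   have "0 <= g x" "g x <= 1" "0 <= h x" "h x <= 1" using midhull_mid.IH that by auto
   thus ?thesis by (simp add: field_simps)
  qed
  ultimately show ?case by (intro conjI ballI exI[of _ "N \<union> N'"]) simp_all
 qed
 have b: "\<bar>w n x\<bar> <= 1" if "x \<in> M" for n x
 proof -
  have "0 <= w n x" "w n x <= 1" using wp that by blast+
  thus ?thesis by simp
 qed
 obtain v N where v: "polar N" "!!x. x \<in> M - N ==> (%n. w n x) \<longlonglongrightarrow> v x" "!!x. x \<in> N ==> v x = 0" "HB v" "qc v"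
  "!!n. N1 (%x. w n x - v x) <= 4 * (1/64)^n"
  by (rule qc_limit[OF w(2) conjunct1[OF wp] b w(4)], assumption) (rule that)
 have AEl: "AE x in \<mu>. (%n. w n x) \<longlonglongrightarrow> v x"
  using polar_AE[OF v(1)] AE_space by eventually_elim (rule v(2), simp)
 have N1v: "N1 v <= eps" by (rule HB_lsc(2)[OF w(2) b AEl HB_bdd[OF v(4)] w(3)])
 have "\<forall>n. \<exists>N. polar N & (\<forall>x\<in>S n - N. 1 <= w n x)" using wp by blast
 from choice[OF this] obtain R where R: "\<forall>n. polar (R n) & (\<forall>x\<in>S n - R n. 1 <= w n x)" ..
 have polar: "polar (N \<union> (\<Union>n. R n))" by (intro polar_Un v(1) polar_UN) (use R in blast)
 show ?thesis
 proof (rule small_of_qc[OF v(4) _ v(5) _ polar])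
  show "N1 v < delta" using N1v assms(4) by simp
  show "AE x in \<mu>. v x = v x" by simp
  show "(\<Union>n. S n) \<subseteq> M" using S(1) by blast
  fix x assume x: "x \<in> (\<Union>n. S n) - (N \<union> (\<Union>n. R n))"
  then obtain n where n: "x \<in> S n" by blast
  have "1 <= w m x" if "n <= m" for m using R x n incseqD[OF inc that] by blast
  moreover have "(%n. w n x) \<longlonglongrightarrow> v x" using v(2)[of x] x S(1) by blast
  ultimately show "1 <= v x" by (intro LIMSEQ_le_const) auto
 qed
qed

lemma capacity_up:
 assumes inc: "incseq S" and S: "!!n::nat. S n \<subseteq> M & capacity M (S n) <= a"
 shows "capacity M (\<Union>n. S n) <= a"
proof (rule ennreal_le_epsilon)
 fix e :: real assume a: "a < top_class.top" and e: "0 < e"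
 obtain r where r: "a = ennreal r" "0 <= r" using a by (cases a) auto
 have "small (r + e / 2) (S n)" for n
  unfolding small_iff using S[of n] r e by (auto simp: ennreal_less_iff intro: order_le_less_trans)
 hence "small (r + e) (\<Union>n. S n)" by (rule small_up[OF inc conjunct1[OF S]]) (use e in simp)
 thus "capacity M (\<Union>n. S n) <= a + ennreal e" using r e by (simp add: small_iff ennreal_plus less_imp_le)
qed

text \<open>An open set around the intersection contains some K n, by compactness.\<close>

lemma capacity_down:
 assumes dec: "decseq K" and K: "!!n::nat. compact (K n) & K n \<subseteq> M & a <= capacity M (K n)"
 shows "a <= capacity M (\<Inter>n. K n)"
 unfolding capacity_def[of M "\<Inter>n. K n"]
proof (rule INF_greatest)
 fix G assume "G \<in> {G. relopen G & (\<Inter>n. K n) \<subseteq> G}"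
 hence G: "relopen G" "(\<Inter>n. K n) \<subseteq> G" by auto
 obtain W where W: "open W" "G = M \<inter> W" using G(1) unfolding openin_open by blast
 have "\<exists>n. K n \<subseteq> W"
 proof (rule ccontr)
  assume no: "\<not> (\<exists>n. K n \<subseteq> W)"
  have "(\<Inter>n. K n - W) ~= {}"
  proof (rule compact_nest)
   show "compact (K n - W)" for n using K W(1) by (intro compact_diff) auto
   show "K n - W ~= {}" for n using no by blast
   show "K n - W \<subseteq> K m - W" if "m <= n" for m n using decseqD[OF dec that] by blast
  qed
  thus False using G(2) W(2) by blast
 qed
 then obtain n where "K n \<subseteq> G" using W K by blast
 have "a <= capacity M (K n)" using K by blast
 also have "... <= cap_open M G" unfolding capacity_def by (rule INF_lower) (use G \<open>K n \<subseteq> G\<close> in auto)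
 finally show "a <= cap_open M G" .
qed

lemma capacity_mono: "S \<subseteq> T ==> capacity M S <= capacity M T"
 unfolding capacity_def by (rule INF_superset_mono) auto

theorem borel_capacitable:
 assumes "A \<subseteq> M" "A \<in> sets borel" "0 < capacity M A"
 obtains K where "compact K" "K \<subseteq> A" "0 < capacity M K"
proof -
 obtain a where a: "0 < a" "a < capacity M A" using dense[OF assms(3)] by blast
 show ?thesis
 proof (rule choquet_capacitability[of M "capacity M" A a])
  show "capacity M S <= capacity M T" if "S \<subseteq> T" for S T by (rule capacity_mono[OF that])
  show "capacity M (\<Union>n. S n) <= b" if "incseq S" "!!n::nat. S n \<subseteq> M & capacity M (S n) <= b" for S b
   by (rule capacity_up[OF that])
  show "b <= capacity M (\<Inter>n. K n)" if "decseq K" "!!n::nat. compact (K n) & K n \<subseteq> M & b <= capacity M (K n)" for K b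
   by (rule capacity_down[OF that])
  show "compact M" "A \<subseteq> M" "suslin A" "a < capacity M A" using compact_M assms a suslin_borel by auto
  fix K assume "compact K" "K \<subseteq> A" "a <= capacity M K"
  thus ?thesis using that[of K] order_less_le_trans[OF a(1)] by blast
 qed
qed

end

section \<open>Paths avoiding a set\<close>

lemma all_le_Suc_split: "(\<forall>k\<le>Suc n. Q k) \<longleftrightarrow> Q 0 & (\<forall>k\<le>n. Q (Suc k))"
proof (intro iffI conjI allI impI)
 fix k assume *: "Q 0 & (\<forall>k\<le>n. Q (Suc k))" "k <= Suc n"
 thus "Q k" by (cases k) auto
qed auto

context reflected_process begin

lemma emeasure_P_measurable:
 assumes "E \<in> sets (path_space M)" shows "(%x. emeasure (P x) E) \<in> borel_measurable \<mu>"
 by (rule measurable_compose[OF measurable_prob_algebraD[OF P_kernel] measurable_emeasure_subprob_algebra[OF assms]])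

lemma bdd_measure_P:
 assumes "E \<in> sets (path_space M)" shows "bdd (%x. measure (P x) E)"
proof (rule bddI[of _ 1])
 show "(%x. measure (P x) E) \<in> borel_measurable \<mu>"
  unfolding measure_def by (rule borel_measurable_enn2real[OF emeasure_P_measurable[OF assms]])
 fix x assume "x \<in> M"
 then interpret prob_space "P x" by (rule prob_space_P)
 show "\<bar>measure (P x) E\<bar> <= 1" by simp
qed

definition avoid :: "real => 'a set => (real => 'a) set" where
 "avoid t S = {omega \<in> space (path_space M). \<forall>r\<in>{0..t}. omega r \<notin> S}"

definition surv :: "'a set => real => 'a => real" where
 "surv S t x = measure (P x) (avoid t S)"

definition avoid_grid :: "'a set => real => nat => (real => 'a) set" where
 "avoid_grid S h n = {omega \<in> space (path_space M). \<forall>k\<le>n. omega (h * real k) \<notin> S}"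

lemma avoid_grid_sets:
 assumes S: "S \<in> sets \<mu>" and h: "0 <= h" shows "avoid_grid S h n \<in> sets (path_space M)"
proof -
 have "avoid_grid S h n = (\<Inter>k\<in>{..n}. (%omega. omega (h * real k)) -` (M - S) \<inter> space (path_space M))"
  using h by (auto simp: avoid_grid_def space_path)
 also have "... \<in> sets (path_space M)"
 proof (rule sets.finite_INT)
  fix k
  have "M - S \<in> sets \<mu>" using sets.compl_sets[OF S] by simp
  thus "(%omega. omega (h * real k)) -` (M - S) \<inter> space (path_space M) \<in> sets (path_space M)"
   using measurable_sets[OF path_measurable[of "h * real k"] \<open>M - S \<in> sets \<mu>\<close>] h by simp
 qed auto
 finally show ?thesis .
qed

lemma avoid_grid_start: "avoid_grid S h n \<subseteq> {omega. omega 0 \<notin> S}"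
 unfolding avoid_grid_def by (auto dest: spec[of _ 0])

lemma start_in_S:
 assumes x: "x \<in> M" "x \<in> S" and E: "E \<in> sets (path_space M)" "E \<subseteq> {omega. omega 0 \<notin> S}"
 shows "emeasure (P x) E = 0"
proof -
 have "emeasure (P x) E = emeasure (P x) {}"
  by (rule emeasure_eq_AE) (use AE_start[OF x(1)] E x sets_P[OF x(1)] in "auto elim!: eventually_mono")
 thus ?thesis by simp
qed

text \<open>The Markov property after the first grid step.\<close>

lemma avoid_grid_rec:
 assumes S: "S \<in> sets \<mu>" and h: "0 <= h" and x: "x \<in> M"
 shows "emeasure (P x) (avoid_grid S h (Suc n)) = indicator (- S) x * (\<integral>\<^sup>+omega. emeasure (P (omega h)) (avoid_grid S h n) \<partial>P x)"
proof (cases "x \<in> S")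
 case True
 thus ?thesis
  using start_in_S[OF x True avoid_grid_sets[OF S h, of "Suc n"] avoid_grid_start] by simp
next
 case False
 let ?E = "{omega \<in> space (path_space M). path_shift h omega \<in> avoid_grid S h n}"
 have E: "?E \<in> sets (path_space M)"
  using measurable_sets[OF path_shift_measurable[OF h] avoid_grid_sets[OF S h, of n]] by (simp add: vimage_def Int_def conj_commute)
 have iff: "omega \<in> avoid_grid S h (Suc n) \<longleftrightarrow> omega \<in> ?E" if "omega 0 = x" for omega
 proof -
  have "(\<forall>k\<le>Suc n. omega (h * real k) \<notin> S) \<longleftrightarrow> omega 0 \<notin> S & (\<forall>k\<le>n. omega (h * real (Suc k)) \<notin> S)"
   by (subst all_le_Suc_split) simp
  moreover have "path_shift h omega \<in> space (path_space M)" if "omega \<in> space (path_space M)"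
   using measurable_space[OF path_shift_measurable[OF h] that] .
  ultimately show ?thesis
   using that False h unfolding avoid_grid_def by (auto simp: path_shift_def algebra_simps)
 qed
 have "emeasure (P x) (avoid_grid S h (Suc n)) = emeasure (P x) ?E"
  by (rule emeasure_eq_AE) (use AE_start[OF x] iff E avoid_grid_sets[OF S h] sets_P[OF x] in "auto elim!: eventually_mono")
 also have "... = (\<integral>\<^sup>+omega. emeasure (P (omega h)) (avoid_grid S h n) \<partial>P x)"
  by (rule simple_markov[OF h x avoid_grid_sets[OF S h]])
 finally show ?thesis using False by simp
qed

lemma symmetric: "symmetric_process M P" using rbm by (simp add: reflected_BM_def)

lemma symmetric_nn:
 fixes f g :: "'a => ennreal"
 assumes "0 <= h" "f \<in> borel_measurable \<mu>" "g \<in> borel_measurable \<mu>"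
 shows "(\<integral>\<^sup>+x. f x * (\<integral>\<^sup>+omega. g (omega h) \<partial>P x)) = (\<integral>\<^sup>+x. (\<integral>\<^sup>+omega. f (omega h) \<partial>P x) * g x)"
 using symmetric[unfolded symmetric_process_def, rule_format, OF assms] .

text \<open>Time reversal for the killed chain: one step at a time is moved from the left factor to the right one by the
symmetry of the process.\<close>

lemma avoid_grid_sym:
 assumes S: "S \<in> sets \<mu>" and h: "0 <= h"
 shows "(\<integral>\<^sup>+x. emeasure (P x) (avoid_grid S h i) * emeasure (P x) (avoid_grid S h j)) =
  (\<integral>\<^sup>+x. emeasure (P x) (avoid_grid S h (i + j)))"
proof -
 let ?d = "%n x. emeasure (P x) (avoid_grid S h n)"
 have dm: "?d n \<in> borel_measurable \<mu>" for n by (rule emeasure_P_measurable[OF avoid_grid_sets[OF S h]])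
 have d1: "indicator (- S) x * ?d n x = ?d n x" if "x \<in> M" for n x
  using start_in_S[OF that, of S "avoid_grid S h n"] avoid_grid_sets[OF S h, of n] avoid_grid_start
  by (cases "x \<in> S") simp_all
 have step: "(\<integral>\<^sup>+x. ?d (Suc i) x * ?d j x) = (\<integral>\<^sup>+x. ?d i x * ?d (Suc j) x)" for i j
 proof -
  have "(\<integral>\<^sup>+x. ?d (Suc i) x * ?d j x) = (\<integral>\<^sup>+x. (\<integral>\<^sup>+omega. ?d i (omega h) \<partial>P x) * (indicator (- S) x * ?d j x))"
   by (rule nn_integral_cong) (simp add: avoid_grid_rec[OF S h] mult_ac)
  also have "... = (\<integral>\<^sup>+x. (\<integral>\<^sup>+omega. ?d i (omega h) \<partial>P x) * ?d j x)"
   by (rule nn_integral_cong) (simp add: d1)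
  also have "... = (\<integral>\<^sup>+x. ?d i x * (\<integral>\<^sup>+omega. ?d j (omega h) \<partial>P x))"
   by (rule symmetric_nn[OF h dm dm, symmetric])
  also have "... = (\<integral>\<^sup>+x. indicator (- S) x * ?d i x * (\<integral>\<^sup>+omega. ?d j (omega h) \<partial>P x))"
   by (rule nn_integral_cong) (simp add: d1)
  also have "... = (\<integral>\<^sup>+x. ?d i x * ?d (Suc j) x)"
   by (rule nn_integral_cong) (simp add: avoid_grid_rec[OF S h] mult_ac)
  finally show ?thesis .
 qed
 have "(\<integral>\<^sup>+x. ?d i x * ?d j x) = (\<integral>\<^sup>+x. ?d 0 x * ?d (i + j) x)"
 proof (induction i arbitrary: j)
  case (Suc i)
  thus ?case using step[of i j] by simp
 qed simp
 also have "... = (\<integral>\<^sup>+x. ?d (i + j) x)"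
 proof (rule nn_integral_cong)
  fix x assume "x \<in> space \<mu>"
  hence x: "x \<in> M" by simp
  interpret prob_space "P x" by (rule prob_space_P[OF x])
  show "?d 0 x * ?d (i + j) x = ?d (i + j) x"
  proof (cases "x \<in> S")
   case True
   thus ?thesis using d1[OF x, of "i + j"] by (metis ComplD indicator_simps(2) mult_zero_left mult_zero_right)
  next
   case False
   have "emeasure (P x) (avoid_grid S h 0) = emeasure (P x) (space (P x))"
    by (rule emeasure_eq_AE) (use AE_start[OF x] AE_space False avoid_grid_sets[OF S h, of 0] sets_P[OF x] space_P[OF x] in "auto simp: avoid_grid_def elim!: eventually_elim2")
   thus ?thesis by (simp add: emeasure_space_1)
  qed
 qed
 finally show ?thesis .
qed

lemma measure_P_product:
 assumes "E \<in> sets (path_space M)" "F \<in> sets (path_space M)"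
 shows "(\<integral>\<^sup>+x. emeasure (P x) E * emeasure (P x) F) = ennreal (\<integral>x. measure (P x) E * measure (P x) F)"
proof -
 have "(\<integral>\<^sup>+x. emeasure (P x) E * emeasure (P x) F) = (\<integral>\<^sup>+x. ennreal (measure (P x) E * measure (P x) F))"
 proof (rule nn_integral_cong)
  fix x assume "x \<in> space \<mu>"
  then interpret prob_space "P x" by (intro prob_space_P) simp
  show "emeasure (P x) E * emeasure (P x) F = ennreal (measure (P x) E * measure (P x) F)"
   by (simp add: emeasure_eq_measure ennreal_mult)
 qed
 also have "... = ennreal (\<integral>x. measure (P x) E * measure (P x) F)"
  by (rule nn_integral_eq_integral[OF bdd_integrable[OF bdd_mult[OF bdd_measure_P bdd_measure_P]]]) (use assms in auto)
 finally show ?thesis .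
qed

lemma measure_P_single:
 assumes "E \<in> sets (path_space M)"
 shows "(\<integral>\<^sup>+x. emeasure (P x) E) = ennreal (\<integral>x. measure (P x) E)"
proof -
 have "(\<integral>\<^sup>+x. emeasure (P x) E) = (\<integral>\<^sup>+x. ennreal (measure (P x) E))"
 proof (rule nn_integral_cong)
  fix x assume "x \<in> space \<mu>"
  then interpret prob_space "P x" by (intro prob_space_P) simp
  show "emeasure (P x) E = ennreal (measure (P x) E)" by (simp add: emeasure_eq_measure)
 qed
 also have "... = ennreal (\<integral>x. measure (P x) E)"
  by (rule nn_integral_eq_integral[OF bdd_integrable[OF bdd_measure_P]]) (use assms in auto)
 finally show ?thesis .
qed

lemma avoid_grid_sym_real:
 assumes S: "S \<in> sets \<mu>" and h: "0 <= h"
 shows "(\<integral>x. measure (P x) (avoid_grid S h i) * measure (P x) (avoid_grid S h j)) =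
  (\<integral>x. measure (P x) (avoid_grid S h (i + j)))"
proof -
 note s = avoid_grid_sets[OF S h]
 have "ennreal (\<integral>x. measure (P x) (avoid_grid S h i) * measure (P x) (avoid_grid S h j)) =
   ennreal (\<integral>x. measure (P x) (avoid_grid S h (i + j)))"
  using avoid_grid_sym[OF S h, of i j] unfolding measure_P_product[OF s s] measure_P_single[OF s] .
 thus ?thesis by (subst (asm) ennreal_inj) auto
qed

text \<open>The avoidance events are measurable and the survival probabilities satisfy (surv S s, surv S t) = mass S (s +
t) at commensurable times, as the killed semigroup would. The second part follows from discrete time by
limits; commensurable times are all that is used.\<close>

definition reversible :: "'a set => bool" where
 "reversible S \<longleftrightarrow> (\<forall>t\<ge>0. avoid t S \<in> sets (path_space M)) &
  (\<forall>delta>0. \<forall>i j. (\<integral>x. surv S (real i * delta) x * surv S (real j * delta) x) = (\<integral>x. surv S (real (i + j) * delta) x))"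

lemma surv_bounds: "x \<in> M ==> 0 <= surv S t x & surv S t x <= 1"
 unfolding surv_def using prob_space.prob_le_1[OF prob_space_P] by simp

lemma surv_abs_le: "x \<in> M ==> \<bar>surv S t x\<bar> <= 1"
 using surv_bounds[of x S t] by simp

lemma integral_limit:
 fixes f :: "nat => 'a => real"
 assumes "!!n. bdd (f n)" "bdd g" "!!n x. x \<in> M ==> \<bar>f n x\<bar> <= B" "!!x. x \<in> M ==> (%n. f n x) \<longlonglongrightarrow> g x"
 shows "(%n. \<integral>x. f n x \<partial>\<mu>) \<longlonglongrightarrow> (\<integral>x. g x)"
proof (rule integral_dominated_convergence[where w = "%_. B"])
 show "g \<in> borel_measurable \<mu>" "f n \<in> borel_measurable \<mu>" for n by (intro bdd_meas assms)+
 show "AE x in \<mu>. (%n. f n x) \<longlonglongrightarrow> g x" by (rule AE_I2) (use assms(4) in simp)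
 show "AE x in \<mu>. norm (f n x) <= B" for n by (rule AE_I2) (use assms(3) in simp)
qed simp

lemma reversible_of_limit:
 assumes sets: "!!t. 0 <= t ==> avoid t S \<in> sets (path_space M)"
  and f: "!!delta n i. 0 < delta ==> bdd (f delta n i)" "!!delta n i x. 0 < delta ==> x \<in> M ==> \<bar>f delta n i x\<bar> <= 1"
  and lim: "!!delta i x. 0 < delta ==> x \<in> M ==> (%n. f delta n i x) \<longlonglongrightarrow> surv S (real i * delta) x"
  and sym: "!!delta n i j. 0 < delta ==> (\<integral>x. f delta n i x * f delta n j x) = (\<integral>x. f delta n (i + j) x)"
 shows "reversible S"
 unfolding reversible_def
proof (intro conjI allI impI)
 fix delta :: real and i j :: nat assume d: "0 < delta"
 have b: "bdd (surv S (real i * delta))" for i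
  unfolding surv_def by (intro bdd_measure_P sets) (use d in simp)
 have "(%n. \<integral>x. f delta n i x * f delta n j x \<partial>\<mu>) \<longlonglongrightarrow> (\<integral>x. surv S (real i * delta) x * surv S (real j * delta) x)"
 proof (rule integral_limit[where B = 1])
  fix n x assume "x \<in> M"
  hence "\<bar>f delta n i x\<bar> * \<bar>f delta n j x\<bar> <= 1 * 1" by (intro mult_mono f d) auto
  thus "\<bar>f delta n i x * f delta n j x\<bar> <= 1" by (simp add: abs_mult)
 qed (use f lim d b in "auto intro!: bdd_mult tendsto_mult")
 moreover have "(%n. \<integral>x. f delta n (i + j) x \<partial>\<mu>) \<longlonglongrightarrow> (\<integral>x. surv S (real (i + j) * delta) x)"
  by (rule integral_limit[where B = 1]) (use f lim d b in "simp_all del: of_nat_add")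
 ultimately show "(\<integral>x. surv S (real i * delta) x * surv S (real j * delta) x) = (\<integral>x. surv S (real (i + j) * delta) x)"
  unfolding sym[OF d] by (rule LIMSEQ_unique)
qed (rule sets)

lemma reversible_sets: "reversible S ==> 0 <= t ==> avoid t S \<in> sets (path_space M)"
 by (simp add: reversible_def)

lemma reversible_sym: "reversible S ==> 0 < delta ==> (\<integral>x. surv S (real i * delta) x * surv S (real j * delta) x) = (\<integral>x. surv S (real (i + j) * delta) x)"
 unfolding reversible_def by blast

lemma surv_bdd: "reversible S ==> 0 <= t ==> bdd (surv S t)"
 unfolding surv_def by (intro bdd_measure_P reversible_sets)

text \<open>A continuous path that enters a relatively open set stays there for a while, so that it is seen there at some
dyadic time.\<close>

lemma avoid_grid_limit:
 assumes G: "relopen G" and d: "0 < delta"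
 shows "avoid (real i * delta) G = (\<Inter>l. avoid_grid G (delta / 2 ^ l) (i * 2 ^ l))"
proof (intro equalityI subsetI)
 fix omega assume w: "omega \<in> avoid (real i * delta) G"
 have "omega (delta / 2 ^ l * real k) \<notin> G" if "k <= i * 2 ^ l" for k l
 proof -
  have "real k <= real (i * 2 ^ l)" using that by (simp only: of_nat_le_iff)
  hence "real k <= real i * 2 ^ l" by simp
  hence "delta / 2 ^ l * real k <= delta / 2 ^ l * (real i * 2 ^ l)" using d by (intro mult_left_mono) auto
  also have "... = real i * delta" by simp
  finally show ?thesis using w d by (auto simp: avoid_def)
 qed
 thus "omega \<in> (\<Inter>l. avoid_grid G (delta / 2 ^ l) (i * 2 ^ l))" using w by (auto simp: avoid_def avoid_grid_def)
next
 fix omega assume w: "omega \<in> (\<Inter>l. avoid_grid G (delta / 2 ^ l) (i * 2 ^ l))"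
 hence sp: "omega \<in> space (path_space M)" and g: "!!l k. k <= i * 2 ^ l ==> omega (delta / 2 ^ l * real k) \<notin> G"
  by (auto simp: avoid_grid_def)
 obtain W where W: "open W" "G = M \<inter> W" using G unfolding openin_open by blast
 have "omega r \<notin> G" if r: "r \<in> {0..real i * delta}" for r
 proof
  assume "omega r \<in> G"
  \<comment> \<open>The last grid point of level l not after r.\<close>
  define k where "k l = nat \<lfloor>r / delta * 2 ^ l\<rfloor>" for l :: nat
  define q where "q l = delta / 2 ^ l * real (k l)" for l
  have nn: "0 <= r / delta * 2 ^ l" for l using r d by simp
  have kb: "real (k l) <= r / delta * 2 ^ l" "r / delta * 2 ^ l < real (k l) + 1" for l
   using nn[of l] unfolding k_def by (simp_all add: of_nat_floor)
  have qb: "q l <= r" "r - delta * (1/2) ^ l < q l" "0 <= q l" for l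
  proof -
   have "q l <= delta / 2 ^ l * (r / delta * 2 ^ l)" unfolding q_def using d by (intro mult_left_mono kb) auto
   thus "q l <= r" using d by simp
   have "delta / 2 ^ l * (r / delta * 2 ^ l) < delta / 2 ^ l * (real (k l) + 1)" using d by (intro mult_strict_left_mono kb) auto
   thus "r - delta * (1/2) ^ l < q l" using d by (simp add: q_def distrib_left power_one_over)
   show "0 <= q l" using d by (simp add: q_def)
  qed
  have "q \<longlonglongrightarrow> r"
  proof (rule tendsto_sandwich[of "%l. r - delta * (1/2) ^ l" _ _ "%_. r"])
   have "(%l. r - delta * (1/2) ^ l) \<longlonglongrightarrow> r - delta * 0" by (intro tendsto_intros) simp_all
   thus "(%l. r - delta * (1/2) ^ l) \<longlonglongrightarrow> r" by simp
  qed (use qb(1) qb(2)[THEN less_imp_le] in "simp_all")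
  moreover have "continuous_on {0..} omega" using sp by (simp add: space_path)
  ultimately have "(%l. omega (q l)) \<longlonglongrightarrow> omega r"
   using continuous_on_tendsto_compose[of "{0..}" omega q r sequentially] qb(3) r by simp
  moreover have "omega r \<in> W" using \<open>omega r \<in> G\<close> W by simp
  ultimately have "\<forall>\<^sub>F l in sequentially. omega (q l) \<in> W" using W(1) topological_tendstoD by blast
  then obtain l where l: "omega (q l) \<in> W" unfolding eventually_sequentially by blast
  have "omega (q l) \<in> M" using sp qb(3) by (auto simp: space_path)
  hence "omega (q l) \<in> G" using l W by simp
  moreover have "k l <= i * 2 ^ l"
  proof -
   have "real (k l) <= r / delta * 2 ^ l" by (rule kb)
   also have "... <= real i * 2 ^ l" using r d by (intro mult_right_mono) (auto simp: pos_divide_le_eq)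
   also have "... = real (i * 2 ^ l)" by simp
   finally show ?thesis by (simp only: of_nat_le_iff)
  qed
  ultimately show False using g unfolding q_def by blast
 qed
 thus "omega \<in> avoid (real i * delta) G" using sp by (simp add: avoid_def)
qed

lemma decseq_avoid_grid: "decseq (%l. avoid_grid G (delta / 2 ^ l) (i * 2 ^ l))"
proof (rule decseq_SucI, rule subsetI)
 fix l omega assume w: "omega \<in> avoid_grid G (delta / 2 ^ Suc l) (i * 2 ^ Suc l)"
 have "omega (delta / 2 ^ l * real k) \<notin> G" if "k <= i * 2 ^ l" for k
 proof -
  have "2 * k <= i * 2 ^ Suc l" using that by simp
  hence "omega (delta / 2 ^ Suc l * real (2 * k)) \<notin> G" using w unfolding avoid_grid_def by blast
  thus ?thesis by simp
 qed
 thus "omega \<in> avoid_grid G (delta / 2 ^ l) (i * 2 ^ l)" using w by (simp add: avoid_grid_def)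
qed

lemma avoid_open_sets:
 assumes G: "relopen G" and t: "0 <= t" shows "avoid t G \<in> sets (path_space M)"
proof (cases "t = 0")
 case True
 have "avoid 0 G = avoid (real 0 * 1) G" by simp
 also have "... \<in> sets (path_space M)"
  unfolding avoid_grid_limit[OF G zero_less_one] using avoid_grid_sets[OF openin_measurable[OF G]] by auto
 finally show ?thesis using True by simp
next
 case False
 hence "avoid t G = avoid (real 1 * t) G" "0 < t" using t by simp_all
 thus ?thesis using avoid_grid_limit[OF G, of t 1] avoid_grid_sets[OF openin_measurable[OF G], of "t / 2 ^ _"] by auto
qed

lemma reversible_open:
 assumes G: "relopen G" shows "reversible G"
proof (rule reversible_of_limit[where f = "%delta n i x. measure (P x) (avoid_grid G (delta / 2 ^ n) (i * 2 ^ n))"])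
 note Gm = openin_measurable[OF G]
 show "avoid t G \<in> sets (path_space M)" if "0 <= t" for t by (rule avoid_open_sets[OF G that])
 fix delta :: real and n i :: nat assume d: "0 < delta"
 show "bdd (%x. measure (P x) (avoid_grid G (delta / 2 ^ n) (i * 2 ^ n)))"
  by (intro bdd_measure_P avoid_grid_sets Gm) (use d in simp)
 show "\<bar>measure (P x) (avoid_grid G (delta / 2 ^ n) (i * 2 ^ n))\<bar> <= 1" if "x \<in> M" for x
  using prob_space.prob_le_1[OF prob_space_P[OF that]] by simp
 show "(%n. measure (P x) (avoid_grid G (delta / 2 ^ n) (i * 2 ^ n))) \<longlonglongrightarrow> surv G (real i * delta) x" if x: "x \<in> M" for x
 proof -
  interpret prob_space "P x" by (rule prob_space_P[OF x])
  show ?thesis unfolding surv_def avoid_grid_limit[OF G d]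
   by (rule finite_Lim_measure_decseq[OF _ decseq_avoid_grid]) (use avoid_grid_sets[OF Gm] sets_P[OF x] d in auto)
 qed
 fix j
 have "i * 2 ^ n + j * 2 ^ n = (i + j) * 2 ^ n" by (simp add: distrib_right)
 thus "(\<integral>x. measure (P x) (avoid_grid G (delta / 2 ^ n) (i * 2 ^ n)) * measure (P x) (avoid_grid G (delta / 2 ^ n) (j * 2 ^ n))) =
    (\<integral>x. measure (P x) (avoid_grid G (delta / 2 ^ n) ((i + j) * 2 ^ n)))"
  using avoid_grid_sym_real[OF Gm, of "delta / 2 ^ n" "i * 2 ^ n" "j * 2 ^ n"] d by simp
qed

lemma reversible_limit:
 assumes S: "!!n::nat. reversible (S' n)" and sets: "!!t. 0 <= t ==> avoid t S \<in> sets (path_space M)"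
  and lim: "!!t x. 0 <= t ==> x \<in> M ==> (%n. surv (S' n) t x) \<longlonglongrightarrow> surv S t x"
 shows "reversible S"
proof (rule reversible_of_limit[where f = "%delta n i. surv (S' n) (real i * delta)"])
 fix delta :: real and n i j :: nat assume d: "0 < delta"
 show "(\<integral>x. surv (S' n) (real i * delta) x * surv (S' n) (real j * delta) x) = (\<integral>x. surv (S' n) (real (i + j) * delta) x)"
  by (rule reversible_sym[OF S d])
qed (use S sets lim surv_bdd surv_abs_le in auto)

lemma reversible_increasing:
 assumes S: "!!n::nat. reversible (S n)" and inc: "incseq S"
 shows "reversible (\<Union>n. S n)" "!!t x. 0 <= t ==> x \<in> M ==> (%n. surv (S n) t x) \<longlonglongrightarrow> surv (\<Union>n. S n) t x"
proof -
 have eq: "avoid t (\<Union>n. S n) = (\<Inter>n. avoid t (S n))" for t by (auto simp: avoid_def)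
 have dec: "decseq (%n. avoid t (S n))" for t using inc by (fastforce simp: avoid_def decseq_def incseq_def)
 show lim: "(%n. surv (S n) t x) \<longlonglongrightarrow> surv (\<Union>n. S n) t x" if t: "0 <= t" and x: "x \<in> M" for t x
 proof -
  interpret prob_space "P x" by (rule prob_space_P[OF x])
  show ?thesis unfolding surv_def eq
   by (rule finite_Lim_measure_decseq[OF _ dec]) (use reversible_sets[OF S t] sets_P[OF x] in auto)
 qed
 have "avoid t (\<Union>n. S n) \<in> sets (path_space M)" if "0 <= t" for t
  unfolding eq using reversible_sets[OF S that] by auto
 from reversible_limit[OF S this lim] show "reversible (\<Union>n. S n)" .
qed

definition open_nbhd :: "'a set => nat => 'a set" where
 "open_nbhd K n = {x \<in> M. infdist x K < 1 / real (Suc n)}"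

lemma openin_open_nbhd: "relopen (open_nbhd K n)"
proof -
 have "open {x. infdist x K < 1 / real (Suc n)}" by (intro open_Collect_less continuous_intros)
 moreover have "open_nbhd K n = M \<inter> {x. infdist x K < 1 / real (Suc n)}" by (auto simp: open_nbhd_def)
 ultimately show ?thesis by (simp add: openin_open_Int)
qed

text \<open>A path that avoids K keeps a positive distance from K up to time t.\<close>

lemma avoid_compact:
 assumes K: "compact K" "K ~= {}" "K \<subseteq> M" and t: "0 <= t"
 shows "avoid t K = (\<Union>n. avoid t (open_nbhd K n))"
proof (intro equalityI subsetI)
 fix omega assume w: "omega \<in> avoid t K"
 hence "continuous_on {0..t} omega" by (auto simp: avoid_def space_path intro: continuous_on_subset)
 hence "compact (omega ` {0..t})" by (rule compact_continuous_image) simp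
 moreover have "omega ` {0..t} ~= {}" using t by auto
 moreover have "continuous_on (omega ` {0..t}) (%y. infdist y K)" by (intro continuous_intros)
 ultimately obtain y where y: "y \<in> omega ` {0..t}" "\<forall>z\<in>omega ` {0..t}. infdist y K <= infdist z K"
  using continuous_attains_inf[of "omega ` {0..t}" "%y. infdist y K"] by blast
 have "y \<notin> K" using y(1) w by (auto simp: avoid_def)
 hence "0 < infdist y K"
  using in_closed_iff_infdist_zero[OF compact_imp_closed[OF K(1)] K(2), of y] infdist_nonneg[of y K] by linarith
 then obtain n where n: "1 / real (Suc n) < infdist y K" using nat_approx_posE by blast
 have "omega \<in> avoid t (open_nbhd K n)"
  using w y(2) n by (force simp: avoid_def open_nbhd_def)
 thus "omega \<in> (\<Union>n. avoid t (open_nbhd K n))" by blast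
next
 fix omega assume "omega \<in> (\<Union>n. avoid t (open_nbhd K n))"
 then obtain n where "omega \<in> avoid t (open_nbhd K n)" by blast
 thus "omega \<in> avoid t K" using K(3) by (auto simp: avoid_def open_nbhd_def dest: bspec)
qed

lemma reversible_compact:
 assumes K: "compact K" "K ~= {}" "K \<subseteq> M"
 shows "reversible K" "!!t x. 0 <= t ==> x \<in> M ==> (%n. surv (open_nbhd K n) t x) \<longlonglongrightarrow> surv K t x"
proof -
 have inc: "incseq (%n. avoid t (open_nbhd K n))" for t
 proof (rule incseq_SucI, rule subsetI)
  fix n omega assume w: "omega \<in> avoid t (open_nbhd K n)"
  have "1 / real (Suc (Suc n)) <= 1 / real (Suc n)" by (simp add: frac_le)
  hence "open_nbhd K (Suc n) \<subseteq> open_nbhd K n" by (auto simp: open_nbhd_def)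
  thus "omega \<in> avoid t (open_nbhd K (Suc n))" using w by (auto simp: avoid_def)
 qed
 show lim: "(%n. surv (open_nbhd K n) t x) \<longlonglongrightarrow> surv K t x" if t: "0 <= t" and x: "x \<in> M" for t x
 proof -
  interpret prob_space "P x" by (rule prob_space_P[OF x])
  show ?thesis unfolding surv_def avoid_compact[OF K t]
   by (rule finite_Lim_measure_incseq[OF _ inc]) (use avoid_open_sets[OF openin_open_nbhd t] sets_P[OF x] in auto)
 qed
 have "avoid t K \<in> sets (path_space M)" if "0 <= t" for t
  unfolding avoid_compact[OF K that] using avoid_open_sets[OF openin_open_nbhd that] by auto
 from reversible_limit[OF reversible_open[OF openin_open_nbhd] this lim] show "reversible K" .
qed

end

section \<open>Energy of survival probabilities\<close>

text \<open>Log-convexity with a 0 <= 1: j times the increment of ln a after place j is at least ln (a j). In powers no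
case of zero values has to be excluded.\<close>

lemma log_convex_power:
 fixes a :: "nat => real"
 assumes "!!j. 0 <= a j" "a 0 <= 1" "!!j. (a (Suc j))^2 <= a j * a (Suc (Suc j))"
 shows "a j ^ Suc j <= a (Suc j) ^ j"
proof (induction j)
 case 0
 thus ?case using assms(2) by simp
next
 case (Suc j)
 show ?case
 proof (cases "a (Suc j) = 0")
  case False
  hence pos: "0 < a (Suc j)" using assms(1)[of "Suc j"] by linarith
  have "a (Suc j) ^ j * a (Suc j) ^ Suc (Suc j) = ((a (Suc j))^2) ^ Suc j"
   by (simp add: power_mult[symmetric] power_add[symmetric] mult_2 del: power_Suc)
  also have "... <= (a j * a (Suc (Suc j))) ^ Suc j" by (intro power_mono assms(3)) simp
  also have "... = a j ^ Suc j * a (Suc (Suc j)) ^ Suc j" by (rule power_mult_distrib)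
  also have "... <= a (Suc j) ^ j * a (Suc (Suc j)) ^ Suc j"
   by (intro mult_right_mono Suc.IH zero_le_power assms(1))
  finally show ?thesis using pos by (simp add: mult_le_cancel_left del: power_Suc)
 qed (use assms(1) in simp)
qed

lemma minus_ln_bound:
 fixes m :: real assumes "0 < m" shows "- ln m * m <= 1"
proof -
 have "ln (1 / m) <= 1 / m - 1" using ln_le_minus_one[of "1 / m"] assms by simp
 hence "- ln m <= 1 / m" using assms by (simp add: ln_div)
 hence "- ln m * m <= 1 / m * m" using assms by (intro mult_right_mono) auto
 thus ?thesis using assms by simp
qed

context reflected_process begin

lemma cauchy_schwarz:
 assumes f: "bdd f" and g: "bdd g"
 shows "(\<integral>x. f x * g x)^2 <= (\<integral>x. f x * f x) * (\<integral>x. g x * g x)"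
proof -
 define a b c where "a = (\<integral>x. f x * f x)" and "b = (\<integral>x. f x * g x)" and "c = (\<integral>x. g x * g x)"
 note I = bdd_integrable[OF bdd_mult[OF f f]] bdd_integrable[OF bdd_mult[OF f g]] bdd_integrable[OF bdd_mult[OF g g]]
 have q: "0 <= s * s * a + 2 * s * t * b + t * t * c" for s t
 proof -
  have "0 <= (\<integral>x. (s * f x + t * g x)^2)" by (rule Bochner_Integration.integral_nonneg) simp
  also have "(\<integral>x. (s * f x + t * g x)^2) = (\<integral>x. s * s * (f x * f x) + 2 * s * t * (f x * g x) + t * t * (g x * g x))"
   by (rule Bochner_Integration.integral_cong) (simp_all add: power2_eq_square algebra_simps)
  also have "... = s * s * a + 2 * s * t * b + t * t * c"
   unfolding a_def b_def c_def using I
   by (simp only: Bochner_Integration.integral_add[OF Bochner_Integration.integrable_add[OF integrable_mult_right[OF I(1)] integrable_mult_right[OF I(2)]] integrable_mult_right[OF I(3)]]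
    Bochner_Integration.integral_add[OF integrable_mult_right[OF I(1)] integrable_mult_right[OF I(2)]] integral_mult_right_zero)
  finally show ?thesis .
 qed
 have a0: "0 <= a" unfolding a_def by (rule Bochner_Integration.integral_nonneg) simp
 have c0: "0 <= c" unfolding c_def by (rule Bochner_Integration.integral_nonneg) simp
 have "b^2 <= a * c"
 proof (cases "a = 0")
  case True
  have "b = 0"
  proof (rule ccontr)
   assume b: "b ~= 0"
   have "0 <= 2 * (- (c + 1) / (2 * b)) * 1 * b + 1 * 1 * c" using q[of "- (c + 1) / (2 * b)" 1] True by simp
   hence "0 <= - (c + 1) + c" using b by (simp add: field_simps)
   thus False by simp
  qed
  thus ?thesis using True by simp
 next
  case False
  hence "0 < a" using a0 by simp
  have "0 <= b * b * a + 2 * b * (- a) * b + (- a) * (- a) * c" by (rule q)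
  also have "... = a * (a * c - b^2)" by (simp add: power2_eq_square algebra_simps)
  finally show ?thesis using \<open>0 < a\<close> by (simp add: zero_le_mult_iff)
 qed
 thus ?thesis by (simp add: a_def b_def c_def)
qed

definition mass :: "'a set => real => real" where "mass S t = (\<integral>x. surv S t x)"

lemma mass_nonneg: "reversible S ==> 0 <= t ==> 0 <= mass S t"
 unfolding mass_def by (rule integral_nonneg_AE, rule AE_I2) (simp add: surv_bounds)

lemma mass_le_1: "reversible S ==> 0 <= t ==> mass S t <= 1"
 unfolding mass_def
 by (rule mu.integral_le_const[OF bdd_integrable[OF surv_bdd]], assumption+, rule AE_I2) (simp add: surv_bounds)

lemma mass_sum:
 assumes S: "reversible S" and d: "0 < delta"
 shows "(\<integral>x. surv S (real i * delta) x * surv S (real j * delta) x) = mass S (real (i + j) * delta)"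
 unfolding mass_def by (rule reversible_sym[OF S d])

text \<open>A path that avoids S up to t + h avoids it between h and t + h.\<close>

lemma surv_le_semigroup:
 assumes S: "reversible S" and t: "0 <= t" and h: "0 <= h" and x: "x \<in> M"
 shows "surv S (t + h) x <= semigroup P h (surv S t) x"
proof -
 interpret Px: prob_space "P x" by (rule prob_space_P[OF x])
 note A = reversible_sets[OF S t]
 let ?E = "{omega \<in> space (path_space M). path_shift h omega \<in> avoid t S}"
 have E: "?E \<in> sets (path_space M)"
  using measurable_sets[OF path_shift_measurable[OF h] A] by (simp add: vimage_def Int_def conj_commute)
 have "avoid (t + h) S \<subseteq> ?E"
 proof
  fix omega assume w: "omega \<in> avoid (t + h) S"
  hence sp: "omega \<in> space (path_space M)" by (simp add: avoid_def)
  have "path_shift h omega r \<notin> S" if "r \<in> {0..t}" for r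
   using w that h by (auto simp: avoid_def path_shift_def)
  thus "omega \<in> ?E" using sp measurable_space[OF path_shift_measurable[OF h] sp] by (simp add: avoid_def)
 qed
 hence "surv S (t + h) x <= measure (P x) ?E"
  unfolding surv_def by (rule Px.finite_measure_mono) (simp add: sets_P[OF x] E)
 also have "... = semigroup P h (surv S t) x"
 proof -
  have "ennreal (measure (P x) ?E) = emeasure (P x) ?E" by (simp add: Px.emeasure_eq_measure)
  also have "... = (\<integral>\<^sup>+omega. emeasure (P (omega h)) (avoid t S) \<partial>P x)" by (rule simple_markov[OF h x A])
  also have "... = (\<integral>\<^sup>+omega. ennreal (surv S t (omega h)) \<partial>P x)"
  proof (rule nn_integral_cong)
   fix omega assume "omega \<in> space (P x)"
   hence "omega h \<in> M" using h by (simp add: space_P[OF x] space_path)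
   then interpret Q: prob_space "P (omega h)" by (rule prob_space_P)
   show "emeasure (P (omega h)) (avoid t S) = ennreal (surv S t (omega h))" by (simp add: surv_def Q.emeasure_eq_measure)
  qed
  also have "... = ennreal (semigroup P h (surv S t) x)"
   unfolding semigroup_def
   by (rule nn_integral_eq_integral[OF bdd_path_integrable[OF h x surv_bdd[OF S t]]])
    (auto intro!: AE_I2 simp: space_P[OF x] space_path surv_bounds h)
  finally show ?thesis
   by (subst (asm) ennreal_inj) (auto intro!: semigroup_nonneg simp: h x surv_bounds)
 qed
 finally show ?thesis .
qed

text \<open>Let f = surv S (u/2) and h = u / k. Then (f, P_h f) \<ge> (f, surv S (u/2 + h)) = mass S (u + h), and
log-convexity on the grid of width h gives mass S (u + h) \<ge> mass S u * exp (ln (mass S u) / k). So Et h f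
<= - ln (mass S u) / u * mass S u for every k, which is enough by HBI_Et_seq.\<close>

lemma surv_energy:
 assumes S: "reversible S" and u: "0 < u" and m: "0 < mass S u"
 shows "HB (surv S (u / 2))" "energy M (surv S (u / 2)) (surv S (u / 2)) <= - ln (mass S u) / u * mass S u"
  and "(\<integral>x. (surv S (u / 2) x)^2) = mass S u"
proof -
 let ?f = "surv S (u / 2)"
 have fb: "bdd ?f" by (rule surv_bdd[OF S]) (use u in simp)
 show sq: "(\<integral>x. (?f x)^2) = mass S u"
  using mass_sum[OF S, of "u / 2" 1 1] u by (simp add: power2_eq_square)
 have Et: "Et (u / real (Suc n)) ?f <= - ln (mass S u) / u * mass S u" for n
 proof -
  define k where "k = Suc n"
  have k: "0 < k" by (simp add: k_def)
  \<comment> \<open>Steps of half the width h, so that products of survival probabilities land on the grid of \<open>a\<close>.\<close>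
  define delta where "delta = u / (2 * real k)"
  have d: "0 < delta" using u k by (simp add: delta_def)
  define h where "h = u / real k"
  have h: "0 < h" "h = 2 * delta" using u k by (simp_all add: h_def delta_def)
  have kd: "real k * delta = u / 2" "real (2 * k) * delta = u" using k by (simp_all add: delta_def)
  define a where "a j = mass S (real (2 * j) * delta)" for j
  have a0: "0 <= a j" for j unfolding a_def by (rule mass_nonneg[OF S]) (use d in simp)
  have a1: "a 0 <= 1" unfolding a_def by (rule mass_le_1[OF S]) simp
  have lc: "(a (Suc j))^2 <= a j * a (Suc (Suc j))" for j
  proof -
   have "(\<integral>x. surv S (real j * delta) x * surv S (real (j + 2) * delta) x)^2
    <= (\<integral>x. surv S (real j * delta) x * surv S (real j * delta) x) * (\<integral>x. surv S (real (j + 2) * delta) x * surv S (real (j + 2) * delta) x)"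
    by (rule cauchy_schwarz) (use d in "auto intro!: surv_bdd[OF S]")
   thus ?thesis
    unfolding mass_sum[OF S d] a_def by (simp add: algebra_simps mult_2)
  qed
  have pw: "a k ^ Suc k <= a (Suc k) ^ k" by (rule log_convex_power[OF a0 a1 lc])
  have ak: "a k = mass S u" using kd by (simp add: a_def)
  have "(a k * exp (ln (a k) / real k)) ^ k = a k ^ k * a k"
   using m k by (simp add: power_mult_distrib exp_of_nat_mult[symmetric] ak)
  hence "(a k * exp (ln (a k) / real k)) ^ k <= a (Suc k) ^ k" using pw by (simp add: mult.commute)
  hence ge: "a k * exp (ln (a k) / real k) <= a (Suc k)" using power_le_imp_le_base[of "a k * exp (ln (a k) / real k)" n "a (Suc k)"] a0
   by (simp add: k_def)
  have "a (Suc k) = (\<integral>x. ?f x * surv S (real (k + 2) * delta) x)"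
  proof -
   have "k + (k + 2) = 2 * Suc k" by simp
   thus ?thesis using mass_sum[OF S d, of k "k + 2"] unfolding kd(1) a_def by (simp only:)
  qed
  also have "... <= (\<integral>x. ?f x * semigroup P h ?f x)"
  proof (rule integral_mono)
   show "integrable \<mu> (%x. ?f x * surv S (real (k + 2) * delta) x)"
    by (intro bdd_integrable bdd_mult fb surv_bdd[OF S]) (use d in simp)
   show "integrable \<mu> (%x. ?f x * semigroup P h ?f x)"
    by (intro bdd_integrable bdd_mult fb bdd_semigroup h)
   fix x assume "x \<in> space \<mu>"
   hence x: "x \<in> M" by simp
   have "real (k + 2) * delta = u / 2 + h" using kd h by (simp add: distrib_right)
   hence "surv S (real (k + 2) * delta) x <= semigroup P h ?f x"
    using surv_le_semigroup[OF S _ _ x, of "u / 2" h] u h by simp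
   thus "?f x * surv S (real (k + 2) * delta) x <= ?f x * semigroup P h ?f x"
    by (rule mult_left_mono) (use surv_bounds[OF x] in simp)
  qed
  finally have "a k * exp (ln (a k) / real k) <= (\<integral>x. ?f x * semigroup P h ?f x)" using ge by (rule order_trans[rotated])
  moreover have "a k * (1 + ln (a k) / real k) <= a k * exp (ln (a k) / real k)"
   by (rule mult_left_mono[OF exp_ge_add_one_self a0])
  ultimately have "a k * (1 + ln (a k) / real k) <= (\<integral>x. ?f x * semigroup P h ?f x)" by (rule order_trans[rotated])
  hence "(\<integral>x. (?f x)^2) - (\<integral>x. ?f x * semigroup P h ?f x) <= a k - a k * (1 + ln (a k) / real k)"
   unfolding sq ak by (rule diff_left_mono)
  also have "... = - ln (a k) * a k / real k" by (simp add: algebra_simps)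
  finally have "Et h ?f <= - ln (a k) * a k / real k / h"
   unfolding Et_eq[OF h(1) bdd_L2[OF fb]] by (rule divide_right_mono) (use h in simp)
  also have "... = - ln (a k) / u * a k" using k by (simp add: h_def)
  finally show ?thesis unfolding ak unfolding h_def k_def .
 qed
 have lim: "(%n. u / real (Suc n)) \<longlonglongrightarrow> 0"
  using tendsto_mult[OF tendsto_const[of u] LIMSEQ_inverse_real_of_nat] by (simp add: divide_inverse)
 have pos: "0 < u / real (Suc n)" for n using u by simp
 show "HB ?f" by (rule HBI_Et_seq(1)[OF fb pos lim Et tendsto_const])
 show "energy M ?f ?f <= - ln (mass S u) / u * mass S u" by (rule HBI_Et_seq(2)[OF fb pos lim Et tendsto_const])
qed

lemma surv_HB:
 assumes S: "reversible S" and s: "0 < s"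
 shows "HB (surv S s)" "N1 (surv S s) <= 1 / (2 * s) + 1"
proof -
 have "HB (surv S s) & N1 (surv S s) <= 1 / (2 * s) + 1"
 proof (cases "mass S (2 * s) = 0")
  case True
  have b: "bdd (surv S s)" by (rule surv_bdd[OF S]) (use s in simp)
  have i: "integrable \<mu> (%x. (surv S s x)^2)" by (intro bdd_integrable bdd_power2 b)
  have "(\<integral>x. (surv S s x)^2) = 0"
   using mass_sum[OF S s, of 1 1] True by (simp add: power2_eq_square)
  hence "AE x in \<mu>. (surv S s x)^2 = 0" using integral_nonneg_eq_0_iff_AE[OF i] by simp
  hence ae: "AE x in \<mu>. 0 = surv S s x" by eventually_elim simp
  show ?thesis using HB_AE[OF HB_zero(1) b ae] HB_zero(2) s by (simp add: add_nonneg_nonneg order_trans[of _ 0])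
 next
  case False
  hence m: "0 < mass S (2 * s)" using mass_nonneg[OF S, of "2 * s"] s by simp
  have s2: "0 < 2 * s" "2 * s / 2 = s" using s by auto
  note * = surv_energy[OF S s2(1) m, unfolded s2(2)]
  have "energy M (surv S s) (surv S s) <= (- ln (mass S (2 * s)) * mass S (2 * s)) / (2 * s)" using *(2) by simp
  also have "... <= 1 / (2 * s)" by (rule divide_right_mono[OF minus_ln_bound[OF m]]) (use s in simp)
  finally have "N1 (surv S s) <= 1 / (2 * s) + mass S (2 * s)" unfolding N1_def *(3) by simp
  thus ?thesis using *(1) mass_le_1[OF S, of "2 * s"] s by simp
 qed
 thus "HB (surv S s)" "N1 (surv S s) <= 1 / (2 * s) + 1" by auto
qed

lemma surv_zero:
 assumes S: "reversible S" and t: "0 <= t" and x: "x \<in> M" "x \<in> S" shows "surv S t x = 0"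
proof -
 have "avoid t S \<subseteq> {omega. omega 0 \<notin> S}" using t by (auto simp: avoid_def)
 from start_in_S[OF x reversible_sets[OF S t] this] show ?thesis by (simp add: surv_def measure_def)
qed

end

context regular_process begin

text \<open>On an open neighbourhood of K the survival probability of the neighbourhood is zero, so its quasi-continuous
version vanishes there quasi-everywhere by qc_le. Shrinking the neighbourhoods, qc_hull_limit carries this
over to K.\<close>

lemma surv_compact_vanishes:
 assumes K: "compact K" "K ~= {}" "K \<subseteq> M" and s: "0 < s"
 shows "\<exists>v N. qc v & (AE x in \<mu>. v x = surv K s x) & polar N & (\<forall>x\<in>K - N. v x = 0)"
proof -
 note g = reversible_open[OF openin_open_nbhd]
 have s0: "0 <= s" using s by simp
 let ?f = "%n. surv (open_nbhd K n) s"
 have "\<forall>n. \<exists>v. qc v & HB v & (AE x in \<mu>. v x = ?f n x) & unit_val v"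
  by (intro allI qc_version surv_HB g s surv_bounds)
 from choice[OF this] obtain v where v: "\<forall>n. qc (v n) & HB (v n) & (AE x in \<mu>. v n x = ?f n x) & unit_val (v n)" ..
 have N1v: "N1 (v n) <= 1 / (2 * s) + 1" for n
 proof -
  have "AE x in \<mu>. ?f n x = v n x" using v[rule_format, of n] by (auto elim!: eventually_mono)
  from HB_AE(2)[OF surv_HB(1)[OF g s] _ this] show ?thesis using v surv_HB(2)[OF g s, of K n] HB_bdd by fastforce
 qed
 have KM: "K \<subseteq> open_nbhd K n" for n using K by (auto simp: open_nbhd_def)
 have Z: "\<exists>N. polar N & (\<forall>x\<in>K - N. v n x = 0)" for n
 proof -
  have "AE x in \<mu>. x \<in> open_nbhd K n --> v n x <= 0"
   using v[rule_format, of n, THEN conjunct2, THEN conjunct2, THEN conjunct1] AE_space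
   by eventually_elim (auto simp: surv_zero[OF g s0])
  from qc_le[OF _ qc_continuous[OF continuous_on_const] openin_open_nbhd this] v
  have "polar {x \<in> open_nbhd K n. 0 < v n x}" by blast
  moreover have "v n x = 0" if x: "x \<in> K - {x \<in> open_nbhd K n. 0 < v n x}" for x
  proof -
   have "x \<in> open_nbhd K n" "x \<in> M" using x KM K(3) by auto
   hence "\<not> 0 < v n x" "0 <= v n x" using x v by auto
   thus ?thesis by linarith
  qed
  ultimately show ?thesis by blast
 qed
 have fb: "bdd (surv K s)" by (rule surv_bdd[OF reversible_compact(1)[OF K] s0])
 have vf: "(\<integral>x. (v n x - surv K s x)^2) = (\<integral>x. (?f n x - surv K s x)^2)" for n
 proof (rule integral_cong_AE)
  show "AE x in \<mu>. (v n x - surv K s x)^2 = (?f n x - surv K s x)^2"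
   using v[rule_format, of n, THEN conjunct2, THEN conjunct2, THEN conjunct1] by eventually_elim simp
  have "bdd (v n)" "bdd (?f n)" using v HB_bdd surv_bdd[OF g s0] by auto
  thus "(%x. (v n x - surv K s x)^2) \<in> borel_measurable \<mu>" "(%x. (?f n x - surv K s x)^2) \<in> borel_measurable \<mu>"
   using fb by (auto intro!: bdd_meas bdd_power2 bdd_diff)
 qed
 have "(%n. \<integral>x. (?f n x - surv K s x)^2 \<partial>\<mu>) \<longlonglongrightarrow> (\<integral>x. 0)"
 proof (rule integral_limit[where B = 1])
  fix x assume x: "x \<in> M"
  have "(%n. (?f n x - surv K s x)^2) \<longlonglongrightarrow> (surv K s x - surv K s x)^2"
   by (intro tendsto_intros reversible_compact(2)[OF K s0 x])
  thus "(%n. (?f n x - surv K s x)^2) \<longlonglongrightarrow> 0" by simp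
  fix n
  have "\<bar>?f n x - surv K s x\<bar> <= 1" using surv_bounds[OF x, of "open_nbhd K n" s] surv_bounds[OF x, of K s] by linarith
  thus "\<bar>(?f n x - surv K s x)^2\<bar> <= 1" by (simp add: abs_square_le_1)
 qed (auto intro!: bdd_power2 bdd_diff surv_bdd[OF g s0] fb)
 hence lim: "(%n. \<integral>x. (v n x - surv K s x)^2 \<partial>\<mu>) \<longlonglongrightarrow> 0" unfolding vf by simp
 have "\<exists>w N. qc w & HB w & (AE x in \<mu>. w x = surv K s x) & unit_val w & polar N & (\<forall>x\<in>(K \<inter> M) - N. w x = 0)"
  by (rule qc_hull_limit[where u = v and C = "1 / (2 * s) + 1"]) (use v N1v fb lim Z in simp_all)
 then obtain w N where "qc w" "AE x in \<mu>. w x = surv K s x" "polar N" "\<forall>x\<in>(K \<inter> M) - N. w x = 0" by (elim exE conjE)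
 moreover have "K \<inter> M = K" using K(3) by blast
 ultimately show ?thesis by (intro exI[of _ w] exI[of _ N]) simp
qed

end

section \<open>Exponential decay and the hitting bound\<close>

context reflected_process begin

lemma surv_antimono:
 assumes "reversible S" "S \<subseteq> T" "0 <= t" "x \<in> M" shows "surv T t x <= surv S t x"
proof -
 interpret prob_space "P x" by (rule prob_space_P[OF assms(4)])
 show ?thesis unfolding surv_def
  by (rule finite_measure_mono) (use assms reversible_sets[OF assms(1,3)] sets_P[OF assms(4)] in "auto simp: avoid_def")
qed

lemma mass_antimono:
 assumes "reversible S" "reversible T" "S \<subseteq> T" "0 <= t" shows "mass T t <= mass S t"
 unfolding mass_def
 by (rule integral_mono) (use assms in "auto intro: bdd_integrable surv_bdd surv_antimono")

lemma mass_increasing: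
 assumes S: "!!n::nat. reversible (S n)" and inc: "incseq S" and t: "0 <= t"
 shows "(%n. mass (S n) t) \<longlonglongrightarrow> mass (\<Union>n. S n) t"
 unfolding mass_def
 by (rule integral_limit[where B = 1]) (use reversible_increasing[OF S inc] S t in "simp_all add: surv_bdd surv_abs_le")

text \<open>At the positive time h the law of the process has a density bounded by \<open>a\<close>, so the starting point
may be exchanged for the stationary law.\<close>

lemma shifted_avoid_prob:
 assumes S: "reversible S" and h: "0 < h" and u: "0 <= u" and x: "x \<in> M" and a: "!!y. y \<in> M ==> p h x y <= a"
 shows "{omega \<in> space (path_space M). path_shift h omega \<in> avoid u S} \<in> sets (path_space M)"
  and "measure (P x) {omega \<in> space (path_space M). path_shift h omega \<in> avoid u S} <= a * mass S u"
proof -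
 have h0: "0 <= h" using h by simp
 interpret Px: prob_space "P x" by (rule prob_space_P[OF x])
 note A = reversible_sets[OF S u]
 let ?E = "{omega \<in> space (path_space M). path_shift h omega \<in> avoid u S}"
 show E: "?E \<in> sets (path_space M)"
  using measurable_sets[OF path_shift_measurable[OF h0] A] by (simp add: vimage_def Int_def conj_commute)
 have "ennreal (measure (P x) ?E) = emeasure (P x) ?E" by (simp add: Px.emeasure_eq_measure)
 also have "... = (\<integral>\<^sup>+omega. emeasure (P (omega h)) (avoid u S) \<partial>P x)" by (rule simple_markov[OF h0 x A])
 also have "... = (\<integral>\<^sup>+y. ennreal (p h x y) * emeasure (P y) (avoid u S))"
  by (rule nn_integral_P[OF h x emeasure_P_measurable[OF A]])
 also have "... <= (\<integral>\<^sup>+y. ennreal a * emeasure (P y) (avoid u S))"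
  by (intro nn_integral_mono mult_right_mono ennreal_leI) (use a in auto)
 also have "... = ennreal a * (\<integral>\<^sup>+y. emeasure (P y) (avoid u S))"
  by (rule nn_integral_cmult[OF emeasure_P_measurable[OF A]])
 also have "... = ennreal a * ennreal (mass S u)"
  unfolding measure_P_single[OF A] mass_def surv_def ..
 also have "... = ennreal (a * mass S u)"
  using mass_nonneg[OF S u] a[OF x] p_nonneg[OF h x x] by (simp add: ennreal_mult)
 finally show "measure (P x) ?E <= a * mass S u"
  using mass_nonneg[OF S u] a[OF x] p_nonneg[OF h x x] by (subst (asm) ennreal_le_iff) auto
qed

end

context regular_process begin

text \<open>S exhausts the infimum of mass K s over the compact subsets K of A. For every such K, joining it to S cannot
decrease the mass, so surv S s <= surv K s almost everywhere, hence quasi-everywhere for the versions; thus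
surv S s vanishes quasi-everywhere on K. If its version were positive on a nonpolar part of A, some nonpolar
compact K inside it would contradict this.\<close>

lemma avoiding_set:
 assumes A: "A \<subseteq> M" "A \<in> sets borel" "A ~= {}" and s: "0 < s"
 shows "\<exists>S. reversible S & S \<subseteq> A & vanishes_qe M (surv S s) A"
proof -
 have s0: "0 <= s" using s by simp
 define \<K> where "\<K> = {K. compact K & K ~= {} & K \<subseteq> A}"
 have gK: "reversible K" if "K \<in> \<K>" for K using that A(1) by (intro reversible_compact(1)) (auto simp: \<K>_def)
 obtain a where "a \<in> A" using A(3) by blast
 hence ne: "\<K> ~= {}" by (auto simp: \<K>_def intro!: exI[of _ "{a}"])
 define I where "I = (INF K\<in>\<K>. mass K s)"
 have bd: "bdd_below ((%K. mass K s) ` \<K>)" using mass_nonneg[OF gK s0] by (intro bdd_belowI[of _ 0]) auto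
 have I_le: "I <= mass K s" if "K \<in> \<K>" for K unfolding I_def by (rule cINF_lower[OF bd that])
 have "\<exists>K. K \<in> \<K> & mass K s < I + 1 / real (Suc n)" for n
  using cINF_less_iff[OF ne bd, of "I + 1 / real (Suc n)"] unfolding I_def[symmetric] by auto
 hence "\<forall>n. \<exists>K. K \<in> \<K> & mass K s < I + 1 / real (Suc n)" ..
 from choice[OF this] obtain K where K: "\<forall>n. K n \<in> \<K> & mass (K n) s < I + 1 / real (Suc n)" ..
 define L where "L n = (\<Union>i\<le>n. K i)" for n
 have L: "L n \<in> \<K>" for n
  using K unfolding \<K>_def L_def by (auto intro!: compact_UN)
 have inc: "incseq L" unfolding L_def by (intro incseq_SucI UN_mono) auto
 define S where "S = (\<Union>n. L n)"
 have gS: "reversible S" unfolding S_def by (rule reversible_increasing(1)[OF gK[OF L] inc])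
 have SA: "S \<subseteq> A" using L by (auto simp: S_def \<K>_def)
 have mS: "mass S s <= I"
 proof (rule field_le_epsilon)
  fix e :: real assume "0 < e"
  then obtain n where n: "1 / real (Suc n) < e" using nat_approx_posE by blast
  have "K n \<subseteq> S" by (auto simp: S_def L_def)
  hence "mass S s <= mass (K n) s" by (rule mass_antimono[OF gK gS _ s0, rotated]) (use K in blast)
  also have "... < I + 1 / real (Suc n)" using K by blast
  finally show "mass S s <= I + e" using n by linarith
 qed
 \<comment> \<open>Minimality of S against the competitor S \<union> K'.\<close>
 have below: "AE x in \<mu>. surv S s x <= surv K' s x" if K': "K' \<in> \<K>" for K'
 proof -
  have LK: "L n \<union> K' \<in> \<K>" for n using L[of n] K' by (auto simp: \<K>_def)
  have inc': "incseq (%n. L n \<union> K')" by (intro incseq_SucI Un_mono incseq_SucD[OF inc] order_refl)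
  have U: "(\<Union>n. L n \<union> K') = S \<union> K'" by (auto simp: S_def)
  have gU: "reversible (S \<union> K')" using reversible_increasing(1)[OF gK[OF LK] inc'] unfolding U .
  have "(%n. mass (L n \<union> K') s) \<longlonglongrightarrow> mass (S \<union> K') s" using mass_increasing[OF gK[OF LK] inc' s0] unfolding U .
  hence IU: "I <= mass (S \<union> K') s" by (rule LIMSEQ_le_const) (use I_le[OF LK] in blast)
  have b: "bdd (%x. surv S s x - surv (S \<union> K') s x)" by (intro bdd_diff surv_bdd gS gU s0)
  have nn: "AE x in \<mu>. 0 <= surv S s x - surv (S \<union> K') s x"
   by (rule AE_I2) (simp add: surv_antimono[OF gS _ s0])
  have eq: "(\<integral>x. surv S s x - surv (S \<union> K') s x) = mass S s - mass (S \<union> K') s"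
   unfolding mass_def by (rule Bochner_Integration.integral_diff; rule bdd_integrable[OF surv_bdd[OF _ s0]]; fact)
  have "mass S s - mass (S \<union> K') s <= 0" using mS IU by linarith
  moreover have "0 <= (\<integral>x. surv S s x - surv (S \<union> K') s x)" by (rule integral_nonneg_AE[OF nn])
  ultimately have "(\<integral>x. surv S s x - surv (S \<union> K') s x) = 0" unfolding eq by linarith
  hence "AE x in \<mu>. surv S s x - surv (S \<union> K') s x = 0"
   using integral_nonneg_eq_0_iff_AE[OF bdd_integrable[OF b] nn] by simp
  with AE_space show ?thesis
  proof eventually_elim
   fix x assume "x \<in> space \<mu>" and *: "surv S s x - surv (S \<union> K') s x = 0"
   hence "surv (S \<union> K') s x <= surv K' s x" by (intro surv_antimono[OF gK[OF K']] s0) auto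
   thus "surv S s x <= surv K' s x" using * by linarith
  qed
 qed
 obtain v where v: "qc v" "HB v" "AE x in \<mu>. v x = surv S s x" "unit_val v"
  using qc_version[OF surv_HB(1)[OF gS s]] surv_bounds by blast
 have null: "polar {x \<in> A. v x ~= 0}"
 proof -
  have "\<forall>n. \<exists>G. relopen G & small (1 / real (Suc n)) G & continuous_on (M - G) v"
  proof
   fix n :: nat
   have "0 < 1 / real (Suc n)" by simp
   from qcE[OF v(1) this] show "\<exists>G. relopen G & small (1 / real (Suc n)) G & continuous_on (M - G) v" by metis
  qed
  from choice[OF this] obtain G where G: "\<forall>n. relopen (G n) & small (1 / real (Suc n)) (G n) & continuous_on (M - G n) v" ..
  \<comment> \<open>Off G n the version is continuous, so these sets are Borel.\<close>
  define D where "D n k = A \<inter> {x \<in> M - G n. 1 / real (Suc k) <= v x}" for n k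
  have "polar (\<Inter>n. G n)"
   unfolding polar_def small_0
  proof (intro conjI allI impI)
   show "(\<Inter>n. G n) \<subseteq> M" using G openin_subset[of "top_of_set M" "G 0"] by auto
   fix e :: real assume "0 < e"
   then obtain n where n: "1 / real (Suc n) < e" using nat_approx_posE by blast
   show "small e (\<Inter>n. G n)" by (rule small_subset[of "1 / real (Suc n)" "G n"]) (use G n in auto)
  qed
  moreover have "polar (D n k)" for n k
  proof (rule ccontr)
   assume no: "\<not> polar (D n k)"
   have DM: "D n k \<subseteq> M" using A(1) by (auto simp: D_def)
   hence cap: "0 < capacity M (D n k)" using no by (simp add: polar_def zero_less_iff_neq_zero)
   have "closedin (top_of_set M) (M - G n)" using G by (intro closedin_diff) auto
   hence cl: "closed (M - G n)" using closedin_closed_trans compact_imp_closed[OF compact_M] by blast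
   have "closed {x \<in> M - G n. 1 / real (Suc k) <= v x}"
    using continuous_closed_preimage[OF _ cl closed_atLeast, of v "1 / real (Suc k)"] G by (simp add: vimage_def Int_def conj_assoc)
   hence "D n k \<in> sets borel" unfolding D_def by (intro sets.Int[OF A(2)] borel_closed)
   then obtain K' where K': "compact K'" "K' \<subseteq> D n k" "0 < capacity M K'"
    using borel_capacitable[OF DM _ cap] by blast
   have neK: "K' ~= {}"
   proof
    assume "K' = {}"
    hence "capacity M K' = 0" by (simp add: small_0 small_empty)
    thus False using K'(3) by simp
   qed
   have KK: "K' \<in> \<K>" using K' neK by (auto simp: \<K>_def D_def)
   have KM: "K' \<subseteq> M" using K'(2) DM by blast
   obtain w N where w: "qc w" "AE x in \<mu>. w x = surv K' s x" "polar N" "\<forall>x\<in>K' - N. w x = 0"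
    using surv_compact_vanishes[OF K'(1) neK KM s] by blast
   have "AE x in \<mu>. x \<in> M --> v x <= w x" using v(3) w(2) below[OF KK] by eventually_elim simp
   from qc_le[OF v(1) w(1) _ this] have n2: "polar {x \<in> M. w x < v x}" by simp
   have "K' \<subseteq> N \<union> {x \<in> M. w x < v x}"
   proof
    fix x assume x: "x \<in> K'"
    have "0 < 1 / real (Suc k)" by simp
    also have "... <= v x" using x K'(2) by (auto simp: D_def)
    finally show "x \<in> N \<union> {x \<in> M. w x < v x}" using w(4) x KM by (cases "x \<in> N") auto
   qed
   hence "polar K'" using polar_subset[OF polar_Un[OF w(3) n2]] by blast
   thus False using K'(3) by (simp add: polar_def)
  qed
  ultimately have "polar ((\<Inter>n. G n) \<union> (\<Union>n. \<Union>k. D n k))" by (intro polar_Un polar_UN)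
  moreover have "{x \<in> A. v x ~= 0} \<subseteq> (\<Inter>n. G n) \<union> (\<Union>n. \<Union>k. D n k)"
  proof
   fix x assume x: "x \<in> {x \<in> A. v x ~= 0}"
   hence xM: "x \<in> M" using A(1) by auto
   have "0 < v x" using v(4) xM x by (simp add: less_le)
   then obtain k where k: "1 / real (Suc k) < v x" using nat_approx_posE by blast
   show "x \<in> (\<Inter>n. G n) \<union> (\<Union>n. \<Union>k. D n k)"
   proof (cases "x \<in> (\<Inter>n. G n)")
    case False
    then obtain n where "x \<notin> G n" by blast
    hence "x \<in> D n k" using x k xM by (simp add: D_def)
    thus ?thesis by blast
   qed blast
  qed
  ultimately show ?thesis by (rule polar_subset)
 qed
 have "vanishes_qe M (surv S s) A"
  unfolding vanishes_qe_def
  by (intro exI[of _ v] conjI v(1,3) exI[of _ "{x \<in> A. v x ~= 0}"]) (use null in "auto simp: polar_def")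
 thus ?thesis using gS SA by blast
qed

text \<open>For u > 0 the function surv S (u/2) is admissible for the killed eigenvalue of A, and surv_energy bounds its
Rayleigh quotient.\<close>

lemma decay:
 assumes A: "A \<subseteq> M" "A \<in> sets borel" "0 < capacity M A" and u: "0 <= u"
 shows "\<exists>S. reversible S & S \<subseteq> A & mass S u <= exp_decay (killed_eigenvalue M A) u"
proof -
 have ne: "A ~= {}"
 proof
  assume "A = {}"
  hence "capacity M A = 0" by (simp add: small_0 small_empty)
  thus False using A(3) by simp
 qed
 show ?thesis
 proof (cases "u = 0")
  case True
  obtain S where S: "reversible S" "S \<subseteq> A" using avoiding_set[OF A(1,2) ne, of 1] by auto
  moreover have "exp_decay (killed_eigenvalue M A) u = 1" using True by (simp add: exp_decay_def)
  ultimately show ?thesis using mass_le_1[OF S(1) u] by auto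
 next
  case False
  hence u: "0 < u" using u by simp
  obtain S where S: "reversible S" "S \<subseteq> A" "vanishes_qe M (surv S (u / 2)) A"
   using avoiding_set[OF A(1,2) ne, of "u / 2"] u by auto
  let ?l = "killed_eigenvalue M A" and ?f = "surv S (u / 2)"
  have "mass S u <= exp_decay ?l u"
  proof (cases "0 < mass S u")
   case False
   moreover have "0 <= exp_decay ?l u" by (simp add: exp_decay_def)
   ultimately show ?thesis by linarith
  next
   case m: True
   note e = surv_energy[OF S(1) u m]
   have l2: "l2_inner M ?f ?f = mass S u" by (simp add: l2_inner_square e(3))
   have "?l <= ereal (energy M ?f ?f / l2_inner M ?f ?f)"
    unfolding killed_eigenvalue_def
    by (rule INF_lower) (use HB_H1[OF e(1)] S(3) l2 m in auto)
   also have "... <= ereal (- ln (mass S u) / u)"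
    using e(2) m unfolding l2 by (simp add: pos_divide_le_eq)
   finally have l_le: "?l <= ereal (- ln (mass S u) / u)" .
   \<comment> \<open>Excludes the value - \<infinity>; the bound above excludes \<infinity>.\<close>
   have "0 <= ?l"
    unfolding killed_eigenvalue_def
   proof (rule INF_greatest)
    fix f
    have "0 <= energy M f f" unfolding energy_def by (intro mult_nonneg_nonneg Bochner_Integration.integral_nonneg) auto
    moreover have "0 <= l2_inner M f f" unfolding l2_inner_square by simp
    ultimately show "0 <= ereal (energy M f f / l2_inner M f f)" by simp
   qed
   then obtain l where l: "?l = ereal l" "l <= - ln (mass S u) / u" using l_le by (cases ?l) auto
   have "ln (mass S u) <= - l * u" using mult_right_mono[OF l(2), of u] u by simp
   hence "exp (ln (mass S u)) <= exp (- l * u)" by simp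
   thus ?thesis using m l(1) by (simp add: exp_decay_def)
  qed
  thus ?thesis using S by blast
 qed
qed

text \<open>Only the path after time s is used: missing A on [0, T] implies missing S A \<subseteq> A on [s, T].\<close>

theorem hitting_bound:
 assumes fin: "finite \<A>" and A: "\<forall>A\<in>\<A>. A \<subseteq> M & A \<in> sets borel & 0 < capacity M A"
  and z: "z \<in> M" and s: "0 < s" "s <= T" and a: "0 <= a" "!!y. y \<in> M ==> p s z y <= a"
 shows "\<exists>E\<in>sets (P z). E \<subseteq> {omega \<in> space (path_space M). hits_all omega T \<A>} &
  1 - a * spectral_profile M \<A> (T - s) <= measure (P z) E"
proof -
 interpret Pz: prob_space "P z" by (rule prob_space_P[OF z])
 let ?u = "T - s"
 have u: "0 <= ?u" using s by simp
 have "\<forall>A\<in>\<A>. \<exists>S. reversible S & S \<subseteq> A & mass S ?u <= exp_decay (killed_eigenvalue M A) ?u"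
  using decay u A by blast
 from bchoice[OF this] obtain S where S: "\<forall>A\<in>\<A>. reversible (S A) & S A \<subseteq> A & mass (S A) ?u <= exp_decay (killed_eigenvalue M A) ?u" ..
 define F where "F A = {omega \<in> space (path_space M). path_shift s omega \<in> avoid ?u (S A)}" for A
 have F: "F A \<in> sets (P z)" "measure (P z) (F A) <= a * exp_decay (killed_eigenvalue M A) ?u" if AA: "A \<in> \<A>" for A
 proof -
  have gS: "reversible (S A)" using S AA by blast
  show "F A \<in> sets (P z)" unfolding F_def sets_P[OF z] by (rule shifted_avoid_prob(1)[OF gS s(1) u z a(2)])
  have "measure (P z) (F A) <= a * mass (S A) ?u" unfolding F_def by (rule shifted_avoid_prob(2)[OF gS s(1) u z a(2)])
  also have "... <= a * exp_decay (killed_eigenvalue M A) ?u" by (rule mult_left_mono) (use S AA a in auto)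
  finally show "measure (P z) (F A) <= a * exp_decay (killed_eigenvalue M A) ?u" .
 qed
 define E where "E = space (P z) - (\<Union>A\<in>\<A>. F A)"
 have UF: "(\<Union>A\<in>\<A>. F A) \<in> sets (P z)" using F(1) fin by (intro sets.finite_UN) auto
 have E: "E \<in> sets (P z)" unfolding E_def using UF by (rule sets.compl_sets)
 have "measure (P z) (\<Union>A\<in>\<A>. F A) <= (\<Sum>A\<in>\<A>. measure (P z) (F A))"
  by (rule Pz.finite_measure_subadditive_finite[OF fin]) (use F(1) in auto)
 also have "... <= (\<Sum>A\<in>\<A>. a * exp_decay (killed_eigenvalue M A) ?u)" by (rule sum_mono) (rule F(2))
 also have "... = a * spectral_profile M \<A> ?u" by (simp add: spectral_profile_def sum_distrib_left)
 finally have "1 - a * spectral_profile M \<A> ?u <= measure (P z) E"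
  unfolding E_def Pz.prob_compl[OF UF] by linarith
 moreover have "E \<subseteq> {omega \<in> space (path_space M). hits_all omega T \<A>}"
 proof
  fix omega assume w: "omega \<in> E"
  hence sp: "omega \<in> space (path_space M)" by (simp add: E_def space_P[OF z])
  have "omega ` {0..T} \<inter> A ~= {}" if AA: "A \<in> \<A>" for A
  proof -
   have "omega \<notin> F A" using w AA by (auto simp: E_def)
   moreover have "path_shift s omega \<in> space (path_space M)"
    using measurable_space[OF path_shift_measurable sp] s by simp
   ultimately obtain r where r: "r \<in> {0..?u}" "path_shift s omega r \<in> S A" using sp by (auto simp: F_def avoid_def)
   hence "omega (s + r) \<in> A" "s + r \<in> {0..T}" using S AA s by (auto simp: path_shift_def)
   thus ?thesis by blast
  qed
  thus "omega \<in> {omega \<in> space (path_space M). hits_all omega T \<A>}" using sp by (simp add: hits_all_def)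
 qed
 ultimately show ?thesis using E by blast
qed

theorem recovery_bound:
 assumes fin: "finite \<A>" and A: "\<forall>A\<in>\<A>. A \<subseteq> M & A \<in> sets borel & 0 < capacity M A"
  and z: "z \<in> M" and s: "0 < s" "s <= T" and a: "0 <= a" "!!y. y \<in> M ==> p s z y <= a"
  and R: "!!omega. omega \<in> space (path_space M) ==> hits_all omega T \<A> ==> omega \<in> R"
 shows "1 - a * spectral_profile M \<A> (T - s) <= inner_prob (P z) R"
proof -
 interpret Pz: prob_space "P z" by (rule prob_space_P[OF z])
 obtain E where E: "E \<in> sets (P z)" "E \<subseteq> {omega \<in> space (path_space M). hits_all omega T \<A>}"
  "1 - a * spectral_profile M \<A> (T - s) <= measure (P z) E"
  using hitting_bound[OF fin A z s a] by blast
 have "measure (P z) E <= inner_prob (P z) R"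
  unfolding inner_prob_def
  by (rule cSUP_upper) (use E R in "auto intro!: bdd_aboveI[of _ 1]")
 thus ?thesis using E(3) by linarith
qed

end

section \<open>Smooth bump functions\<close>

text \<open>Polynomials in 1/x times exp (- 1/x): the derivatives of exp (- 1/x) extended by zero stay in this family,
which makes smoothness an induction.\<close>

definition flat_exp :: "real poly => real => real" where
 "flat_exp p x = (if 0 < x then poly p (1 / x) * exp (- (1 / x)) else 0)"

lemma poly_exp_tendsto: "((%y::real. poly p y * exp (- y)) \<longlongrightarrow> 0) at_top"
proof -
 have "((%y. \<Sum>i\<le>degree p. coeff p i * (y ^ i / exp y)) \<longlongrightarrow> (\<Sum>i\<le>degree p. coeff p i * 0)) at_top"
  by (intro tendsto_sum tendsto_mult tendsto_const tendsto_power_div_exp_0)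
 thus ?thesis
  by (simp add: poly_altdef sum_distrib_right exp_minus divide_inverse mult.assoc)
qed

lemma flat_exp_deriv:
 "(flat_exp p has_real_derivative flat_exp ([:0, 0, 1:] * (p - pderiv p)) x) (at x)"
proof -
 consider "x < 0" | "x = 0" | "0 < x" by linarith
 thus ?thesis
 proof cases
  case 1
  have "((%_. 0) has_real_derivative 0) (at x)" by simp
  hence "(flat_exp p has_real_derivative 0) (at x)"
   by (rule has_field_derivative_transform_within_open[of _ _ _ "{..<0}"]) (use 1 in "auto simp: flat_exp_def")
  thus ?thesis using 1 by (simp add: flat_exp_def)
 next
  case 3
  have "((%x. poly p (1 / x) * exp (- (1 / x))) has_real_derivative
    poly (pderiv p) (1 / x) * (- 1 / x^2) * exp (- (1 / x)) + poly p (1 / x) * (exp (- (1 / x)) * (1 / x^2))) (at x)"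
   using 3 by (auto intro!: derivative_eq_intros DERIV_chain2[OF poly_DERIV] simp: power2_eq_square)
  hence "(flat_exp p has_real_derivative
    poly (pderiv p) (1 / x) * (- 1 / x^2) * exp (- (1 / x)) + poly p (1 / x) * (exp (- (1 / x)) * (1 / x^2))) (at x)"
   by (rule has_field_derivative_transform_within_open[of _ _ _ "{0<..}"]) (use 3 in "auto simp: flat_exp_def")
  moreover have "poly (pderiv p) (1 / x) * (- 1 / x^2) * exp (- (1 / x)) + poly p (1 / x) * (exp (- (1 / x)) * (1 / x^2)) =
   flat_exp ([:0, 0, 1:] * (p - pderiv p)) x"
   using 3 by (simp add: flat_exp_def power2_eq_square algebra_simps)
  ultimately show ?thesis by simp
 next
  case 2
  have r: "((%h. poly (pCons 0 p) (1 / h) * exp (- (1 / h))) \<longlongrightarrow> 0) (at_right 0)"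
   using filterlim_compose[OF poly_exp_tendsto[of "pCons 0 p"] filterlim_inverse_at_top_right] by (simp add: inverse_eq_divide)
  have "((%h. (flat_exp p (0 + h) - flat_exp p 0) / h) \<longlongrightarrow> 0) (at_right 0)"
   by (rule tendsto_cong[THEN iffD1, OF _ r])
    (use eventually_at_right_less[of "0::real"] in "auto elim!: eventually_mono simp: flat_exp_def field_simps")
  moreover have "((%h. (flat_exp p (0 + h) - flat_exp p 0) / h) \<longlongrightarrow> 0) (at_left 0)"
  proof (rule tendsto_cong[THEN iffD1, OF _ tendsto_const])
   show "\<forall>\<^sub>F h in at_left 0. 0 = (flat_exp p (0 + h) - flat_exp p 0) / h"
    unfolding eventually_at_left_field by (intro exI[of _ "-1"]) (simp add: flat_exp_def)
  qed
  ultimately have "((%h. (flat_exp p (0 + h) - flat_exp p 0) / h) \<longlongrightarrow> 0) (at 0)"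
   by (rule filterlim_split_at_real[rotated])
  thus ?thesis using 2 by (simp add: DERIV_def flat_exp_def)
 qed
qed

lemma flat_exp_nonneg: "0 <= flat_exp 1 x"
 by (simp add: flat_exp_def)

lemma Ck_continuous: "Ck k f ==> continuous_on UNIV f"
proof (cases k)
 case (Suc m)
 assume "Ck k f"
 hence "\<forall>x. f differentiable (at x)" using Suc by simp
 thus ?thesis
  by (auto simp: continuous_on_eq_continuous_at differentiable_imp_continuous_within)
qed simp

lemma Ck_Suc_imp: "Ck (Suc k) f ==> Ck k f"
proof (induction k arbitrary: f)
 case 0
 thus ?case using Ck_continuous[of "Suc 0" f] by simp
next
 case (Suc k)
 have "Ck (Suc k) (%x. frechet_derivative f (at x) b)" if "b \<in> Basis" for b
  using Suc.prems that by (subst (asm) Ck.simps(2)) blast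
 hence "Ck k (%x. frechet_derivative f (at x) b)" if "b \<in> Basis" for b
  using Suc.IH that by blast
 thus ?case using Suc.prems by simp
qed

lemma Ck_add: "Ck k f ==> Ck k g ==> Ck k (%x. f x + g x)"
proof (induction k arbitrary: f g)
 case (Suc k)
 have "frechet_derivative (%x. f x + g x) (at x) = (%h. frechet_derivative f (at x) h + frechet_derivative g (at x) h)" for x
  by (rule frechet_derivative_at[symmetric], intro has_derivative_add) (use Suc.prems in "auto simp: frechet_derivative_works")
 thus ?case using Suc by (auto intro: differentiable_add)
qed (auto intro: continuous_intros)

lemma Ck_mult: "Ck k f ==> Ck k g ==> Ck k (%x. f x * g x)"
proof (induction k arbitrary: f g)
 case (Suc k)
 have "frechet_derivative (%x. f x * g x) (at x) = (%h. f x * frechet_derivative g (at x) h + frechet_derivative f (at x) h * g x)" for x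
  by (rule frechet_derivative_at[symmetric], intro has_derivative_mult) (use Suc.prems in "auto simp: frechet_derivative_works")
 thus ?case
  using Suc Ck_Suc_imp[of k f] Ck_Suc_imp[of k g] by (auto intro!: differentiable_mult Ck_add)
qed (auto intro: continuous_intros)

lemma Ck_const: "Ck k (%_. c)"
proof (induction k arbitrary: c)
 case (Suc k)
 have "frechet_derivative (%_. c) (at x) = (%h. 0)" for x :: 'a
  by (rule frechet_derivative_at[symmetric]) simp
 thus ?case using Suc by simp
qed simp

lemma Ck_flat_exp: "Ck k (%x::'a::euclidean_space. flat_exp p (c + x \<bullet> v))"
proof (induction k arbitrary: p)
 case 0
 have "continuous_on UNIV (flat_exp p)"
  by (auto simp: continuous_on_eq_continuous_at intro!: DERIV_isCont flat_exp_deriv)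
 thus ?case by (auto intro!: continuous_on_compose2[of UNIV "flat_exp p"] continuous_intros)
next
 case (Suc k)
 have d: "((%x. flat_exp p (c + x \<bullet> v)) has_derivative (%h. flat_exp ([:0, 0, 1:] * (p - pderiv p)) (c + x \<bullet> v) * (h \<bullet> v))) (at x)" for x
 proof -
  have "((%x. c + x \<bullet> v) has_derivative (%h. h \<bullet> v)) (at x)" by (auto intro!: derivative_eq_intros)
  from has_derivative_compose[OF this flat_exp_deriv[unfolded has_field_derivative_def]] show ?thesis by (simp add: o_def)
 qed
 have "frechet_derivative (%x. flat_exp p (c + x \<bullet> v)) (at x) = (%h. flat_exp ([:0, 0, 1:] * (p - pderiv p)) (c + x \<bullet> v) * (h \<bullet> v))" for x
  by (rule frechet_derivative_at[symmetric, OF d])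
 thus ?case using Suc.IH d by (auto intro!: Ck_mult Ck_const simp: differentiable_def simp del: mult_pCons_left)
qed

lemma Ck_prod: "finite I ==> (!!i. i \<in> I ==> Ck k (f i)) ==> Ck k (%x. \<Prod>i\<in>I. f i x)"
 by (induction I rule: finite_induct) (auto intro: Ck_const Ck_mult)

text \<open>A product over the coordinates, so that smoothness reduces to the real line. The support is a cube of half
side eta.\<close>

definition bump :: "real => 'a::euclidean_space => real" where
 "bump eta x = (\<Prod>b\<in>Basis. flat_exp 1 (1 - x \<bullet> b / eta) * flat_exp 1 (1 + x \<bullet> b / eta))"

lemma bump_nonneg: "0 <= bump eta x"
 unfolding bump_def by (intro prod_nonneg) (simp add: flat_exp_nonneg)

lemma bump_uminus: "bump eta (- x) = bump eta x"
 by (simp add: bump_def mult.commute)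

lemma bump_pos:
 assumes "0 < eta" shows "0 < bump eta x \<longleftrightarrow> (\<forall>b\<in>Basis. \<bar>x \<bullet> b\<bar> < eta)"
proof -
 have 1: "flat_exp 1 (1 - y / eta) * flat_exp 1 (1 + y / eta) ~= 0 \<longleftrightarrow> \<bar>y\<bar> < eta" for y
 proof -
  have f: "flat_exp 1 z ~= 0 \<longleftrightarrow> 0 < z" for z by (simp add: flat_exp_def)
  have "0 < 1 - y / eta \<longleftrightarrow> y < eta" using pos_divide_less_eq[OF assms, of y 1] by auto
  moreover have "0 < 1 + y / eta \<longleftrightarrow> - eta < y"
  proof -
   have "0 < 1 + y / eta \<longleftrightarrow> - 1 < y / eta" by linarith
   thus ?thesis using pos_less_divide_eq[OF assms, of "- 1" y] by simp
  qed
  ultimately show ?thesis unfolding mult_eq_0_iff de_Morgan_disj f by linarith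
 qed
 have "0 < bump eta x \<longleftrightarrow> bump eta x ~= 0" using bump_nonneg[of eta x] by linarith
 also have "... \<longleftrightarrow> (\<forall>b\<in>Basis. \<bar>x \<bullet> b\<bar> < eta)" unfolding bump_def by (subst prod_zero_iff[OF finite_Basis]) (use 1 in blast)
 finally show ?thesis .
qed

lemma Ck_bump_shift: "Ck k (%x. bump eta (x - a))"
proof -
 have "(%x. bump eta (x - a)) = (%x. \<Prod>b\<in>Basis. flat_exp 1 ((1 + a \<bullet> b / eta) + x \<bullet> (- b /\<^sub>R eta)) * flat_exp 1 ((1 - a \<bullet> b / eta) + x \<bullet> (b /\<^sub>R eta)))"
  by (auto simp: bump_def fun_eq_iff inner_diff_left diff_divide_distrib divide_inverse algebra_simps intro!: prod.cong)
 thus ?thesis by (simp only:) (intro Ck_prod finite_Basis Ck_mult Ck_flat_exp)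
qed

lemma bump_support:
 assumes "0 < eta" shows "closure {x. bump eta (x - a) ~= 0} \<subseteq> cbox (a - eta *\<^sub>R One) (a + eta *\<^sub>R One)"
proof (rule closure_minimal)
 show "{x. bump eta (x - a) ~= 0} \<subseteq> cbox (a - eta *\<^sub>R One) (a + eta *\<^sub>R One)"
 proof
  fix x assume "x \<in> {x. bump eta (x - a) ~= 0}"
  hence "0 < bump eta (x - a)" using bump_nonneg[of eta "x - a"] by (simp add: less_le)
  hence "\<bar>(x - a) \<bullet> b\<bar> < eta" if "b \<in> Basis" for b using bump_pos[OF assms] that by blast
  hence "\<bar>x \<bullet> b - a \<bullet> b\<bar> < eta" if "b \<in> Basis" for b using that by (simp add: inner_diff_left)
  thus "x \<in> cbox (a - eta *\<^sub>R One) (a + eta *\<^sub>R One)"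
   by (force simp: mem_box inner_simps abs_less_iff)
 qed
qed (rule closed_cbox)

lemma test_function_bump:
 assumes "0 < eta" "cbox (a - eta *\<^sub>R One) (a + eta *\<^sub>R One) \<subseteq> U"
 shows "test_function U (%x. c * bump eta (x - a))"
proof -
 have "closure {x. c * bump eta (x - a) ~= 0} \<subseteq> closure {x. bump eta (x - a) ~= 0}" by (rule closure_mono) auto
 hence s: "closure {x. c * bump eta (x - a) ~= 0} \<subseteq> cbox (a - eta *\<^sub>R One) (a + eta *\<^sub>R One)" using bump_support[OF assms(1)] by blast
 hence "compact (closure {x. c * bump eta (x - a) ~= 0})"
  using bounded_subset[OF bounded_cbox] by (auto simp: compact_eq_bounded_closed)
 thus ?thesis unfolding test_function_def
  using s assms(2) Ck_mult[OF Ck_const Ck_bump_shift] by blast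
qed

lemma test_function_has_derivative:
 assumes "test_function U phi" shows "(phi has_derivative frechet_derivative phi (at x)) (at x)"
proof -
 have "Ck (Suc 0) phi" using assms by (simp only: test_function_def)
 thus ?thesis by (simp add: frechet_derivative_works)
qed

lemma test_function_partial_continuous:
 assumes "test_function U phi" "b \<in> Basis" shows "continuous_on UNIV (%x. frechet_derivative phi (at x) b)"
proof -
 have "Ck (Suc 0) phi" using assms by (simp only: test_function_def)
 thus ?thesis using assms(2) by simp
qed

lemma test_function_zero:
 assumes "test_function U phi" "x \<notin> closure {x. phi x ~= 0}"
 shows "phi x = 0" "frechet_derivative phi (at x) = (%h. 0)"
proof -
 show "phi x = 0" using assms(2) closure_subset[of "{x. phi x ~= 0}"] by blast
 have "((%_. 0) has_derivative (%_. 0)) (at x)" by simp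
 hence "(phi has_derivative (%_. 0)) (at x)"
 proof (rule has_derivative_transform_within_open[of _ _ _ _ "- closure {x. phi x ~= 0}"])
  fix y assume "y \<in> - closure {x. phi x ~= 0}"
  thus "0 = phi y" using closure_subset[of "{x. phi x ~= 0}"] by auto
 qed (use assms in auto)
 from frechet_derivative_at[OF this] show "frechet_derivative phi (at x) = (%h. 0)" ..
qed

text \<open>One constant for the function, its partial derivatives and its increments keeps the later estimates short.\<close>

lemma test_function_lipschitz:
 fixes phi :: "'a::euclidean_space => real"
 assumes phi: "test_function U phi"
 obtains L where "0 < L" "!!x y. \<bar>phi x - phi y\<bar> <= L * dist x y" "!!x b. b \<in> Basis ==> \<bar>frechet_derivative phi (at x) b\<bar> <= L" "!!x. \<bar>phi x\<bar> <= L"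
proof -
 let ?S = "closure {x. phi x ~= 0}"
 have cS: "compact ?S" using phi by (simp add: test_function_def)
 have "\<exists>B. \<forall>x. \<bar>frechet_derivative phi (at x) b\<bar> <= B" if b: "b \<in> Basis" for b
 proof -
  have "compact ((%x. frechet_derivative phi (at x) b) ` ?S)"
   by (rule compact_continuous_image[OF continuous_on_subset[OF test_function_partial_continuous[OF phi b]] cS]) simp
  then obtain B where B: "!!y. y \<in> (%x. frechet_derivative phi (at x) b) ` ?S ==> \<bar>y\<bar> <= B"
   by (metis bounded_real compact_imp_bounded)
  have "\<bar>frechet_derivative phi (at x) b\<bar> <= \<bar>B\<bar>" for x
  proof (cases "x \<in> ?S")
   case True
   thus ?thesis using B[of "frechet_derivative phi (at x) b"] by auto
  qed (simp add: test_function_zero(2)[OF phi])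
  thus ?thesis by blast
 qed
 hence "\<forall>b\<in>Basis. \<exists>B. \<forall>x. \<bar>frechet_derivative phi (at x) b\<bar> <= B" by blast
 from bchoice[OF this] obtain B where B: "\<forall>b\<in>Basis. \<forall>x. \<bar>frechet_derivative phi (at x) b\<bar> <= B b" ..
 have cphi: "continuous_on UNIV phi" using phi Ck_continuous[of 0 phi] unfolding test_function_def by blast
 have "compact (phi ` ?S)" by (rule compact_continuous_image[OF continuous_on_subset[OF cphi] cS]) simp
 then obtain A where A: "!!y. y \<in> phi ` ?S ==> \<bar>y\<bar> <= A" by (metis bounded_real compact_imp_bounded)
 have A: "\<bar>phi x\<bar> <= \<bar>A\<bar>" for x
 proof (cases "x \<in> ?S")
  case True
  hence "\<bar>phi x\<bar> <= A" by (intro A imageI)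
  thus ?thesis by linarith
 next
  case False
  thus ?thesis using test_function_zero(1)[OF phi, of x] by simp
 qed
 have B0: "0 <= B b" if "b \<in> Basis" for b using B that by (meson abs_ge_zero order_trans)
 define L where "L = (\<Sum>b\<in>Basis. B b) + \<bar>A\<bar> + 1"
 have sB: "0 <= (\<Sum>b\<in>Basis. B b)" by (intro sum_nonneg B0)
 have on: "onorm (frechet_derivative phi (at x)) <= L" for x
 proof (rule onorm_le)
  fix h
  have lin: "linear (frechet_derivative phi (at x))"
   using has_derivative_linear[OF test_function_has_derivative[OF phi]] .
  have "frechet_derivative phi (at x) h = (\<Sum>b\<in>Basis. (h \<bullet> b) * frechet_derivative phi (at x) b)"
   by (subst euclidean_representation[of h, symmetric]) (simp add: linear_sum[OF lin] linear_cmul[OF lin])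
  hence "norm (frechet_derivative phi (at x) h) <= (\<Sum>b\<in>Basis. \<bar>h \<bullet> b\<bar> * \<bar>frechet_derivative phi (at x) b\<bar>)"
   by (simp add: abs_mult[symmetric] sum_abs)
  also have "... <= (\<Sum>b\<in>Basis. norm h * B b)"
   using B by (intro sum_mono mult_mono Basis_le_norm) auto
  also have "... = norm h * (\<Sum>b\<in>Basis. B b)" by (simp add: sum_distrib_left)
  also have "... <= norm h * L" by (rule mult_left_mono) (auto simp: L_def)
  finally show "norm (frechet_derivative phi (at x) h) <= L * norm h" by (simp add: mult.commute)
 qed
 show ?thesis
 proof (rule that[of L])
  show "0 < L" using sB by (simp add: L_def)
  show "\<bar>phi x - phi y\<bar> <= L * dist x y" for x y
   using differentiable_bound[of UNIV phi "%x. frechet_derivative phi (at x)" L x y] test_function_has_derivative[OF phi] on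
   by (simp add: dist_norm)
  show "\<bar>frechet_derivative phi (at x) b\<bar> <= L" if "b \<in> Basis" for x b
  proof -
   have "\<bar>frechet_derivative phi (at x) b\<bar> <= B b" using B that by blast
   also have "B b <= (\<Sum>b\<in>Basis. B b)" by (rule member_le_sum[OF that]) (use B0 in auto)
   finally show ?thesis by (simp add: L_def)
  qed
  show "\<bar>phi x\<bar> <= L" for x using A[of x] sB by (simp add: L_def)
 qed
qed

text \<open>Differentiation under the integral at a single point, with a Lipschitz bound as the majorant of the difference
quotients.\<close>

lemma DERIV_integral:
 fixes f :: "'b => real" and K :: "real => 'b => real"
 assumes f: "integrable N f" and K: "!!s. K s \<in> borel_measurable N" "K' \<in> borel_measurable N"
  and b0: "!!y. y \<in> space N ==> \<bar>K 0 y\<bar> <= B"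
  and lip: "!!s y. y \<in> space N ==> \<bar>K s y - K 0 y\<bar> <= C * \<bar>s\<bar>"
  and der: "!!y. y \<in> space N ==> ((%s. K s y) has_real_derivative K' y) (at 0)"
 shows "((%s. \<integral>y. f y * K s y \<partial>N) has_real_derivative (\<integral>y. f y * K' y \<partial>N)) (at 0)"
proof -
 note [measurable] = K borel_measurable_integrable[OF f]
 have fi: "integrable N (%y. B' * \<bar>f y\<bar>)" for B' using f by simp
 have iK: "integrable N (%y. f y * K s y)" for s
 proof (rule Bochner_Integration.integrable_bound[OF fi[of "\<bar>B\<bar> + \<bar>C\<bar> * \<bar>s\<bar>"]])
  show "AE y in N. norm (f y * K s y) <= norm ((\<bar>B\<bar> + \<bar>C\<bar> * \<bar>s\<bar>) * \<bar>f y\<bar>)"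
  proof (rule AE_I2)
   fix y assume y: "y \<in> space N"
   have "C * \<bar>s\<bar> <= \<bar>C\<bar> * \<bar>s\<bar>" by (intro mult_right_mono) auto
   hence "\<bar>K s y\<bar> <= \<bar>B\<bar> + \<bar>C\<bar> * \<bar>s\<bar>" using b0[OF y] lip[OF y, of s] by linarith
   hence "\<bar>f y\<bar> * \<bar>K s y\<bar> <= \<bar>f y\<bar> * (\<bar>B\<bar> + \<bar>C\<bar> * \<bar>s\<bar>)" by (rule mult_left_mono) simp
   moreover have "0 <= \<bar>B\<bar> + \<bar>C\<bar> * \<bar>s\<bar>" by simp
   ultimately show "norm (f y * K s y) <= norm ((\<bar>B\<bar> + \<bar>C\<bar> * \<bar>s\<bar>) * \<bar>f y\<bar>)"
    by (simp add: abs_mult mult.commute)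
  qed
 qed simp
 have "((%s. \<integral>y. f y * ((K s y - K 0 y) / s) \<partial>N) \<longlongrightarrow> (\<integral>y. f y * K' y \<partial>N)) (at 0)"
  unfolding tendsto_at_iff_sequentially comp_def
 proof (intro allI impI)
  fix X :: "nat => real" assume X: "\<forall>i. X i \<in> UNIV - {0}" "X \<longlonglongrightarrow> 0"
  show "(%i. \<integral>y. f y * ((K (X i) y - K 0 y) / X i) \<partial>N) \<longlonglongrightarrow> (\<integral>y. f y * K' y \<partial>N)"
  proof (rule integral_dominated_convergence[where w = "%y. \<bar>C\<bar> * \<bar>f y\<bar>"])
   show "AE y in N. (%i. f y * ((K (X i) y - K 0 y) / X i)) \<longlonglongrightarrow> f y * K' y"
   proof (rule AE_I2)
    fix y assume "y \<in> space N"
    hence "((%s. (K (0 + s) y - K 0 y) / s) \<longlongrightarrow> K' y) (at 0)" using der by (simp add: DERIV_def)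
    hence "(%i. (K (X i) y - K 0 y) / X i) \<longlonglongrightarrow> K' y"
     using X unfolding tendsto_at_iff_sequentially comp_def by simp
    thus "(%i. f y * ((K (X i) y - K 0 y) / X i)) \<longlonglongrightarrow> f y * K' y" by (intro tendsto_intros)
   qed
   fix i
   show "AE y in N. norm (f y * ((K (X i) y - K 0 y) / X i)) <= \<bar>C\<bar> * \<bar>f y\<bar>"
   proof (rule AE_I2)
    fix y assume y: "y \<in> space N"
    have "X i ~= 0" using X by auto
    have "C * \<bar>X i\<bar> <= \<bar>C\<bar> * \<bar>X i\<bar>" by (intro mult_right_mono) auto
    hence "\<bar>K (X i) y - K 0 y\<bar> <= \<bar>C\<bar> * \<bar>X i\<bar>" using lip[OF y, of "X i"] by linarith
    hence "\<bar>(K (X i) y - K 0 y) / X i\<bar> <= \<bar>C\<bar>" using \<open>X i ~= 0\<close> by (simp add: abs_divide pos_divide_le_eq)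
    hence "\<bar>f y\<bar> * \<bar>(K (X i) y - K 0 y) / X i\<bar> <= \<bar>f y\<bar> * \<bar>C\<bar>" by (rule mult_left_mono) simp
    thus "norm (f y * ((K (X i) y - K 0 y) / X i)) <= \<bar>C\<bar> * \<bar>f y\<bar>" by (simp only: real_norm_def abs_mult mult.commute)
   qed
  qed (use fi in auto)
 qed
 moreover have "(\<integral>y. f y * ((K s y - K 0 y) / s) \<partial>N) = ((\<integral>y. f y * K (0 + s) y \<partial>N) - (\<integral>y. f y * K 0 y \<partial>N)) / s" for s
  using iK[of s] iK[of 0] by (simp add: right_diff_distrib diff_divide_distrib)
 ultimately show ?thesis unfolding DERIV_def by (simp only:)
qed

section \<open>Mollification\<close>

lemma nn_integral_translate:
 fixes f :: "'a::euclidean_space => ennreal"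
 assumes [measurable]: "f \<in> borel_measurable borel"
 shows "(\<integral>\<^sup>+x. f (c + x) \<partial>lborel) = (\<integral>\<^sup>+x. f x \<partial>lborel)"
 using nn_integral_distr[of "(+) c" lborel borel f] lborel_distr_plus[of c] by simp

lemma integral_translate:
 fixes f :: "'a::euclidean_space => real"
 assumes [measurable]: "f \<in> borel_measurable borel"
 shows "(\<integral>x. f (c + x) \<partial>lborel) = (\<integral>x. f x \<partial>lborel)"
 using integral_distr[of "(+) c" lborel borel f] lborel_distr_plus[of c] by simp

lemma integrable_translate:
 fixes f :: "'a::euclidean_space => real"
 assumes [measurable]: "f \<in> borel_measurable borel" and "integrable lborel f"
 shows "integrable lborel (%x. f (c + x))"
 using integrable_distr_eq[of "(+) c" lborel borel f] lborel_distr_plus[of c] assms(2) by simp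

lemma integrable_bounded_support:
 fixes f :: "'a::euclidean_space => real"
 assumes "f \<in> borel_measurable borel" "A \<in> sets borel" "emeasure lborel A < \<infinity>" "!!x. \<bar>f x\<bar> <= B" "!!x. x \<notin> A ==> f x = 0"
 shows "integrable lborel f"
proof (rule Bochner_Integration.integrable_bound[of lborel "%x. \<bar>B\<bar> * indicator A x"])
 show "integrable lborel (%x. \<bar>B\<bar> * indicator A x :: real)" using assms(2,3) by (intro integrable_mult_right) simp
 show "AE x in lborel. norm (f x) <= norm (\<bar>B\<bar> * indicator A x :: real)"
 proof (rule AE_I2)
  fix x
  have "\<bar>f x\<bar> <= \<bar>B\<bar>" using assms(4)[of x] by linarith
  thus "norm (f x) <= norm (\<bar>B\<bar> * indicator A x :: real)" using assms(5)[of x] by (cases "x \<in> A") simp_all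
 qed
qed (use assms(1) in simp)

lemma bump_continuous: "continuous_on UNIV (bump eta :: 'a::euclidean_space => real)"
 using Ck_continuous[OF Ck_bump_shift[of 0 eta 0]] by simp

lemma bump_measurable [measurable]: "(bump eta :: 'a::euclidean_space => real) \<in> borel_measurable borel"
 by (rule borel_measurable_continuous_onI[OF bump_continuous])

lemma bump_zero: "0 < eta ==> x \<notin> box (- (eta *\<^sub>R One)) (eta *\<^sub>R One) ==> bump eta x = 0"
 using bump_pos[of eta x] bump_nonneg[of eta x] by (force simp: mem_box abs_less_iff)

lemma test_function_bump_UNIV: "0 < eta ==> test_function UNIV (bump eta :: 'a::euclidean_space => real)"
 using test_function_bump[of eta 0 UNIV 1] by simp

lemma bump_integrable: assumes "0 < eta" shows "integrable lborel (bump eta :: 'a::euclidean_space => real)"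
proof -
 obtain L where "0 < L" "!!x y::'a. \<bar>bump eta x - bump eta y\<bar> <= L * dist x y"
  "!!x b. b \<in> Basis ==> \<bar>frechet_derivative (bump eta :: 'a => real) (at x) b\<bar> <= L" and L: "!!x::'a. \<bar>bump eta x\<bar> <= L"
  by (rule test_function_lipschitz[OF test_function_bump_UNIV[OF assms]]) (rule that)
 show ?thesis
  by (rule integrable_bounded_support[OF bump_measurable _ _ L bump_zero[OF assms]]) (simp_all add: emeasure_bounded_finite[OF bounded_box, simplified])
qed

lemma bump_integral_pos: assumes "0 < eta" shows "0 < (\<integral>x. bump eta x \<partial>(lborel :: 'a::euclidean_space measure))"
proof -
 have "(\<integral>x. bump eta x \<partial>(lborel :: 'a measure)) ~= 0"
 proof
  assume "(\<integral>x. bump eta x \<partial>(lborel :: 'a measure)) = 0"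
  hence "AE x in (lborel :: 'a measure). bump eta x = 0"
   using integral_nonneg_eq_0_iff_AE[OF bump_integrable[OF assms]] bump_nonneg by auto
  hence "AE x in (lborel :: 'a measure). x \<notin> box (- (eta *\<^sub>R One)) (eta *\<^sub>R One)"
  proof eventually_elim
   fix x :: 'a assume "bump eta x = 0"
   hence "\<not> 0 < bump eta x" by simp
   thus "x \<notin> box (- (eta *\<^sub>R One)) (eta *\<^sub>R One)" using bump_pos[OF assms, of x] by (force simp: mem_box abs_less_iff)
  qed
  hence "emeasure lborel (box (- (eta *\<^sub>R One)) (eta *\<^sub>R One) :: 'a set) = 0"
   by (subst (asm) AE_iff_measurable[OF _ refl]) auto
  moreover have "(0::'a) \<in> box (- (eta *\<^sub>R One)) (eta *\<^sub>R One)" using assms by (simp add: mem_box)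
  ultimately show False
   using open_not_negligible[of "box (- (eta *\<^sub>R One)) (eta *\<^sub>R One) :: 'a set"] by (auto simp: negligible_iff_emeasure0)
 qed
 moreover have "0 <= (\<integral>x. bump eta x \<partial>(lborel :: 'a measure))" by (rule Bochner_Integration.integral_nonneg) (rule bump_nonneg)
 ultimately show ?thesis by (simp add: less_le)
qed

definition moll :: "real => 'a::euclidean_space => real" where
 "moll eta z = bump eta z / (\<integral>x. bump eta x \<partial>(lborel :: 'a measure))"

lemma moll_measurable [measurable]: "(moll eta :: 'a::euclidean_space => real) \<in> borel_measurable borel"
 unfolding moll_def by measurable

lemma moll_nonneg: "0 < eta ==> 0 <= moll eta (z :: 'a::euclidean_space)"
 unfolding moll_def using bump_nonneg[of eta z] bump_integral_pos[where 'a = 'a, of eta] by simp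

lemma moll_sym: "moll eta (x - y) = moll eta (y - x)"
 unfolding moll_def using bump_uminus[of eta "y - x"] by simp

lemma moll_integrable: "0 < eta ==> integrable lborel (%y::'a::euclidean_space. moll eta (y - x))"
proof -
 assume "0 < eta"
 hence "integrable lborel (moll eta :: 'a => real)" unfolding moll_def[abs_def] by (intro integrable_divide_zero bump_integrable)
 from integrable_translate[OF moll_measurable this, of "- x"] show ?thesis by simp
qed

lemma moll_integral: "0 < eta ==> (\<integral>y. moll eta (y - x) \<partial>(lborel :: 'a::euclidean_space measure)) = 1"
 using integral_translate[OF moll_measurable, of eta "- x"] bump_integral_pos[where 'a = 'a, of eta] by (simp add: moll_def)

lemma moll_nn_integral:
 assumes "0 < eta"
 shows "(\<integral>\<^sup>+y. ennreal (moll eta (y - x)) \<partial>(lborel :: 'a::euclidean_space measure)) = 1"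
  and "(\<integral>\<^sup>+y. ennreal (moll eta (x - y)) \<partial>(lborel :: 'a::euclidean_space measure)) = 1"
proof -
 show 1: "(\<integral>\<^sup>+y. ennreal (moll eta (y - x)) \<partial>(lborel :: 'a measure)) = 1"
  using nn_integral_eq_integral[OF moll_integrable[OF assms, of x] AE_I2[OF moll_nonneg[OF assms]]] moll_integral[OF assms, of x] by simp
 show "(\<integral>\<^sup>+y. ennreal (moll eta (x - y)) \<partial>(lborel :: 'a measure)) = 1" using 1 by (simp add: moll_sym)
qed

lemma moll_near: "0 < eta ==> moll eta (z :: 'a::euclidean_space) ~= 0 ==> norm z <= real DIM('a) * eta"
proof -
 assume "0 < eta" "moll eta z ~= 0"
 hence "z \<in> box (- (eta *\<^sub>R One)) (eta *\<^sub>R One)" using bump_zero[of eta z] by (auto simp: moll_def)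
 hence "\<bar>z \<bullet> b\<bar> <= eta" if "b \<in> Basis" for b using that by (force simp: mem_box abs_le_iff)
 hence "(\<Sum>b\<in>Basis. \<bar>z \<bullet> b\<bar>) <= real DIM('a) * eta" by (rule sum_bounded_above)
 thus ?thesis using norm_le_l1[of z] by linarith
qed

lemma test_function_moll:
 assumes "0 < eta" "cbox (x - eta *\<^sub>R One) (x + eta *\<^sub>R One) \<subseteq> U"
 shows "test_function U (%y. moll eta (y - x))"
 using test_function_bump[OF assms, of "1 / (\<integral>x. bump eta x \<partial>(lborel :: 'a::euclidean_space measure))"] by (simp add: moll_def[abs_def])

lemma moll_lipschitz:
 assumes "0 < eta"
 obtains L where "0 < L" "!!x y :: 'a::euclidean_space. \<bar>moll eta x - moll eta y\<bar> <= L * dist x y" "!!x::'a. \<bar>moll eta x\<bar> <= L"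
proof -
 have "test_function UNIV (%y::'a. moll eta (y - 0))" by (rule test_function_moll[OF assms]) simp
 hence t: "test_function UNIV (moll eta :: 'a => real)" by simp
 show ?thesis by (rule test_function_lipschitz[OF t]) (rule that)
qed

text \<open>Convolution with the normalized bump function, which is even.\<close>

definition mollify :: "real => ('a::euclidean_space => real) => 'a => real" where
 "mollify eta f x = (\<integral>y. f y * moll eta (y - x) \<partial>lborel)"

lemma mollify_integrable:
 fixes f :: "'a::euclidean_space => real"
 assumes "0 < eta" and f: "integrable lborel f" shows "integrable lborel (%y. f y * moll eta (y - x))"
proof -
 obtain L where "0 < L" "!!x y::'a. \<bar>moll eta x - moll eta y\<bar> <= L * dist x y" and L: "!!x::'a. \<bar>moll eta x\<bar> <= L"
  by (rule moll_lipschitz[OF assms(1)]) (rule that)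
 have [measurable]: "f \<in> borel_measurable borel" using f by simp
 show ?thesis
 proof (rule Bochner_Integration.integrable_bound[of lborel "%y. L * f y"])
  show "AE y in lborel. norm (f y * moll eta (y - x)) <= norm (L * f y)"
  proof (rule AE_I2)
   fix y
   have "0 <= L" using L[of x] by simp
   thus "norm (f y * moll eta (y - x)) <= norm (L * f y)"
    using mult_left_mono[OF L[of "y - x"] abs_ge_zero[of "f y"]] by (simp add: abs_mult mult.commute)
  qed
 qed (use f in auto)
qed

lemma mollify_lipschitz:
 fixes f :: "'a::euclidean_space => real"
 assumes "0 < eta" and f: "integrable lborel f"
 obtains L where "0 <= L" "!!x x'. \<bar>mollify eta f x - mollify eta f x'\<bar> <= L * dist x x'"
proof -
 obtain L where L: "0 < L" "!!x y::'a. \<bar>moll eta x - moll eta y\<bar> <= L * dist x y" "!!x::'a. \<bar>moll eta x\<bar> <= L"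
  by (rule moll_lipschitz[OF assms(1)]) (rule that)
 have "\<bar>mollify eta f x - mollify eta f x'\<bar> <= (L * (\<integral>y. \<bar>f y\<bar> \<partial>lborel)) * dist x x'" for x x'
 proof -
  have "mollify eta f x - mollify eta f x' = (\<integral>y. f y * moll eta (y - x) - f y * moll eta (y - x') \<partial>lborel)"
   unfolding mollify_def by (rule Bochner_Integration.integral_diff[symmetric]; rule mollify_integrable[OF assms])
  also have "\<bar>...\<bar> <= (\<integral>y. \<bar>f y * moll eta (y - x) - f y * moll eta (y - x')\<bar> \<partial>lborel)" by (rule integral_abs_bound)
  also have "... <= (\<integral>y. (L * dist x x') * \<bar>f y\<bar> \<partial>lborel)"
  proof (rule integral_mono)
   show "integrable lborel (%y. \<bar>f y * moll eta (y - x) - f y * moll eta (y - x')\<bar>)"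
    using mollify_integrable[OF assms, of x] mollify_integrable[OF assms, of x'] by simp
   show "integrable lborel (%y. (L * dist x x') * \<bar>f y\<bar>)" using f by simp
   fix y
   have "\<bar>moll eta (y - x) - moll eta (y - x')\<bar> <= L * dist x x'"
    using L(2)[of "y - x" "y - x'"] by (simp add: dist_norm norm_minus_commute)
   hence "\<bar>f y\<bar> * \<bar>moll eta (y - x) - moll eta (y - x')\<bar> <= \<bar>f y\<bar> * (L * dist x x')" by (rule mult_left_mono) simp
   thus "\<bar>f y * moll eta (y - x) - f y * moll eta (y - x')\<bar> <= (L * dist x x') * \<bar>f y\<bar>"
    by (simp only: right_diff_distrib[symmetric] abs_mult mult.commute)
  qed
  also have "... = (L * dist x x') * (\<integral>y. \<bar>f y\<bar> \<partial>lborel)" by simp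
  finally show ?thesis by (simp add: mult_ac)
 qed
 moreover have "0 <= L * (\<integral>y. \<bar>f y\<bar> \<partial>lborel)" using L by simp
 ultimately show ?thesis by (intro that)
qed

lemma mollify_continuous:
 fixes f :: "'a::euclidean_space => real"
 assumes "0 < eta" and f: "integrable lborel f"
 shows "continuous_on UNIV (mollify eta f)"
proof -
 obtain L where L: "0 <= L" "!!x x'. \<bar>mollify eta f x - mollify eta f x'\<bar> <= L * dist x x'" by (rule mollify_lipschitz[OF assms]) (rule that)
 have "L-lipschitz_on UNIV (mollify eta f)" by (rule lipschitz_onI) (use L in "simp_all add: dist_real_def")
 thus ?thesis by (rule lipschitz_on_continuous_on)
qed

lemma mollify_measurable:
 fixes f :: "'a::euclidean_space => real"
 assumes "0 < eta" and f: "integrable lborel f"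
 shows "mollify eta f \<in> borel_measurable borel"
 by (rule borel_measurable_continuous_onI[OF mollify_continuous[OF assms]])

lemma mollify_nonneg:
 assumes "0 < eta" "!!x. 0 <= f x" shows "0 <= mollify eta f x"
 unfolding mollify_def by (rule Bochner_Integration.integral_nonneg, rule mult_nonneg_nonneg) (use assms moll_nonneg in simp_all)

lemma mollify_diff:
 fixes f :: "'a::euclidean_space => real"
 assumes "0 < eta" "integrable lborel f" "integrable lborel g"
 shows "mollify eta (%x. f x - g x) x = mollify eta f x - mollify eta g x"
 unfolding mollify_def left_diff_distrib
 by (rule Bochner_Integration.integral_diff; rule mollify_integrable[OF assms(1)]; fact)

text \<open>Young's inequality, by exchanging the integrals.\<close>

lemma mollify_L1:
 fixes f :: "'a::euclidean_space => real"
 assumes "0 < eta" and f: "integrable lborel f"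
 shows "(\<integral>\<^sup>+x. ennreal \<bar>mollify eta f x\<bar> \<partial>lborel) <= (\<integral>\<^sup>+x. ennreal \<bar>f x\<bar> \<partial>lborel)"
proof -
 have [measurable]: "f \<in> borel_measurable borel" using f by simp
 have "(\<integral>\<^sup>+x. ennreal \<bar>mollify eta f x\<bar> \<partial>lborel) <= (\<integral>\<^sup>+x. \<integral>\<^sup>+y. ennreal \<bar>f y\<bar> * ennreal (moll eta (y - x)) \<partial>lborel \<partial>lborel)"
 proof (rule nn_integral_mono)
  fix x
  have "ennreal \<bar>mollify eta f x\<bar> <= ennreal (\<integral>y. \<bar>f y * moll eta (y - x)\<bar> \<partial>lborel)"
   unfolding mollify_def by (rule ennreal_leI[OF integral_abs_bound])
  also have "... = (\<integral>\<^sup>+y. ennreal \<bar>f y * moll eta (y - x)\<bar> \<partial>lborel)"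
   by (rule nn_integral_eq_integral[symmetric]) (use mollify_integrable[OF assms, of x] in auto)
  also have "... = (\<integral>\<^sup>+y. ennreal \<bar>f y\<bar> * ennreal (moll eta (y - x)) \<partial>lborel)"
   by (intro nn_integral_cong) (simp add: abs_mult moll_nonneg[OF assms(1)] ennreal_mult)
  finally show "ennreal \<bar>mollify eta f x\<bar> <= (\<integral>\<^sup>+y. ennreal \<bar>f y\<bar> * ennreal (moll eta (y - x)) \<partial>lborel)" .
 qed
 also have "... = (\<integral>\<^sup>+y. \<integral>\<^sup>+x. ennreal \<bar>f y\<bar> * ennreal (moll eta (y - x)) \<partial>lborel \<partial>lborel)"
  by (rule lborel_pair.Fubini'[symmetric]) measurable
 also have "... = (\<integral>\<^sup>+y. ennreal \<bar>f y\<bar> \<partial>lborel)"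
  by (intro nn_integral_cong) (simp add: nn_integral_cmult moll_nn_integral[OF assms(1)])
 finally show ?thesis .
qed

text \<open>Jensen's inequality as the nonnegativity of a variance.\<close>

lemma mollify_jensen:
 fixes f :: "'a::euclidean_space => real"
 assumes "0 < eta" and f: "integrable lborel f" "integrable lborel (%x. (f x)^2)"
 shows "(mollify eta f x)^2 <= mollify eta (%x. (f x)^2) x"
proof -
 let ?c = "mollify eta f x"
 have "0 <= (\<integral>y. (f y - ?c)^2 * moll eta (y - x) \<partial>lborel)"
  by (rule Bochner_Integration.integral_nonneg) (simp add: moll_nonneg[OF assms(1)])
 also have "... = (\<integral>y. (f y)^2 * moll eta (y - x) - 2 * ?c * (f y * moll eta (y - x)) + ?c^2 * moll eta (y - x) \<partial>lborel)"
  by (intro Bochner_Integration.integral_cong) (simp_all add: power2_eq_square algebra_simps)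
 also have "... = mollify eta (%x. (f x)^2) x - 2 * ?c * ?c + ?c^2 * 1"
 proof -
  note I = mollify_integrable[OF assms(1) f(2), of x] mollify_integrable[OF assms(1) f(1), of x] moll_integrable[OF assms(1), of x]
  show ?thesis
   by (simp only: Bochner_Integration.integral_add[OF Bochner_Integration.integrable_diff[OF I(1) integrable_mult_right[OF I(2)]] integrable_mult_right[OF I(3)]]
     Bochner_Integration.integral_diff[OF I(1) integrable_mult_right[OF I(2)]] integral_mult_right_zero moll_integral[OF assms(1)] mollify_def)
 qed
 also have "... = mollify eta (%x. (f x)^2) x - ?c^2" by (simp add: power2_eq_square)
 finally show ?thesis by simp
qed

lemma mollify_square_integral:
 fixes f :: "'a::euclidean_space => real"
 assumes "0 < eta" and f: "integrable lborel f" "integrable lborel (%x. (f x)^2)"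
 shows "(\<integral>\<^sup>+x. ennreal ((mollify eta f x)^2) \<partial>lborel) <= (\<integral>\<^sup>+x. ennreal ((f x)^2) \<partial>lborel)"
proof -
 have "(\<integral>\<^sup>+x. ennreal ((mollify eta f x)^2) \<partial>lborel) <= (\<integral>\<^sup>+x. ennreal \<bar>mollify eta (%x. (f x)^2) x\<bar> \<partial>lborel)"
  by (intro nn_integral_mono ennreal_leI order_trans[OF mollify_jensen[OF assms] abs_ge_self])
 also have "... <= (\<integral>\<^sup>+x. ennreal \<bar>(f x)^2\<bar> \<partial>lborel)" by (rule mollify_L1[OF assms(1) f(2)])
 finally show ?thesis by simp
qed

text \<open>Truncate to a bounded function T n of bounded support, then use that it is an almost everywhere limit of
continuous functions. Clamping these by cl and cutting them off by ct gives a common integrable majorant.\<close>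

lemma L1_continuous_approx:
 fixes f :: "'a::euclidean_space => real"
 assumes f: "integrable lborel f" and e: "0 < e"
 obtains h R where "continuous_on UNIV h" "!!x. R < norm x ==> h x = 0" "integrable lborel h"
  "(\<integral>x. \<bar>f x - h x\<bar> \<partial>lborel) < e"
proof -
 have small: "\<exists>n. (\<integral>x. d n x \<partial>lborel) < e / 2"
  if "!!n. d n \<in> borel_measurable lborel" "integrable lborel w" "AE x in lborel. (%n. d n x) \<longlonglongrightarrow> 0" "!!n x. \<bar>d n x\<bar> <= w x"
  for d :: "nat => 'a => real" and w
 proof -
  have "(%n. \<integral>x. d n x \<partial>lborel) \<longlonglongrightarrow> (\<integral>x. 0 \<partial>(lborel :: 'a measure))"
   by (rule integral_dominated_convergence[where w = w]) (use that in auto)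
  hence "\<forall>\<^sub>F n in sequentially. (\<integral>x. d n x \<partial>lborel) < e / 2" by (rule order_tendstoD(2)) (use e in simp)
  thus ?thesis unfolding eventually_sequentially by blast
 qed
 have [measurable]: "f \<in> borel_measurable borel" using f by simp
 define T where "T n x = (if \<bar>f x\<bar> <= real n & norm x <= real n then f x else 0)" for n x
 have Tm[measurable]: "T n \<in> borel_measurable borel" for n unfolding T_def by measurable
 have "(%n. \<bar>f x - T n x\<bar>) \<longlonglongrightarrow> 0" for x
 proof -
  obtain n0 where "max \<bar>f x\<bar> (norm x) <= real n0" using real_arch_simple by blast
  hence "\<bar>f x - T n x\<bar> = 0" if "n0 <= n" for n using that by (simp add: T_def)
  thus ?thesis by (intro tendsto_eventually) (auto simp: eventually_sequentially)
 qed
 hence "\<exists>n. (\<integral>x. \<bar>f x - T n x\<bar> \<partial>lborel) < e / 2"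
  by (intro small[where w = "%x. \<bar>f x\<bar>"]) (use f in "simp_all add: T_def")
 then obtain n where n: "(\<integral>x. \<bar>f x - T n x\<bar> \<partial>lborel) < e / 2" ..
 define cl where "cl y = max (- real n) (min (real n) y)" for y
 define ct where "ct x = max 0 (min 1 (real n + 1 - norm x))" for x :: 'a
 have cl: "continuous_on UNIV cl" "\<bar>cl y\<bar> <= real n" for y by (auto simp: cl_def intro!: continuous_intros)
 have ct: "continuous_on UNIV ct" "0 <= ct x" "ct x <= 1" "real n + 1 < norm x ==> ct x = 0" for x
  by (auto simp: ct_def intro!: continuous_intros)
 have Tc: "T n x = cl (T n x) * ct x" for x by (auto simp: T_def cl_def ct_def)
 have "T n measurable_on UNIV" by (intro lebesgue_measurable_imp_measurable_on_real measurable_completion) auto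
 then obtain N g where N: "negligible N" and g: "!!k::nat. continuous_on UNIV (g k)" "!!x. x \<notin> N ==> (%k. g k x) \<longlonglongrightarrow> T n x"
  unfolding measurable_on_def by auto
 have AEN: "AE x in lborel. x \<notin> N"
  using AE_not_in[of N lebesgue] N by (simp add: negligible_iff_null_sets AE_completion_iff)
 define H where "H k x = cl (g k x) * ct x" for k x
 have cH: "continuous_on UNIV (H k)" for k
  unfolding H_def by (intro continuous_on_mult ct continuous_on_compose2[OF cl(1) g(1)]) auto
 have mH[measurable]: "H k \<in> borel_measurable borel" for k by (rule borel_measurable_continuous_onI[OF cH])
 have b: "\<bar>cl y * ct x\<bar> <= real n" for y x using mult_mono[OF cl(2) ct(3)] ct(2)[of x] by (simp add: abs_mult)
 let ?B = "cball (0::'a) (real n + 1)"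
 have fin: "emeasure lborel ?B < \<infinity>" by (rule emeasure_bounded_finite[OF bounded_cball])
 have i: "integrable lborel (H k)" "integrable lborel (T n)" for k
  using ct(4) by (auto intro!: integrable_bounded_support[OF _ _ fin, where B = "real n"] simp: H_def b T_def)
 have "\<exists>k. (\<integral>x. \<bar>T n x - H k x\<bar> \<partial>lborel) < e / 2"
 proof (rule small[where w = "%x. 2 * real n * indicator ?B x"])
  show "AE x in lborel. (%k. \<bar>T n x - H k x\<bar>) \<longlonglongrightarrow> 0"
   using AEN
  proof eventually_elim
   fix x assume "x \<notin> N"
   hence "(%k. cl (g k x)) \<longlonglongrightarrow> cl (T n x)" using continuous_on_tendsto_compose[OF cl(1) g(2), of x] by simp
   hence "(%k. \<bar>T n x - cl (g k x) * ct x\<bar>) \<longlonglongrightarrow> \<bar>T n x - cl (T n x) * ct x\<bar>" by (intro tendsto_intros)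
   thus "(%k. \<bar>T n x - H k x\<bar>) \<longlonglongrightarrow> 0" using Tc[of x] by (simp add: H_def)
  qed
  show "\<bar>\<bar>T n x - H k x\<bar>\<bar> <= 2 * real n * indicator ?B x" for k x
   using b[of "g k x" x] b[of "T n x" x] ct(4)[of x] Tc[of x] unfolding H_def by (cases "x \<in> ?B") auto
  show "integrable lborel (%x. 2 * real n * indicator ?B x)" using fin by (intro integrable_mult_right integrable_real_indicator) auto
 qed measurable
 then obtain k where k: "(\<integral>x. \<bar>T n x - H k x\<bar> \<partial>lborel) < e / 2" ..
 have "(\<integral>x. \<bar>f x - H k x\<bar> \<partial>lborel) <= (\<integral>x. \<bar>f x - T n x\<bar> + \<bar>T n x - H k x\<bar> \<partial>lborel)"
  by (rule integral_mono) (use f i in auto)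
 also have "... = (\<integral>x. \<bar>f x - T n x\<bar> \<partial>lborel) + (\<integral>x. \<bar>T n x - H k x\<bar> \<partial>lborel)"
  by (rule Bochner_Integration.integral_add) (use f i in auto)
 also have "... < e" using n k by linarith
 finally show ?thesis using that[of "H k" "real n + 1", OF cH] i ct(4) by (simp add: H_def)
qed

text \<open>For a uniformly continuous function the mollification is uniformly close; an integrable function is close to
such a function in mean, and mollification does not increase the mean error.\<close>

lemma mollify_L1_tendsto:
 fixes f :: "'a::euclidean_space => real"
 assumes f: "integrable lborel f" and A: "A \<in> sets borel" "emeasure lborel A < \<infinity>" and e: "0 < e"
 obtains eta0 where "0 < eta0" "!!eta. 0 < eta ==> eta < eta0 ==> (\<integral>\<^sup>+x. ennreal \<bar>f x - mollify eta f x\<bar> * indicator A x \<partial>lborel) <= ennreal e"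
proof -
 note [measurable] = A(1)
 have [measurable]: "f \<in> borel_measurable borel" using f by simp
 obtain h R where h: "continuous_on UNIV h" "!!x. R < norm x ==> h x = 0" "integrable lborel h" "(\<integral>x. \<bar>f x - h x\<bar> \<partial>lborel) < e / 3"
  by (rule L1_continuous_approx[OF f, of "e / 3"]) (use e in simp, rule that)
 have hm[measurable]: "h \<in> borel_measurable borel" using h(3) by simp
 have fh: "(\<integral>\<^sup>+x. ennreal \<bar>f x - h x\<bar> \<partial>lborel) <= ennreal (e / 3)"
  using nn_integral_eq_integral[of lborel "%x. \<bar>f x - h x\<bar>"] f h(3,4) by (simp add: ennreal_leI)
 define a where "a = measure lborel A"
 have a: "0 <= a" "emeasure lborel A = ennreal a" using A(2) by (auto simp: a_def emeasure_eq_ennreal_measure less_top)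
 define kappa where "kappa = e / 3 / (a + 1)"
 have kappa: "0 < kappa" using e a by (simp add: kappa_def add_nonneg_pos)
 have "uniformly_continuous_on (cball 0 (R + 1)) h"
  by (rule compact_uniformly_continuous[OF continuous_on_subset[OF h(1)]]) auto
 then obtain delta where delta: "0 < delta" "!!x y. x \<in> cball 0 (R + 1) ==> y \<in> cball 0 (R + 1) ==> dist y x < delta ==> dist (h y) (h x) < kappa"
  unfolding uniformly_continuous_on_def using kappa by metis
 have uc: "\<bar>h y - h x\<bar> <= kappa" if d: "dist y x < min delta 1" for x y
 proof (cases "norm x <= R + 1 & norm y <= R + 1")
  case True
  thus ?thesis using delta(2)[of x y] d by (simp add: dist_real_def)
 next
  case False
  have "norm x <= norm y + dist y x" "norm y <= norm x + dist y x"
   using norm_triangle_ineq2[of x y] norm_triangle_ineq2[of y x] by (simp_all add: dist_norm norm_minus_commute)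
  hence "R < norm x" "R < norm y" using False d by auto
  thus ?thesis using h(2) kappa by simp
 qed
 define eta0 where "eta0 = min delta 1 / real DIM('a)"
 have "0 < eta0" using delta by (simp add: eta0_def)
 moreover have "(\<integral>\<^sup>+x. ennreal \<bar>f x - mollify eta f x\<bar> * indicator A x \<partial>lborel) <= ennreal e" if eta: "0 < eta" "eta < eta0" for eta
 proof -
  note [measurable] = mollify_measurable[OF eta(1) f] mollify_measurable[OF eta(1) h(3)]
  have hh: "\<bar>h x - mollify eta h x\<bar> <= kappa" for x
  proof -
   have near: "dist y x < min delta 1" if "moll eta (y - x) ~= 0" for y
   proof -
    have "norm (y - x) <= real DIM('a) * eta" by (rule moll_near[OF eta(1) that])
    also have "... < real DIM('a) * eta0" using eta(2) by simp
    also have "... = min delta 1" by (simp add: eta0_def)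
    finally show ?thesis by (simp add: dist_norm)
   qed
   have i: "integrable lborel (%y. h x * moll eta (y - x))" using moll_integrable[OF eta(1), of x] by simp
   have "h x - mollify eta h x = (\<integral>y. h x * moll eta (y - x) \<partial>lborel) - (\<integral>y. h y * moll eta (y - x) \<partial>lborel)"
    by (simp add: moll_integral[OF eta(1)] mollify_def)
   also have "... = (\<integral>y. h x * moll eta (y - x) - h y * moll eta (y - x) \<partial>lborel)"
    by (rule Bochner_Integration.integral_diff[symmetric, OF i mollify_integrable[OF eta(1) h(3)]])
   also have "\<bar>...\<bar> <= (\<integral>y. \<bar>h x * moll eta (y - x) - h y * moll eta (y - x)\<bar> \<partial>lborel)" by (rule integral_abs_bound)
   also have "... <= (\<integral>y. kappa * moll eta (y - x) \<partial>lborel)"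
   proof (rule integral_mono)
    show "integrable lborel (%y. \<bar>h x * moll eta (y - x) - h y * moll eta (y - x)\<bar>)"
     using i mollify_integrable[OF eta(1) h(3)] by simp
    show "integrable lborel (%y. kappa * moll eta (y - x))" using moll_integrable[OF eta(1), of x] by simp
    fix y
    have "\<bar>h x - h y\<bar> * moll eta (y - x) <= kappa * moll eta (y - x)"
    proof (cases "moll eta (y - x) = 0")
     case False
     hence "\<bar>h x - h y\<bar> <= kappa" using uc[OF near, of y] by (simp add: abs_minus_commute)
     thus ?thesis by (rule mult_right_mono[OF _ moll_nonneg[OF eta(1)]])
    qed simp
    thus "\<bar>h x * moll eta (y - x) - h y * moll eta (y - x)\<bar> <= kappa * moll eta (y - x)"
     by (simp add: left_diff_distrib[symmetric] abs_mult moll_nonneg[OF eta(1)])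
   qed
   also have "... = kappa" by (simp add: moll_integral[OF eta(1)])
   finally show ?thesis .
  qed
  have "(\<integral>\<^sup>+x. ennreal \<bar>f x - mollify eta f x\<bar> * indicator A x \<partial>lborel) <=
   (\<integral>\<^sup>+x. ennreal \<bar>f x - h x\<bar> + (ennreal kappa * indicator A x + ennreal \<bar>mollify eta (%x. h x - f x) x\<bar>) \<partial>lborel)"
  proof (rule nn_integral_mono)
   fix x
   have "\<bar>f x - mollify eta f x\<bar> <= \<bar>f x - h x\<bar> + (kappa + \<bar>mollify eta (%x. h x - f x) x\<bar>)"
    using hh[of x] unfolding mollify_diff[OF eta(1) h(3) f] by linarith
   hence "ennreal \<bar>f x - mollify eta f x\<bar> <= ennreal \<bar>f x - h x\<bar> + (ennreal kappa + ennreal \<bar>mollify eta (%x. h x - f x) x\<bar>)"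
    using kappa by (simp add: ennreal_plus[symmetric] ennreal_leI del: ennreal_plus)
   thus "ennreal \<bar>f x - mollify eta f x\<bar> * indicator A x <= ennreal \<bar>f x - h x\<bar> + (ennreal kappa * indicator A x + ennreal \<bar>mollify eta (%x. h x - f x) x\<bar>)"
    by (cases "x \<in> A") auto
  qed
  also have "... = (\<integral>\<^sup>+x. ennreal \<bar>f x - h x\<bar> \<partial>lborel) + (ennreal kappa * emeasure lborel A + (\<integral>\<^sup>+x. ennreal \<bar>mollify eta (%x. h x - f x) x\<bar> \<partial>lborel))"
  proof -
   have [measurable]: "mollify eta (%x. h x - f x) \<in> borel_measurable borel"
    by (rule mollify_measurable[OF eta(1)]) (use h f in simp)
   show ?thesis by (simp add: nn_integral_add nn_integral_cmult_indicator)
  qed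
  also have "... <= ennreal (e / 3) + (ennreal (e / 3) + ennreal (e / 3))"
  proof (intro add_mono fh)
   have "kappa * a <= e / 3" using kappa a e unfolding kappa_def by (simp add: field_simps)
   thus "ennreal kappa * emeasure lborel A <= ennreal (e / 3)"
    using kappa a by (simp add: ennreal_mult[symmetric] ennreal_leI)
   have "(\<integral>\<^sup>+x. ennreal \<bar>mollify eta (%x. h x - f x) x\<bar> \<partial>lborel) <= (\<integral>\<^sup>+x. ennreal \<bar>h x - f x\<bar> \<partial>lborel)"
    by (rule mollify_L1[OF eta(1)]) (use h f in simp)
   thus "(\<integral>\<^sup>+x. ennreal \<bar>mollify eta (%x. h x - f x) x\<bar> \<partial>lborel) <= ennreal (e / 3)"
    using fh by (simp add: abs_minus_commute)
  qed
  also have "... = ennreal e" using e by (simp add: ennreal_plus[symmetric] del: ennreal_plus)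
  finally show ?thesis .
 qed
 ultimately show ?thesis by (rule that)
qed

section \<open>Lipschitz images of Lebesgue measure\<close>

lemma dist_in_cube:
 fixes x y :: "'a::euclidean_space"
 assumes "x \<in> cbox u v" "y \<in> cbox u v" "!!i. i \<in> Basis ==> v \<bullet> i - u \<bullet> i = s"
 shows "dist x y <= real DIM('a) * s"
proof -
 have "\<bar>(x - y) \<bullet> i\<bar> <= s" if "i \<in> Basis" for i
  using assms(1,2) assms(3)[OF that] that unfolding mem_box inner_diff_left by fastforce
 hence "(\<Sum>i\<in>Basis. \<bar>(x - y) \<bullet> i\<bar>) <= real DIM('a) * s" by (rule sum_bounded_above)
 thus ?thesis using norm_le_l1[of "x - y"] by (simp add: dist_norm)
qed

lemma cball_subset_cube:
 fixes x :: "'a::euclidean_space" shows "cball x r \<subseteq> cbox (x - r *\<^sub>R One) (x + r *\<^sub>R One)"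
proof
 fix y assume "y \<in> cball x r"
 hence "\<bar>(y - x) \<bullet> i\<bar> <= r" if "i \<in> Basis" for i
  using Basis_le_norm[OF that, of "y - x"] by (simp add: dist_norm norm_minus_commute)
 thus "y \<in> cbox (x - r *\<^sub>R One) (x + r *\<^sub>R One)"
  by (force simp: mem_box inner_simps abs_le_iff)
qed

lemma emeasure_cube:
 fixes x :: "'a::euclidean_space" assumes "0 <= r"
 shows "emeasure lborel (cbox (x - r *\<^sub>R One) (x + r *\<^sub>R One)) = ennreal ((2 * r) ^ DIM('a))"
proof -
 have "emeasure lborel (cbox (x - r *\<^sub>R One) (x + r *\<^sub>R One)) = ennreal (\<Prod>b\<in>Basis. ((x + r *\<^sub>R One) - (x - r *\<^sub>R One)) \<bullet> b)"
  by (rule emeasure_lborel_cbox) (use assms in "simp add: inner_simps")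
 also have "(\<Prod>b\<in>(Basis::'a set). ((x + r *\<^sub>R One) - (x - r *\<^sub>R One)) \<bullet> b) = (\<Prod>b\<in>(Basis::'a set). 2 * r)"
  by (rule prod.cong) (simp_all add: inner_simps)
 finally show ?thesis by simp
qed

lemma emeasure_cball_le:
 fixes x :: "'a::euclidean_space" assumes "0 <= r"
 shows "emeasure lborel (cball x r) <= ennreal ((2 * r) ^ DIM('a))"
 using emeasure_mono[OF cball_subset_cube[of x r], of lborel] emeasure_cube[OF assms, of x] by simp

text \<open>Cover the set by nonoverlapping dyadic cubes inside an open set of nearly the same measure. The image of a
cube of side s lies in a ball of radius L * d * s, whose measure is a fixed multiple of the measure of the
cube.\<close>

lemma lip_image_emeasure:
 fixes theta :: "'a::euclidean_space => 'a"
 assumes L: "0 <= L" and lip: "!!a b. a \<in> S ==> b \<in> S ==> dist (theta a) (theta b) <= L * dist a b"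
  and S: "S \<in> sets borel" "bounded S" and thetaS: "theta ` S \<in> sets borel"
 shows "emeasure lborel (theta ` S) <= ennreal ((2 * (L * real DIM('a))) ^ DIM('a)) * emeasure lborel S"
proof -
 let ?d = "DIM('a)" let ?C = "(2 * (L * real DIM('a))) ^ DIM('a)"
 have C0: "0 <= ?C" using L by simp
 have fin: "emeasure lborel S < \<infinity>" by (rule emeasure_bounded_finite[OF S(2)])
 have main: "emeasure lborel (theta ` S) <= ennreal ?C * (emeasure lborel S + ennreal e)" if e: "0 < e" for e
 proof -
  \<comment> \<open>Cubes inside U have total measure close to that of S.\<close>
  obtain U where U: "open U" "S \<subseteq> U" "emeasure lborel (U - S) < ennreal e"
   using outer_regular_lborel[OF S(1) e] by blast
  have "emeasure lborel U <= emeasure lborel S + emeasure lborel (U - S)"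
   using emeasure_subadditive[of S lborel "U - S"] S(1) U by (simp add: Un_absorb1)
  also have "... <= emeasure lborel S + ennreal e" using U(3) by (intro add_left_mono) simp
  finally have Ue: "emeasure lborel U <= emeasure lborel S + ennreal e" .
  obtain r where r: "0 < r" "!!x. x \<in> S ==> norm x <= r" using S(2) bounded_pos by metis
  let ?a = "0 - r *\<^sub>R One :: 'a" and ?b = "0 + r *\<^sub>R One :: 'a"
  have Sab: "S \<subseteq> cbox ?a ?b" using r(2) cball_subset_cube[of 0 r] by force
  have ne: "box ?a ?b ~= {}" using r(1) by (auto simp: box_ne_empty inner_simps)
  have ga: "gauge (%x. if x \<in> S then U else UNIV)" using U by (auto simp: gauge_def)
  obtain \<D> where \<D>: "countable \<D>" "\<Union>\<D> \<subseteq> cbox ?a ?b"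
   "!!K. K \<in> \<D> ==> interior K ~= {} & (\<exists>c d. K = cbox c d)"
   "pairwise (%A B. interior A \<inter> interior B = {}) \<D>"
   "!!K. K \<in> \<D> ==> \<exists>x \<in> S \<inter> K. K \<subseteq> (if x \<in> S then U else UNIV)"
   "!!u v. cbox u v \<in> \<D> ==> \<exists>n. \<forall>i \<in> Basis. v \<bullet> i - u \<bullet> i = (?b \<bullet> i - ?a \<bullet> i) / 2^n"
   "S \<subseteq> \<Union>\<D>"
   by (rule covering_lemma[OF Sab ne ga]) (rule that)
  have KU: "K \<subseteq> U" if "K \<in> \<D>" for K using \<D>(5)[OF that] by auto
  have Q: "\<exists>Q. Q \<in> sets borel & theta ` (S \<inter> K) \<subseteq> Q & emeasure lborel Q <= ennreal ?C * emeasure lborel (interior K)" if K: "K \<in> \<D>" for K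
  proof -
   obtain u v where uv: "K = cbox u v" using \<D>(3)[OF K] by blast
   then obtain n where n: "!!i. i \<in> Basis ==> v \<bullet> i - u \<bullet> i = (?b \<bullet> i - ?a \<bullet> i) / 2^n" using \<D>(6) K by metis
   define s where "s = 2 * r / 2 ^ n"
   have s: "0 < s" "!!i. i \<in> Basis ==> v \<bullet> i - u \<bullet> i = s" using r(1) n by (simp_all add: s_def inner_simps)
   obtain x0 where x0: "x0 \<in> S" "x0 \<in> K" using \<D>(5)[OF K] by blast
   let ?r = "L * (real ?d * s)"
   have r0: "0 <= ?r" using L s by simp
   have "theta ` (S \<inter> K) \<subseteq> cball (theta x0) ?r"
   proof
    fix y assume "y \<in> theta ` (S \<inter> K)"
    then obtain x where x: "x \<in> S" "x \<in> K" "y = theta x" by blast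
    have "dist (theta x0) (theta x) <= L * dist x0 x" by (rule lip[OF x0(1) x(1)])
    also have "... <= ?r" using x0(2) x(2) uv s by (intro mult_left_mono[OF dist_in_cube L]) auto
    finally show "y \<in> cball (theta x0) ?r" using x by simp
   qed
   moreover have "emeasure lborel (cball (theta x0) ?r) <= ennreal ?C * emeasure lborel (interior K)"
   proof -
    have "emeasure lborel (cball (theta x0) ?r) <= ennreal ((2 * ?r) ^ ?d)" by (rule emeasure_cball_le[OF r0])
    also have "(2 * ?r) ^ ?d = ?C * s ^ ?d" by (simp add: power_mult_distrib[symmetric] mult_ac)
    also have "ennreal (?C * s ^ ?d) = ennreal ?C * ennreal (s ^ ?d)" using C0 s by (simp add: ennreal_mult)
    also have "ennreal (s ^ ?d) = emeasure lborel (box u v)"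
    proof -
     have "emeasure lborel (box u v) = ennreal (\<Prod>b\<in>Basis. (v - u) \<bullet> b)"
      by (rule emeasure_lborel_box) (use s in "force simp: inner_diff_left")
     also have "(\<Prod>b\<in>Basis. (v - u) \<bullet> b) = (\<Prod>b\<in>(Basis::'a set). s)"
      by (rule prod.cong) (simp_all add: inner_diff_left s(2))
     finally show ?thesis by simp
    qed
    finally show ?thesis by (simp add: uv)
   qed
   ultimately show ?thesis by (intro exI[of _ "cball (theta x0) ?r"]) simp
  qed
  from bchoice[of \<D>] Q obtain Q where Q: "!!K. K \<in> \<D> ==> Q K \<in> sets borel" "!!K. K \<in> \<D> ==> theta ` (S \<inter> K) \<subseteq> Q K"
   "!!K. K \<in> \<D> ==> emeasure lborel (Q K) <= ennreal ?C * emeasure lborel (interior K)" by metis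
  define I where "I = to_nat_on \<D> ` \<D>"
  define k where "k = from_nat_into \<D>"
  have k: "k n \<in> \<D>" if "n \<in> I" for n using that \<D>(1) by (auto simp: I_def k_def)
  have kinj: "k m ~= k n" if "m \<in> I" "n \<in> I" "m ~= n" for m n using that \<D>(1) by (auto simp: I_def k_def)
  have ksur: "\<exists>n\<in>I. k n = K" if "K \<in> \<D>" for K using that \<D>(1) by (auto simp: I_def k_def)
  define P where "P n = (if n \<in> I then Q (k n) else {})" for n
  define B where "B n = (if n \<in> I then interior (k n) else {})" for n
  have "theta ` S \<subseteq> (\<Union>n. P n)"
  proof
   fix y assume "y \<in> theta ` S"
   then obtain x where x: "x \<in> S" "y = theta x" by blast
   then obtain K where K: "K \<in> \<D>" "x \<in> K" using \<D>(7) by blast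
   then obtain n where "n \<in> I" "k n = K" using ksur by blast
   thus "y \<in> (\<Union>n. P n)" using Q(2)[OF K(1)] x K by (auto simp: P_def)
  qed
  moreover have Pm: "P n \<in> sets lborel" for n using Q(1) k by (simp add: P_def)
  ultimately have "emeasure lborel (theta ` S) <= emeasure lborel (\<Union>n. P n)" by (intro emeasure_mono) auto
  also have "... <= suminf (%n. emeasure lborel (P n))" by (rule emeasure_subadditive_countably) (use Pm in auto)
  also have "... <= suminf (%n. ennreal ?C * emeasure lborel (B n))"
   by (intro suminf_le summableI) (use Q(3) k in "auto simp: P_def B_def")
  also have "... = ennreal ?C * suminf (%n. emeasure lborel (B n))" by (rule ennreal_suminf_cmult)
  also have "suminf (%n. emeasure lborel (B n)) = emeasure lborel (\<Union>n. B n)"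
  proof (rule suminf_emeasure)
   show "range B \<subseteq> sets lborel" by (auto simp: B_def)
   have dis: "B m \<inter> B n = {}" if "m ~= n" for m n
    using pairwiseD[OF \<D>(4) k k, of m n] kinj[of m n] that by (auto simp: B_def)
   show "disjoint_family B" using dis by (simp add: disjoint_family_on_def)
  qed
  also have "... <= emeasure lborel U"
  proof (rule emeasure_mono)
   have "B n \<subseteq> U" for n using KU[OF k, of n] interior_subset[of "k n"] by (auto simp: B_def)
   thus "(\<Union>n. B n) \<subseteq> U" by blast
  qed (use U in simp)
  also note Ue
  finally show ?thesis by (simp add: mult_left_mono)
 qed
 obtain m where m: "emeasure lborel S = ennreal m" "0 <= m" using fin by (cases "emeasure lborel S") auto
 show ?thesis
 proof (rule ennreal_le_epsilon)
  fix e :: real assume e: "0 < e"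
  have "emeasure lborel (theta ` S) <= ennreal ?C * (emeasure lborel S + ennreal (e / (?C + 1)))"
   by (rule main) (use e C0 in "simp add: add_nonneg_pos")
  also have "... = ennreal (?C * m + ?C * (e / (?C + 1)))"
   using m C0 e by (simp add: ennreal_plus[symmetric] ennreal_mult[symmetric] distrib_left del: ennreal_plus)
  also have "... <= ennreal (?C * m + e)"
  proof (rule ennreal_leI, rule add_left_mono)
   have "?C * e <= (?C + 1) * e" using e by (intro mult_right_mono) auto
   thus "?C * (e / (?C + 1)) <= e" using C0 by (simp add: pos_divide_le_eq add_nonneg_pos mult.commute)
  qed
  also have "... = ennreal ?C * emeasure lborel S + ennreal e"
   using m C0 e by (simp add: ennreal_mult)
  finally show "emeasure lborel (theta ` S) <= ennreal ?C * emeasure lborel S + ennreal e" .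
 qed
qed

lemma nn_integral_le_of_emeasure_le:
 assumes sets: "sets N1 = sets N2" and le: "!!A. A \<in> sets N1 ==> emeasure N1 A <= C * emeasure N2 A"
  and f: "f \<in> borel_measurable N1"
 shows "(\<integral>\<^sup>+x. f x \<partial>N1) <= C * (\<integral>\<^sup>+x. f x \<partial>N2)"
proof -
 have m: "g \<in> borel_measurable N2" if "g \<in> borel_measurable N1" for g :: "_ => ennreal"
  using that sets by (simp cong: measurable_cong_sets)
 note sp = sets_eq_imp_space_eq[OF sets]
 show ?thesis
  using f
 proof (induction rule: borel_measurable_induct)
  case (cong f g)
  hence "(\<integral>\<^sup>+x. g x \<partial>N1) = (\<integral>\<^sup>+x. f x \<partial>N1)" "(\<integral>\<^sup>+x. g x \<partial>N2) = (\<integral>\<^sup>+x. f x \<partial>N2)"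
   by (auto intro!: nn_integral_cong simp: sp[symmetric])
  thus ?case using cong by simp
 next
  case (set A)
  thus ?case using le sets by simp
 next
  case (mult u c)
  have "c * (\<integral>\<^sup>+x. u x \<partial>N1) <= c * (C * (\<integral>\<^sup>+x. u x \<partial>N2))" by (rule mult_left_mono[OF mult.IH]) simp
  thus ?case using mult m[OF mult.hyps(2)] by (simp add: nn_integral_cmult mult_ac)
 next
  case (add u v)
  have e: "(\<integral>\<^sup>+x. v x + u x \<partial>N1) = integral\<^sup>N N1 v + integral\<^sup>N N1 u"
   "(\<integral>\<^sup>+x. v x + u x \<partial>N2) = integral\<^sup>N N2 v + integral\<^sup>N N2 u"
   by (rule nn_integral_add; (rule m)?; rule add.hyps)+
  show ?case unfolding e distrib_left by (rule add_mono; rule add.IH)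
 next
  case (seq U)
  have mU: "U i \<in> borel_measurable N2" for i using seq m by blast
  have "(\<integral>\<^sup>+x. (SUP i. U i x) \<partial>N1) = (SUP i. \<integral>\<^sup>+x. U i x \<partial>N1)"
   by (rule nn_integral_monotone_convergence_SUP) (use seq in auto)
  also have "... <= (SUP i. C * (\<integral>\<^sup>+x. U i x \<partial>N2))" by (intro SUP_mono) (use seq in blast)
  also have "... = C * (SUP i. \<integral>\<^sup>+x. U i x \<partial>N2)" by (rule SUP_mult_left_ennreal[symmetric])
  also have "(SUP i. \<integral>\<^sup>+x. U i x \<partial>N2) = (\<integral>\<^sup>+x. (SUP i. U i x) \<partial>N2)"
   by (rule nn_integral_monotone_convergence_SUP[symmetric]) (use seq mU in auto)
  finally show ?case by (simp add: image_comp SUP_apply[abs_def])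
 qed
qed

text \<open>The inequality between measures of sets, with phi inverting theta, extends to integrals of nonnegative
functions.\<close>

lemma nn_integral_lip_image:
 fixes theta phi :: "'a::euclidean_space => 'a" and h :: "'a => ennreal"
 assumes W: "compact W" and V: "V = theta ` W" and inv: "!!a. a \<in> W ==> phi (theta a) = a"
  and L: "0 <= L" and lip: "!!a b. a \<in> W ==> b \<in> W ==> dist (theta a) (theta b) <= L * dist a b"
  and cphi: "continuous_on V phi" and h[measurable]: "h \<in> borel_measurable borel"
 shows "(\<integral>\<^sup>+x. h x * indicator V x \<partial>lborel) <=
  ennreal ((2 * (L * real DIM('a))) ^ DIM('a)) * (\<integral>\<^sup>+a. h (theta a) * indicator W a \<partial>lborel)"
proof -
 let ?C = "ennreal ((2 * (L * real DIM('a))) ^ DIM('a))"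
 have ctheta: "continuous_on W theta"
  by (rule lipschitz_on_continuous_on[of L]) (use lip L in "auto intro: lipschitz_onI")
 have Wb[measurable]: "W \<in> sets borel" using W by (simp add: borel_compact)
 have Vb[measurable]: "V \<in> sets borel" unfolding V using compact_continuous_image[OF ctheta W] by (simp add: borel_compact)
 let ?N0 = "restrict_space lborel V"
 have mphi: "phi \<in> ?N0 \<rightarrow>\<^sub>M borel"
  using borel_measurable_continuous_on_restrict[OF cphi] by (simp cong: measurable_cong_sets add: sets_restrict_space)
 define N1 where "N1 = distr ?N0 borel phi"
 define N2 where "N2 = density lborel (indicator W)"
 have u: "(%a. h (theta a) * indicator W a) \<in> borel_measurable borel"
 proof -
  have "(%a. if a \<in> W then theta a else 0) \<in> borel_measurable borel"
   by (rule borel_measurable_continuous_on_if[OF Wb ctheta]) auto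
  hence "(%a. h (if a \<in> W then theta a else 0) * indicator W a) \<in> borel_measurable borel" by measurable
  moreover have "(%a. h (if a \<in> W then theta a else 0) * indicator W a) = (%a. h (theta a) * indicator W a)"
   by (auto simp: fun_eq_iff indicator_def)
  ultimately show ?thesis by simp
 qed
 have "(\<integral>\<^sup>+x. h x * indicator V x \<partial>lborel) = (\<integral>\<^sup>+x. h x \<partial>?N0)"
  by (subst nn_integral_restrict_space) auto
 also have "... = (\<integral>\<^sup>+x. h (theta (phi x)) * indicator W (phi x) \<partial>?N0)"
  by (rule nn_integral_cong) (use inv in "auto simp: space_restrict_space V")
 also have "... = (\<integral>\<^sup>+a. h (theta a) * indicator W a \<partial>N1)"
  unfolding N1_def by (rule nn_integral_distr[symmetric, OF mphi]) (use u in simp)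
 also have "... <= ?C * (\<integral>\<^sup>+a. h (theta a) * indicator W a \<partial>N2)"
 proof (rule nn_integral_le_of_emeasure_le)
  show "sets N1 = sets N2" by (simp add: N1_def N2_def)
  show "(%a. h (theta a) * indicator W a) \<in> borel_measurable N1" using u by (simp add: N1_def)
  fix A assume "A \<in> sets N1"
  hence A[measurable]: "A \<in> sets borel" by (simp add: N1_def)
  have im: "theta ` (W \<inter> A) = phi -` A \<inter> space ?N0" using inv by (auto simp: V space_restrict_space)
  have mm: "theta ` (W \<inter> A) \<in> sets borel"
   using measurable_sets[OF mphi A] unfolding im[symmetric] by (simp add: sets_restrict_space_iff)
  have "emeasure N1 A = emeasure ?N0 (theta ` (W \<inter> A))" unfolding N1_def by (subst emeasure_distr[OF mphi A]) (simp add: im)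
  also have "... = emeasure lborel (theta ` (W \<inter> A))" by (rule emeasure_restrict_space) (use Vb in "auto simp: V")
  also have "... <= ?C * emeasure lborel (W \<inter> A)"
   by (rule lip_image_emeasure[OF L _ _ _ mm]) (use lip W compact_imp_bounded bounded_subset in "auto intro: bounded_Int")
  also have "emeasure lborel (W \<inter> A) = emeasure N2 A" unfolding N2_def by (subst emeasure_density) (auto simp: nn_integral_indicator[symmetric] indicator_inter_arith intro!: nn_integral_cong)
  finally show "emeasure N1 A <= ?C * emeasure N2 A" .
 qed
 also have "(\<integral>\<^sup>+a. h (theta a) * indicator W a \<partial>N2) = (\<integral>\<^sup>+a. h (theta a) * indicator W a \<partial>lborel)"
  unfolding N2_def by (subst nn_integral_density) (use u in "auto intro!: nn_integral_cong simp: indicator_def")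
 finally show ?thesis .
qed

section \<open>The oscillation estimate in a chart\<close>

lemma telescope_square:
 fixes u s :: "nat => real"
 assumes n: "0 < n" and st: "!!i. i < n ==> \<bar>u (Suc i) - u i\<bar> <= c / real n * s i" and c: "0 <= c"
 shows "(u n - u 0)^2 <= c^2 * (1 / real n) * (\<Sum>i<n. (s i)^2)"
proof -
 have "u n - u 0 = (\<Sum>i<n. u (Suc i) - u i)" by (rule sum_lessThan_telescope[symmetric])
 also have "\<bar>...\<bar> <= (\<Sum>i<n. \<bar>u (Suc i) - u i\<bar>)" by (rule sum_abs)
 also have "... <= (\<Sum>i<n. c / real n * s i)" by (rule sum_mono) (use st in simp)
 also have "... = c / real n * (\<Sum>i<n. s i)" by (rule sum_distrib_left[symmetric])
 finally have "(u n - u 0)^2 <= (c / real n * (\<Sum>i<n. s i))^2" by (rule abs_le_square_iff[THEN iffD1, OF order_trans[OF _ abs_ge_self]])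
 also have "... = (c / real n)^2 * (\<Sum>i<n. s i)^2" by (rule power_mult_distrib)
 also have "... <= (c / real n)^2 * ((\<Sum>i<n. (s i)^2) * real (card {..<n}))"
  by (rule mult_left_mono[OF sum_squared_le_sum_of_squares]) simp
 also have "... = c^2 * (1 / real n) * (\<Sum>i<n. (s i)^2)" using n by (simp add: power2_eq_square field_simps)
 finally show ?thesis .
qed

text \<open>The segment from \<open>a\<close> to a + w is cut into n steps, so short that along each of them the increment
of F is controlled by the local bound G.\<close>

lemma chain_step:
 fixes theta :: "'a::euclidean_space => 'a" and F G :: "'a => real"
 assumes W: "convex W" and L: "0 <= L" and lip: "!!a b. a \<in> W ==> b \<in> W ==> dist (theta a) (theta b) <= L * dist a b"
  and loc: "!!x y. x \<in> theta ` W ==> y \<in> theta ` W ==> dist x y < kappa ==> \<bar>F y - F x\<bar> <= dist x y * (G x + \<Lambda> * dist x y)"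
  and \<Lambda>: "0 <= \<Lambda>" and n: "0 < n" "L * D / real n < kappa" "\<Lambda> * (L * D / real n) <= nu" and G: "!!x. 0 <= G x"
  and a: "a \<in> W" and w: "a + w \<in> W" "norm w <= D"
 shows "(F (theta (a + w)) - F (theta a))^2 <= (L * D)^2 * (1 / real n) * (\<Sum>i<n. (G (theta (a + (real i / real n) *\<^sub>R w)) + nu)^2)"
proof -
 let ?c = "%i. a + (real i / real n) *\<^sub>R w"
 have cW: "?c i \<in> W" if "i <= n" for i
 proof -
  have "(1 - real i / real n) *\<^sub>R a + (real i / real n) *\<^sub>R (a + w) \<in> W"
   by (rule convexD[OF W a w(1)]) (use that n in auto)
  moreover have "(1 - real i / real n) *\<^sub>R a + (real i / real n) *\<^sub>R (a + w) = ?c i" by (simp add: algebra_simps)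
  ultimately show ?thesis by simp
 qed
 have LD: "0 <= L * D" using L w(2) norm_ge_zero[of w] by (intro mult_nonneg_nonneg) linarith+
 have st: "\<bar>F (theta (?c (Suc i))) - F (theta (?c i))\<bar> <= L * D / real n * (G (theta (?c i)) + nu)" if i: "i < n" for i
 proof -
  have "?c (Suc i) - ?c i = (1 / real n) *\<^sub>R w" 
  proof -
   have "?c (Suc i) - ?c i = (real (Suc i) / real n - real i / real n) *\<^sub>R w"
    by (simp only: scaleR_left_diff_distrib add_diff_cancel_left)
   also have "real (Suc i) / real n - real i / real n = 1 / real n" by (simp add: add_divide_distrib)
   finally show ?thesis .
  qed
  hence "norm (?c (Suc i) - ?c i) = norm w / real n" by simp
  hence "dist (?c i) (?c (Suc i)) = norm w / real n" by (simp only: dist_norm norm_minus_commute)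
  hence "dist (theta (?c i)) (theta (?c (Suc i))) <= L * (norm w / real n)" using lip[OF cW cW, of i "Suc i"] i by simp
  also have "... <= L * D / real n" using mult_left_mono[OF w(2) L] n by (simp add: divide_right_mono)
  finally have d: "dist (theta (?c i)) (theta (?c (Suc i))) <= L * D / real n" .
  have "\<bar>F (theta (?c (Suc i))) - F (theta (?c i))\<bar> <= dist (theta (?c i)) (theta (?c (Suc i))) * (G (theta (?c i)) + \<Lambda> * dist (theta (?c i)) (theta (?c (Suc i))))"
   by (rule loc[OF imageI[OF cW] imageI[OF cW]]) (use i d n in linarith)+
  also have "... <= L * D / real n * (G (theta (?c i)) + nu)"
   using mult_left_mono[OF d \<Lambda>] n(3) d G LD \<Lambda> by (intro mult_mono add_left_mono add_nonneg_nonneg mult_nonneg_nonneg) auto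
  finally show ?thesis .
 qed
 have "(F (theta (?c n)) - F (theta (?c 0)))^2 <= (L * D)^2 * (1 / real n) * (\<Sum>i<n. (G (theta (?c i)) + nu)^2)"
  by (rule telescope_square[where u = "%i. F (theta (?c i))" and s = "%i. G (theta (?c i)) + nu", OF n(1) st LD])
 thus ?thesis using n by simp
qed

lemma nn_integral_pair_translate:
 fixes X :: "'a::euclidean_space => 'a => ennreal"
 assumes X: "(%(a, b). X a b) \<in> borel_measurable (borel \<Otimes>\<^sub>M borel)"
 shows "(\<integral>\<^sup>+a. \<integral>\<^sup>+b. X a b \<partial>lborel \<partial>lborel) = (\<integral>\<^sup>+w. \<integral>\<^sup>+a. X a (a + w) \<partial>lborel \<partial>lborel)"
proof -
 note [measurable] = X
 have "(\<integral>\<^sup>+a. \<integral>\<^sup>+b. X a b \<partial>lborel \<partial>lborel) = (\<integral>\<^sup>+a. \<integral>\<^sup>+w. X a (a + w) \<partial>lborel \<partial>lborel)"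
 proof (rule nn_integral_cong)
  fix a :: 'a
  have "(%b. X a b) \<in> borel_measurable borel" using measurable_Pair2[OF X, of a] by simp
  from nn_integral_translate[OF this, of a] show "(\<integral>\<^sup>+b. X a b \<partial>lborel) = (\<integral>\<^sup>+w. X a (a + w) \<partial>lborel)" by simp
 qed
 also have "... = (\<integral>\<^sup>+w. \<integral>\<^sup>+a. X a (a + w) \<partial>lborel \<partial>lborel)"
 proof (rule lborel_pair.Fubini'[symmetric])
  have "(%(a, w). (a, a + w)) \<in> (borel \<Otimes>\<^sub>M borel) \<rightarrow>\<^sub>M ((borel \<Otimes>\<^sub>M borel) :: ('a \<times> 'a) measure)" by measurable
  from measurable_compose[OF this X]
  show "(%(a, w). X a (a + w)) \<in> borel_measurable (lborel \<Otimes>\<^sub>M lborel)" by (simp add: case_prod_beta' cong: measurable_cong_sets)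
 qed
 finally show ?thesis .
qed

definition osc_kernel :: "real => ('a::euclidean_space => real) => 'a => 'a => ennreal" where
 "osc_kernel r F x y = ennreal ((F y - F x)^2) * indicator (ball 0 r) (y - x)"

lemma osc_kernel_measurable [measurable (raw)]:
 assumes [measurable]: "F \<in> borel_measurable borel" "f \<in> borel_measurable N" "g \<in> borel_measurable N"
 shows "(%z. osc_kernel r F (f z) (g z)) \<in> borel_measurable N"
 unfolding osc_kernel_def indicator_def mem_ball_0 by measurable

text \<open>The squared increments over pairs at distance less than r, as a measure on pairs. Restricting it to squares of
sets makes unions, null sets and monotone limits available.\<close>

definition osc_measure :: "real => ('a::euclidean_space => real) => ('a \<times> 'a) measure" where
 "osc_measure r F = density (lborel \<Otimes>\<^sub>M lborel) (%z. osc_kernel r F (fst z) (snd z))"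

lemma sets_osc [simp]: "sets (osc_measure r F) = sets (borel \<Otimes>\<^sub>M borel)"
 unfolding osc_measure_def sets_density by (rule sets_pair_measure_cong) simp_all

lemma emeasure_osc:
 fixes A :: "'a::euclidean_space set"
 assumes F[measurable]: "F \<in> borel_measurable borel" and A[measurable]: "A \<in> sets borel"
 shows "emeasure (osc_measure r F) (A \<times> A) = (\<integral>\<^sup>+x. (\<integral>\<^sup>+y. osc_kernel r F x y * indicator A y \<partial>lborel) * indicator A x \<partial>lborel)"
proof -
 have AA: "A \<times> A \<in> sets (lborel \<Otimes>\<^sub>M lborel)" by (rule pair_measureI) simp_all
 have "emeasure (osc_measure r F) (A \<times> A) = (\<integral>\<^sup>+z. osc_kernel r F (fst z) (snd z) * indicator (A \<times> A) z \<partial>(lborel \<Otimes>\<^sub>M lborel))"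
  unfolding osc_measure_def by (rule emeasure_density[OF _ AA]) measurable
 also have "... = (\<integral>\<^sup>+x. \<integral>\<^sup>+y. osc_kernel r F x y * indicator (A \<times> A) (x, y) \<partial>lborel \<partial>lborel)"
  by (subst lborel.nn_integral_fst[symmetric]) (use AA in simp_all)
 also have "... = (\<integral>\<^sup>+x. (\<integral>\<^sup>+y. osc_kernel r F x y * indicator A y \<partial>lborel) * indicator A x \<partial>lborel)"
  by (rule nn_integral_cong) (simp add: indicator_def)
 finally show ?thesis .
qed

text \<open>Integrate chain_step over \<open>a\<close>: by translation invariance each of the n terms contributes the same
integral of G, and the factor 1/n averages them. Convexity of W keeps the segments inside. The surplus nu
is removed at the end.\<close>

lemma chain_estimate:
 fixes theta :: "'a::euclidean_space => 'a" and F G :: "'a => real"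
 assumes W: "compact W" "convex W" and L: "0 <= L" and lip: "!!a b. a \<in> W ==> b \<in> W ==> dist (theta a) (theta b) <= L * dist a b"
  and loc: "!!x y. x \<in> theta ` W ==> y \<in> theta ` W ==> dist x y < kappa ==> \<bar>F y - F x\<bar> <= dist x y * (G x + \<Lambda> * dist x y)"
  and kappa: "0 < kappa" and \<Lambda>: "0 <= \<Lambda>" and r: "0 < r" and G: "!!x. 0 <= G x"
  and meas[measurable]: "theta \<in> borel_measurable borel" "F \<in> borel_measurable borel" "G \<in> borel_measurable borel"
 shows "emeasure (osc_measure r (%a. F (theta a))) (W \<times> W)
  <= ennreal (2 * (L * r)^2 * (2 * r) ^ DIM('a)) * (\<integral>\<^sup>+a. ennreal ((G (theta a))^2) * indicator W a \<partial>lborel)"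
  (is "?I <= _ * ?J")
proof -
 have Wb[measurable]: "W \<in> sets borel" using W by (simp add: borel_compact)
 define X where "X a b = osc_kernel r (%a. F (theta a)) a b * indicator W b * indicator W a" for a b
 have Xm[measurable]: "(%(a, b). X a b) \<in> borel_measurable (borel \<Otimes>\<^sub>M borel)" unfolding X_def by measurable
 have Xm2: "(%a. X a (a + w)) \<in> borel_measurable borel" for w unfolding X_def by measurable
 have IX: "?I = (\<integral>\<^sup>+a. \<integral>\<^sup>+b. X a b \<partial>lborel \<partial>lborel)"
  unfolding X_def by (subst emeasure_osc) (simp_all add: nn_integral_multc)
 define Z where "Z nu c = ennreal ((G (theta c) + nu)^2) * indicator W c" for nu c
 have Zm[measurable]: "Z nu \<in> borel_measurable borel" for nu unfolding Z_def by measurable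
 have B: "emeasure lborel (ball (0::'a) r) <= ennreal ((2 * r) ^ DIM('a))"
  using emeasure_mono[OF ball_subset_cball, of "0::'a" r lborel] emeasure_cball_le[of r "0::'a"] r by simp
 have main: "?I <= ennreal ((L * r)^2 * (2 * r) ^ DIM('a)) * (\<integral>\<^sup>+c. Z nu c \<partial>lborel)" if nu: "0 < nu" for nu
 proof -
  \<comment> \<open>Steps shorter than kappa, with second order error below nu.\<close>
  obtain n where n: "L * r / kappa + \<Lambda> * (L * r) / nu < real n" using reals_Archimedean2 by blast
  have q: "0 <= L * r / kappa" "0 <= \<Lambda> * (L * r) / nu" using L r kappa nu \<Lambda> by auto
  have n0: "0 < n" using n q by (cases n) auto
  have "L * r / kappa < real n" "\<Lambda> * (L * r) / nu <= real n" using n q by linarith+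
  hence n1: "L * r / real n < kappa" and n2: "\<Lambda> * (L * r / real n) <= nu" using kappa nu n0 by (simp_all add: field_simps)
  let ?q = "(L * r)^2 * (1 / real n)" and ?c = "%a w i. a + (real i / real n) *\<^sub>R w"
  have Xb: "(\<integral>\<^sup>+a. X a (a + w) \<partial>lborel) <= ennreal ((L * r)^2) * (\<integral>\<^sup>+c. Z nu c \<partial>lborel) * indicator (ball 0 r) w" for w
  proof (cases "w \<in> ball 0 r")
   case True
   have "X a (a + w) <= (\<Sum>i<n. ennreal ?q * Z nu ((real i / real n) *\<^sub>R w + a))" for a
   proof (cases "a \<in> W & a + w \<in> W")
    case True': True
    have cs: "(F (theta (a + w)) - F (theta a))^2 <= ?q * (\<Sum>i<n. (G (theta (?c a w i)) + nu)^2)"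
     by (rule chain_step[OF W(2) L lip loc \<Lambda> n0 n1 n2 G]) (use True' True in auto)
    have cW: "?c a w i \<in> W" if "i < n" for i
    proof -
     have "(1 - real i / real n) *\<^sub>R a + (real i / real n) *\<^sub>R (a + w) \<in> W"
      by (rule convexD[OF W(2)]) (use True' that in auto)
     thus ?thesis by (simp add: algebra_simps)
    qed
    have "X a (a + w) <= ennreal (?q * (\<Sum>i<n. (G (theta (?c a w i)) + nu)^2))"
     using True True' cs by (simp add: X_def osc_kernel_def ennreal_leI)
    also have "... = (\<Sum>i<n. ennreal (?q * (G (theta (?c a w i)) + nu)^2))"
     by (simp add: sum_distrib_left sum_ennreal)
    also have "... = (\<Sum>i<n. ennreal ?q * Z nu ((real i / real n) *\<^sub>R w + a))"
    proof (rule sum.cong[OF refl])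
     fix i assume "i \<in> {..<n}"
     hence "Z nu ((real i / real n) *\<^sub>R w + a) = ennreal ((G (theta (?c a w i)) + nu)^2)" using cW[of i] by (simp add: Z_def add.commute)
     thus "ennreal (?q * (G (theta (?c a w i)) + nu)^2) = ennreal ?q * Z nu ((real i / real n) *\<^sub>R w + a)"
      by (simp only:) (rule ennreal_mult, simp_all)
    qed
    finally show ?thesis .
   qed (auto simp: X_def)
   hence "(\<integral>\<^sup>+a. X a (a + w) \<partial>lborel) <= (\<integral>\<^sup>+a. (\<Sum>i<n. ennreal ?q * Z nu ((real i / real n) *\<^sub>R w + a)) \<partial>lborel)"
    by (rule nn_integral_mono)
   also have "... = (ennreal (real n) * ennreal ?q) * (\<integral>\<^sup>+a. Z nu a \<partial>lborel)"
    by (simp add: nn_integral_sum nn_integral_cmult nn_integral_translate mult.assoc ennreal_of_nat_eq_real_of_nat)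
   also have "ennreal (real n) * ennreal ?q = ennreal ((L * r)^2)" using n0 by (simp add: ennreal_mult[symmetric])
   finally show ?thesis using True by simp
  qed (simp add: X_def osc_kernel_def)
  have "?I <= (\<integral>\<^sup>+w. ennreal ((L * r)^2) * (\<integral>\<^sup>+c. Z nu c \<partial>lborel) * indicator (ball (0::'a) r) w \<partial>lborel)"
   unfolding IX nn_integral_pair_translate[OF Xm] by (rule nn_integral_mono) (rule Xb)
  also have "... = ennreal ((L * r)^2) * (\<integral>\<^sup>+c. Z nu c \<partial>lborel) * emeasure lborel (ball (0::'a) r)" by (rule nn_integral_cmult_indicator) simp
  also have "... <= ennreal ((L * r)^2) * (\<integral>\<^sup>+c. Z nu c \<partial>lborel) * ennreal ((2 * r) ^ DIM('a))" by (rule mult_left_mono[OF B]) simp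
  finally show ?thesis using r by (simp add: ennreal_mult mult_ac)
 qed
 have fW: "emeasure lborel W < \<infinity>" by (rule emeasure_bounded_finite[OF compact_imp_bounded[OF W(1)]])
 have ZJ: "(\<integral>\<^sup>+c. Z nu c \<partial>lborel) <= 2 * ?J + ennreal (2 * nu^2) * emeasure lborel W" for nu
 proof -
  have "Z nu c <= 2 * (ennreal ((G (theta c))^2) * indicator W c) + ennreal (2 * nu^2) * indicator W c" for c
  proof (cases "c \<in> W")
   case True
   have "(G (theta c) + nu)^2 <= 2 * (G (theta c))^2 + 2 * nu^2" using sum_squares_bound[of "G (theta c)" nu] by (simp add: power2_sum)
   hence "ennreal ((G (theta c) + nu)^2) <= ennreal (2 * (G (theta c))^2) + ennreal (2 * nu^2)"
    by (subst ennreal_plus[symmetric]) (auto simp del: ennreal_plus intro: ennreal_leI)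
   thus ?thesis using True by (simp add: Z_def ennreal_mult)
  qed (simp add: Z_def)
  hence "(\<integral>\<^sup>+c. Z nu c \<partial>lborel) <= (\<integral>\<^sup>+c. 2 * (ennreal ((G (theta c))^2) * indicator W c) + ennreal (2 * nu^2) * indicator W c \<partial>lborel)"
   by (rule nn_integral_mono)
  also have "... = 2 * ?J + ennreal (2 * nu^2) * emeasure lborel W"
   by (subst nn_integral_add) (auto simp: nn_integral_cmult)
  finally show ?thesis .
 qed
 define k where "k = (L * r)^2 * (2 * r) ^ DIM('a)"
 have k: "0 <= k" using r by (simp add: k_def)
 have "?I <= ennreal (2 * k) * ?J"
 proof (rule ennreal_le_epsilon)
  fix e :: real assume e: "0 < e"
  obtain v where v: "emeasure lborel W = ennreal v" "0 <= v" using fW by (cases "emeasure lborel W") auto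
  have vk: "0 <= k * v" using k v by simp
  define nu where "nu = sqrt (e / (2 * (k * v + 1)))"
  have nu: "0 < nu" "nu^2 = e / (2 * (k * v + 1))" using e vk by (auto simp: nu_def)
  have "?I <= ennreal k * (2 * ?J + ennreal (2 * nu^2) * ennreal v)"
   using order_trans[OF main[OF nu(1)] mult_left_mono[OF ZJ]] by (simp add: k_def v)
  also have "... = ennreal (2 * k) * ?J + ennreal (2 * nu^2 * (k * v))" using k v by (simp add: distrib_left ennreal_mult mult_ac)
  also have "2 * nu^2 * (k * v) <= e"
  proof -
   have "k * v * e <= (k * v + 1) * e" using e by (intro mult_right_mono) auto
   thus ?thesis unfolding nu(2) using vk by (simp add: field_simps)
  qed
  finally show "?I <= ennreal (2 * k) * ?J + ennreal e" by (simp add: ennreal_leI add_left_mono)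
 qed
 thus ?thesis by (simp add: k_def mult.assoc)
qed

text \<open>The Lipschitz constant enters by three changes of variables, by the length of image segments and by the radius
in the chart.\<close>

definition chart_const :: "'a::euclidean_space itself => real => real" where
 "chart_const _ L = ((2 * (L * real DIM('a))) ^ DIM('a)) ^ 3 * (2 * (L * L)^2) * (2 * L) ^ DIM('a)"

lemma chart_const_nonneg: "0 <= L ==> 0 <= chart_const TYPE('a::euclidean_space) L"
 by (simp add: chart_const_def)

text \<open>Transport of chain_estimate by a bi-Lipschitz map: both variables are pulled back to the chart and the
integral of G is pushed forward.\<close>

lemma chart_estimate:
 fixes theta phi :: "'a::euclidean_space => 'a" and F G :: "'a => real"
 assumes W: "compact W" "convex W" and V: "V = theta ` W" and inv: "!!a. a \<in> W ==> phi (theta a) = a" and L: "0 < L"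
  and lip: "!!a b. a \<in> W ==> b \<in> W ==> dist (theta a) (theta b) <= L * dist a b"
  and lip': "!!x y. x \<in> V ==> y \<in> V ==> dist (phi x) (phi y) <= L * dist x y"
  and loc: "!!x y. x \<in> V ==> y \<in> V ==> dist x y < kappa ==> \<bar>F y - F x\<bar> <= dist x y * (G x + \<Lambda> * dist x y)"
  and kappa: "0 < kappa" and \<Lambda>: "0 <= \<Lambda>" and r: "0 < r" and G: "!!x. 0 <= G x"
  and meas[measurable]: "theta \<in> borel_measurable borel" "F \<in> borel_measurable borel" "G \<in> borel_measurable borel"
 shows "emeasure (osc_measure r F) (V \<times> V) <= ennreal (chart_const TYPE('a) L * r ^ (DIM('a) + 2)) * (\<integral>\<^sup>+x. ennreal ((G x)^2) * indicator V x \<partial>lborel)"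
  (is "?I <= _ * ?J")
proof -
 let ?C = "(2 * (L * real DIM('a))) ^ DIM('a)"
 have L0: "0 <= L" using L by simp
 have ctheta: "continuous_on W theta"
  by (rule lipschitz_on_continuous_on[of L]) (use lip L in "auto intro: lipschitz_onI")
 have cV: "compact V" unfolding V by (rule compact_continuous_image[OF ctheta W(1)])
 have cphi: "continuous_on V phi"
  by (rule lipschitz_on_continuous_on[of L]) (use lip' L in "auto intro: lipschitz_onI")
 have Wb[measurable]: "W \<in> sets borel" and Vb[measurable]: "V \<in> sets borel" using W cV by (simp_all add: borel_compact)
 note lipint = nn_integral_lip_image[OF W(1) V inv L0 lip cphi]
 define H where "H x = (\<integral>\<^sup>+b. osc_kernel r F x (theta b) * indicator W b \<partial>lborel)" for x
 have Hm: "H \<in> borel_measurable borel" unfolding H_def by measurable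
 have hm: "osc_kernel r F x \<in> borel_measurable borel" for x by measurable
 have "?I <= (\<integral>\<^sup>+x. (ennreal ?C * H x) * indicator V x \<partial>lborel)"
  unfolding H_def emeasure_osc[OF meas(2) Vb] by (intro nn_integral_mono mult_right_mono lipint hm) simp_all
 also have "... = ennreal ?C * (\<integral>\<^sup>+x. H x * indicator V x \<partial>lborel)" using Hm by (simp add: nn_integral_cmult mult.assoc)
 also have "... <= ennreal ?C * (ennreal ?C * (\<integral>\<^sup>+a. H (theta a) * indicator W a \<partial>lborel))"
  by (intro mult_left_mono lipint Hm) simp_all
 finally have s1: "?I <= ennreal ?C * (ennreal ?C * (\<integral>\<^sup>+a. H (theta a) * indicator W a \<partial>lborel))" .
 have "(\<integral>\<^sup>+a. H (theta a) * indicator W a \<partial>lborel) <= emeasure (osc_measure (L * r) (%a. F (theta a))) (W \<times> W)"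
 proof (subst emeasure_osc; (intro nn_integral_mono)?)
  fix a
  have "osc_kernel r F (theta a) (theta b) <= osc_kernel (L * r) (%a. F (theta a)) a b" if "a \<in> W" "b \<in> W" for b
  proof (cases "theta b - theta a \<in> ball 0 r")
   case True
   have "dist a b <= L * dist (theta a) (theta b)" using lip'[of "theta a" "theta b"] that inv by (simp add: V)
   also have "... < L * r" using True L by (simp add: dist_norm norm_minus_commute)
   finally show ?thesis by (simp add: osc_kernel_def indicator_def dist_norm norm_minus_commute)
  qed (simp add: osc_kernel_def)
  thus "H (theta a) * indicator W a <= (\<integral>\<^sup>+b. osc_kernel (L * r) (%a. F (theta a)) a b * indicator W b \<partial>lborel) * indicator W a"
   unfolding H_def by (cases "a \<in> W") (auto intro!: nn_integral_mono simp: indicator_def)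
 qed measurable
 also have "... <= ennreal (2 * (L * (L * r))^2 * (2 * (L * r)) ^ DIM('a)) * (\<integral>\<^sup>+a. ennreal ((G (theta a))^2) * indicator W a \<partial>lborel)"
  by (rule chain_estimate[OF W L0 lip _ kappa \<Lambda> _ G meas]) (use loc L r in "auto simp: V")
 finally have s2: "(\<integral>\<^sup>+a. H (theta a) * indicator W a \<partial>lborel) <= ..." .
 have "(\<integral>\<^sup>+a. ennreal ((G (theta a))^2) * indicator W a \<partial>lborel) <= ennreal ?C * (\<integral>\<^sup>+x. ennreal ((G (theta (phi x)))^2) * indicator V x \<partial>lborel)"
 proof (rule nn_integral_lip_image[OF cV _ _ L0 lip' ctheta])
  show "W = phi ` V" using inv by (force simp: V)
 qed (use inv in "auto simp: V")
 also have "(\<integral>\<^sup>+x. ennreal ((G (theta (phi x)))^2) * indicator V x \<partial>lborel) = ?J"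
  by (rule nn_integral_cong) (use inv in "auto simp: V indicator_def")
 finally have s3: "(\<integral>\<^sup>+a. ennreal ((G (theta a))^2) * indicator W a \<partial>lborel) <= ennreal ?C * ?J" .
 have "?I <= ennreal ?C * (ennreal ?C * (ennreal (2 * (L * (L * r))^2 * (2 * (L * r)) ^ DIM('a)) * (ennreal ?C * ?J)))"
  by (rule order_trans[OF s1]) (intro mult_left_mono order_trans[OF s2] s3, simp_all)
 also have "... = ennreal (?C * (?C * (2 * (L * (L * r))^2 * (2 * (L * r)) ^ DIM('a) * ?C))) * ?J"
  using L r by (simp add: ennreal_mult mult.assoc)
 also have "?C * (?C * (2 * (L * (L * r))^2 * (2 * (L * r)) ^ DIM('a) * ?C)) = chart_const TYPE('a) L * r ^ (DIM('a) + 2)"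
  by (simp add: chart_const_def power_add power2_eq_square power3_eq_cube power_mult_distrib mult_ac)
 finally show ?thesis .
qed

section \<open>Mollified Sobolev functions\<close>

lemma moll_test: "0 < eta ==> test_function UNIV (moll eta :: 'a::euclidean_space => real)"
 using test_function_moll[of eta 0 UNIV] by simp

abbreviation dmoll :: "real => 'a::euclidean_space => 'a => real" where
 "dmoll eta z \<equiv> frechet_derivative (moll eta) (at z)"

lemma dmoll_uminus:
 assumes "0 < eta" shows "dmoll eta v (- w) = (\<Sum>b\<in>Basis. - (w \<bullet> b) * dmoll eta v (b :: 'a::euclidean_space))"
proof -
 interpret bounded_linear "dmoll eta v"
  by (rule has_derivative_bounded_linear[OF test_function_has_derivative[OF moll_test[OF assms]]])
 have "dmoll eta v (- w) = dmoll eta v (\<Sum>b\<in>Basis. (- w \<bullet> b) *\<^sub>R b)" by (simp only: euclidean_representation)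
 thus ?thesis by (simp only: sum scaleR real_scaleR_def inner_minus_left)
qed

lemma dmoll_measurable:
 assumes "0 < eta" shows "(%v::'a::euclidean_space. dmoll eta v (- w)) \<in> borel_measurable borel"
 unfolding dmoll_uminus[OF assms]
 by (intro borel_measurable_sum borel_measurable_times borel_measurable_const
   borel_measurable_continuous_onI[OF test_function_partial_continuous[OF moll_test[OF assms]]])

lemma mollify_deriv:
 fixes f :: "'a::euclidean_space => real"
 assumes eta: "0 < eta" and f: "integrable lborel f"
 shows "((%s. mollify eta f (z + s *\<^sub>R w)) has_real_derivative (\<integral>y. f y * dmoll eta (y - z) (- w) \<partial>lborel)) (at 0)"
proof -
 note t = moll_test[OF eta, where 'a = 'a]
 note fd = test_function_has_derivative[OF t]
 obtain L where L: "0 < L" "!!x y::'a. \<bar>moll eta x - moll eta y\<bar> <= L * dist x y" "!!x::'a. \<bar>moll eta x\<bar> <= L"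
  by (rule moll_lipschitz[OF eta]) (rule that)
 have lin: "bounded_linear (dmoll eta v)" for v :: 'a by (rule has_derivative_bounded_linear[OF fd])
 show ?thesis unfolding mollify_def
 proof (rule DERIV_integral[OF f, where B = L and C = "L * norm w"])
  show "(%y. moll eta (y - (z + s *\<^sub>R w))) \<in> borel_measurable lborel" for s by measurable
  show "(%y. dmoll eta (y - z) (- w)) \<in> borel_measurable lborel" using dmoll_measurable[OF eta] by measurable
  show "\<bar>moll eta (y - (z + 0 *\<^sub>R w))\<bar> <= L" for y by (rule L)
  show "\<bar>moll eta (y - (z + s *\<^sub>R w)) - moll eta (y - (z + 0 *\<^sub>R w))\<bar> <= L * norm w * \<bar>s\<bar>" for s y
   using L(2)[of "y - (z + s *\<^sub>R w)" "y - z"] by (simp add: dist_norm mult_ac)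
  fix y
  interpret bounded_linear "dmoll eta (y - z)" by (rule lin)
  have "((%s. y - (z + s *\<^sub>R w)) has_derivative (%s. s *\<^sub>R (- w))) (at 0)" by (auto intro!: derivative_eq_intros)
  from has_derivative_compose[OF this, of "moll eta"] fd[of "y - z"]
  have "((%s. moll eta (y - (z + s *\<^sub>R w))) has_derivative (%s. dmoll eta (y - z) (s *\<^sub>R (- w)))) (at 0)" by simp
  also have "(%s. dmoll eta (y - z) (s *\<^sub>R (- w))) = (*) (dmoll eta (y - z) (- w))" by (rule ext) (simp only: scaleR real_scaleR_def mult.commute)
  finally show "((%s. moll eta (y - (z + s *\<^sub>R w))) has_real_derivative dmoll eta (y - z) (- w)) (at 0)" unfolding has_field_derivative_def .
 qed
qed

lemma dmoll_shift:
 assumes "0 < eta" shows "frechet_derivative (%y. moll eta (y - z)) (at y) = dmoll eta (y - (z :: 'a::euclidean_space))"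
proof -
 have "((%y. y - z) has_derivative (%h. h)) (at y)" by (auto intro!: derivative_eq_intros)
 from has_derivative_compose[OF this test_function_has_derivative[OF moll_test[OF assms]]]
 show ?thesis by (rule frechet_derivative_at[symmetric])
qed

context reflected_process begin

text \<open>Extension by zero, which turns integrals against \<mu> into Lebesgue integrals on the whole space.\<close>

definition zext :: "('a => 'b::real_vector) => 'a => 'b" where
 "zext f x = indicator M x *\<^sub>R f x"

definition vol :: real where "vol = measure lborel M"

lemma vol_pos: "0 < vol" and emeasure_vol: "emeasure lborel M = ennreal vol"
 using emeasure_M by (simp_all add: vol_def measure_def enn2real_positive_iff top.not_eq_extremum zero_less_iff_neq_zero less_top)

lemma zext_in [simp]: "x \<in> M ==> zext f x = f x" and zext_out [simp]: "x \<notin> M ==> zext f x = 0"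
 by (simp_all add: zext_def)

lemma meas_mu_iff: "f \<in> borel_measurable \<mu> \<longleftrightarrow> f \<in> borel_measurable (restrict_space lborel M)"
proof -
 have e: "sets \<mu> = sets (restrict_space lborel M)" by (simp add: sets_mu sets_restrict_space)
 show ?thesis unfolding measurable_cong_sets[OF e refl] ..
qed

lemma zext_measurable: 
 fixes f :: "'a => 'b::real_normed_vector"
 assumes "f \<in> borel_measurable \<mu>" shows "zext f \<in> borel_measurable borel"
 using assms unfolding meas_mu_iff zext_def[abs_def]
 by (subst (asm) borel_measurable_restrict_space_iff) (auto simp: zext_def)

lemma meas_mu_borel: "f \<in> borel_measurable borel ==> f \<in> borel_measurable \<mu>"
 unfolding meas_mu_iff by (rule measurable_restrict_space1) simp

lemma mu_density: "\<mu> = density (restrict_space lborel M) (%x. ennreal (1 / vol))"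
proof -
 have e: "emeasure (restrict_space lborel M) M = ennreal vol" by (subst emeasure_restrict_space) (auto simp: emeasure_vol)
 have "1 / ennreal vol = ennreal (1 / vol)" using vol_pos by (simp add: divide_ennreal[symmetric])
 thus ?thesis unfolding nleb_def uniform_measure_def e 
  by (intro density_cong measurable_restrict_space1) (auto simp: space_restrict_space)
qed

lemma nn_integral_mu:
 assumes f: "f \<in> borel_measurable \<mu>"
 shows "(\<integral>\<^sup>+x. f x) = ennreal (1 / vol) * (\<integral>\<^sup>+x. f x * indicator M x \<partial>lborel)"
proof -
 note f' = f[unfolded meas_mu_iff]
 have "(\<integral>\<^sup>+x. f x) = (\<integral>\<^sup>+x. ennreal (1 / vol) * f x \<partial>restrict_space lborel M)"
  unfolding mu_density by (rule nn_integral_density) (use f' in auto)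
 also have "... = ennreal (1 / vol) * (\<integral>\<^sup>+x. f x \<partial>restrict_space lborel M)" by (rule nn_integral_cmult[OF f'])
 also have "(\<integral>\<^sup>+x. f x \<partial>restrict_space lborel M) = (\<integral>\<^sup>+x. f x * indicator M x \<partial>lborel)"
  by (rule nn_integral_restrict_space) simp
 finally show ?thesis .
qed

lemma nn_integral_lborel_mu:
 assumes f: "f \<in> borel_measurable \<mu>"
 shows "(\<integral>\<^sup>+x. f x * indicator M x \<partial>lborel) = ennreal vol * (\<integral>\<^sup>+x. f x)"
 unfolding nn_integral_mu[OF f] using vol_pos by (simp add: mult.assoc[symmetric] ennreal_mult[symmetric])

lemma integral_mu:
 fixes f :: "'a => real"
 assumes f: "f \<in> borel_measurable \<mu>"
 shows "(\<integral>x. f x) = (\<integral>x. zext f x \<partial>lborel) / vol"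
  and "integrable \<mu> f \<longleftrightarrow> integrable lborel (zext f)"
proof -
 note f' = f[unfolded meas_mu_iff]
 have "(\<integral>x. f x) = (\<integral>x. (1 / vol) * f x \<partial>restrict_space lborel M)"
  unfolding mu_density by (rule integral_real_density[OF _ _ f']) (use vol_pos in auto)
 also have "... = (\<integral>x. f x \<partial>restrict_space lborel M) / vol" by simp
 also have "(\<integral>x. f x \<partial>restrict_space lborel M) = (\<integral>x. zext f x \<partial>lborel)"
  unfolding zext_def by (rule integral_restrict_space) simp
 finally show "(\<integral>x. f x) = (\<integral>x. zext f x \<partial>lborel) / vol" .
 have "integrable \<mu> f \<longleftrightarrow> integrable (restrict_space lborel M) (%x. (1 / vol) * f x)"
  unfolding mu_density by (rule integrable_real_density[OF _ _ f']) (use vol_pos in auto)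
 also have "... \<longleftrightarrow> integrable (restrict_space lborel M) f" using vol_pos by (subst integrable_mult_left_iff) auto
 also have "... \<longleftrightarrow> integrable lborel (zext f)"
  unfolding zext_def[abs_def] by (rule integrable_restrict_space) simp
 finally show "integrable \<mu> f \<longleftrightarrow> integrable lborel (zext f)" .
qed

lemma zext_integrable: fixes f :: "'a => real" shows "integrable \<mu> f ==> integrable lborel (zext f)"
 using integral_mu(2)[of f] by auto

lemma weak_gradientD:
 assumes "weak_gradient M f g"
 shows "g \<in> borel_measurable \<mu>" "integrable \<mu> (%x. (norm (g x))^2)" "integrable \<mu> (%x. norm (g x))" "integrable \<mu> (%x. g x \<bullet> b)"
  "!!phi b. test_function (interior M) phi ==> b \<in> Basis ==>
   (\<integral>x. f x * frechet_derivative phi (at x) b) = - (\<integral>x. (g x \<bullet> b) * phi x)"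
proof -
 show gm[measurable]: "g \<in> borel_measurable \<mu>" and g2: "integrable \<mu> (%x. (norm (g x))^2)"
  using assms unfolding weak_gradient_def by blast+
 show gn: "integrable \<mu> (%x. norm (g x))"
  by (rule mu.square_integrable_imp_integrable[OF _ g2]) measurable
 show "integrable \<mu> (%x. g x \<bullet> b)"
 proof (rule Bochner_Integration.integrable_bound[of _ "%x. norm (g x) * norm b"])
  show "integrable \<mu> (%x. norm (g x) * norm b)" using gn by simp
  show "AE x in \<mu>. norm (g x \<bullet> b) <= norm (norm (g x) * norm b)"
   by (rule AE_I2) (simp add: Cauchy_Schwarz_ineq2)
 qed measurable
 show "!!phi b. test_function (interior M) phi ==> b \<in> Basis ==>
   (\<integral>x. f x * frechet_derivative phi (at x) b) = - (\<integral>x. (g x \<bullet> b) * phi x)"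
  using assms unfolding weak_gradient_def by blast
qed

lemma test_function_measurable:
 assumes "test_function U phi" "b \<in> Basis"
 shows "phi \<in> borel_measurable borel" "(%x. frechet_derivative phi (at x) b) \<in> borel_measurable borel"
proof -
 have "Ck 0 phi" using assms(1) unfolding test_function_def by blast
 thus "phi \<in> borel_measurable borel" by (simp add: borel_measurable_continuous_onI)
 show "(%x. frechet_derivative phi (at x) b) \<in> borel_measurable borel"
  by (rule borel_measurable_continuous_onI[OF test_function_partial_continuous[OF assms]])
qed

text \<open>The translated kernel is a test function as long as its support stays in the interior.\<close>

lemma moll_weak_gradient:
 assumes f: "bdd f" and g: "weak_gradient M f g" and eta: "0 < eta"
  and z: "cbox (z - eta *\<^sub>R One) (z + eta *\<^sub>R One) \<subseteq> interior M" and b: "b \<in> Basis"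
 shows "(\<integral>y. zext f y * frechet_derivative (%y. moll eta (y - z)) (at y) b \<partial>lborel) = - mollify eta (zext (%x. g x \<bullet> b)) z"
proof -
 let ?phi = "%y. moll eta (y - z)"
 have t: "test_function (interior M) ?phi" by (rule test_function_moll[OF eta z])
 note tm = test_function_measurable[OF t b]
 note [measurable] = bdd_meas[OF f] weak_gradientD(1)[OF g] tm[THEN meas_mu_borel]
 have 1: "(\<integral>x. f x * frechet_derivative ?phi (at x) b) = (\<integral>y. zext f y * frechet_derivative ?phi (at y) b \<partial>lborel) / vol"
  by (subst integral_mu(1)) (measurable, simp add: zext_def[abs_def] mult.assoc)
 have 2: "(\<integral>x. (g x \<bullet> b) * ?phi x) = mollify eta (zext (%x. g x \<bullet> b)) z / vol"
  by (subst integral_mu(1)) (measurable, simp add: zext_def[abs_def] mult.assoc mollify_def)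
 show ?thesis using weak_gradientD(5)[OF g t b] vol_pos unfolding 1 2 by (simp add: field_simps)
qed

text \<open>The derivative falls on the kernel and is moved to f by the definition of the weak gradient.\<close>

lemma mollify_zext_derivative:
 assumes f: "bdd f" and g: "weak_gradient M f g" and eta: "0 < eta"
  and z: "cbox (z - eta *\<^sub>R One) (z + eta *\<^sub>R One) \<subseteq> interior M"
 shows "\<exists>D. ((%s. mollify eta (zext f) (z + s *\<^sub>R w)) has_real_derivative D) (at 0) &
  \<bar>D\<bar> <= norm w * mollify eta (zext (%x. norm (g x))) z"
proof -
 note fi = zext_integrable[OF bdd_integrable[OF f]]
 have gb: "integrable lborel (zext (%x. g x \<bullet> b))" for b by (rule zext_integrable[OF weak_gradientD(4)[OF g]])
 have gn: "integrable lborel (zext (%x. norm (g x)))" by (rule zext_integrable[OF weak_gradientD(3)[OF g]])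
 have if': "integrable lborel (%y. zext f y * dmoll eta (y - z) b)" if b: "b \<in> Basis" for b
 proof -
  have t: "test_function UNIV (%y. moll eta (y - z))" by (rule test_function_moll[OF eta]) simp
  obtain L where L: "0 < L" "!!x y. \<bar>moll eta (x - z) - moll eta (y - z)\<bar> <= L * dist x y"
   "!!x b. b \<in> Basis ==> \<bar>frechet_derivative (%y. moll eta (y - z)) (at x) b\<bar> <= L" "!!x. \<bar>moll eta (x - z)\<bar> <= L"
   by (rule test_function_lipschitz[OF t]) (rule that)
  note [measurable] = test_function_measurable(2)[OF t b, unfolded dmoll_shift[OF eta]] zext_measurable[OF bdd_meas[OF f]]
  show ?thesis
  proof (rule Bochner_Integration.integrable_bound[of _ "%y. L * zext f y"])
   show "AE y in lborel. norm (zext f y * dmoll eta (y - z) b) <= norm (L * zext f y)"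
    using L(1) mult_right_mono[OF L(3)[OF b, unfolded dmoll_shift[OF eta]] abs_ge_zero]
    by (intro AE_I2) (simp add: abs_mult mult.commute)
  qed (use fi in simp, measurable)
 qed
 have "(\<integral>y. zext f y * dmoll eta (y - z) (- w) \<partial>lborel) = (\<integral>y. (\<Sum>b\<in>Basis. - (w \<bullet> b) * (zext f y * dmoll eta (y - z) b)) \<partial>lborel)"
  unfolding dmoll_uminus[OF eta] by (simp add: sum_distrib_left mult_ac)
 also have "... = (\<Sum>b\<in>Basis. - (w \<bullet> b) * (\<integral>y. zext f y * dmoll eta (y - z) b \<partial>lborel))"
  using if' by (subst Bochner_Integration.integral_sum) auto
 also have "... = (\<Sum>b\<in>Basis. (w \<bullet> b) * mollify eta (zext (%x. g x \<bullet> b)) z)"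
  by (rule sum.cong) (simp_all add: moll_weak_gradient[OF f g eta z, unfolded dmoll_shift[OF eta]])
 also have "... = (\<integral>y. (\<Sum>b\<in>Basis. (w \<bullet> b) * (zext (%x. g x \<bullet> b) y * moll eta (y - z))) \<partial>lborel)"
  unfolding mollify_def using mollify_integrable[OF eta gb] by (subst Bochner_Integration.integral_sum) auto
 also have "... = (\<integral>y. (zext g y \<bullet> w) * moll eta (y - z) \<partial>lborel)"
 proof (intro Bochner_Integration.integral_cong refl)
  fix y
  have "zext g y \<bullet> w = (\<Sum>b\<in>Basis. (w \<bullet> b) * zext (%x. g x \<bullet> b) y)"
   by (subst euclidean_inner, rule sum.cong) (auto simp: zext_def)
  thus "(\<Sum>b\<in>Basis. (w \<bullet> b) * (zext (%x. g x \<bullet> b) y * moll eta (y - z))) = (zext g y \<bullet> w) * moll eta (y - z)"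
   by (simp only: sum_distrib_right mult.assoc)
 qed
 also have "\<bar>...\<bar> <= (\<integral>y. \<bar>(zext g y \<bullet> w) * moll eta (y - z)\<bar> \<partial>lborel)" by (rule integral_abs_bound)
 also have "... <= (\<integral>y. norm w * (zext (%x. norm (g x)) y * moll eta (y - z)) \<partial>lborel)"
 proof (rule integral_mono')
  show "integrable lborel (%y. norm w * (zext (%x. norm (g x)) y * moll eta (y - z)))" using mollify_integrable[OF eta gn] by simp
  fix y
  have "\<bar>zext g y \<bullet> w\<bar> <= norm w * zext (%x. norm (g x)) y"
   using Cauchy_Schwarz_ineq2[of "zext g y" w] by (cases "y \<in> M") (auto simp: mult.commute)
  thus "\<bar>(zext g y \<bullet> w) * moll eta (y - z)\<bar> <= norm w * (zext (%x. norm (g x)) y * moll eta (y - z))"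
   using moll_nonneg[OF eta, of "y - z"] by (simp add: abs_mult mult.assoc[symmetric] mult_right_mono)
 qed (simp add: zext_def moll_nonneg[OF eta])
 also have "... = norm w * mollify eta (zext (%x. norm (g x))) z" by (simp add: mollify_def)
 finally show ?thesis using mollify_deriv[OF eta fi, of z w] by blast
qed

text \<open>The mean value theorem along the segment. The gradient bound at the intermediate point is traded for that at
x, at the expense of the Lipschitz constant \<Lambda>.\<close>

lemma mollify_zext_local:
 assumes f: "bdd f" and g: "weak_gradient M f g" and eta: "0 < eta"
  and x: "cball x (dist x y + real DIM('a) * eta) \<subseteq> interior M"
  and \<Lambda>: "0 <= \<Lambda>" "!!u v. \<bar>mollify eta (zext (%x. norm (g x))) u - mollify eta (zext (%x. norm (g x))) v\<bar> <= \<Lambda> * dist u v"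
 shows "\<bar>mollify eta (zext f) y - mollify eta (zext f) x\<bar> <= dist x y * (mollify eta (zext (%x. norm (g x))) x + \<Lambda> * dist x y)"
proof -
 let ?G = "mollify eta (zext (%x. norm (g x)))" and ?F = "mollify eta (zext f)"
 let ?w = "y - x"
 have box: "cbox (z - eta *\<^sub>R One) (z + eta *\<^sub>R One) \<subseteq> interior M" if z: "dist x z <= dist x y" for z
 proof
  fix v assume "v \<in> cbox (z - eta *\<^sub>R One) (z + eta *\<^sub>R One)"
  hence "\<bar>(v - z) \<bullet> b\<bar> <= eta" if "b \<in> Basis" for b
   using that by (auto simp: mem_box inner_simps abs_le_iff dest!: bspec[of _ _ b])
  hence "(\<Sum>b\<in>Basis. \<bar>(v - z) \<bullet> b\<bar>) <= real DIM('a) * eta" by (rule sum_bounded_above)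
  hence "dist z v <= real DIM('a) * eta" using norm_le_l1[of "v - z"] by (simp add: dist_norm norm_minus_commute)
  hence "v \<in> cball x (dist x y + real DIM('a) * eta)" using dist_triangle[of x v z] z by simp
  thus "v \<in> interior M" using x by blast
 qed
 have ds: "dist x (x + t *\<^sub>R ?w) <= dist x y" if "0 <= t" "t <= 1" for t
  using that mult_right_mono[of t 1 "norm ?w"] by (simp add: dist_norm norm_minus_commute)
 have "\<exists>D. ((%s. ?F (x + s *\<^sub>R ?w)) has_real_derivative D) (at t) & \<bar>D\<bar> <= norm ?w * ?G (x + t *\<^sub>R ?w)" if t: "0 <= t" "t <= 1" for t
 proof -
  obtain D where D: "((%s. ?F ((x + t *\<^sub>R ?w) + s *\<^sub>R ?w)) has_real_derivative D) (at 0)" "\<bar>D\<bar> <= norm ?w * ?G (x + t *\<^sub>R ?w)"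
   using mollify_zext_derivative[OF f g eta box[OF ds[OF t]]] by blast
  have "((%s. ?F (x + (t + s) *\<^sub>R ?w)) has_real_derivative D) (at 0)" using D(1) by (simp only: scaleR_left_distrib add.assoc)
  hence "((%s. ?F (x + s *\<^sub>R ?w)) has_real_derivative D) (at (t + 0))"
   using DERIV_shift[of "%s. ?F (x + s *\<^sub>R ?w)" D 0 t] by (simp add: add.commute)
  thus ?thesis using D(2) by auto
 qed
 then obtain D where D: "!!t. 0 <= t ==> t <= 1 ==> ((%s. ?F (x + s *\<^sub>R ?w)) has_real_derivative D t) (at t)"
  "!!t. 0 <= t ==> t <= 1 ==> \<bar>D t\<bar> <= norm ?w * ?G (x + t *\<^sub>R ?w)" by metis
 obtain t where t: "0 < t" "t < 1" "?F (x + 1 *\<^sub>R ?w) - ?F (x + 0 *\<^sub>R ?w) = (1 - 0) * D t"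
  using MVT2[of 0 1 "%s. ?F (x + s *\<^sub>R ?w)" D] D(1) by auto
 have "\<bar>?F y - ?F x\<bar> <= norm ?w * ?G (x + t *\<^sub>R ?w)" using t D(2)[of t] by simp
 also have "... <= norm ?w * (?G x + \<Lambda> * dist x y)"
 proof (rule mult_left_mono)
  have "?G (x + t *\<^sub>R ?w) <= ?G x + \<Lambda> * dist x (x + t *\<^sub>R ?w)" using \<Lambda>(2)[of "x + t *\<^sub>R ?w" x] by (simp add: dist_commute)
  also have "... <= ?G x + \<Lambda> * dist x y" using mult_left_mono[OF ds[of t] \<Lambda>(1)] t by simp
  finally show "?G (x + t *\<^sub>R ?w) <= ?G x + \<Lambda> * dist x y" .
 qed simp
 finally show ?thesis by (simp add: dist_norm norm_minus_commute)
qed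

lemma zext_norm_square:
 assumes "weak_gradient M f g"
 shows "(\<integral>\<^sup>+x. ennreal ((zext (%x. norm (g x)) x)^2) \<partial>lborel) = ennreal (vol * grad_sq g)"
proof -
 note [measurable] = weak_gradientD(1)[OF assms]
 have "(\<integral>\<^sup>+x. ennreal ((zext (%x. norm (g x)) x)^2) \<partial>lborel) = (\<integral>\<^sup>+x. ennreal ((norm (g x))^2) * indicator M x \<partial>lborel)"
  by (rule nn_integral_cong) (auto simp: zext_def indicator_def)
 also have "... = ennreal vol * (\<integral>\<^sup>+x. ennreal ((norm (g x))^2))" by (rule nn_integral_lborel_mu) measurable
 also have "(\<integral>\<^sup>+x. ennreal ((norm (g x))^2)) = ennreal (grad_sq g)"
  by (rule nn_integral_eq_integral[OF weak_gradientD(2)[OF assms]]) simp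
 finally show ?thesis using vol_pos by (simp add: ennreal_mult)
qed

end

section \<open>Oscillation and energy\<close>

context reflected_process begin

lemma mollify_le_1:
 assumes f: "integrable lborel (f :: 'a => real)" "!!x. f x <= 1" and eta: "0 < eta"
 shows "mollify eta f x <= 1"
proof -
 have "mollify eta f x <= (\<integral>y. moll eta (y - x) \<partial>lborel)"
  unfolding mollify_def
  by (rule integral_mono[OF mollify_integrable[OF eta f(1)] moll_integrable[OF eta]])
   (use mult_right_mono[OF f(2) moll_nonneg[OF eta]] in simp)
 thus ?thesis using moll_integral[OF eta, of x] by simp
qed

text \<open>For values in [0, 1] squared increments are Lipschitz in the function, so convergence in mean suffices to pass
from mollifications to f.\<close>

lemma osc_L1_stable:
 fixes F G :: "'a => real"
 assumes F[measurable]: "F \<in> borel_measurable borel" and G[measurable]: "G \<in> borel_measurable borel"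
  and F01: "!!x. 0 <= F x" "!!x. F x <= 1" and G01: "!!x. 0 <= G x" "!!x. G x <= 1"
  and V[measurable]: "V \<in> sets borel" and v: "emeasure lborel V = ennreal v" "0 <= v"
 shows "emeasure (osc_measure r G) (V \<times> V) <= emeasure (osc_measure r F) (V \<times> V) + ennreal (4 * v) * (\<integral>\<^sup>+x. ennreal \<bar>G x - F x\<bar> * indicator V x \<partial>lborel)"
proof -
 let ?h = "%x. ennreal \<bar>G x - F x\<bar>"
 define E where "E = (\<integral>\<^sup>+x. ?h x * indicator V x \<partial>lborel)"
 have pt: "osc_kernel r G x y <= osc_kernel r F x y + (2 * ?h x + 2 * ?h y)" for x y
 proof -
  have "(G y - G x)^2 - (F y - F x)^2 = ((G y - G x) - (F y - F x)) * ((G y - G x) + (F y - F x))" by (simp add: power2_eq_square algebra_simps)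
  also have "... <= \<bar>(G y - G x) - (F y - F x)\<bar> * \<bar>(G y - G x) + (F y - F x)\<bar>" using abs_ge_self by (simp add: abs_mult[symmetric])
  also have "... <= (\<bar>G x - F x\<bar> + \<bar>G y - F y\<bar>) * 2"
   using F01[of x] F01[of y] G01[of x] G01[of y] by (intro mult_mono) linarith+
  finally have "(G y - G x)^2 <= (F y - F x)^2 + (2 * \<bar>G x - F x\<bar> + 2 * \<bar>G y - F y\<bar>)" by (simp add: algebra_simps)
  hence "ennreal ((G y - G x)^2) <= ennreal ((F y - F x)^2 + (2 * \<bar>G x - F x\<bar> + 2 * \<bar>G y - F y\<bar>))" by (rule ennreal_leI)
  thus ?thesis by (simp add: osc_kernel_def indicator_def ennreal_mult)
 qed
 have inner: "(\<integral>\<^sup>+y. osc_kernel r G x y * indicator V y \<partial>lborel) <= (\<integral>\<^sup>+y. osc_kernel r F x y * indicator V y \<partial>lborel) + (2 * ?h x * ennreal v + 2 * E)" for x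
 proof -
  have "(\<integral>\<^sup>+y. osc_kernel r G x y * indicator V y \<partial>lborel) <= (\<integral>\<^sup>+y. osc_kernel r F x y * indicator V y + (2 * ?h x * indicator V y + 2 * (?h y * indicator V y)) \<partial>lborel)"
   by (rule nn_integral_mono) (use pt in "simp add: indicator_def")
  thus ?thesis by (simp add: nn_integral_add nn_integral_cmult E_def v(1))
 qed
 have "emeasure (osc_measure r G) (V \<times> V) <= (\<integral>\<^sup>+x. (\<integral>\<^sup>+y. osc_kernel r F x y * indicator V y \<partial>lborel) * indicator V x + (2 * ennreal v * (?h x * indicator V x) + 2 * E * indicator V x) \<partial>lborel)"
  unfolding emeasure_osc[OF G V] by (rule nn_integral_mono) (use inner in "simp add: indicator_def mult_ac")
 also have "... = emeasure (osc_measure r F) (V \<times> V) + (2 * ennreal v * E + 2 * E * ennreal v)"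
  unfolding emeasure_osc[OF F V] by (subst nn_integral_add) (simp_all add: nn_integral_add nn_integral_cmult E_def[symmetric] v(1))
 also have "2 * ennreal v * E + 2 * E * ennreal v = ennreal (4 * v) * E"
 proof -
  have e4: "ennreal (4 * v) = 2 * ennreal v + 2 * ennreal v" using v(2) ennreal_plus[of "2 * v" "2 * v"] by (simp add: ennreal_mult)
  show ?thesis unfolding e4 distrib_right by (simp only: mult_ac)
 qed
 finally show ?thesis by (simp add: E_def)
qed

text \<open>On a compact chart domain inside the interior the mollifications satisfy the hypotheses of chart_estimate, and
the squared mollified gradient has no larger integral than the squared gradient. The constant does not depend
on the domain, which allows the exhaustion of the chart.\<close>

lemma chart_bound_compact:
 fixes theta phi :: "'a => 'a"
 assumes f: "bdd f" "!!x. x \<in> M ==> 0 <= f x & f x <= 1" and g: "weak_gradient M f g"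
  and W: "compact W" "convex W" and V: "V = theta ` W" and inv: "!!a. a \<in> W ==> phi (theta a) = a" and L: "0 < L"
  and lip: "!!a b. a \<in> W ==> b \<in> W ==> dist (theta a) (theta b) <= L * dist a b"
  and lip': "!!x y. x \<in> V ==> y \<in> V ==> dist (phi x) (phi y) <= L * dist x y"
  and VM: "V \<subseteq> interior M" and r: "0 < r"
 shows "emeasure (osc_measure r (zext f)) (V \<times> V) <= ennreal (chart_const TYPE('a) L * r ^ (DIM('a) + 2) * (vol * grad_sq g))"
proof -
 have ctheta: "continuous_on W theta"
  by (rule lipschitz_on_continuous_on[of L]) (use lip L in "auto intro: lipschitz_onI")
 have cV: "compact V" unfolding V by (rule compact_continuous_image[OF ctheta W(1)])
 have Wb[measurable]: "W \<in> sets borel" and Vb[measurable]: "V \<in> sets borel" using W cV by (simp_all add: borel_compact)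
 \<comment> \<open>Measurable on the whole space.\<close>
 define theta' where "theta' a = (if a \<in> W then theta a else 0)" for a
 have theta'm: "theta' \<in> borel_measurable borel"
  unfolding theta'_def[abs_def] by (rule borel_measurable_continuous_on_if[OF Wb ctheta]) auto
 have V': "V = theta' ` W" unfolding V theta'_def by auto
 have "V \<inter> - interior M = {}" using VM by auto
 from separate_compact_closed[OF cV closed_Compl[OF open_interior] this]
 obtain d where d: "0 < d" "!!x y. x \<in> V ==> y \<in> - interior M ==> d <= dist x y" by blast
 \<comment> \<open>Room for mollification at scales below d / 4.\<close>
 have dV: "cball x (d / 2) \<subseteq> interior M" if "x \<in> V" for x
  using d(2)[OF that] d(1) by force
 let ?f = "zext f" and ?n = "zext (%x. norm (g x))" and ?J = "vol * grad_sq g"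
 note fi = zext_integrable[OF bdd_integrable[OF f(1)]]
 have fm[measurable]: "?f \<in> borel_measurable borel" by (rule zext_measurable[OF bdd_meas[OF f(1)]])
 have f01: "0 <= ?f x" "?f x <= 1" for x using f(2)[of x] by (auto simp: zext_def indicator_def)
 have ni: "integrable lborel ?n" by (rule zext_integrable[OF weak_gradientD(3)[OF g]])
 have "(%x. (?n x)^2) = zext (%x. (norm (g x))^2)" by (auto simp: zext_def indicator_def)
 hence n2: "integrable lborel (%x. (?n x)^2)" using zext_integrable[OF weak_gradientD(2)[OF g]] by simp
 define K where "K = chart_const TYPE('a) L * r ^ (DIM('a) + 2)"
 have K0: "0 <= K" unfolding K_def using L r by (simp add: chart_const_nonneg)
 have step: "emeasure (osc_measure r (mollify eta ?f)) (V \<times> V) <= ennreal (K * ?J)" if eta: "0 < eta" "real DIM('a) * eta <= d / 4" for eta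
 proof -
  obtain \<Lambda> where \<Lambda>: "0 <= \<Lambda>" "!!u v. \<bar>mollify eta ?n u - mollify eta ?n v\<bar> <= \<Lambda> * dist u v" by (rule mollify_lipschitz[OF eta(1) ni]) (rule that)
  have "emeasure (osc_measure r (mollify eta ?f)) (V \<times> V) <= ennreal K * (\<integral>\<^sup>+x. ennreal ((mollify eta ?n x)^2) * indicator V x \<partial>lborel)"
   unfolding K_def
  proof (rule chart_estimate[where kappa = "d / 4" and theta = theta' and phi = phi, OF W V' _ L _ lip' _ _ \<Lambda>(1) r _ theta'm mollify_measurable[OF eta(1) fi] mollify_measurable[OF eta(1) ni]])
   show "\<bar>mollify eta ?f y - mollify eta ?f x\<bar> <= dist x y * (mollify eta ?n x + \<Lambda> * dist x y)" if "x \<in> V" "y \<in> V" "dist x y < d / 4" for x y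
   proof (rule mollify_zext_local[OF f(1) g eta(1) _ \<Lambda>])
    have "cball x (dist x y + real DIM('a) * eta) \<subseteq> cball x (d / 2)" by (rule subset_cball) (use that eta in linarith)
    thus "cball x (dist x y + real DIM('a) * eta) \<subseteq> interior M" using dV[OF that(1)] by blast
   qed
   show "0 <= mollify eta ?n x" for x by (rule mollify_nonneg[OF eta(1)]) (simp add: zext_def)
  qed (use d inv lip in "simp_all add: theta'_def")
  also have "... <= ennreal K * (\<integral>\<^sup>+x. ennreal ((mollify eta ?n x)^2) \<partial>lborel)"
   by (intro mult_left_mono nn_integral_mono) (simp_all add: indicator_def)
  also have "... <= ennreal K * (\<integral>\<^sup>+x. ennreal ((?n x)^2) \<partial>lborel)"
   by (rule mult_left_mono[OF mollify_square_integral[OF eta(1) ni n2]]) simp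
  also have "... = ennreal (K * ?J)" unfolding zext_norm_square[OF g] by (rule ennreal_mult'[symmetric]) (rule K0)
  finally show ?thesis .
 qed
 show ?thesis
  unfolding K_def[symmetric]
 proof (rule ennreal_le_epsilon)
  fix e :: real assume e: "0 < e"
  have fV: "emeasure lborel V < \<infinity>" by (rule emeasure_bounded_finite[OF compact_imp_bounded[OF cV]])
  then obtain v where v: "emeasure lborel V = ennreal v" "0 <= v" by (cases "emeasure lborel V") auto
  have e': "0 < e / (4 * v + 1)" using e v by (simp add: add_nonneg_pos)
  obtain eta0 where eta0: "0 < eta0" "!!eta. 0 < eta ==> eta < eta0 ==> (\<integral>\<^sup>+x. ennreal \<bar>?f x - mollify eta ?f x\<bar> * indicator V x \<partial>lborel) <= ennreal (e / (4 * v + 1))"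
   by (rule mollify_L1_tendsto[OF fi Vb fV e']) (rule that)
  define eta where "eta = min (eta0 / 2) (d / (4 * real DIM('a)))"
  have eta: "0 < eta" "eta < eta0" using eta0(1) d(1) by (auto simp: eta_def min_less_iff_disj)
  have "real DIM('a) * eta <= real DIM('a) * (d / (4 * real DIM('a)))" by (rule mult_left_mono) (simp_all add: eta_def)
  hence eta': "real DIM('a) * eta <= d / 4" by simp
  have "emeasure (osc_measure r ?f) (V \<times> V) <= emeasure (osc_measure r (mollify eta ?f)) (V \<times> V) + ennreal (4 * v) * (\<integral>\<^sup>+x. ennreal \<bar>?f x - mollify eta ?f x\<bar> * indicator V x \<partial>lborel)"
   by (rule osc_L1_stable[OF mollify_measurable[OF eta(1) fi] fm mollify_nonneg[OF eta(1) f01(1)] mollify_le_1[OF fi f01(2) eta(1)] f01 Vb v])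
  also have "... <= ennreal (K * ?J) + ennreal (4 * v) * ennreal (e / (4 * v + 1))"
   by (intro add_mono step eta eta' mult_left_mono eta0(2)) simp
  also have "ennreal (4 * v) * ennreal (e / (4 * v + 1)) = ennreal (4 * v * (e / (4 * v + 1)))" by (rule ennreal_mult[symmetric]) (use v e' in auto)
  also have "... <= ennreal e"
  proof (rule ennreal_leI)
   have "4 * v * e <= (4 * v + 1) * e" using e by (intro mult_right_mono) auto
   thus "4 * v * (e / (4 * v + 1)) <= e" using v by (simp add: pos_divide_le_eq add_nonneg_pos mult.commute)
  qed
  finally show "emeasure (osc_measure r ?f) (V \<times> V) <= ennreal (K * ?J) + ennreal e" by (simp add: add_left_mono)
 qed
qed


lemma osc_incseq:
 assumes X: "incseq X" "!!n. X n \<in> sets borel" and F: "F \<in> borel_measurable borel"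
  and b: "!!n. emeasure (osc_measure r F) (X n \<times> X n) <= B"
 shows "emeasure (osc_measure r F) ((\<Union>n. X n) \<times> (\<Union>n. X n)) <= B"
proof -
 have "(\<Union>n. X n) \<times> (\<Union>n. X n) = (\<Union>n. X n \<times> X n)"
 proof safe
  fix a b m n assume "a \<in> X m" "b \<in> X n"
  hence "a \<in> X (max m n)" "b \<in> X (max m n)" using incseqD[OF X(1), of m "max m n"] incseqD[OF X(1), of n "max m n"] by auto
  thus "(a, b) \<in> (\<Union>n. X n \<times> X n)" by blast
 qed auto
 note eq = this
 have eq2: "(SUP n. emeasure (osc_measure r F) (X n \<times> X n)) = emeasure (osc_measure r F) (\<Union>n. X n \<times> X n)"
 proof (rule SUP_emeasure_incseq)
  show "range (%n. X n \<times> X n) \<subseteq> sets (osc_measure r F)" using X(2) by auto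
  show "incseq (%n. X n \<times> X n)" using X(1) by (auto simp: incseq_def)
 qed
 show ?thesis unfolding eq eq2[symmetric] by (rule SUP_least) (rule b)
qed

definition osc_bounded :: "real => 'a set => bool" where
 "osc_bounded L V' \<longleftrightarrow> (\<forall>f g r. bdd f --> unit_val f --> weak_gradient M f g --> 0 < r -->
   emeasure (osc_measure r (zext f)) (V' \<times> V') <= ennreal (chart_const TYPE('a) L * r ^ (DIM('a) + 2) * (vol * grad_sq g)))"

text \<open>The bound for compact convex W n passes to their union. What is left of the chart is null, being a Lipschitz
image of a null set.\<close>

lemma chart_exhaustion:
 fixes phi :: "'a => 'a"
 assumes L: "1 <= L" and ch: "bilipschitz_chart L phi V D" and VM: "V \<subseteq> M"
  and W: "incseq W" "!!n. compact (W n)" "!!n. convex (W n)" "!!n. W n \<subseteq> D"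
  and null: "negligible (D - (\<Union>n. W n))" and fr: "!!x. x \<in> V ==> x \<in> frontier M ==> phi x \<notin> (\<Union>n. W n)"
 shows "\<exists>V'. V' \<in> sets borel & V' \<subseteq> V \<inter> interior M & negligible (V - V') & osc_bounded L V'"
proof -
 have bij: "bij_betw phi V D" and lo: "!!x y. x \<in> V ==> y \<in> V ==> dist x y / L <= dist (phi x) (phi y)"
  and up: "!!x y. x \<in> V ==> y \<in> V ==> dist (phi x) (phi y) <= L * dist x y"
  using ch unfolding bilipschitz_chart_def by blast+
 define theta where "theta = inv_into V phi"
 have thetaV: "theta a \<in> V" and phitheta: "phi (theta a) = a" if "a \<in> D" for a
  using that bij unfolding theta_def bij_betw_def by (auto intro: inv_into_into f_inv_into_f)
 have thetaphi: "theta (phi x) = x" "phi x \<in> D" if "x \<in> V" for x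
  using that bij unfolding theta_def bij_betw_def by auto
 have lip: "dist (theta a) (theta b) <= L * dist a b" if "a \<in> D" "b \<in> D" for a b
  using lo[OF thetaV[OF that(1)] thetaV[OF that(2)]] L that by (simp add: phitheta pos_divide_le_eq mult.commute)
 define X where "X n = theta ` W n" for n
 have XV: "X n \<subseteq> V" for n unfolding X_def using thetaV W(4)[of n] by auto
 have cl: "closed M" by (rule compact_imp_closed[OF compact_M])
 have XM: "X n \<subseteq> interior M" for n
 proof
  fix x assume x: "x \<in> X n"
  then obtain a where a: "a \<in> W n" "x = theta a" by (auto simp: X_def)
  have "phi x = a" using a phitheta[of a] W(4)[of n] by auto
  hence "phi x \<in> (\<Union>n. W n)" using a by blast
  hence "x \<notin> frontier M" using fr[of x] XV x by blast
  thus "x \<in> interior M" using XV[of n] x VM cl by (auto simp: frontier_def)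
 qed
 have Xb: "X n \<in> sets borel" for n
 proof -
  have "continuous_on (W n) theta"
   by (rule lipschitz_on_continuous_on[of L]) (use lip L W(4)[of n] in "auto intro!: lipschitz_onI")
  hence "compact (X n)" unfolding X_def using W(2) by (rule compact_continuous_image)
  thus ?thesis by (simp add: borel_compact)
 qed
 have Xi: "incseq X" using W(1) unfolding incseq_def X_def by (auto intro!: image_mono)
 have neg: "negligible (V - (\<Union>n. X n))"
 proof -
  have "negligible (theta ` (D - (\<Union>n. W n)))"
  proof (rule negligible_locally_Lipschitz_image[OF _ null])
   fix x assume x: "x \<in> D - (\<Union>n. W n)"
   show "\<exists>T B. open T & x \<in> T & (\<forall>y\<in>(D - (\<Union>n. W n)) \<inter> T. norm (theta y - theta x) <= B * norm (y - x))"
    using lip x by (intro exI[of _ UNIV] exI[of _ L]) (auto simp: dist_norm[symmetric])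
  qed simp
  moreover have "V - (\<Union>n. X n) \<subseteq> theta ` (D - (\<Union>n. W n))"
  proof
   fix x assume x: "x \<in> V - (\<Union>n. X n)"
   have "phi x \<notin> (\<Union>n. W n)"
   proof
    assume "phi x \<in> (\<Union>n. W n)"
    then obtain n where "phi x \<in> W n" by blast
    hence "theta (phi x) \<in> X n" by (simp add: X_def)
    thus False using x thetaphi(1)[of x] by auto
   qed
   thus "x \<in> theta ` (D - (\<Union>n. W n))" using thetaphi[of x] x by (intro image_eqI[of _ _ "phi x"]) auto
  qed
  ultimately show ?thesis by (rule negligible_subset)
 qed
 have bound: "emeasure (osc_measure r (zext f)) ((\<Union>n. X n) \<times> (\<Union>n. X n)) <= ennreal (chart_const TYPE('a) L * r ^ (DIM('a) + 2) * (vol * grad_sq g))"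
  if f: "bdd f" "unit_val f" and g: "weak_gradient M f g" and r: "0 < r" for f g r
 proof (rule osc_incseq[OF Xi Xb zext_measurable[OF bdd_meas[OF f(1)]]])
  fix n
  show "emeasure (osc_measure r (zext f)) (X n \<times> X n) <= ennreal (chart_const TYPE('a) L * r ^ (DIM('a) + 2) * (vol * grad_sq g))"
  proof (rule chart_bound_compact[where theta = theta and phi = phi, OF f(1) _ g W(2,3) X_def _ _ _ _ XM r])
   show "phi (theta a) = a" if "a \<in> W n" for a using that W(4) phitheta by blast
   show "dist (theta a) (theta b) <= L * dist a b" if "a \<in> W n" "b \<in> W n" for a b using that W(4) lip by blast
   show "dist (phi x) (phi y) <= L * dist x y" if "x \<in> X n" "y \<in> X n" for x y using that XV up by blast
   show "0 < L" using L by simp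
   show "0 <= f x & f x <= 1" if "x \<in> M" for x using f(2) that by blast
  qed
 qed
 show ?thesis
 proof (rule exI[of _ "\<Union>n. X n"], intro conjI allI impI)
  show "(\<Union>n. X n) \<in> sets borel" using Xb by (intro sets.countable_UN) auto
  show "(\<Union>n. X n) \<subseteq> V \<inter> interior M" using XV XM by blast
 qed (use neg bound in "simp_all add: osc_bounded_def")
qed

lemma ex_small_fraction: assumes "0 < delta" shows "\<exists>n. R / real (n + 2) <= delta"
proof -
 obtain n where n: "\<bar>R\<bar> / delta < real n" using reals_Archimedean2 by blast
 hence "\<bar>R\<bar> <= delta * real (n + 2)" using assms by (simp add: pos_divide_less_eq algebra_simps)
 thus ?thesis by (intro exI[of _ n]) (simp add: pos_divide_le_eq)
qed

text \<open>Balls are exhausted by smaller balls, half-balls by smaller balls cut by a hyperplane parallel to the flat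
face; the face itself is null.\<close>

lemma chart_poincare:
 fixes phi :: "'a => 'a"
 assumes L: "1 <= L" and R: "0 < R" and V: "relopen V"
  and ch: "V \<inter> frontier M = {} & bilipschitz_chart L phi V (ball (0::'a) R) \<or>
    (\<exists>e\<in>Basis. bilipschitz_chart L phi V {y \<in> ball (0::'a) R. 0 <= y \<bullet> e} &
      phi ` (V \<inter> frontier M) \<subseteq> {y. y \<bullet> e = 0})"
 shows "\<exists>V'. V' \<in> sets borel & V' \<subseteq> V \<inter> interior M & negligible (V - V') & osc_bounded L V'"
proof -
 have VM: "V \<subseteq> M" using openin_subset[OF V] by simp
 \<comment> \<open>The index is shifted by 2 so that R - delta n is positive.\<close>
 define delta where "delta n = R / real (n + 2)" for n
 have delta: "0 < delta n" for n using R by (simp add: delta_def)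
 have deltam: "delta n <= delta m" if "m <= n" for m n using that R unfolding delta_def by (intro divide_left_mono) auto
 have sub: "cball 0 (R - delta n) \<subseteq> ball (0::'a) R" for n using delta[of n] by (intro cball_subset_ball_iff[THEN iffD2]) auto
 have ex: "\<exists>n. norm y <= R - delta n & delta n <= s" if ys: "norm y < R" "0 < s" for y :: 'a and s
 proof -
  have "0 < min (R - norm y) s" using ys by simp
  from ex_small_fraction[OF this, of R] obtain n where "R / real (n + 2) <= min (R - norm y) s" ..
  thus ?thesis by (intro exI[of _ n]) (simp add: delta_def)
 qed
 from ch show ?thesis
 proof
  assume c: "V \<inter> frontier M = {} & bilipschitz_chart L phi V (ball (0::'a) R)"
  show ?thesis
  proof (rule chart_exhaustion[OF L conjunct2[OF c] VM, of "%n. cball 0 (R - delta n)"])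
   show "incseq (%n. cball (0::'a) (R - delta n))" using deltam by (auto simp: incseq_def intro!: subset_cball)
   have "ball (0::'a) R - (\<Union>n. cball 0 (R - delta n)) = {}" using ex[of _ 1] by fastforce
   thus "negligible (ball (0::'a) R - (\<Union>n. cball 0 (R - delta n)))" by simp
  qed (use c sub in auto)
 next
  assume "\<exists>e\<in>Basis. bilipschitz_chart L phi V {y \<in> ball (0::'a) R. 0 <= y \<bullet> e} & phi ` (V \<inter> frontier M) \<subseteq> {y. y \<bullet> e = 0}"
  then obtain e where e: "e \<in> Basis" and c: "bilipschitz_chart L phi V {y \<in> ball (0::'a) R. 0 <= y \<bullet> e}"
   and fr: "phi ` (V \<inter> frontier M) \<subseteq> {y. y \<bullet> e = 0}" by blast
  let ?W = "%n. cball (0::'a) (R - delta n) \<inter> {y. delta n <= e \<bullet> y}"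
  show ?thesis
  proof (rule chart_exhaustion[OF L c VM, of ?W])
   show "incseq ?W"
   proof (rule incseq_SucI)
    fix n
    have "delta (Suc n) <= delta n" by (rule deltam) simp
    thus "?W n \<subseteq> ?W (Suc n)" by auto
   qed
   show "compact (?W n)" for n by (intro compact_Int_closed compact_cball closed_halfspace_ge)
   show "convex (?W n)" for n by (intro convex_Int convex_cball convex_halfspace_ge)
   show "?W n \<subseteq> {y \<in> ball 0 R. 0 <= y \<bullet> e}" for n using sub[of n] delta[of n] by (auto simp: inner_commute)
   show "phi x \<notin> (\<Union>n. ?W n)" if "x \<in> V" "x \<in> frontier M" for x
   proof -
    have "e \<bullet> phi x = 0" using fr that by (auto simp: inner_commute)
    thus ?thesis using delta by (auto simp: not_le)
   qed
   have "{y \<in> ball (0::'a) R. 0 <= y \<bullet> e} - (\<Union>n. ?W n) \<subseteq> {y. y \<bullet> e = 0}"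
   proof
    fix y assume y: "y \<in> {y \<in> ball (0::'a) R. 0 <= y \<bullet> e} - (\<Union>n. ?W n)"
    show "y \<in> {y. y \<bullet> e = 0}"
    proof (rule ccontr)
     assume "y \<notin> {y. y \<bullet> e = 0}"
     hence "0 < e \<bullet> y" using y by (auto simp: inner_commute)
     then obtain n where "norm y <= R - delta n" "delta n <= e \<bullet> y" using ex[of y "e \<bullet> y"] y by auto
     hence "y \<in> ?W n" by simp
     thus False using y by blast
    qed
   qed
   thus "negligible ({y \<in> ball (0::'a) R. 0 <= y \<bullet> e} - (\<Union>n. ?W n))"
    by (rule negligible_subset[OF negligible_standard_hyperplane[OF e]])
  qed
 qed
qed

lemma osc_null:
 fixes F :: "'a => real"
 assumes F[measurable]: "F \<in> borel_measurable borel" and Z: "Z \<in> sets borel" "negligible Z"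
 shows "{z. snd z - fst z \<notin> ball 0 r} \<union> (Z \<times> UNIV \<union> UNIV \<times> Z) \<in> null_sets (osc_measure r F)" (is "?far \<union> ?N \<in> _")
proof -
 have s: "sets (lborel \<Otimes>\<^sub>M (lborel :: 'a measure)) = sets (borel \<Otimes>\<^sub>M borel)" by (rule sets_pair_measure_cong) simp_all
 have "Measurable.pred (borel \<Otimes>\<^sub>M borel) (%z :: 'a \<times> 'a. \<not> (snd z - fst z \<in> ball 0 r))" unfolding mem_ball_0 by measurable
 hence far: "?far \<in> sets (lborel \<Otimes>\<^sub>M lborel)" unfolding s pred_def by (simp add: space_pair_measure)
 have "emeasure lborel Z = 0" using Z by (simp add: negligible_iff_emeasure0)
 hence N: "?N \<in> null_sets (lborel \<Otimes>\<^sub>M lborel)"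
  using Z lborel.emeasure_pair_measure_Times[of Z lborel UNIV] lborel.emeasure_pair_measure_Times[of UNIV lborel Z]
  by (intro null_sets.Un null_setsI) auto
 have "AE z in lborel \<Otimes>\<^sub>M lborel. z \<in> ?far \<union> ?N --> osc_kernel r F (fst z) (snd z) = 0"
  using AE_not_in[OF N] by eventually_elim (auto simp: osc_kernel_def)
 thus ?thesis unfolding osc_measure_def using far N by (subst null_sets_density_iff) auto
qed

text \<open>Two points at distance below half the chart size lie in one chart of a finite cover. The frontier is null
because the sets V' x lie in the interior and fill the charts up to null sets.\<close>

lemma oscillation_bound:
 assumes ch: "uniform_bilipschitz_charts M"
 obtains K rho where "0 <= K" "0 < rho" "negligible (frontier M)"
  "!!f g r. bdd f ==> unit_val f ==> weak_gradient M f g ==> 0 < r ==> r <= rho ==>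
   emeasure (osc_measure r (zext f)) (M \<times> M) <= ennreal (K * r ^ (DIM('a) + 2) * grad_sq g)"
proof -
 obtain L R rho where LR: "1 <= L" "0 < R" "0 < rho" and cv: "\<forall>x\<in>M. \<exists>V phi. relopen V & M \<inter> ball x rho \<subseteq> V &
    ((V \<inter> frontier M = {} & bilipschitz_chart L phi V (ball (0::'a) R)) \<or>
    (\<exists>e\<in>Basis. bilipschitz_chart L phi V {y \<in> ball (0::'a) R. 0 <= y \<bullet> e} &
      phi ` (V \<inter> frontier M) \<subseteq> {y. y \<bullet> e = 0}))"
  using ch unfolding uniform_bilipschitz_charts_def by (elim exE conjE) (rule that)
 have "\<exists>VV. relopen (fst VV) & M \<inter> ball x rho \<subseteq> fst VV & snd VV \<in> sets borel & snd VV \<subseteq> fst VV \<inter> interior M & negligible (fst VV - snd VV) & osc_bounded L (snd VV)" if x: "x \<in> M" for x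
 proof -
  obtain V phi where V: "relopen V" "M \<inter> ball x rho \<subseteq> V"
   and c: "(V \<inter> frontier M = {} & bilipschitz_chart L phi V (ball (0::'a) R)) \<or>
    (\<exists>e\<in>Basis. bilipschitz_chart L phi V {y \<in> ball (0::'a) R. 0 <= y \<bullet> e} &
      phi ` (V \<inter> frontier M) \<subseteq> {y. y \<bullet> e = 0})" using bspec[OF cv x] by (elim exE conjE) (rule that)
  from chart_poincare[OF LR(1,2) V(1) c] obtain V' where "V' \<in> sets borel" "V' \<subseteq> V \<inter> interior M" "negligible (V - V')" "osc_bounded L V'" by blast
  thus ?thesis using V by (intro exI[of _ "(V, V')"]) simp
 qed
 hence "\<forall>x\<in>M. \<exists>VV. relopen (fst VV) & M \<inter> ball x rho \<subseteq> fst VV & snd VV \<in> sets borel & snd VV \<subseteq> fst VV \<inter> interior M & negligible (fst VV - snd VV) & osc_bounded L (snd VV)" by blast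
 from bchoice[OF this] obtain VV where VV: "\<forall>x\<in>M. relopen (fst (VV x)) & M \<inter> ball x rho \<subseteq> fst (VV x) & snd (VV x) \<in> sets borel & snd (VV x) \<subseteq> fst (VV x) \<inter> interior M & negligible (fst (VV x) - snd (VV x)) & osc_bounded L (snd (VV x))" by blast
 define V where "V x = fst (VV x)" for x
 define V' where "V' x = snd (VV x)" for x
 have V: "relopen (V x)" "M \<inter> ball x rho \<subseteq> V x" "V' x \<in> sets borel" "V' x \<subseteq> V x \<inter> interior M" "negligible (V x - V' x)" "osc_bounded L (V' x)"
  if "x \<in> M" for x using VV that unfolding V_def V'_def by blast+
 obtain I where I: "finite I" "I \<subseteq> M" "M \<subseteq> (\<Union>x\<in>I. ball x (rho / 2))"
 proof -
  have "M \<subseteq> (\<Union>x\<in>M. ball x (rho / 2))" using LR(3) by force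
  from compactE_image[OF compact_M _ this] obtain I where "I \<subseteq> M" "finite I" "M \<subseteq> (\<Union>x\<in>I. ball x (rho / 2))" by auto
  thus ?thesis using that by blast
 qed
 have inV: "x \<in> V i" if "i \<in> I" "x \<in> M" "dist i x < rho" for i x
 proof -
  have "x \<in> M \<inter> ball i rho" using that by simp
  thus ?thesis using V(2)[of i] I(2) that(1) by blast
 qed
 define Z where "Z = (\<Union>x\<in>I. V x - V' x)"
 have Vb: "V x \<in> sets borel" if x: "x \<in> M" for x
 proof -
  obtain T where "open T" "V x = M \<inter> T" using V(1)[OF x] by (auto simp: openin_open)
  thus ?thesis by simp
 qed
 have Zb: "Z \<in> sets borel" unfolding Z_def using I Vb V(3) by (intro sets.finite_UN) auto
 have Zn: "negligible Z" unfolding Z_def using I V(5) by (intro negligible_Union) auto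
 have fr: "negligible (frontier M)"
 proof (rule negligible_subset[OF Zn])
  show "frontier M \<subseteq> Z"
  proof
   fix x assume x: "x \<in> frontier M"
   hence xM: "x \<in> M" "x \<notin> interior M" using compact_imp_closed[OF compact_M] by (auto simp: frontier_def)
   then obtain i where i: "i \<in> I" "x \<in> ball i (rho / 2)" using I(3) by blast
   hence "x \<in> V i" using inV[OF i(1) xM(1)] LR(3) by auto
   moreover have "x \<notin> V' i" using V(4)[of i] I(2) i xM(2) by blast
   ultimately show "x \<in> Z" using i unfolding Z_def by blast
  qed
 qed
 define K where "K = real (card I) * (chart_const TYPE('a) L * vol)"
 have cc: "0 <= chart_const TYPE('a) L" by (rule chart_const_nonneg) (use LR in simp)
 have K: "0 <= K" unfolding K_def using cc vol_pos by simp
 show ?thesis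
 proof (rule that[OF K _ fr])
  show "0 < rho / 2" using LR by simp
  fix f g r assume f: "bdd f" "unit_val f" and g: "weak_gradient M f g" and r: "0 < r" "r <= rho / 2"
  let ?O = "osc_measure r (zext f)"
  let ?B = "chart_const TYPE('a) L * r ^ (DIM('a) + 2) * (vol * grad_sq g)"
  have B0: "0 <= ?B" using cc r vol_pos by (intro mult_nonneg_nonneg Bochner_Integration.integral_nonneg) auto
  have Fm: "zext f \<in> borel_measurable borel" by (rule zext_measurable[OF bdd_meas[OF f(1)]])
  let ?N = "{z. snd z - fst z \<notin> ball (0::'a) r} \<union> (Z \<times> UNIV \<union> UNIV \<times> Z)"
  have Nn: "?N \<in> null_sets ?O" by (rule osc_null[OF Fm Zb Zn])
  have V'b: "V' x \<times> V' x \<in> sets ?O" if "x \<in> I" for x using V(3)[of x] I(2) that by (auto intro!: pair_measureI)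
  have Ub: "(\<Union>x\<in>I. V' x \<times> V' x) \<in> sets ?O" using I V'b by (intro sets.finite_UN) auto
  have "M \<times> M \<subseteq> (\<Union>x\<in>I. V' x \<times> V' x) \<union> ?N"
  proof
   fix z assume z: "z \<in> M \<times> M"
   obtain x y where xy: "z = (x, y)" "x \<in> M" "y \<in> M" using z by blast
   obtain i where i: "i \<in> I" "x \<in> ball i (rho / 2)" using I(3) xy by blast
   show "z \<in> (\<Union>x\<in>I. V' x \<times> V' x) \<union> ?N"
   proof (cases "y - x \<in> ball 0 r")
    case True
    have "dist i y <= dist i x + dist x y" by (rule dist_triangle)
    also have "... < rho" using True i r by (simp add: dist_norm norm_minus_commute)
    finally have "x \<in> V i" "y \<in> V i" using inV[OF i(1) xy(2)] inV[OF i(1) xy(3)] i(2) LR(3) by auto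
    thus ?thesis using i xy by (auto simp: Z_def)
   qed (simp add: xy)
  qed
  hence "emeasure ?O (M \<times> M) <= emeasure ?O ((\<Union>x\<in>I. V' x \<times> V' x) \<union> ?N)" by (rule emeasure_mono) (use Ub Nn in auto)
  also have "... = emeasure ?O (\<Union>x\<in>I. V' x \<times> V' x)" by (rule emeasure_Un_null_set[OF Ub Nn])
  also have "... <= (\<Sum>x\<in>I. emeasure ?O (V' x \<times> V' x))" by (rule emeasure_subadditive_finite[OF I(1)]) (use V'b in auto)
  also have "... <= (\<Sum>x\<in>I. ennreal ?B)"
  proof (rule sum_mono)
   fix x assume "x \<in> I"
   hence "osc_bounded L (V' x)" using V(6) I(2) by blast
   thus "emeasure ?O (V' x \<times> V' x) <= ennreal ?B" unfolding osc_bounded_def using f g r by blast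
  qed
  also have "... = ennreal (real (card I) * ?B)" using B0 by (simp add: ennreal_mult ennreal_of_nat_eq_real_of_nat)
  also have "real (card I) * ?B = K * r ^ (DIM('a) + 2) * grad_sq g" unfolding K_def by (simp only: mult_ac)
  finally show "emeasure ?O (M \<times> M) <= ennreal (K * r ^ (DIM('a) + 2) * grad_sq g)" .
 qed
qed

end

section \<open>Uniqueness of the weak gradient\<close>

context reflected_process begin

text \<open>Well inside the interior two weak gradients have the same mollifications at small scales, and mollifications
converge in mean.\<close>

lemma weak_gradient_unique:
 assumes fr: "negligible (frontier M)" and g: "weak_gradient M f g" "weak_gradient M f g'"
 shows "AE x in \<mu>. g x = g' x"
proof -
 let ?C = "- interior M"
 have C: "closed ?C" "?C ~= {}"
 proof -
  show "closed ?C" by (rule closed_Compl[OF open_interior])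
  have "M ~= UNIV" using compact_M not_compact_UNIV by auto
  thus "?C ~= {}" using interior_subset[of M] by auto
 qed
 define A where "A n = {x. 1 / real (Suc n) <= infdist x ?C}" for n
 have Ab[measurable]: "A n \<in> sets borel" for n
  unfolding A_def by (intro borel_closed closed_Collect_le continuous_intros)
 have in_int: "v \<in> interior M" if "x \<in> A n" "dist x v < 1 / real (Suc n)" for x v n
 proof (rule ccontr)
  assume "v \<notin> interior M"
  hence "infdist x ?C <= dist x v" by (intro infdist_le) simp
  thus False using that by (simp add: A_def)
 qed
 have AM: "A n \<subseteq> M" for n using in_int[of _ n] interior_subset[of M] by fastforce
 have UA: "interior M \<subseteq> (\<Union>n. A n)"
 proof
  fix x assume "x \<in> interior M"
  hence "0 < infdist x ?C" using in_closed_iff_infdist_zero[OF C, of x] infdist_nonneg[of x ?C] by (simp add: less_le)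
  then obtain n where "inverse (real (Suc n)) < infdist x ?C" using reals_Archimedean by blast
  thus "x \<in> (\<Union>n. A n)" by (auto simp: A_def inverse_eq_divide intro!: exI[of _ n])
 qed
 have comp: "AE x in lborel. x \<in> A n --> zext (%x. g x \<bullet> b) x = zext (%x. g' x \<bullet> b) x" if b: "b \<in> Basis" for b n
 proof -
  let ?g = "zext (%x. g x \<bullet> b)" and ?g' = "zext (%x. g' x \<bullet> b)"
  let ?h = "%x. ?g x - ?g' x"
  have gi: "integrable lborel ?g" "integrable lborel ?g'" by (rule zext_integrable[OF weak_gradientD(4)], rule g)+
  have hi: "integrable lborel ?h" using gi by simp
  have [measurable]: "?g \<in> borel_measurable borel" "?g' \<in> borel_measurable borel" using gi by simp_all
  have fA: "emeasure lborel (A n) < \<infinity>" by (rule emeasure_bounded_finite[OF bounded_subset[OF compact_imp_bounded[OF compact_M] AM]])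
  have mol0: "mollify eta ?h x = 0" if x: "x \<in> A n" and eta: "0 < eta" "real DIM('a) * eta < 1 / real (Suc n)" for x eta
  proof -
   have box: "cbox (x - eta *\<^sub>R One) (x + eta *\<^sub>R One) \<subseteq> interior M"
   proof
    fix v assume v: "v \<in> cbox (x - eta *\<^sub>R One) (x + eta *\<^sub>R One)"
    have "\<bar>(v - x) \<bullet> i\<bar> <= eta" if "i \<in> Basis" for i
     using v that by (auto simp: mem_box inner_simps abs_le_iff dest!: bspec[of _ _ i])
    hence "(\<Sum>i\<in>Basis. \<bar>(v - x) \<bullet> i\<bar>) <= real DIM('a) * eta" by (rule sum_bounded_above)
    hence "dist x v <= real DIM('a) * eta" using norm_le_l1[of "v - x"] by (simp add: dist_norm norm_minus_commute)
    thus "v \<in> interior M" using in_int[OF x] eta by simp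
   qed
   have t: "test_function (interior M) (%y. moll eta (y - x))" by (rule test_function_moll[OF eta(1) box])
   have e: "mollify eta (zext (%x. G x \<bullet> b)) x = vol * (\<integral>y. (G y \<bullet> b) * moll eta (y - x))" if G: "weak_gradient M f G" for G
   proof -
    note [measurable] = weak_gradientD(1)[OF G] meas_mu_borel[OF test_function_measurable(1)[OF t b]]
    have "(\<integral>y. (G y \<bullet> b) * moll eta (y - x)) = mollify eta (zext (%x. G x \<bullet> b)) x / vol"
     by (subst integral_mu(1)) (measurable, simp add: zext_def[abs_def] mult.assoc mollify_def)
    thus ?thesis using vol_pos by simp
   qed
   show ?thesis unfolding mollify_diff[OF eta(1) gi] e[OF g(1)] e[OF g(2)]
    using weak_gradientD(5)[OF g(1) t b] weak_gradientD(5)[OF g(2) t b] by simp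
  qed
  have "(\<integral>\<^sup>+x. ennreal \<bar>?h x\<bar> * indicator (A n) x \<partial>lborel) <= 0"
  proof (rule ennreal_le_epsilon)
   fix e :: real assume e: "0 < e"
   obtain eta0 where eta0: "0 < eta0" "!!eta. 0 < eta ==> eta < eta0 ==> (\<integral>\<^sup>+x. ennreal \<bar>?h x - mollify eta ?h x\<bar> * indicator (A n) x \<partial>lborel) <= ennreal e"
    by (rule mollify_L1_tendsto[OF hi Ab fA e]) (rule that)
   define eta where "eta = min (eta0 / 2) (1 / (2 * real (Suc n) * real DIM('a)))"
   have eta: "0 < eta" "eta < eta0" using eta0(1) by (auto simp: eta_def min_less_iff_disj)
   have "real DIM('a) * eta <= real DIM('a) * (1 / (2 * real (Suc n) * real DIM('a)))" by (rule mult_left_mono) (simp_all add: eta_def)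
   also have "... = 1 / (2 * real (Suc n))" by simp
   also have "... < 1 / real (Suc n)" by (simp add: divide_strict_left_mono)
   finally have eta': "real DIM('a) * eta < 1 / real (Suc n)" .
   have "(\<integral>\<^sup>+x. ennreal \<bar>?h x\<bar> * indicator (A n) x \<partial>lborel) = (\<integral>\<^sup>+x. ennreal \<bar>?h x - mollify eta ?h x\<bar> * indicator (A n) x \<partial>lborel)"
    by (rule nn_integral_cong) (use mol0[OF _ eta(1) eta'] in "auto simp: indicator_def")
   also have "... <= ennreal e" by (rule eta0(2)[OF eta])
   finally show "(\<integral>\<^sup>+x. ennreal \<bar>?h x\<bar> * indicator (A n) x \<partial>lborel) <= 0 + ennreal e" by simp
  qed
  hence "(\<integral>\<^sup>+x. ennreal \<bar>?h x\<bar> * indicator (A n) x \<partial>lborel) = 0" by simp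
  hence "AE x in lborel. ennreal \<bar>?h x\<bar> * indicator (A n) x = 0" by (subst (asm) nn_integral_0_iff_AE) auto
  thus ?thesis by eventually_elim (auto simp: indicator_def split: if_splits)
 qed
 have "AE x in lborel. \<forall>n. \<forall>b\<in>Basis. x \<in> A n --> zext (%x. g x \<bullet> b) x = zext (%x. g' x \<bullet> b) x"
  unfolding AE_all_countable by (intro allI AE_finite_allI finite_Basis) (rule comp)
 moreover have "AE x in lborel. x \<notin> frontier M"
 proof (rule AE_not_in, rule null_setsI)
  show "emeasure lborel (frontier M) = 0" using fr by (simp add: negligible_iff_emeasure0)
 qed simp
 ultimately have "AE x in lborel. x \<in> M --> g x = g' x"
 proof eventually_elim
  case (elim x)
  show ?case
  proof
   assume x: "x \<in> M"
   hence "x \<in> interior M" using elim(2) compact_imp_closed[OF compact_M] by (auto simp: frontier_def)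
   then obtain n where "x \<in> A n" using UA by blast
   hence "g x \<bullet> b = g' x \<bullet> b" if "b \<in> Basis" for b using elim(1)[rule_format, OF that, of n] x by simp
   thus "g x = g' x" by (rule euclidean_eqI)
  qed
 qed
 hence 1: "AE x in restrict_space lborel M. g x = g' x" by (subst AE_restrict_space_iff) simp_all
 show ?thesis unfolding mu_density by (subst AE_density) (use 1 in "auto elim: eventually_mono")
qed

text \<open>The energy is defined through a choice of gradient, which is irrelevant by uniqueness.\<close>

lemma energy_weak_gradient:
 assumes fr: "negligible (frontier M)" and g: "weak_gradient M f g"
 shows "energy M f f = grad_sq g / 2"
proof -
 have wg: "weak_gradient M f (grad M f)" unfolding grad_def by (rule someI[of "weak_gradient M f"]) (rule g)
 note [measurable] = weak_gradientD(1)[OF g] weak_gradientD(1)[OF wg]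
 have "(\<integral>x. grad M f x \<bullet> grad M f x) = grad_sq g"
  by (rule integral_cong_AE; (measurable)?) (use weak_gradient_unique[OF fr wg g] in "auto simp: power2_norm_eq_inner elim: eventually_mono")
 thus ?thesis by (simp add: energy_def)
qed

end

section \<open>Averages against a smooth kernel\<close>

text \<open>By scaling, all kernels look like the one of radius 1 up to the factor c, which cancels in quotients of
averages.\<close>

lemma moll_bounds:
 obtains L m where "0 < L" "0 < m" "!!r. 0 < r ==> \<exists>c>0. \<forall>z::'a::euclidean_space. moll r z <= L * c &
  (\<forall>b\<in>Basis. \<bar>dmoll r z (- b)\<bar> <= L * c / r) & (norm z <= r / 2 --> m * c <= moll r z)"
proof -
 note t = test_function_bump_UNIV[OF zero_less_one, where 'a = 'a]
 note fd = test_function_has_derivative[OF t]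
 obtain L where L: "0 < L" "!!x y::'a. \<bar>bump 1 x - bump 1 y\<bar> <= L * dist x y"
  "!!x b. b \<in> Basis ==> \<bar>frechet_derivative (bump 1 :: 'a => real) (at x) b\<bar> <= L" "!!x::'a. \<bar>bump 1 x\<bar> <= L"
  by (rule test_function_lipschitz[OF t]) (rule that)
 have "\<exists>x\<in>cball (0::'a) (1/2). \<forall>y\<in>cball (0::'a) (1/2). bump 1 x <= bump 1 y"
  by (rule continuous_attains_inf[of "cball (0::'a) (1/2)" "bump 1"]) (auto intro: continuous_on_subset[OF bump_continuous])
 then obtain x0 :: 'a where x0: "norm x0 <= 1/2" "!!y :: 'a. norm y <= 1/2 ==> bump 1 x0 <= bump 1 y" by auto
 have m: "0 < bump 1 x0" unfolding bump_pos[OF zero_less_one] using Basis_le_norm[of _ x0] x0(1) by fastforce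
 show ?thesis
 proof (rule that[OF L(1) m])
  fix r :: real assume r: "0 < r"
  define c where "c = 1 / (\<integral>x. bump r x \<partial>(lborel :: 'a measure))"
  have c: "0 < c" using bump_integral_pos[OF r, where 'a = 'a] by (simp add: c_def)
  have e: "moll r z = bump 1 (z /\<^sub>R r) * c" for z :: 'a by (simp add: moll_def c_def bump_def divide_inverse mult.commute)
  have d: "dmoll r z b = frechet_derivative (bump 1) (at (z /\<^sub>R r)) (b /\<^sub>R r) * c" for z b :: 'a
  proof -
   have "((%z. z /\<^sub>R r) has_derivative (%z. z /\<^sub>R r)) (at z)" by (auto intro!: derivative_eq_intros)
   from has_derivative_mult_left[OF has_derivative_compose[OF this fd], of c] show ?thesis
    unfolding e[abs_def] by (simp add: frechet_derivative_at[symmetric])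
  qed
  have "moll r z <= L * c" for z :: 'a using L(4)[of "z /\<^sub>R r"] c by (simp add: e)
  moreover have "\<bar>dmoll r z (- b)\<bar> <= L * c / r" if b: "b \<in> Basis" for z b :: 'a
  proof -
   interpret bounded_linear "frechet_derivative (bump 1) (at (z /\<^sub>R r))" by (rule has_derivative_bounded_linear[OF fd])
   have "\<bar>dmoll r z (- b)\<bar> = \<bar>frechet_derivative (bump 1) (at (z /\<^sub>R r)) b\<bar> * (c / r)"
    using r c unfolding d by (simp add: neg scaleR abs_mult divide_inverse)
   thus ?thesis using mult_right_mono[OF L(3)[OF b, of "z /\<^sub>R r"], of "c / r"] r c by simp
  qed
  moreover have "bump 1 x0 * c <= moll r z" if "norm z <= r / 2" for z :: 'a
  proof -
   have "norm (z /\<^sub>R r) = norm z / r" using r by (simp add: divide_inverse mult.commute)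
   hence "bump 1 x0 <= bump 1 (z /\<^sub>R r)" using that r by (intro x0(2)) (simp add: pos_divide_le_eq)
   thus ?thesis using c by (simp add: e)
  qed
  ultimately show "\<exists>c>0. \<forall>z::'a. moll r z <= L * c & (\<forall>b\<in>Basis. \<bar>dmoll r z (- b)\<bar> <= L * c / r) & (norm z <= r / 2 --> bump 1 x0 * c <= moll r z)"
   using c by blast
 qed
qed

lemma dmoll_near: 
 assumes "0 < eta" "dmoll eta z (b :: 'a::euclidean_space) ~= 0" shows "norm z <= real DIM('a) * eta"
proof -
 have "closure {x :: 'a. moll eta x ~= 0} \<subseteq> cball 0 (real DIM('a) * eta)" by (rule closure_minimal) (use moll_near[OF assms(1)] in auto)
 thus ?thesis using test_function_zero(2)[OF moll_test[OF assms(1)], of z] assms(2) by fastforce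
qed

context reflected_process begin

lemma bdd_borelI: "f \<in> borel_measurable borel ==> (!!x. x \<in> M ==> \<bar>f x\<bar> <= C) ==> bdd f"
 by (rule bddI[OF meas_mu_borel])

lemma bdd_indicator: "A \<in> sets borel ==> bdd (indicator A)"
 by (rule bdd_borelI[of _ 1]) (auto simp: indicator_def)

text \<open>Integral against the kernel over M only; dividing by the value for the constant 1 gives an average up to the
boundary.\<close>

definition kernel_int :: "real => ('a => real) => 'a => real" where
 "kernel_int r h x = (\<integral>y. h y * moll r (y - x))"

text \<open>The derivative of kernel_int r h in direction b.\<close>

definition kernel_deriv :: "real => 'a => ('a => real) => 'a => real" where
 "kernel_deriv r b h x = (\<integral>y. h y * dmoll r (y - x) (- b))"

lemma bdd_moll:
 assumes r: "0 < r" shows "bdd (%y. moll r (y - x))" "b \<in> Basis ==> bdd (%y. dmoll r (y - x) (- b))"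
proof -
 obtain L m where "0 < L" "0 < m" and L: "!!r. 0 < r ==> \<exists>c>0. \<forall>z::'a. moll r z <= L * c &
  (\<forall>b\<in>Basis. \<bar>dmoll r z (- b)\<bar> <= L * c / r) & (norm z <= r / 2 --> m * c <= moll r z)" by (rule moll_bounds) (rule that)
 obtain c where c: "!!z::'a. moll r z <= L * c" "!!(z::'a) b. b \<in> Basis ==> \<bar>dmoll r z (- b)\<bar> <= L * c / r" using L[OF r] by blast
 show "bdd (%y. moll r (y - x))"
  by (rule bdd_borelI[of _ "L * c"]) (use c(1) in "auto simp: abs_of_nonneg[OF moll_nonneg[OF r]]")
 show "b \<in> Basis ==> bdd (%y. dmoll r (y - x) (- b))"
  by (rule bdd_borelI[of _ "L * c / r"], rule measurable_compose[OF _ dmoll_measurable[OF r]]) (auto intro: c(2))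
qed

lemma kernel_int_mol: "bdd h ==> 0 < r ==> kernel_int r h x = mollify r (zext h) x / vol"
 unfolding kernel_int_def mollify_def
 by (subst integral_mu(1)[OF bdd_meas[OF bdd_mult[OF _ bdd_moll(1)]]]) (auto simp: zext_def[abs_def] mult.assoc)

lemma kernel_int_continuous: "bdd h ==> 0 < r ==> continuous_on UNIV (kernel_int r h)"
 using vol_pos continuous_on_divide[OF mollify_continuous[OF _ zext_integrable[OF bdd_integrable]] continuous_on_const, of r h vol] by (simp add: kernel_int_mol)

lemma kernel_int_deriv:
 assumes h: "bdd h" and r: "0 < r" and b: "b \<in> Basis"
 shows "((%s. kernel_int r h (x + s *\<^sub>R b)) has_real_derivative kernel_deriv r b h x) (at 0)"
proof -
 have "kernel_deriv r b h x = (\<integral>y. zext h y * dmoll r (y - x) (- b) \<partial>lborel) / vol"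
  unfolding kernel_deriv_def by (subst integral_mu(1)[OF bdd_meas[OF bdd_mult[OF h bdd_moll(2)[OF r b]]]]) (simp add: zext_def[abs_def] mult.assoc)
 thus ?thesis
  using DERIV_cdivide[OF mollify_deriv[OF r zext_integrable[OF bdd_integrable[OF h]], of x b], of vol] by (simp add: kernel_int_mol[OF h r])
qed

lemma square_integral_ball:
 assumes a: "bdd a" and A: "A \<in> sets borel" and beta: "0 < beta" "(\<integral>y. indicator A y) <= beta"
 shows "(\<integral>y. \<bar>a y\<bar> * indicator A y)^2 <= beta * (\<integral>y. (a y)^2 * indicator A y)"
proof -
 let ?S = "\<integral>y. \<bar>a y\<bar> * indicator A y \<partial>\<mu>" and ?Q = "\<integral>y. (a y)^2 * indicator A y \<partial>\<mu>" and ?m = "\<integral>y. indicator A y \<partial>\<mu> :: real"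
 note bi = bdd_indicator[OF A]
 have ba: "bdd (%y. \<bar>a y\<bar>)" using a unfolding bdd_def by auto
 have i: "integrable \<mu> (%y. (a y)^2 * indicator A y)" "integrable \<mu> (%y. \<bar>a y\<bar> * indicator A y)" "integrable \<mu> (indicator A :: 'a => real)"
  by (intro bdd_integrable bdd_mult bdd_power2 a ba bi)+
 have "0 <= (\<integral>y. (beta * \<bar>a y\<bar> - ?S)^2 * indicator A y)" by (rule Bochner_Integration.integral_nonneg) simp
 also have "... = (\<integral>y. beta^2 * ((a y)^2 * indicator A y) - 2 * beta * ?S * (\<bar>a y\<bar> * indicator A y) + ?S^2 * indicator A y)"
  by (intro Bochner_Integration.integral_cong refl) (simp add: power2_eq_square algebra_simps indicator_def)
 also have "... = beta^2 * ?Q - 2 * beta * ?S * ?S + ?S^2 * ?m" using i by simp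
 also have "... <= beta^2 * ?Q - 2 * beta * ?S * ?S + ?S^2 * beta" using mult_left_mono[OF beta(2), of "?S^2"] by simp
 also have "... = beta * (beta * ?Q - ?S^2)" by (simp add: power2_eq_square algebra_simps)
 finally show ?thesis using beta(1) by (simp add: zero_le_mult_iff)
qed

text \<open>With the kernel w and its derivative w', the average F w / D and its derivative are unchanged if
\<open>a\<close> is subtracted from f, apart from the shift of the average. So both are controlled by the mean
oscillation of f about \<open>a\<close>.\<close>

lemma average_pointwise:
 fixes f w w' :: "'a => real" and B :: "'a set" and a :: real
 defines "D \<equiv> \<integral>y. 1 * w y \<partial>\<mu>" and "F \<equiv> %w. \<integral>y. f y * w y \<partial>\<mu>" and "Q \<equiv> \<integral>y. (f y - a)^2 * indicator B y \<partial>\<mu>"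
 assumes f: "bdd f" and B: "B \<in> sets borel" "0 < beta" "(\<integral>y. indicator B y) <= beta" and delta: "0 < delta" "delta <= D"
  and w: "bdd w" "!!y. \<bar>w y\<bar> <= K * indicator B y" "0 <= K" and w': "bdd w'" "!!y. \<bar>w' y\<bar> <= K' * indicator B y" "0 <= K'"
 shows "(F w / D - a)^2 <= (K / delta)^2 * beta * Q"
  and "((F w' * D - F w * (\<integral>y. 1 * w' y)) / D^2)^2 <= (K' / delta * (1 + K * beta / delta))^2 * beta * Q"
proof -
 define S where "S = (\<integral>y. \<bar>f y - a\<bar> * indicator B y)"
 have bfx: "bdd (%y. f y - a)" by (intro bdd_diff f bdd_const)
 have bab: "bdd (%y. \<bar>f y - a\<bar>)" using bfx unfolding bdd_def by auto
 have S0: "0 <= S" unfolding S_def by (rule Bochner_Integration.integral_nonneg) simp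
 have sq: "x^2 <= c^2 * beta * Q" if "\<bar>x\<bar> <= c * S" for x c
 proof -
  have "x^2 <= (c * S)^2" by (rule abs_le_square_iff[THEN iffD1, OF order_trans[OF that abs_ge_self]])
  also have "... = c^2 * S^2" by (rule power_mult_distrib)
  also have "... <= c^2 * (beta * Q)" unfolding S_def Q_def by (intro mult_left_mono square_integral_ball bfx B) simp
  finally show ?thesis by (simp add: mult.assoc)
 qed
 have int: "\<bar>\<integral>y. h y * v y \<partial>\<mu>\<bar> <= k * (\<integral>y. \<bar>h y\<bar> * indicator B y)" if v: "!!y. \<bar>v y\<bar> <= k * indicator B y" "0 <= k" and h: "bdd (%y. \<bar>h y\<bar>)" for h v k
 proof -
  have "\<bar>\<integral>y. h y * v y \<partial>\<mu>\<bar> <= (\<integral>y. \<bar>h y * v y\<bar>)" by (rule integral_abs_bound)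
  also have "... <= (\<integral>y. k * (\<bar>h y\<bar> * indicator B y))"
  proof (rule integral_mono')
   show "integrable \<mu> (%y. k * (\<bar>h y\<bar> * indicator B y))" by (intro bdd_integrable bdd_mult bdd_const h bdd_indicator B)
   show "\<bar>h y * v y\<bar> <= k * (\<bar>h y\<bar> * indicator B y)" for y using mult_left_mono[OF v(1)[of y], of "\<bar>h y\<bar>"] by (simp add: abs_mult mult_ac)
  qed (use v in simp)
  finally show ?thesis by simp
 qed
 have spl: "F v - a * (\<integral>y. 1 * v y) = (\<integral>y. (f y - a) * v y)" if "bdd v" for v
  unfolding F_def using bdd_integrable[OF bdd_mult[OF f that]] bdd_integrable[OF that] by (simp add: left_diff_distrib)
 define E E' D' where "E = F w - a * D" and "E' = F w' - a * (\<integral>y. 1 * w' y)" and "D' = (\<integral>y. 1 * w' y)"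
 have D: "0 < D" using delta by linarith
 have dv: "\<bar>x / D\<bar> <= c / delta" if "\<bar>x\<bar> <= c" for x c
 proof -
  have "\<bar>x / D\<bar> = \<bar>x\<bar> / D" using D by (simp add: abs_divide)
  also have "... <= c / delta" by (rule frac_le[OF _ that delta]) (use that in linarith)
  finally show ?thesis .
 qed
 have E: "\<bar>E / D\<bar> <= K * S / delta" and E': "\<bar>E' / D\<bar> <= K' * S / delta"
  unfolding E_def E'_def D_def spl[OF w(1)] spl[OF w'(1)] S_def unfolding D_def[symmetric] by (intro dv int w w' bab)+
 have "\<bar>D'\<bar> <= K' * beta"
 proof -
  have "\<bar>D'\<bar> <= K' * (\<integral>y. \<bar>1\<bar> * indicator B y)" unfolding D'_def by (rule int[OF w'(2,3)]) simp
  also have "... <= K' * beta" using mult_left_mono[OF B(3) w'(3)] by simp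
  finally show ?thesis .
 qed
 note D' = dv[OF this]
 have "F w / D - a = E / D" using D by (simp add: E_def field_simps)
 thus "(F w / D - a)^2 <= (K / delta)^2 * beta * Q" using E by (intro sq) simp
 have "(F w' * D - F w * D') / D^2 = E' / D - (E / D) * (D' / D)"
  using D by (simp add: E_def E'_def D'_def field_simps power2_eq_square)
 also have "\<bar>...\<bar> <= \<bar>E' / D\<bar> + \<bar>E / D\<bar> * \<bar>D' / D\<bar>" unfolding abs_mult[symmetric] by (rule abs_triangle_ineq4)
 also have "... <= K' * S / delta + (K * S / delta) * (K' * beta / delta)"
  using E E' D' S0 delta w(3) by (intro add_mono mult_mono) auto
 also have "... = K' / delta * (1 + K * beta / delta) * S" by (simp add: algebra_simps)
 finally show "((F w' * D - F w * (\<integral>y. 1 * w' y)) / D^2)^2 <= (K' / delta * (1 + K * beta / delta))^2 * beta * Q"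
  unfolding D'_def by (rule sq)
qed
lemma kernel_deriv_measurable:
 assumes h: "bdd h" and r: "0 < r" shows "kernel_deriv r b h \<in> borel_measurable borel"
proof -
 note [measurable] = dmoll_measurable[OF r] bdd_meas[OF h]
 have [measurable]: "(%y. y) \<in> \<mu> \<rightarrow>\<^sub>M borel" by (rule meas_mu_borel) simp
 show ?thesis unfolding kernel_deriv_def[abs_def] by measurable
qed

lemma integral_mu_support:
 fixes h :: "'a => real"
 assumes "h \<in> borel_measurable borel" "!!x. x \<notin> M ==> h x = 0" shows "(\<integral>x. h x) = (\<integral>x. h x \<partial>lborel) / vol"
proof -
 have "zext h = h" using assms(2) by (auto simp: fun_eq_iff zext_def indicator_def)
 thus ?thesis using integral_mu(1)[OF meas_mu_borel[OF assms(1)]] by simp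
qed

text \<open>Translation does not change the integral of U; differentiate in the direction b. The indicator of a large ball
supplies an integrable weight.\<close>

lemma integral_partial_zero:
 fixes U U' :: "'a => real"
 assumes m: "U \<in> borel_measurable borel" "U' \<in> borel_measurable borel" and b: "norm b = 1"
  and S: "compact S" "!!x. x \<notin> S ==> U x = 0" "!!x. x \<notin> S ==> U' x = 0"
  and bnd: "!!x. \<bar>U x\<bar> <= C" "!!x. \<bar>U' x\<bar> <= C"
  and d: "!!x. ((%s. U (x + s *\<^sub>R b)) has_real_derivative U' x) (at 0)"
 shows "(\<integral>x. U' x \<partial>lborel) = 0"
proof -
 note [measurable] = m
 obtain q where q: "0 < q" "!!x. x \<in> S ==> norm x <= q" using compact_imp_bounded[OF S(1)] bounded_pos by metis
 let ?A = "indicator (cball (0::'a) (q + 1)) :: 'a => real"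
 have lip: "\<bar>U (x + s *\<^sub>R b) - U (x + 0 *\<^sub>R b)\<bar> <= C * \<bar>s\<bar>" for x s
 proof -
  have d': "((%s. U (x + s *\<^sub>R b)) has_real_derivative U' (x + t *\<^sub>R b)) (at t)" for t
  proof -
   have "((%s. U (x + (t + s) *\<^sub>R b)) has_real_derivative U' (x + t *\<^sub>R b)) (at 0)"
    using d[of "x + t *\<^sub>R b"] by (simp only: scaleR_left_distrib add.assoc)
   thus ?thesis using DERIV_shift[of "%s. U (x + s *\<^sub>R b)" "U' (x + t *\<^sub>R b)" 0 t] by (simp add: add.commute)
  qed
  have "norm (U (x + s *\<^sub>R b) - U (x + 0 *\<^sub>R b)) <= C * norm (s - 0)"
   by (rule field_differentiable_bound[of UNIV "%s. U (x + s *\<^sub>R b)" "%s. U' (x + s *\<^sub>R b)"]) (use d' bnd(2) in auto)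
  thus ?thesis by simp
 qed
 have dJ: "((%s. \<integral>y. ?A y * U (y + s *\<^sub>R b) \<partial>lborel) has_real_derivative (\<integral>y. ?A y * U' y \<partial>lborel)) (at 0)"
 proof (rule DERIV_integral[where B = C and C = C])
  show "integrable lborel ?A" by (rule integrable_real_indicator) (simp_all add: emeasure_bounded_finite[OF bounded_cball, simplified])
 qed (use bnd lip d in auto)
 have const: "(\<integral>y. ?A y * U (y + s *\<^sub>R b) \<partial>lborel) = (\<integral>y. U y \<partial>lborel)" if s: "\<bar>s\<bar> < 1" for s
 proof -
  have e: "?A y * U (y + s *\<^sub>R b) = U (s *\<^sub>R b + y)" for y
  proof (cases "y + s *\<^sub>R b \<in> S")
   case True
   have "norm y <= norm (y + s *\<^sub>R b) + norm (s *\<^sub>R b)" using norm_triangle_ineq4[of "y + s *\<^sub>R b" "s *\<^sub>R b"] by simp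
   also have "... <= q + 1" using q(2)[OF True] s b by simp
   finally show ?thesis by (simp add: add.commute)
  qed (simp add: S(2) add.commute)
  show ?thesis unfolding e by (rule integral_translate[OF m(1)])
 qed
 have "(\<integral>y. ?A y * U' y \<partial>lborel) = 0"
 proof (rule DERIV_local_const[OF dJ zero_less_one], intro allI impI)
  fix s :: real assume "\<bar>0 - s\<bar> < 1"
  thus "(\<integral>y. ?A y * U (y + 0 *\<^sub>R b) \<partial>lborel) = (\<integral>y. ?A y * U (y + s *\<^sub>R b) \<partial>lborel)"
   using const[of 0] const[of s] by simp
 qed
 moreover have "?A y * U' y = U' y" for y using q(2)[of y] S(3)[of y] by (cases "y \<in> S") simp_all
 ultimately show ?thesis by (simp only:)
qed

text \<open>Integration by parts: the derivative of u * phi integrates to zero.\<close>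

lemma weak_gradient_of_partials:
 fixes u :: "'a => real" and ub :: "'a => 'a => real"
 assumes um[measurable]: "u \<in> borel_measurable borel" and ubm: "!!b. b \<in> Basis ==> ub b \<in> borel_measurable borel"
  and bnd: "!!x. x \<in> M ==> \<bar>u x\<bar> <= B" "!!x b. x \<in> M ==> b \<in> Basis ==> \<bar>ub b x\<bar> <= B"
  and der: "!!x b. x \<in> interior M ==> b \<in> Basis ==> ((%s. u (x + s *\<^sub>R b)) has_real_derivative ub b x) (at 0)"
 shows "weak_gradient M u (%x. \<Sum>b\<in>Basis. ub b x *\<^sub>R b)"
proof -
 let ?G = "%x. \<Sum>b\<in>Basis. ub b x *\<^sub>R b"
 have Gm: "?G \<in> borel_measurable borel" using ubm by (intro borel_measurable_sum borel_measurable_scaleR) auto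
 have Gb: "?G x \<bullet> b = ub b x" if "b \<in> Basis" for x b using that by (simp add: inner_sum_left inner_Basis if_distrib cong: if_cong)
 have Gmu[measurable]: "?G \<in> borel_measurable \<mu>" by (rule meas_mu_borel[OF Gm])
 have Gn: "norm (?G x) <= real DIM('a) * B" if "x \<in> M" for x
  by (rule order_trans[OF norm_le_l1 sum_bounded_above]) (use Gb bnd(2) that in simp)
 have main: "(\<integral>x. u x * frechet_derivative phi (at x) b) = - (\<integral>x. (?G x \<bullet> b) * phi x)" if t: "test_function (interior M) phi" and b: "b \<in> Basis" for phi b
 proof -
  define S where "S = closure {x. phi x ~= 0}"
  have cS: "compact S" and SM: "S \<subseteq> interior M" using t by (auto simp: test_function_def S_def)
  have SM'': "S \<subseteq> M" using SM interior_subset by blast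
  hence SM': "x \<in> S ==> x \<in> M" for x by blast
  obtain L where L: "0 < L" "!!x y. \<bar>phi x - phi y\<bar> <= L * dist x y" "!!x b. b \<in> Basis ==> \<bar>frechet_derivative phi (at x) b\<bar> <= L" "!!x. \<bar>phi x\<bar> <= L"
   by (rule test_function_lipschitz[OF t]) (rule that)
  let ?phi' = "%x. frechet_derivative phi (at x) b"
  note tm[measurable] = test_function_measurable[OF t b] ubm[OF b]
  have z: "phi x = 0" "?phi' x = 0" if "x \<notin> S" for x
   by (rule test_function_zero(1)[OF t that[unfolded S_def]] fun_cong[OF test_function_zero(2)[OF t that[unfolded S_def]]])+
  have dU: "((%s. u (x + s *\<^sub>R b) * phi (x + s *\<^sub>R b)) has_real_derivative ub b x * phi x + u x * ?phi' x) (at 0)" for x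
  proof (cases "x \<in> S")
   case True
   note fd = test_function_has_derivative[OF t, of x]
   interpret bounded_linear "frechet_derivative phi (at x)" by (rule has_derivative_bounded_linear[OF fd])
   have "((%s. x + s *\<^sub>R b) has_derivative (%s. s *\<^sub>R b)) (at 0)" by (auto intro!: derivative_eq_intros)
   from has_derivative_compose[OF this, of phi] fd
   have "((%s. phi (x + s *\<^sub>R b)) has_derivative (%s. frechet_derivative phi (at x) (s *\<^sub>R b))) (at 0)" by simp
   also have "(%s. frechet_derivative phi (at x) (s *\<^sub>R b)) = (*) (?phi' x)" by (rule ext) (simp only: scaleR real_scaleR_def mult.commute)
   finally have "((%s. phi (x + s *\<^sub>R b)) has_real_derivative ?phi' x) (at 0)" unfolding has_field_derivative_def .
   from DERIV_mult[OF der[OF subsetD[OF SM True] b] this] show ?thesis by (simp add: mult.commute add.commute)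
  next
   case False
   have op: "open ((%s::real. x + s *\<^sub>R b) -` (- S))" by (intro open_vimage continuous_intros compact_imp_closed cS open_Compl)
   have "((%s. 0) has_real_derivative 0) (at (0::real))" by simp
   hence "((%s. u (x + s *\<^sub>R b) * phi (x + s *\<^sub>R b)) has_real_derivative 0) (at 0)"
   proof (rule has_field_derivative_transform_within_open[OF _ op])
    show "0 = u (x + s *\<^sub>R b) * phi (x + s *\<^sub>R b)" if "s \<in> (%s::real. x + s *\<^sub>R b) -` (- S)" for s
     using z(1)[of "x + s *\<^sub>R b"] that by simp
   qed (use False in simp)
   thus ?thesis using z[OF False] by simp
  qed
  have bd: "\<bar>a * c\<bar> <= \<bar>B\<bar> * L" if h: "x \<notin> S ==> c = 0" "x \<in> M ==> \<bar>a\<bar> <= B" "\<bar>c\<bar> <= L" for a c x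
  proof (cases "x \<in> S")
   case True
   thus ?thesis unfolding abs_mult using h(2)[OF SM'] h(3) by (intro mult_mono) linarith+
  qed (use h L in simp)
  have b1: "\<bar>ub b x * phi x\<bar> <= \<bar>B\<bar> * L" "\<bar>u x * ?phi' x\<bar> <= \<bar>B\<bar> * L" "\<bar>u x * phi x\<bar> <= \<bar>B\<bar> * L" for x
   by (rule bd[OF z(1) bnd(2)[OF _ b] L(4)] bd[OF z(2) bnd(1) L(3)[OF b]] bd[OF z(1) bnd(1) L(4)]; assumption)+
  have 1: "(\<integral>x. ub b x * phi x + u x * ?phi' x \<partial>lborel) = 0"
  proof (rule integral_partial_zero[OF _ _ norm_Basis[OF b] cS _ _ _ _ dU, where C = "\<bar>B\<bar> * L + \<bar>B\<bar> * L"])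
   show "\<bar>u x * phi x\<bar> <= \<bar>B\<bar> * L + \<bar>B\<bar> * L" "\<bar>ub b x * phi x + u x * ?phi' x\<bar> <= \<bar>B\<bar> * L + \<bar>B\<bar> * L" for x using b1[of x] by linarith+
  qed (measurable, simp_all add: z)
  have Sb: "S \<in> sets borel" "emeasure lborel S < \<infinity>" using cS emeasure_bounded_finite[OF compact_imp_bounded[OF cS]] by (auto simp: borel_compact)
  have i: "integrable lborel (%x. ub b x * phi x)" "integrable lborel (%x. u x * ?phi' x)"
   by (rule integrable_bounded_support[OF _ Sb b1(1)] integrable_bounded_support[OF _ Sb b1(2)]; (measurable)?; simp add: z)+
  have "(\<integral>x. u x * ?phi' x) = (\<integral>y. u y * ?phi' y \<partial>lborel) / vol" "(\<integral>x. ub b x * phi x) = (\<integral>y. ub b y * phi y \<partial>lborel) / vol"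
   by (rule integral_mu_support; (measurable)?; simp add: z[OF contra_subsetD[OF SM'']])+
  moreover have "(\<integral>y. u y * ?phi' y \<partial>lborel) = - (\<integral>y. ub b y * phi y \<partial>lborel)" using 1 Bochner_Integration.integral_add[OF i] by simp
  ultimately show ?thesis by (simp add: Gb[OF b])
 qed
 have "integrable \<mu> (%x. (norm (?G x))^2)"
  by (rule mu.integrable_const_bound[of _ "(real DIM('a) * B)^2"]) (use Gn in "auto intro!: power_mono")
 thus ?thesis unfolding weak_gradient_def using Gmu main by blast
qed

end

section \<open>Density of continuous functions in the Sobolev space\<close>

text \<open>A curve is at least as long as the distance of its endpoints.\<close>

lemma intrinsic_ball_subset: "intrinsic_ball M x eps \<subseteq> M \<inter> ball x eps"
proof
 fix y assume "y \<in> intrinsic_ball M x eps"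
 hence y: "y \<in> M" "intrinsic_dist M x y < ennreal eps" by (auto simp: intrinsic_ball_def)
 then obtain g where g: "pathstart g = x" "pathfinish g = y" "curve_length g < ennreal eps"
  unfolding intrinsic_dist_def INF_less_iff by auto
 have "ennreal (\<Sum>i<length [0, 1::real] - 1. dist (g ([0, 1] ! i)) (g ([0, 1] ! Suc i))) <= curve_length g"
  unfolding curve_length_def by (rule SUP_upper) simp
 hence "ennreal (dist x y) <= curve_length g" using g by (simp add: pathstart_def pathfinish_def)
 hence "ennreal (dist x y) < ennreal eps" using g(3) by (rule le_less_trans)
 thus "y \<in> M \<inter> ball x eps" using y by (simp add: ennreal_less_iff)
qed

context reflected_process begin

text \<open>The squared oscillation of f around x, whose integral over x is estimated by oscillation_bound.\<close>

definition local_osc :: "real => ('a => real) => 'a => real" where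
 "local_osc R f x = (\<integral>y. (f y - f x)^2 * indicator (ball x R) y)"

lemma local_osc_nonneg: "0 <= local_osc R f x"
 unfolding local_osc_def by (rule Bochner_Integration.integral_nonneg) simp

lemma local_osc_measurable:
 assumes "bdd f" shows "local_osc R f \<in> borel_measurable \<mu>"
proof -
 note [measurable] = bdd_meas[OF assms]
 have [measurable]: "(%y. y) \<in> \<mu> \<rightarrow>\<^sub>M borel" by (rule meas_mu_borel) simp
 show ?thesis unfolding local_osc_def[abs_def] indicator_def mem_ball by measurable
qed

lemma local_osc_integral:
 assumes f: "bdd f"
 shows "(\<integral>\<^sup>+x. ennreal (local_osc R f x)) = ennreal (1 / vol) * (ennreal (1 / vol) * emeasure (osc_measure R (zext f)) (M \<times> M))"
proof -
 have [measurable]: "zext f \<in> borel_measurable borel" by (rule zext_measurable[OF bdd_meas[OF f]])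
 have q: "ennreal (local_osc R f x) = ennreal (1 / vol) * (\<integral>\<^sup>+y. osc_kernel R (zext f) x y * indicator M y \<partial>lborel)" if x: "x \<in> M" for x
 proof -
  have "ennreal (local_osc R f x) = (\<integral>\<^sup>+y. ennreal ((f y - f x)^2 * indicator (ball x R) y))"
   unfolding local_osc_def by (rule nn_integral_eq_integral[symmetric], intro bdd_integrable bdd_mult bdd_power2 bdd_diff f bdd_const bdd_indicator) auto
  also have "... = (\<integral>\<^sup>+y. osc_kernel R (zext f) x y)"
   by (rule nn_integral_cong) (use x in "simp add: osc_kernel_def indicator_def dist_norm norm_minus_commute")
  also have "... = ennreal (1 / vol) * (\<integral>\<^sup>+y. osc_kernel R (zext f) x y * indicator M y \<partial>lborel)"
   by (rule nn_integral_mu[OF meas_mu_borel]) measurable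
  finally show ?thesis .
 qed
 have "(\<integral>\<^sup>+x. ennreal (local_osc R f x)) = ennreal (1 / vol) * (\<integral>\<^sup>+x. ennreal (local_osc R f x) * indicator M x \<partial>lborel)"
  by (rule nn_integral_mu) (use local_osc_measurable[OF f] in measurable)
 also have "(\<integral>\<^sup>+x. ennreal (local_osc R f x) * indicator M x \<partial>lborel) =
  (\<integral>\<^sup>+x. ennreal (1 / vol) * ((\<integral>\<^sup>+y. osc_kernel R (zext f) x y * indicator M y \<partial>lborel) * indicator M x) \<partial>lborel)"
  by (rule nn_integral_cong) (simp add: indicator_def q)
 also have "... = ennreal (1 / vol) * emeasure (osc_measure R (zext f)) (M \<times> M)"
  by (subst emeasure_osc) (simp_all add: nn_integral_cmult)
 finally show ?thesis .
qed

lemma integral_le_of_nn_integral: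
 fixes w :: "'a => real"
 assumes w: "w \<in> borel_measurable \<mu>" "!!x. x \<in> M ==> 0 <= w x & w x <= c * local_osc R f x" and c: "0 <= c" and f: "bdd f"
  and Q: "emeasure (osc_measure R (zext f)) (M \<times> M) <= ennreal B" and B: "0 <= B"
 shows "(\<integral>x. w x) <= c * B / vol^2"
proof -
 have "(\<integral>\<^sup>+x. ennreal (w x)) <= (\<integral>\<^sup>+x. ennreal c * ennreal (local_osc R f x))"
  by (rule nn_integral_mono) (use w(2) c local_osc_nonneg in "auto simp: ennreal_mult[symmetric] intro!: ennreal_leI")
 also have "... = ennreal c * (ennreal (1 / vol) * (ennreal (1 / vol) * emeasure (osc_measure R (zext f)) (M \<times> M)))"
  unfolding local_osc_integral[OF f, symmetric] by (rule nn_integral_cmult) (use local_osc_measurable[OF f] in measurable)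
 also have "... <= ennreal c * (ennreal (1 / vol) * (ennreal (1 / vol) * ennreal B))" by (intro mult_left_mono Q) simp_all
 also have "... = ennreal (c * (1 / vol * (1 / vol * B)))"
 proof -
  have e: "ennreal a * ennreal b = ennreal (a * b)" if "0 <= a" "0 <= b" for a b using that by (simp add: ennreal_mult)
  show ?thesis using c B vol_pos by (simp add: e del: ennreal_1)
 qed
 also have "c * (1 / vol * (1 / vol * B)) = c * B / vol^2" by (simp add: power2_eq_square)
 finally have le: "(\<integral>\<^sup>+x. ennreal (w x)) <= ennreal (c * B / vol^2)" .
 have "(\<integral>x. w x) = enn2real (\<integral>\<^sup>+x. ennreal (w x))"
  by (rule integral_eq_nn_integral[OF w(1)]) (use w(2) in "auto intro!: AE_I2")
 also have "... <= c * B / vol^2" using le c B vol_pos by (intro enn2real_leI) auto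
 finally show ?thesis .
qed
text \<open>Euclidean balls contain intrinsic ones.\<close>

lemma volume_lower:
 assumes "volume_regular M"
 obtains c rho where "0 < c" "0 < rho" "!!x eps. x \<in> M ==> 0 < eps ==> eps < rho ==> c * eps ^ DIM('a) <= (\<integral>y. indicator (ball x eps) y)"
proof -
 obtain c C rho where c: "0 < c" "0 < C" "0 < rho" and v: "\<forall>x\<in>M. \<forall>eps. 0 < eps & eps < rho -->
    c * eps ^ DIM('a) <= measure (nleb M) (intrinsic_ball M x eps) &
    measure (nleb M) (intrinsic_ball M x eps) <= C * eps ^ DIM('a)"
  using assms unfolding volume_regular_def by (elim exE conjE) (rule that)
 show ?thesis
 proof (rule that[OF c(1,3)])
  fix x eps assume h: "x \<in> M" "0 < eps" "eps < rho"
  have "c * eps ^ DIM('a) <= measure \<mu> (intrinsic_ball M x eps)" using v h by blast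
  also have "... <= measure \<mu> (M \<inter> ball x eps)"
   by (rule mu.finite_measure_mono[OF intrinsic_ball_subset]) (auto simp: sets_mu sets_restrict_space)
  also have "... = (\<integral>y. indicator (ball x eps) y)"
  proof -
   have "(\<integral>y. indicator (ball x eps) y) = (\<integral>y. indicator (M \<inter> ball x eps) y \<partial>\<mu> :: real)"
    by (intro Bochner_Integration.integral_cong refl) (simp add: indicator_def)
   thus ?thesis by (simp add: Int_commute)
  qed
  finally show "c * eps ^ DIM('a) <= (\<integral>y. indicator (ball x eps) y)" .
 qed
qed

lemma volume_upper:
 assumes "0 < R" shows "(\<integral>y. indicator (ball x R) y) <= (2 * R) ^ DIM('a) / vol"
proof -
 have m: "(%y. indicator (ball x R) y :: ennreal) \<in> borel_measurable borel"
  by (intro borel_measurable_indicator borel_open open_ball)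
 have "(\<integral>\<^sup>+y. indicator (ball x R) y) = ennreal (1 / vol) * (\<integral>\<^sup>+y. indicator (ball x R) y * indicator M y \<partial>lborel)"
  by (rule nn_integral_mu[OF meas_mu_borel[OF m]])
 also have "(\<integral>\<^sup>+y. indicator (ball x R) y * indicator M y \<partial>lborel) <= (\<integral>\<^sup>+y. indicator (cball x R) y \<partial>lborel)"
  by (rule nn_integral_mono) (simp add: indicator_def)
 also have "... = emeasure lborel (cball x R)" by simp
 also have "... <= ennreal ((2 * R) ^ DIM('a))" by (rule emeasure_cball_le) (use assms in simp)
 finally have le: "(\<integral>\<^sup>+y. indicator (ball x R) y) <= ennreal (1 / vol) * ennreal ((2 * R) ^ DIM('a))"
  by (simp add: mult_left_mono)
 have "ennreal (1 / vol) * ennreal ((2 * R) ^ DIM('a)) = ennreal ((2 * R) ^ DIM('a) / vol)"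
  using vol_pos assms by (simp add: ennreal_mult[symmetric])
 hence le': "(\<integral>\<^sup>+y. ennreal (indicator (ball x R) y)) <= ennreal ((2 * R) ^ DIM('a) / vol)" using le by (simp add: ennreal_indicator)
 have "(\<integral>y. indicator (ball x R) y) = enn2real (\<integral>\<^sup>+y. ennreal (indicator (ball x R) y))"
  by (rule integral_eq_nn_integral) (auto intro: bdd_meas[OF bdd_indicator])
 also have "... <= (2 * R) ^ DIM('a) / vol" using le' vol_pos assms by (intro enn2real_leI) auto
 finally show ?thesis .
qed

text \<open>average_pointwise with a = f x bounds the error and the partial derivatives at x by local_osc; integrate over
x.\<close>

lemma average_H1:
 assumes f: "bdd f" "!!x. x \<in> M ==> 0 <= f x & f x <= 1" and r: "0 < r" and fr: "negligible (frontier M)" and c: "0 <= K" "0 <= K'"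
  and moll: "!!z::'a. moll r z <= K" "!!(z::'a) b. b \<in> Basis ==> \<bar>dmoll r z (- b)\<bar> <= K'"
  and delta: "0 < delta" "!!x. x \<in> M ==> delta <= kernel_int r (%_. 1) x"
  and R: "real DIM('a) * r < R" and beta: "0 < beta" "!!x. (\<integral>y. indicator (ball x R) y) <= beta"
  and Q: "emeasure (osc_measure R (zext f)) (M \<times> M) <= ennreal B" "0 <= B"
 shows "\<exists>u. HB u & continuous_on M u & unit_val u &
  N1 u <= real DIM('a) * ((K' / delta * (1 + K * beta / delta))^2 * beta * B / vol^2) + 1 &
  (\<integral>x. (u x - f x)^2) <= (K / delta)^2 * beta * B / vol^2"
proof -
 let ?D = "kernel_int r (%_. 1)" and ?F = "kernel_int r f"
 define u where "u x = ?F x / ?D x" for x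
 define ub where "ub b x = (kernel_deriv r b f x * ?D x - ?F x * kernel_deriv r b (%_. 1) x) / (?D x)^2" for b x
 have one: "bdd (%_. 1)" by simp
 have D0: "0 < ?D x" if "x \<in> M" for x using delta(2)[OF that] delta(1) by linarith
 have k: "\<bar>w (y - x)\<bar> <= k * indicator (ball x R) y" if "!!z. w z ~= 0 ==> norm z <= real DIM('a) * r" "!!z. \<bar>w z\<bar> <= k" for w :: "'a => real" and k x y
  using that(1)[of "y - x"] that(2)[of "y - x"] R by (cases "y \<in> ball x R") (auto simp: dist_norm norm_minus_commute)
 have k1: "\<bar>moll r (y - x)\<bar> <= K * indicator (ball x R) y" for x y :: 'a
  by (rule k[OF moll_near[OF r]]) (simp_all add: abs_of_nonneg[OF moll_nonneg[OF r]] moll)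
 have k2: "\<bar>dmoll r (y - x) (- b)\<bar> <= K' * indicator (ball x R) y" if "b \<in> Basis" for x y b :: 'a
  by (rule k[OF dmoll_near[OF r] moll(2)[OF that]])
 have pw1: "(u x - f x)^2 <= (K / delta)^2 * beta * local_osc R f x" if "x \<in> M" for x
  unfolding u_def kernel_int_def local_osc_def
  by (rule average_pointwise(1)[OF f(1) _ beta delta(1) delta(2)[OF that, unfolded kernel_int_def] bdd_moll(1)[OF r] k1 c(1) bdd_const[of 0], where K' = 0]) auto
 have pw2: "(ub b x)^2 <= (K' / delta * (1 + K * beta / delta))^2 * beta * local_osc R f x" if "x \<in> M" "b \<in> Basis" for x b
  unfolding ub_def kernel_int_def kernel_deriv_def local_osc_def
  by (rule average_pointwise(2)[OF f(1) _ beta delta(1) delta(2)[OF that(1), unfolded kernel_int_def] bdd_moll(1)[OF r] k1 c(1) bdd_moll(2)[OF r that(2)] k2[OF that(2)] c(2)]) auto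
 have nm: "kernel_int r h \<in> borel_measurable borel" if "bdd h" for h by (rule borel_measurable_continuous_onI[OF kernel_int_continuous[OF that r]])
 note [measurable] = nm[OF f(1)] nm[OF one]
 have um[measurable]: "u \<in> borel_measurable borel" unfolding u_def[abs_def] by measurable
 have ubm: "ub b \<in> borel_measurable borel" for b
 proof -
  note [measurable] = kernel_deriv_measurable[OF f(1) r] kernel_deriv_measurable[OF one r]
  show ?thesis unfolding ub_def[abs_def] by measurable
 qed
 have u01: "0 <= u x & u x <= 1" if x: "x \<in> M" for x
 proof -
  have "0 <= ?F x" unfolding kernel_int_def
   by (rule integral_nonneg_AE, rule AE_I2) (simp add: f(2) moll_nonneg[OF r])
  moreover have "?F x <= ?D x" unfolding kernel_int_def
   by (rule integral_mono; (intro bdd_integrable bdd_mult bdd_const bdd_moll r f(1))?) (simp add: f(2) moll_nonneg[OF r] mult_left_le_one_le)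
  ultimately show ?thesis using D0[OF x] by (simp add: u_def)
 qed
 have bu: "bdd u" by (rule bdd_borelI[OF um, of 1]) (use u01 in auto)
 have fm: "f \<in> borel_measurable \<mu>" by (rule bdd_meas[OF f(1)])
 have i1: "(\<integral>x. (u x - f x)^2) <= (K / delta)^2 * beta * B / vol^2"
  by (rule integral_le_of_nn_integral[OF _ _ _ f(1) Q], intro borel_measurable_power borel_measurable_diff fm meas_mu_borel um) (use pw1 beta in auto)
 have i2: "(\<integral>x. (ub b x)^2) <= (K' / delta * (1 + K * beta / delta))^2 * beta * B / vol^2" if b: "b \<in> Basis" for b
  by (rule integral_le_of_nn_integral[OF _ _ _ f(1) Q], intro borel_measurable_power meas_mu_borel ubm) (use pw2 b beta in auto)
 let ?G = "%x. \<Sum>b\<in>Basis. ub b x *\<^sub>R b"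
 let ?c = "(K' / delta * (1 + K * beta / delta))^2 * beta"
 have ubB: "\<bar>ub b x\<bar> <= sqrt ?c" if x: "x \<in> M" and b: "b \<in> Basis" for x b
 proof -
  have "local_osc R f x <= (\<integral>y. 1)" unfolding local_osc_def
  proof (rule integral_mono)
   show "integrable \<mu> (%y. (f y - f x)^2 * indicator (ball x R) y)"
    by (intro bdd_integrable bdd_mult bdd_power2 bdd_diff f bdd_const bdd_indicator) simp
   fix y assume "y \<in> space \<mu>"
   hence "\<bar>f y - f x\<bar> <= 1" using f(2)[of y] f(2)[OF x] by auto
   thus "(f y - f x)^2 * indicator (ball x R) y <= 1" by (simp add: abs_square_le_1 indicator_def)
  qed simp
  hence "?c * local_osc R f x <= ?c * 1" using beta(1) by (intro mult_left_mono) (simp_all add: mu.prob_space[simplified])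
  thus ?thesis using pw2[OF x b] by (intro real_le_rsqrt) simp
 qed
 have wg: "weak_gradient M u ?G"
 proof (rule weak_gradient_of_partials[OF um ubm, where B = "1 + sqrt ?c"])
  have s0: "0 <= sqrt ?c" using beta(1) by simp
  show "\<bar>u x\<bar> <= 1 + sqrt ?c" if "x \<in> M" for x using u01[OF that] s0 by linarith
  show "\<bar>ub b x\<bar> <= 1 + sqrt ?c" if "x \<in> M" "b \<in> Basis" for x b using ubB[OF that] by linarith
  show "((%s. u (x + s *\<^sub>R b)) has_real_derivative ub b x) (at 0)" if x: "x \<in> interior M" and b: "b \<in> Basis" for x b
  proof -
   have nz: "?D (x + 0 *\<^sub>R b) ~= 0" using D0[of x] x interior_subset[of M] by auto
   from DERIV_divide[OF kernel_int_deriv[OF f(1) r b] kernel_int_deriv[OF one r b] nz]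
   show ?thesis unfolding u_def ub_def by (simp add: power2_eq_square)
  qed
 qed
 have Gn: "(norm (?G x))^2 = (\<Sum>b\<in>Basis. (ub b x)^2)" for x
 proof -
  have "?G x \<bullet> b = ub b x" if "b \<in> Basis" for b using that by (simp add: inner_sum_left inner_Basis if_distrib cong: if_cong)
  hence "(\<Sum>b\<in>Basis. (?G x \<bullet> b) * (?G x \<bullet> b)) = (\<Sum>b\<in>Basis. (ub b x)^2)" by (intro sum.cong refl) (simp add: power2_eq_square)
  thus ?thesis unfolding power2_norm_eq_inner euclidean_inner[of "?G x" "?G x"] .
 qed
 have "energy M u u = (\<integral>x. (norm (?G x))^2) / 2" by (rule energy_weak_gradient[OF fr wg])
 also have "... <= (\<integral>x. (norm (?G x))^2)" using Bochner_Integration.integral_nonneg[of \<mu> "%x. (norm (?G x))^2"] by simp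
 also have "... = (\<Sum>b\<in>Basis. \<integral>x. (ub b x)^2 \<partial>\<mu>)"
  unfolding Gn
 proof (rule Bochner_Integration.integral_sum, intro bdd_integrable bdd_power2)
  show "bdd (ub b)" if "b \<in> Basis" for b using bdd_borelI[OF ubm ubB] that by blast
 qed
 also have "... <= real DIM('a) * (?c * B / vol^2)" by (rule sum_bounded_above) (rule i2)
 finally have eu: "energy M u u <= real DIM('a) * (?c * B / vol^2)" .
 have "(\<integral>x. (u x)^2) <= (\<integral>x. 1)"
  by (rule integral_mono) (use u01 in "auto intro!: bdd_integrable bdd_power2 bu power_le_one")
 hence "N1 u <= real DIM('a) * (?c * B / vol^2) + 1" unfolding N1_def using eu by (simp add: mu.prob_space[simplified])
 moreover have "continuous_on M u" unfolding u_def
  by (intro continuous_on_divide continuous_on_subset[OF kernel_int_continuous[OF _ r]] f(1) one) (use D0 in force)+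
 moreover have "HB u" using bu bdd_L2[OF bu] wg by (auto simp: HB_def H1_def)
 ultimately show ?thesis using i1 u01 by blast
qed

text \<open>With oscillations of order r ^ (d + 2), kernels of size c, their derivatives of size c / r and normalizations
of order at least c * r ^ d, all powers of r cancel in the energy and a factor r^2 remains in the error.\<close>

lemma average_estimates:
 assumes ch: "uniform_bilipschitz_charts M" and vr: "volume_regular M"
 obtains K r0 where "0 < r0" "!!f g r. bdd f ==> \<forall>x\<in>M. 0 <= f x & f x <= 1 ==> weak_gradient M f g ==> 0 < r ==> r < r0 ==>
  \<exists>u. HB u & continuous_on M u & unit_val u & N1 u <= K * grad_sq g + 1 &
   (\<integral>x. (u x - f x)^2) <= K * grad_sq g * r^2"
proof -
 let ?d = "DIM('a)"
 obtain K0 rho0 where K0: "0 <= K0" "0 < rho0" and fr: "negligible (frontier M)" and osc: "!!f g r. bdd f ==> unit_val f ==> weak_gradient M f g ==> 0 < r ==> r <= rho0 ==>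
   emeasure (osc_measure r (zext f)) (M \<times> M) <= ennreal (K0 * r ^ (?d + 2) * grad_sq g)"
  by (rule oscillation_bound[OF ch]) (rule that)
 obtain c0 rho1 where c0: "0 < c0" "0 < rho1" "!!x eps. x \<in> M ==> 0 < eps ==> eps < rho1 ==> c0 * eps ^ ?d <= (\<integral>y. indicator (ball x eps) y)"
  by (rule volume_lower[OF vr]) (rule that)
 obtain L m where L: "0 < L" "0 < m" and moll: "!!r. 0 < r ==> \<exists>c>0. \<forall>z::'a. moll r z <= L * c &
  (\<forall>b\<in>Basis. \<bar>dmoll r z (- b)\<bar> <= L * c / r) & (norm z <= r / 2 --> m * c <= moll r z)" by (rule moll_bounds) (rule that)
 \<comment> \<open>The kernel of radius r is supported in a cube, which the ball of radius n * r contains.\<close>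
 define n where "n = real (?d + 1)"
 define delta0 where "delta0 = m * c0 / 2 ^ ?d"
 define beta0 where "beta0 = (2 * n) ^ ?d / vol"
 define A where "A = beta0 * (K0 * n ^ (?d + 2)) / vol^2"
 define K where "K = (L / delta0)^2 * A + real ?d * ((L / delta0 * (1 + L * beta0 / delta0))^2 * A)"
 have n: "0 < n" by (simp add: n_def)
 have pos: "0 < delta0" "0 < beta0" using L c0 n vol_pos by (simp_all add: delta0_def beta0_def)
 have A: "0 <= A" using pos K0 n by (simp add: A_def)
 show ?thesis
 proof (rule that[of "min (rho0 / n) rho1" K])
  show "0 < min (rho0 / n) rho1" using K0 c0 n by simp
  fix f g r assume f: "bdd f" "unit_val f" and g: "weak_gradient M f g" and r: "0 < r" "r < min (rho0 / n) rho1"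
  define J where "J = grad_sq g"
  have J: "0 <= J" unfolding J_def by (rule Bochner_Integration.integral_nonneg) simp
  obtain c where c: "0 < c" and mc: "!!z::'a. moll r z <= L * c" "!!(z::'a) b. b \<in> Basis ==> \<bar>dmoll r z (- b)\<bar> <= L * c / r"
   "!!z::'a. norm z <= r / 2 ==> m * c <= moll r z" using moll[OF r(1)] by blast
  define delta where "delta = c * delta0 * r ^ ?d"
  define beta where "beta = beta0 * r ^ ?d"
  define B where "B = K0 * (n * r) ^ (?d + 2) * J"
  have R: "0 < n * r" "n * r <= rho0" using r n by (simp_all add: pos_less_divide_eq mult.commute less_imp_le)
  have D: "delta <= kernel_int r (%_. 1) x" if x: "x \<in> M" for x
  proof -
   have "c0 * (r / 2) ^ ?d <= (\<integral>y. indicator (ball x (r / 2)) y)" using c0(3)[OF x, of "r / 2"] r by simp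
   hence "m * c * (c0 * (r / 2) ^ ?d) <= m * c * (\<integral>y. indicator (ball x (r / 2)) y)" using L(2) c by (intro mult_left_mono) auto
   also have "... = (\<integral>y. m * c * indicator (ball x (r / 2)) y)" by simp
   also have "... <= (\<integral>y. 1 * moll r (y - x))"
   proof (rule integral_mono)
    show "integrable \<mu> (%y. m * c * indicator (ball x (r / 2)) y)" "integrable \<mu> (%y. 1 * moll r (y - x))"
     by (intro bdd_integrable bdd_mult bdd_const bdd_indicator bdd_moll r; simp)+
    show "m * c * indicator (ball x (r / 2)) y <= 1 * moll r (y - x)" for y
     using mc(3)[of "y - x"] moll_nonneg[OF r(1), of "y - x"] by (auto simp: indicator_def dist_norm norm_minus_commute)
   qed
   finally show ?thesis by (simp add: kernel_int_def delta_def delta0_def power_divide mult_ac)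
  qed
  have av: "\<exists>u. HB u & continuous_on M u & unit_val u &
   N1 u <= real ?d * ((L * c / r / delta * (1 + L * c * beta / delta))^2 * beta * B / vol^2) + 1 &
   (\<integral>x. (u x - f x)^2) <= (L * c / delta)^2 * beta * B / vol^2"
  proof (rule average_H1[OF f(1) _ r(1) fr _ _ mc(1,2) _ D])
   show "emeasure (osc_measure (n * r) (zext f)) (M \<times> M) <= ennreal B" unfolding B_def J_def by (rule osc[OF f g R])
   show "(\<integral>y. indicator (ball x (n * r)) y) <= beta" for x
    using volume_upper[OF R(1), of x] by (simp add: beta_def beta0_def power_mult_distrib mult_ac)
   show "0 <= B" using K0 R J by (simp add: B_def)
   show "0 < delta" "0 < beta" using pos c r by (simp_all add: delta_def beta_def)
   show "real ?d * r < n * r" using r by (simp add: n_def)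
  qed (use f L c r in auto)
  have e: "L * c / delta = L / delta0 / r ^ ?d" "L * c * beta / delta = L * beta0 / delta0" using c r by (simp_all add: delta_def beta_def)
  have e': "L * c / r / delta = L / delta0 / r ^ ?d / r" unfolding e(1)[symmetric] by simp
  have BA: "beta * B / vol^2 = A * (r ^ ?d)^2 * r^2 * J" by (simp add: beta_def B_def A_def power_mult_distrib power_add power2_eq_square)
  have "(L * c / delta)^2 * beta * B / vol^2 = (L * c / delta)^2 * (beta * B / vol^2)" by simp
  also have "... = (L / delta0)^2 * A * J * r^2" unfolding e BA using r by (simp add: power_divide power_mult_distrib)
  finally have 1: "(L * c / delta)^2 * beta * B / vol^2 = (L / delta0)^2 * A * J * r^2" .
  have "(L * c / r / delta * (1 + L * c * beta / delta))^2 * beta * B / vol^2 = (L * c / r / delta * (1 + L * c * beta / delta))^2 * (beta * B / vol^2)" by simp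
  also have "... = (L / delta0 * (1 + L * beta0 / delta0))^2 * A * J" unfolding e(2) e' BA using r by (simp add: power_divide power_mult_distrib)
  finally have 2: "(L * c / r / delta * (1 + L * c * beta / delta))^2 * beta * B / vol^2 = (L / delta0 * (1 + L * beta0 / delta0))^2 * A * J" .
  have "real ?d * ((L / delta0 * (1 + L * beta0 / delta0))^2 * A * J) + 1 <= K * J + 1" "(L / delta0)^2 * A * J * r^2 <= K * J * r^2"
   using A J by (auto simp: K_def distrib_right intro!: mult_right_mono)
  thus "\<exists>u. HB u & continuous_on M u & unit_val u & N1 u <= K * grad_sq g + 1 &
   (\<integral>x. (u x - f x)^2) <= K * grad_sq g * r^2"
   using av unfolding 1 2 J_def[symmetric] by (meson order_trans)
 qed
qed

lemma continuous_functions_dense: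
 assumes ch: "uniform_bilipschitz_charts M" and vr: "volume_regular M" and f: "HB f" "!!x. x \<in> M ==> 0 <= f x & f x <= 1"
 shows "\<exists>(u :: nat => 'a => real) C. (\<forall>n. HB (u n) & continuous_on M (u n) & unit_val (u n) & N1 (u n) <= C) &
    (%n. \<integral>x. (u n x - f x)^2 \<partial>nleb M) \<longlonglongrightarrow> 0"
proof -
 obtain K r0 where K: "0 < r0" and app: "!!f g r. bdd f ==> \<forall>x\<in>M. 0 <= f x & f x <= 1 ==> weak_gradient M f g ==> 0 < r ==> r < r0 ==>
  \<exists>u. HB u & continuous_on M u & unit_val u & N1 u <= K * grad_sq g + 1 &
   (\<integral>x. (u x - f x)^2) <= K * grad_sq g * r^2"
  by (rule average_estimates[OF ch vr]) (rule that)
 obtain g where g: "weak_gradient M f g" using f(1) by (auto simp: HB_def H1_def)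
 define J where "J = grad_sq g"
 define r where "r n = r0 / real (n + 2)" for n
 have r: "0 < r n" "r n < r0" for n using K by (auto simp: r_def divide_less_eq)
 have "\<exists>u. HB u & continuous_on M u & unit_val u & N1 u <= K * J + 1 &
   (\<integral>x. (u x - f x)^2) <= K * J * (r n)^2" for n
  unfolding J_def by (rule app[OF _ _ g r]) (use f in "auto simp: HB_def")
 hence "\<forall>n. \<exists>u. HB u & continuous_on M u & unit_val u & N1 u <= K * J + 1 &
   (\<integral>x. (u x - f x)^2) <= K * J * (r n)^2" by blast
 from choice[OF this] obtain u where u: "!!n. HB (u n) & continuous_on M (u n) & unit_val (u n) & N1 (u n) <= K * J + 1 &
   (\<integral>x. (u n x - f x)^2) <= K * J * (r n)^2" by blast
 have "(%n. \<integral>x. (u n x - f x)^2 \<partial>\<mu>) \<longlonglongrightarrow> 0"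
 proof (rule tendsto_sandwich[OF _ _ tendsto_const])
  show "\<forall>\<^sub>F n in sequentially. 0 <= (\<integral>x. (u n x - f x)^2)" by (intro always_eventually allI Bochner_Integration.integral_nonneg) simp
  show "\<forall>\<^sub>F n in sequentially. (\<integral>x. (u n x - f x)^2) <= K * J * (r n)^2" using u by (intro always_eventually allI) blast
  have "r \<longlonglongrightarrow> 0" unfolding r_def using LIMSEQ_ignore_initial_segment[OF lim_const_over_n[of r0], of 2] by simp
  hence "(%n. K * J * (r n)^2) \<longlonglongrightarrow> K * J * 0^2" by (intro tendsto_intros)
  thus "(%n. K * J * (r n)^2) \<longlonglongrightarrow> 0" by simp
 qed
 thus ?thesis using u by blast
qed

end

section \<open>Probability of recovering the homology\<close>

theorem theorem6p1:
  fixes M U :: "'a::euclidean_space set"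
    and P :: "'a \<Rightarrow> (real \<Rightarrow> 'a) measure"
    and p :: "real \<Rightarrow> 'a \<Rightarrow> 'a \<Rightarrow> real"
    and s0 a_hk r :: real
    and q :: nat
    and \<A> :: "'a set set"
  assumes "2 \<le> DIM('a)"
    and "open U" and "connected U" and "bounded U" and "U \<noteq> {}" and "M = closure U"
    and "0 < reach M"
    and "intrinsic_euclidean_comparison M"
    and "volume_regular M"
    and "admissible_reflecting_domain M"
    and "reflected_BM M P"
    and "neumann_heat_kernel M P p"
    and "0 < s0" and "1 \<le> a_hk"
    and "\<forall>t\<ge>s0. \<forall>x\<in>M. \<forall>y\<in>M. p t x y \<le> a_hk"
    and "q \<le> DIM('a)" and "0 < r"
    and "finite \<A>"
    and "\<forall>A\<in>\<A>. A \<subseteq> M \<and> A \<in> sets borel \<and> 0 < capacity M A"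
    and "homological_certificate TYPE('k::field) M q r \<A>"
  shows "(\<forall>z\<in>M. \<forall>T\<ge>s0.
            inner_prob (P z) (recovery_event TYPE('k) M q T r)
              \<ge> 1 - a_hk * spectral_profile M \<A> (T - s0)) \<and>
         (\<forall>z\<in>M. \<forall>T\<ge>s0. \<forall>\<delta>. a_hk * spectral_profile M \<A> (T - s0) \<le> \<delta> \<longrightarrow>
            inner_prob (P z) (recovery_event TYPE('k) M q T r) \<ge> 1 - \<delta>) \<and>
         (full_homological_certificate TYPE('k) M r \<A> \<longrightarrow>
            (\<forall>z\<in>M. \<forall>T\<ge>s0.
               inner_prob (P z) (full_recovery_event TYPE('k) M T r)
                 \<ge> 1 - a_hk * spectral_profile M \<A> (T - s0)))"
proof -
 have "U \<subseteq> interior M" using assms(2,6) closure_subset[of U] by (simp add: interior_maximal)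
 hence int: "interior M ~= {}" using assms(5) by blast
 have cpt: "compact M" using assms(4,6) by (simp add: compact_closure)
 interpret reflected_process M P p by (unfold_locales; fact)
 have ch: "uniform_bilipschitz_charts M" using assms(10) by (simp add: admissible_reflecting_domain_def)
 interpret regular_process M P p
  by unfold_locales (rule continuous_functions_dense[OF ch assms(9)])
 have bound: "1 - a_hk * spectral_profile M \<A> (T - s0) <= inner_prob (P z) R"
  if "z \<in> M" "s0 <= T" "!!omega. omega \<in> space (path_space M) ==> hits_all omega T \<A> ==> omega \<in> R" for z T R
  by (rule recovery_bound[OF assms(18,19) that(1) assms(13) that(2) _ _ that(3)]) (use assms(14,15) that(1) in auto)
 have event: "omega \<in> recovery_event TYPE('k) M q' T r"
  if "homological_certificate TYPE('k) M q' r \<A>" "s0 <= T" "omega \<in> space (path_space M)" "hits_all omega T \<A>" for omega T q'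
 proof -
  have "continuous_on {0..T} omega" "omega ` {0..T} \<subseteq> M" using that(3) unfolding space_path by (auto intro: continuous_on_subset)
  moreover have "0 <= T" using that(2) assms(13) by linarith
  ultimately have "homology_recovered TYPE('k) M q' r (omega ` {0..T})" using that(1,4) unfolding homological_certificate_def by blast
  thus ?thesis using that(3) by (simp add: recovery_event_def)
 qed
 have 1: "1 - a_hk * spectral_profile M \<A> (T - s0) <= inner_prob (P z) (recovery_event TYPE('k) M q T r)" if "z \<in> M" "s0 <= T" for z T
  by (rule bound[OF that]) (rule event[OF assms(20) that(2)])
 have 2: "1 - a_hk * spectral_profile M \<A> (T - s0) <= inner_prob (P z) (full_recovery_event TYPE('k) M T r)"
  if "full_homological_certificate TYPE('k) M r \<A>" "z \<in> M" "s0 <= T" for z T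
 proof (rule bound[OF that(2,3)])
  fix omega assume "omega \<in> space (path_space M)" "hits_all omega T \<A>"
  thus "omega \<in> full_recovery_event TYPE('k) M T r"
   using that event unfolding full_recovery_event_def full_homological_certificate_def by blast
 qed
 show ?thesis using 1 2 by (auto intro: order_trans[OF diff_left_mono])
qed

end
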